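(* Let $P$ be a submonoid of a group $G$, and let $\gamma=(\{A_g\}_{g\in G},\{\gamma_g\}_{g\in G})$ be the canonical partial action of $G$ on the reduced diagonal $D_r$. Then the map $t_p\mapsto \mathbb 1_{pP}\delta_p$ ($p\in P$) induces an isomorphism $\mathcal T_u(P)\cong D_r\rtimes_{\gamma}G$. In addition, $L_p\mapsto \mathbb 1_{pP}\delta_p$ gives rise to an isomorphism between reduced $\mathrm C^*$-algebras $\mathcal T_\lambda(P)\cong D_r\rtimes_{\gamma,r}G$.
   Context: $P$ is a submonoid of a group $G$ with identity $e$. A word is a finite sequence $\alpha=(p_1,p_2,\ldots,p_{2k-1},p_{2k})$ of even length $2k\ge 0$ with entries in $P$; $\mathcal W$ is the set of all words (including the empty word). Put $\dot\alpha:=p_1^{-1}p_2\cdots p_{2k-1}^{-1}p_{2k}\in G$ (equal to $e$ for the empty word); $\alpha$ is neutral if $\dot\alpha=e$. The reverse word is $\tilde\alpha:=(p_{2k},p_{2k-1},\ldots,p_2,p_1)$. Put $K(\alpha):=P\cap p_{2k}^{-1}p_{2k-1}P\cap p_{2k}^{-1}p_{2k-1}p_{2k-2}^{-1}p_{2k-3}P\cap\cdots\cap p_{2k}^{-1}p_{2k-1}\cdots p_2^{-1}p_1P$ (equal to $P$ for the empty word). For a map $w\colon P\to B$ into a unital $\mathrm C^*$-algebra, $\dot w_\alpha:=w_{p_1}^*w_{p_2}\cdots w_{p_{2k-1}}^*w_{p_{2k}}$ ($=1$ for the empty word). $\mathcal T_u(P)$ is the universal $\mathrm C^*$-algebra with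 generators $\{t_p: p\in P\}$ subject to: (T1) $t_e=1$; (T2) $\dot t_\alpha=0$ if $\alpha$ is neutral and $K(\alpha)=\emptyset$; (T3) $\dot t_\alpha=\dot t_\beta$ if $\alpha,\beta$ are neutral and $K(\alpha)=K(\beta)$; (T4) $\prod_{\beta\in F}(\dot t_\alpha-\dot t_\beta)=0$ if $\alpha$ is a neutral word and $F$ is a finite set of neutral words with $K(\alpha)=\bigcup_{\beta\in F}K(\beta)$. $L_p\delta_q=\delta_{pq}$ defines the left regular representation of $P$ by isometries on $\ell^2(P)$, and $\mathcal T_\lambda(P)$ is the $\mathrm C^*$-algebra generated by $\{L_p:p\in P\}$. For neutral $\alpha$, $\dot L_\alpha$ is multiplication by the characteristic function $\mathbb 1_{K(\alpha)}$; $D_r:=\overline{\mathrm{span}}\{\mathbb 1_{K(\alpha)}:\alpha\in\mathcal W,\dot\alpha=e\}\subseteq \ell^\infty(P)$. Canonical partial action: for $g\in G$ let $A_{g^{-1}}:=\overline{\mathrm{span}}\{\mathbb 1_{K(\alpha)}:\alpha\in\mathcal W,\dot\alpha=g\}$, a closed ideal of $D_r$, and let $\gamma_g\colon A_{g^{-1}}\to A_g$ be the $*$-isomorphism with $\gamma_g(\mathbb 1_{K(\alpha)})=\mathbb 1_{gK(\alpha)}=\mathbb 1_{K(\tilde\alpha)}$ for $\dot\alpha=g$. The semidirect product bundle of $\gamma$ is the Fell bundle over $G$ with fibers $A_g\delta_g$, multiplication $(a\delta_g)(b\delta_h)=\gamma_g(\gamma_{g^{-1}}(a)b)\delta_{gh}$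 and involution $(a\delta_g)^*=\gamma_{g^{-1}}(a^* )\delta_{g^{-1}}$; $D_r\rtimes_\gamma G$ and $D_r\rtimes_{\gamma,r}G$ are its full and reduced cross-sectional $\mathrm C^*$-algebras.
   Formalization: In (T4) the finite set F is taken nonempty: with F empty and K(α)=∅ (covered by (T2)) the relation would read 1=0 and make T_u(P) zero, for instance for free monoids. *)

theory Defs
  imports "HOL-Analysis.Infinite_Sum" "HOL-Algebra.Coset" "HOL-Algebra.Ring"
begin

section \<open>Unital complex *-algebras and C*-algebras as records\<close>

record 'a star_algebra = "'a ring" +
  cscale :: "complex \<Rightarrow> 'a \<Rightarrow> 'a"
  star :: "'a \<Rightarrow> 'a"

record 'a normed_star_algebra = "'a star_algebra" +
  cnorm :: "'a \<Rightarrow> real"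

text \<open>Isomorphisms of C*-algebras. Preservation of the norm is automatic for bijective
  *-homomorphisms of C*-algebras, and preservation of units follows from surjectivity.\<close>

definition cstar_iso ::
  "('a, 'm) normed_star_algebra_scheme \<Rightarrow> ('b, 'n) normed_star_algebra_scheme \<Rightarrow> ('a \<Rightarrow> 'b) \<Rightarrow> bool"
  where
  "cstar_iso A B \<phi> \<longleftrightarrow>
     bij_betw \<phi> (carrier A) (carrier B) \<and>
     (\<forall>x\<in>carrier A. \<forall>y\<in>carrier A. \<phi> (x \<oplus>\<^bsub>A\<^esub> y) = \<phi> x \<oplus>\<^bsub>B\<^esub> \<phi> y) \<and>
     (\<forall>x\<in>carrier A. \<forall>y\<in>carrier A. \<phi> (x \<otimes>\<^bsub>A\<^esub> y) = \<phi> x \<otimes>\<^bsub>B\<^esub> \<phi> y) \<and>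
     (\<forall>c. \<forall>x\<in>carrier A. \<phi> (cscale A c x) = cscale B c (\<phi> x)) \<and>
     (\<forall>x\<in>carrier A. \<phi> (star A x) = star B (\<phi> x)) \<and>
     (\<forall>x\<in>carrier A. cnorm B (\<phi> x) = cnorm A x)"

definition norm_closure :: "('a, 'm) normed_star_algebra_scheme \<Rightarrow> 'a set \<Rightarrow> 'a set" where
  "norm_closure A S = {x \<in> carrier A. \<forall>\<epsilon>>0. \<exists>y\<in>S. cnorm A (x \<ominus>\<^bsub>A\<^esub> y) < \<epsilon>}"

inductive_set lin_span :: "('a, 'm) star_algebra_scheme \<Rightarrow> 'a set \<Rightarrow> 'a set"
  for A :: "('a, 'm) star_algebra_scheme" and S :: "'a set"
  where
    lin_span_zero: "\<zero>\<^bsub>A\<^esub> \<in> lin_span A S"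
  | lin_span_base: "x \<in> S \<Longrightarrow> x \<in> lin_span A S"
  | lin_span_add: "x \<in> lin_span A S \<Longrightarrow> y \<in> lin_span A S \<Longrightarrow> x \<oplus>\<^bsub>A\<^esub> y \<in> lin_span A S"
  | lin_span_scale: "x \<in> lin_span A S \<Longrightarrow> cscale A c x \<in> lin_span A S"

definition closed_star_subalgebra :: "('a, 'm) normed_star_algebra_scheme \<Rightarrow> 'a set \<Rightarrow> bool" where
  "closed_star_subalgebra A B \<longleftrightarrow>
     B \<subseteq> carrier A \<and> \<zero>\<^bsub>A\<^esub> \<in> B \<and>
     (\<forall>x\<in>B. \<forall>y\<in>B. x \<oplus>\<^bsub>A\<^esub> y \<in> B \<and> x \<otimes>\<^bsub>A\<^esub> y \<in> B) \<and>
     (\<forall>c. \<forall>x\<in>B. cscale A c x \<in> B) \<and>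
     (\<forall>x\<in>B. star A x \<in> B) \<and>
     norm_closure A B \<subseteq> B"

definition generated_cstar ::
  "('a, 'm) normed_star_algebra_scheme \<Rightarrow> 'a set \<Rightarrow> ('a, 'm) normed_star_algebra_scheme" where
  "generated_cstar A S = A\<lparr>carrier := \<Inter>{B. closed_star_subalgebra A B \<and> S \<subseteq> B}\<rparr>"


section \<open>Hausdorff completion and universal C*-algebras\<close>

definition seminorm_cauchy :: "('a, 'm) star_algebra_scheme \<Rightarrow> ('a \<Rightarrow> real) \<Rightarrow> (nat \<Rightarrow> 'a) set" where
  "seminorm_cauchy A \<nu> =
     {s. range s \<subseteq> carrier A \<and>
         (\<forall>\<epsilon>>0. \<exists>N. \<forall>m\<ge>N. \<forall>n\<ge>N. \<nu> (s m \<ominus>\<^bsub>A\<^esub> s n) < \<epsilon>)}"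

definition completion_class ::
  "('a, 'm) star_algebra_scheme \<Rightarrow> ('a \<Rightarrow> real) \<Rightarrow> (nat \<Rightarrow> 'a) \<Rightarrow> (nat \<Rightarrow> 'a) set" where
  "completion_class A \<nu> s =
     {s' \<in> seminorm_cauchy A \<nu>. (\<lambda>n. \<nu> (s' n \<ominus>\<^bsub>A\<^esub> s n)) \<longlonglongrightarrow> 0}"

text \<open>The separated completion of \<^term>\<open>A\<close> for the seminorm \<^term>\<open>\<nu>\<close>: Cauchy
  sequences modulo null sequences, with the operations computed on representatives.\<close>

definition completion ::
  "('a, 'm) star_algebra_scheme \<Rightarrow> ('a \<Rightarrow> real) \<Rightarrow> (nat \<Rightarrow> 'a) set normed_star_algebra" where
  "completion A \<nu> =
     \<lparr>carrier = completion_class A \<nu> ` seminorm_cauchy A \<nu>,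
      monoid.mult = (\<lambda>X Y. \<Union>s\<in>X. \<Union>t\<in>Y. completion_class A \<nu> (\<lambda>n. s n \<otimes>\<^bsub>A\<^esub> t n)),
      one = completion_class A \<nu> (\<lambda>_. \<one>\<^bsub>A\<^esub>),
      zero = completion_class A \<nu> (\<lambda>_. \<zero>\<^bsub>A\<^esub>),
      add = (\<lambda>X Y. \<Union>s\<in>X. \<Union>t\<in>Y. completion_class A \<nu> (\<lambda>n. s n \<oplus>\<^bsub>A\<^esub> t n)),
      cscale = (\<lambda>c X. \<Union>s\<in>X. completion_class A \<nu> (\<lambda>n. cscale A c (s n))),
      star = (\<lambda>X. \<Union>s\<in>X. completion_class A \<nu> (\<lambda>n. star A (s n))),
      cnorm = (\<lambda>X. THE r. \<forall>s\<in>X. (\<lambda>n. \<nu> (s n)) \<longlonglongrightarrow> r)\<rparr>"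

definition completion_embed ::
  "('a, 'm) star_algebra_scheme \<Rightarrow> ('a \<Rightarrow> real) \<Rightarrow> 'a \<Rightarrow> (nat \<Rightarrow> 'a) set" where
  "completion_embed A \<nu> x = completion_class A \<nu> (\<lambda>_. x)"

definition cstar_seminorm :: "('a, 'm) star_algebra_scheme \<Rightarrow> ('a \<Rightarrow> real) \<Rightarrow> bool" where
  "cstar_seminorm A \<nu> \<longleftrightarrow>
     (\<forall>x\<in>carrier A. 0 \<le> \<nu> x) \<and>
     (\<forall>x\<in>carrier A. \<forall>y\<in>carrier A. \<nu> (x \<oplus>\<^bsub>A\<^esub> y) \<le> \<nu> x + \<nu> y) \<and>
     (\<forall>c. \<forall>x\<in>carrier A. \<nu> (cscale A c x) = cmod c * \<nu> x) \<and>
     (\<forall>x\<in>carrier A. \<forall>y\<in>carrier A. \<nu> (x \<otimes>\<^bsub>A\<^esub> y) \<le> \<nu> x * \<nu> y) \<and>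
     (\<forall>x\<in>carrier A. \<nu> (star A x \<otimes>\<^bsub>A\<^esub> x) = (\<nu> x)\<^sup>2)"

text \<open>The largest C*-seminorm on \<^term>\<open>A\<close> that vanishes on \<^term>\<open>R\<close>. The *-homomorphisms of
  \<^term>\<open>A\<close> into C*-algebras that kill \<^term>\<open>R\<close> induce precisely the C*-seminorms
  vanishing on \<^term>\<open>R\<close>, so the completion for this seminorm is the C*-algebra
  universal for such *-homomorphisms, without a quantification over all types that may
  carry a C*-algebra. The supremum must be finite, as it is in both applications below:
  there the generators are forced to be isometries, respectively the seminorms are
  dominated by the 1-norm of sections.\<close>

definition max_cstar_seminorm :: "('a, 'm) star_algebra_scheme \<Rightarrow> 'a set \<Rightarrow> 'a \<Rightarrow> real" where
  "max_cstar_seminorm A R x =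
     (SUP \<nu>\<in>{\<nu>. cstar_seminorm A \<nu> \<and> (\<forall>r\<in>R. \<nu> r = 0)}. \<nu> x)"

definition enveloping_cstar ::
  "('a, 'm) star_algebra_scheme \<Rightarrow> 'a set \<Rightarrow> (nat \<Rightarrow> 'a) set normed_star_algebra" where
  "enveloping_cstar A R = completion A (max_cstar_seminorm A R)"

definition enveloping_embed ::
  "('a, 'm) star_algebra_scheme \<Rightarrow> 'a set \<Rightarrow> 'a \<Rightarrow> (nat \<Rightarrow> 'a) set" where
  "enveloping_embed A R = completion_embed A (max_cstar_seminorm A R)"

text \<open>The free unital *-algebra on \<^term>\<open>X\<close>: finitely supported complex functions on words
  in letters \<^term>\<open>(x, False)\<close>, standing for \<^term>\<open>x\<close>, and \<^term>\<open>(x, True)\<close>, standing for its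
  adjoint.\<close>

definition free_star_algebra :: "'x set \<Rightarrow> (('x \<times> bool) list \<Rightarrow> complex) star_algebra" where
  "free_star_algebra X =
     \<lparr>carrier = {f. finite {w. f w \<noteq> 0} \<and> {w. f w \<noteq> 0} \<subseteq> lists (X \<times> UNIV)},
      monoid.mult = (\<lambda>f g w. \<Sum>i\<le>length w. f (take i w) * g (drop i w)),
      one = (\<lambda>w. if w = [] then 1 else 0),
      zero = (\<lambda>w. 0),
      add = (\<lambda>f g w. f w + g w),
      cscale = (\<lambda>c f w. c * f w),
      star = (\<lambda>f w. cnj (f (rev (map (\<lambda>(x, b). (x, \<not> b)) w))))\<rparr>"

definition free_gen :: "'x \<Rightarrow> ('x \<times> bool) list \<Rightarrow> complex" where
  "free_gen x = (\<lambda>w. if w = [(x, False)] then 1 else 0)"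


section \<open>Words and constructible ideals\<close>

definition words :: "'g set \<Rightarrow> 'g list set" where
  "words P = {\<alpha>. set \<alpha> \<subseteq> P \<and> even (length \<alpha>)}"

fun word_eval :: "('g, 'm) monoid_scheme \<Rightarrow> 'g list \<Rightarrow> 'g" where
  "word_eval G (p # q # \<alpha>) = inv\<^bsub>G\<^esub> p \<otimes>\<^bsub>G\<^esub> q \<otimes>\<^bsub>G\<^esub> word_eval G \<alpha>"
| "word_eval G _ = \<one>\<^bsub>G\<^esub>"

fun word_star_eval :: "('a, 'm) star_algebra_scheme \<Rightarrow> ('g \<Rightarrow> 'a) \<Rightarrow> 'g list \<Rightarrow> 'a" where
  "word_star_eval A w (p # q # \<alpha>) = star A (w p) \<otimes>\<^bsub>A\<^esub> w q \<otimes>\<^bsub>A\<^esub> word_star_eval A w \<alpha>"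
| "word_star_eval A w _ = \<one>\<^bsub>A\<^esub>"

definition words_over :: "('g, 'm) monoid_scheme \<Rightarrow> 'g set \<Rightarrow> 'g \<Rightarrow> 'g list set" where
  "words_over G P g = {\<alpha> \<in> words P. word_eval G \<alpha> = g}"

abbreviation neutral_words :: "('g, 'm) monoid_scheme \<Rightarrow> 'g set \<Rightarrow> 'g list set" where
  "neutral_words G P \<equiv> words_over G P \<one>\<^bsub>G\<^esub>"

text \<open>The \<^term>\<open>i\<close>-th set of the intersection is the translate of \<^term>\<open>P\<close> by the product of the
  first \<^term>\<open>2 * i\<close> letters of the reverse word, with inverses in the odd places.\<close>

definition constr_ideal :: "('g, 'm) monoid_scheme \<Rightarrow> 'g set \<Rightarrow> 'g list \<Rightarrow> 'g set" where
  "constr_ideal G P \<alpha> =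
     (\<Inter>i\<in>{..length \<alpha> div 2}. word_eval G (take (2 * i) (rev \<alpha>)) <#\<^bsub>G\<^esub> P)"


section \<open>The universal Toeplitz algebra\<close>

text \<open>A map \<^term>\<open>w\<close> satisfies (T1)--(T4) iff all these elements vanish. In (T4) the finite set
  is given by all its enumerations, since the factors commute only modulo
  the other relations; it is taken nonempty, since the empty product would impose \<open>1 = 0\<close>
  as soon as some neutral word has an empty ideal (the case covered by (T2)).\<close>

definition toeplitz_relators ::
  "('g, 'm) monoid_scheme \<Rightarrow> 'g set \<Rightarrow> ('a, 'n) star_algebra_scheme \<Rightarrow> ('g \<Rightarrow> 'a) \<Rightarrow> 'a set" where
  "toeplitz_relators G P A w =
     {w \<one>\<^bsub>G\<^esub> \<ominus>\<^bsub>A\<^esub> \<one>\<^bsub>A\<^esub>} \<union>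
     {word_star_eval A w \<alpha> | \<alpha>. \<alpha> \<in> neutral_words G P \<and> constr_ideal G P \<alpha> = {}} \<union>
     {word_star_eval A w \<alpha> \<ominus>\<^bsub>A\<^esub> word_star_eval A w \<beta> | \<alpha> \<beta>.
        \<alpha> \<in> neutral_words G P \<and> \<beta> \<in> neutral_words G P \<and>
        constr_ideal G P \<alpha> = constr_ideal G P \<beta>} \<union>
     {foldr (\<lambda>\<beta> x. (word_star_eval A w \<alpha> \<ominus>\<^bsub>A\<^esub> word_star_eval A w \<beta>) \<otimes>\<^bsub>A\<^esub> x) F \<one>\<^bsub>A\<^esub> | \<alpha> F.
        \<alpha> \<in> neutral_words G P \<and> distinct F \<and> F \<noteq> [] \<and> set F \<subseteq> neutral_words G P \<and>
        constr_ideal G P \<alpha> = (\<Union>\<beta>\<in>set F. constr_ideal G P \<beta>)}"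

definition universal_toeplitz ::
  "('g, 'm) monoid_scheme \<Rightarrow> 'g set \<Rightarrow> (nat \<Rightarrow> ('g \<times> bool) list \<Rightarrow> complex) set normed_star_algebra"
  where
  "universal_toeplitz G P =
     enveloping_cstar (free_star_algebra P) (toeplitz_relators G P (free_star_algebra P) free_gen)"

definition toeplitz_gen ::
  "('g, 'm) monoid_scheme \<Rightarrow> 'g set \<Rightarrow> 'g \<Rightarrow> (nat \<Rightarrow> ('g \<times> bool) list \<Rightarrow> complex) set" where
  "toeplitz_gen G P p =
     enveloping_embed (free_star_algebra P) (toeplitz_relators G P (free_star_algebra P) free_gen)
       (free_gen p)"


section \<open>Hilbert modules and their adjointable operators\<close>

record ('h, 'a) hilbert_module = "'h partial_object" +
  hadd :: "'h \<Rightarrow> 'h \<Rightarrow> 'h"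
  hzero :: 'h
  hscale :: "complex \<Rightarrow> 'h \<Rightarrow> 'h"
  hinner :: "'h \<Rightarrow> 'h \<Rightarrow> 'a"
  hnorm :: "'h \<Rightarrow> real"

definition is_adjoint ::
  "('h, 'a, 'm) hilbert_module_scheme \<Rightarrow> ('h \<Rightarrow> 'h) \<Rightarrow> ('h \<Rightarrow> 'h) \<Rightarrow> bool" where
  "is_adjoint E T S \<longleftrightarrow>
     (\<forall>x\<in>carrier E. \<forall>y\<in>carrier E. hinner E (T x) y = hinner E x (S y))"

text \<open>Adjointable maps on a Hilbert module are automatically linear and bounded; on a Hilbert
  space they are exactly the bounded operators.\<close>

definition adjointable_ops ::
  "('h, 'a, 'm) hilbert_module_scheme \<Rightarrow> ('h \<Rightarrow> 'h) normed_star_algebra" where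
  "adjointable_ops E =
     \<lparr>carrier = {T \<in> carrier E \<rightarrow>\<^sub>E carrier E. \<exists>S \<in> carrier E \<rightarrow>\<^sub>E carrier E. is_adjoint E T S},
      monoid.mult = (\<lambda>S T. \<lambda>x\<in>carrier E. S (T x)),
      one = (\<lambda>x\<in>carrier E. x),
      zero = (\<lambda>x\<in>carrier E. hzero E),
      add = (\<lambda>S T. \<lambda>x\<in>carrier E. hadd E (S x) (T x)),
      cscale = (\<lambda>c T. \<lambda>x\<in>carrier E. hscale E c (T x)),
      star = (\<lambda>T. THE S. S \<in> carrier E \<rightarrow>\<^sub>E carrier E \<and> is_adjoint E T S),
      cnorm = (\<lambda>T. SUP x\<in>{x \<in> carrier E. hnorm E x \<le> 1}. hnorm E (T x))\<rparr>"

definition ell2 :: "'x set \<Rightarrow> ('x \<Rightarrow> complex, complex) hilbert_module" where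
  "ell2 X =
     \<lparr>carrier = {\<xi> \<in> X \<rightarrow>\<^sub>E UNIV. (\<lambda>x. (cmod (\<xi> x))\<^sup>2) summable_on X},
      hadd = (\<lambda>\<xi> \<eta>. \<lambda>x\<in>X. \<xi> x + \<eta> x),
      hzero = (\<lambda>x\<in>X. 0),
      hscale = (\<lambda>c \<xi>. \<lambda>x\<in>X. c * \<xi> x),
      hinner = (\<lambda>\<xi> \<eta>. \<Sum>\<^sub>\<infinity>x\<in>X. cnj (\<xi> x) * \<eta> x),
      hnorm = (\<lambda>\<xi>. sqrt (\<Sum>\<^sub>\<infinity>x\<in>X. (cmod (\<xi> x))\<^sup>2))\<rparr>"


section \<open>The reduced Toeplitz algebra\<close>

text \<open>The operator with \<open>L\<^sub>p \<delta>\<^sub>q = \<delta>\<^bsub>pq\<^esub>\<close>.\<close>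

definition left_regular ::
  "('g, 'm) monoid_scheme \<Rightarrow> 'g set \<Rightarrow> 'g \<Rightarrow> ('g \<Rightarrow> complex) \<Rightarrow> 'g \<Rightarrow> complex" where
  "left_regular G P p =
     (\<lambda>\<xi>\<in>carrier (ell2 P). \<lambda>x\<in>P.
        if x \<in> p <#\<^bsub>G\<^esub> P then \<xi> (inv\<^bsub>G\<^esub> p \<otimes>\<^bsub>G\<^esub> x) else 0)"

definition reduced_toeplitz ::
  "('g, 'm) monoid_scheme \<Rightarrow> 'g set \<Rightarrow> (('g \<Rightarrow> complex) \<Rightarrow> 'g \<Rightarrow> complex) normed_star_algebra" where
  "reduced_toeplitz G P = generated_cstar (adjointable_ops (ell2 P)) (left_regular G P ` P)"


section \<open>Fell bundles and their cross-sectional algebras\<close>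

text \<open>Fell bundles over a group with unital unit fiber. The fibers lie in a common
  type but are regarded as disjoint: every operation receives the group elements over which its
  arguments live.\<close>

record ('g, 'b) fell_bundle =
  fiber :: "'g \<Rightarrow> 'b set"
  fadd :: "'g \<Rightarrow> 'b \<Rightarrow> 'b \<Rightarrow> 'b"
  fzero :: "'g \<Rightarrow> 'b"
  fscale :: "'g \<Rightarrow> complex \<Rightarrow> 'b \<Rightarrow> 'b"
  fnorm :: "'g \<Rightarrow> 'b \<Rightarrow> real"
  fmult :: "'g \<Rightarrow> 'g \<Rightarrow> 'b \<Rightarrow> 'b \<Rightarrow> 'b"
  fstar :: "'g \<Rightarrow> 'b \<Rightarrow> 'b"
  fone :: 'b

definition fiber_monoid :: "('g, 'b, 'n) fell_bundle_scheme \<Rightarrow> 'g \<Rightarrow> 'b monoid" where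
  "fiber_monoid B g = \<lparr>carrier = fiber B g, monoid.mult = fadd B g, one = fzero B g\<rparr>"

definition unit_fiber ::
  "('g, 'm) monoid_scheme \<Rightarrow> ('g, 'b, 'n) fell_bundle_scheme \<Rightarrow> 'b normed_star_algebra" where
  "unit_fiber G B =
     \<lparr>carrier = fiber B \<one>\<^bsub>G\<^esub>, monoid.mult = fmult B \<one>\<^bsub>G\<^esub> \<one>\<^bsub>G\<^esub>, one = fone B, zero = fzero B \<one>\<^bsub>G\<^esub>,
      add = fadd B \<one>\<^bsub>G\<^esub>, cscale = fscale B \<one>\<^bsub>G\<^esub>, star = fstar B \<one>\<^bsub>G\<^esub>, cnorm = fnorm B \<one>\<^bsub>G\<^esub>\<rparr>"

definition delta_section ::
  "('g, 'm) monoid_scheme \<Rightarrow> ('g, 'b, 'n) fell_bundle_scheme \<Rightarrow> 'b \<Rightarrow> 'g \<Rightarrow> 'g \<Rightarrow> 'b" where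
  "delta_section G B a g = (\<lambda>h\<in>carrier G. if h = g then a else fzero B h)"

definition section_support ::
  "('g, 'm) monoid_scheme \<Rightarrow> ('g, 'b, 'n) fell_bundle_scheme \<Rightarrow> ('g \<Rightarrow> 'b) \<Rightarrow> 'g set" where
  "section_support G B f = {g \<in> carrier G. f g \<noteq> fzero B g}"

text \<open>Convolution of a finitely supported section with an arbitrary one.\<close>

definition section_conv ::
  "('g, 'm) monoid_scheme \<Rightarrow> ('g, 'b, 'n) fell_bundle_scheme \<Rightarrow> ('g \<Rightarrow> 'b) \<Rightarrow> ('g \<Rightarrow> 'b) \<Rightarrow> 'g \<Rightarrow> 'b" where
  "section_conv G B f \<xi> =
     (\<lambda>g\<in>carrier G. finprod (fiber_monoid B g)
        (\<lambda>h. fmult B h (inv\<^bsub>G\<^esub> h \<otimes>\<^bsub>G\<^esub> g) (f h) (\<xi> (inv\<^bsub>G\<^esub> h \<otimes>\<^bsub>G\<^esub> g)))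
        (section_support G B f))"

definition sections_fin ::
  "('g, 'm) monoid_scheme \<Rightarrow> ('g, 'b, 'n) fell_bundle_scheme \<Rightarrow> ('g \<Rightarrow> 'b) star_algebra" where
  "sections_fin G B =
     \<lparr>carrier = {f \<in> PiE (carrier G) (fiber B). finite (section_support G B f)},
      monoid.mult = section_conv G B,
      one = delta_section G B (fone B) \<one>\<^bsub>G\<^esub>,
      zero = (\<lambda>g\<in>carrier G. fzero B g),
      add = (\<lambda>f f'. \<lambda>g\<in>carrier G. fadd B g (f g) (f' g)),
      cscale = (\<lambda>c f. \<lambda>g\<in>carrier G. fscale B g c (f g)),
      star = (\<lambda>f. \<lambda>g\<in>carrier G. fstar B (inv\<^bsub>G\<^esub> g) (f (inv\<^bsub>G\<^esub> g)))\<rparr>"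

definition full_cross_sectional ::
  "('g, 'm) monoid_scheme \<Rightarrow> ('g, 'b, 'n) fell_bundle_scheme \<Rightarrow> (nat \<Rightarrow> 'g \<Rightarrow> 'b) set normed_star_algebra"
  where
  "full_cross_sectional G B = enveloping_cstar (sections_fin G B) {}"

definition full_embed ::
  "('g, 'm) monoid_scheme \<Rightarrow> ('g, 'b, 'n) fell_bundle_scheme \<Rightarrow> ('g \<Rightarrow> 'b) \<Rightarrow> (nat \<Rightarrow> 'g \<Rightarrow> 'b) set" where
  "full_embed G B = enveloping_embed (sections_fin G B) {}"

text \<open>Unconditional norm convergence of a family in a C*-algebra.\<close>

definition has_norm_sum ::
  "('a, 'm) normed_star_algebra_scheme \<Rightarrow> ('i \<Rightarrow> 'a) \<Rightarrow> 'i set \<Rightarrow> 'a \<Rightarrow> bool" where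
  "has_norm_sum A f I s \<longleftrightarrow>
     s \<in> carrier A \<and>
     (\<forall>\<epsilon>>0. \<exists>F\<^sub>0. finite F\<^sub>0 \<and> F\<^sub>0 \<subseteq> I \<and>
        (\<forall>F. finite F \<and> F\<^sub>0 \<subseteq> F \<and> F \<subseteq> I \<longrightarrow> cnorm A (s \<ominus>\<^bsub>A\<^esub> finsum A f F) < \<epsilon>))"

definition fiber_inner ::
  "('g, 'm) monoid_scheme \<Rightarrow> ('g, 'b, 'n) fell_bundle_scheme \<Rightarrow> ('g \<Rightarrow> 'b) \<Rightarrow> ('g \<Rightarrow> 'b) \<Rightarrow> 'g \<Rightarrow> 'b" where
  "fiber_inner G B \<xi> \<eta> g = fmult B (inv\<^bsub>G\<^esub> g) g (fstar B g (\<xi> g)) (\<eta> g)"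

definition section_inner ::
  "('g, 'm) monoid_scheme \<Rightarrow> ('g, 'b, 'n) fell_bundle_scheme \<Rightarrow> ('g \<Rightarrow> 'b) \<Rightarrow> ('g \<Rightarrow> 'b) \<Rightarrow> 'b" where
  "section_inner G B \<xi> \<eta> =
     (THE s. has_norm_sum (unit_fiber G B) (fiber_inner G B \<xi> \<eta>) (carrier G) s)"

text \<open>The Hilbert module of square-summable sections over the unit fiber, i.e. the completion
  of the finitely supported sections.\<close>

definition ell2_sections ::
  "('g, 'm) monoid_scheme \<Rightarrow> ('g, 'b, 'n) fell_bundle_scheme \<Rightarrow> ('g \<Rightarrow> 'b, 'b) hilbert_module" where
  "ell2_sections G B =
     \<lparr>carrier = {\<xi> \<in> PiE (carrier G) (fiber B).
                   \<exists>s. has_norm_sum (unit_fiber G B) (fiber_inner G B \<xi> \<xi>) (carrier G) s},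
      hadd = (\<lambda>\<xi> \<eta>. \<lambda>g\<in>carrier G. fadd B g (\<xi> g) (\<eta> g)),
      hzero = (\<lambda>g\<in>carrier G. fzero B g),
      hscale = (\<lambda>c \<xi>. \<lambda>g\<in>carrier G. fscale B g c (\<xi> g)),
      hinner = section_inner G B,
      hnorm = (\<lambda>\<xi>. sqrt (fnorm B \<one>\<^bsub>G\<^esub> (section_inner G B \<xi> \<xi>)))\<rparr>"

definition regular_rep ::
  "('g, 'm) monoid_scheme \<Rightarrow> ('g, 'b, 'n) fell_bundle_scheme \<Rightarrow> ('g \<Rightarrow> 'b) \<Rightarrow> ('g \<Rightarrow> 'b) \<Rightarrow> 'g \<Rightarrow> 'b" where
  "regular_rep G B f = (\<lambda>\<xi>\<in>carrier (ell2_sections G B). section_conv G B f \<xi>)"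

definition reduced_cross_sectional ::
  "('g, 'm) monoid_scheme \<Rightarrow> ('g, 'b, 'n) fell_bundle_scheme \<Rightarrow> (('g \<Rightarrow> 'b) \<Rightarrow> 'g \<Rightarrow> 'b) normed_star_algebra"
  where
  "reduced_cross_sectional G B =
     (adjointable_ops (ell2_sections G B))
       \<lparr>carrier := norm_closure (adjointable_ops (ell2_sections G B))
                     (regular_rep G B ` carrier (sections_fin G B))\<rparr>"

text \<open>The semidirect product bundle of a partial action on the C*-algebra \<^term>\<open>D\<close> by
  isomorphisms between the ideals \<^term>\<open>A (inv\<^bsub>G\<^esub> g)\<close> and \<^term>\<open>A g\<close>; the element \<open>a\<delta>\<^sub>g\<close> is
  represented by \<^term>\<open>a\<close> in the fiber over \<^term>\<open>g\<close>.\<close>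

definition semidirect_bundle ::
  "('g, 'm) monoid_scheme \<Rightarrow> ('a, 'n) normed_star_algebra_scheme \<Rightarrow> ('g \<Rightarrow> 'a set) \<Rightarrow> ('g \<Rightarrow> 'a \<Rightarrow> 'a)
     \<Rightarrow> ('g, 'a) fell_bundle" where
  "semidirect_bundle G D A \<gamma> =
     \<lparr>fiber = A,
      fadd = (\<lambda>g. add D),
      fzero = (\<lambda>g. \<zero>\<^bsub>D\<^esub>),
      fscale = (\<lambda>g. cscale D),
      fnorm = (\<lambda>g. cnorm D),
      fmult = (\<lambda>g h a b. \<gamma> g (\<gamma> (inv\<^bsub>G\<^esub> g) a \<otimes>\<^bsub>D\<^esub> b)),
      fstar = (\<lambda>g a. \<gamma> (inv\<^bsub>G\<^esub> g) (star D a)),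
      fone = \<one>\<^bsub>D\<^esub>\<rparr>"


section \<open>The canonical partial action on the reduced diagonal\<close>

definition ell_infty :: "'x set \<Rightarrow> ('x \<Rightarrow> complex) normed_star_algebra" where
  "ell_infty X =
     \<lparr>carrier = {f \<in> X \<rightarrow>\<^sub>E UNIV. bdd_above ((\<lambda>x. cmod (f x)) ` X)},
      monoid.mult = (\<lambda>f g. \<lambda>x\<in>X. f x * g x),
      one = (\<lambda>x\<in>X. 1),
      zero = (\<lambda>x\<in>X. 0),
      add = (\<lambda>f g. \<lambda>x\<in>X. f x + g x),
      cscale = (\<lambda>c f. \<lambda>x\<in>X. c * f x),
      star = (\<lambda>f. \<lambda>x\<in>X. cnj (f x)),
      cnorm = (\<lambda>f. SUP x\<in>X. cmod (f x))\<rparr>"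

definition char_fun :: "'x set \<Rightarrow> 'x set \<Rightarrow> 'x \<Rightarrow> complex" where
  "char_fun X K = (\<lambda>x\<in>X. if x \<in> K then 1 else 0)"

text \<open>The ideal usually denoted \<open>A\<^sub>g\<close>; it is spanned by the words over the inverse of \<^term>\<open>g\<close>.\<close>

definition diag_ideal :: "('g, 'm) monoid_scheme \<Rightarrow> 'g set \<Rightarrow> 'g \<Rightarrow> ('g \<Rightarrow> complex) set" where
  "diag_ideal G P g =
     norm_closure (ell_infty P) (lin_span (ell_infty P)
       ((\<lambda>\<alpha>. char_fun P (constr_ideal G P \<alpha>)) ` words_over G P (inv\<^bsub>G\<^esub> g)))"

definition reduced_diagonal ::
  "('g, 'm) monoid_scheme \<Rightarrow> 'g set \<Rightarrow> ('g \<Rightarrow> complex) normed_star_algebra" where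
  "reduced_diagonal G P = (ell_infty P)\<lparr>carrier :=
     norm_closure (ell_infty P) (lin_span (ell_infty P)
       ((\<lambda>\<alpha>. char_fun P (constr_ideal G P \<alpha>)) ` neutral_words G P))\<rparr>"

text \<open>Translation by \<^term>\<open>g\<close>, with value 0 where the translated function is undefined. See
  \<open>canonical_action_iso\<close>, \<open>canonical_action_char_fun\<close> and \<open>constr_ideal_rev\<close> below for the
  properties characterizing it on the ideals.\<close>

definition canonical_action ::
  "('g, 'm) monoid_scheme \<Rightarrow> 'g set \<Rightarrow> 'g \<Rightarrow> ('g \<Rightarrow> complex) \<Rightarrow> 'g \<Rightarrow> complex" where
  "canonical_action G P g f =
     (\<lambda>x\<in>P. if inv\<^bsub>G\<^esub> g \<otimes>\<^bsub>G\<^esub> x \<in> P then f (inv\<^bsub>G\<^esub> g \<otimes>\<^bsub>G\<^esub> x) else 0)"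

lemma word_eval_closed:
  assumes "group G" "set \<alpha> \<subseteq> carrier G"
  shows "word_eval G \<alpha> \<in> carrier G"
proof -
  interpret group G by fact
  show ?thesis using assms(2)
  proof (induction "length \<alpha>" arbitrary: \<alpha> rule: less_induct)
    case less
    consider "\<alpha> = []" | p where "\<alpha> = [p]" | p q \<alpha>' where "\<alpha> = p # q # \<alpha>'"
      by (metis list.exhaust)
    then show ?case by cases (use less in auto)
  qed
qed

lemma word_eval_append:
  assumes "group G" "set \<alpha> \<subseteq> carrier G" "set \<beta> \<subseteq> carrier G" "even (length \<alpha>)"
  shows "word_eval G (\<alpha> @ \<beta>) = word_eval G \<alpha> \<otimes>\<^bsub>G\<^esub> word_eval G \<beta>"
proof -
  interpret group G by fact
  show ?thesis using assms(2-4)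
  proof (induction "length \<alpha>" arbitrary: \<alpha> rule: less_induct)
    case less
    show ?case
    proof (cases "\<alpha> = []")
      case True
      then show ?thesis using less.prems word_eval_closed[OF assms(1)] by simp
    next
      case False
      with less.prems obtain p q \<alpha>' where \<alpha>: "\<alpha> = p # q # \<alpha>'"
        by (cases \<alpha>; cases "tl \<alpha>") auto
      have "word_eval G (\<alpha>' @ \<beta>) = word_eval G \<alpha>' \<otimes>\<^bsub>G\<^esub> word_eval G \<beta>"
        using less.hyps[of \<alpha>'] less.prems \<alpha> by auto
      then show ?thesis using \<alpha> less.prems word_eval_closed[OF assms(1)]
        by (simp add: m_assoc)
    qed
  qed
qed

lemma word_eval_rev:
  assumes "group G" "set \<alpha> \<subseteq> carrier G" "even (length \<alpha>)"
  shows "word_eval G (rev \<alpha>) = inv\<^bsub>G\<^esub> word_eval G \<alpha>"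
proof -
  interpret group G by fact
  show ?thesis using assms(2-3)
  proof (induction "length \<alpha>" arbitrary: \<alpha> rule: less_induct)
    case less
    show ?case
    proof (cases "\<alpha> = []")
      case True
      then show ?thesis by simp
    next
      case False
      with less.prems obtain p q \<alpha>' where \<alpha>: "\<alpha> = p # q # \<alpha>'"
        by (cases \<alpha>; cases "tl \<alpha>") auto
      have pq: "p \<in> carrier G" "q \<in> carrier G" "set \<alpha>' \<subseteq> carrier G" "even (length \<alpha>')"
        using less.prems \<alpha> by auto
      have "word_eval G (rev \<alpha>) = word_eval G (rev \<alpha>' @ [q, p])" using \<alpha> by simp
      also have "\<dots> = word_eval G (rev \<alpha>') \<otimes>\<^bsub>G\<^esub> word_eval G [q, p]"
        using pq by (intro word_eval_append[OF assms(1)]) auto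
      also have "word_eval G (rev \<alpha>') = inv\<^bsub>G\<^esub> word_eval G \<alpha>'"
        using less.hyps[of \<alpha>'] pq \<alpha> by auto
      also have "inv\<^bsub>G\<^esub> word_eval G \<alpha>' \<otimes>\<^bsub>G\<^esub> word_eval G [q, p] = inv\<^bsub>G\<^esub> word_eval G \<alpha>"
        using \<alpha> pq word_eval_closed[OF assms(1) pq(3)] by (simp add: inv_mult_group)
      finally show ?thesis .
    qed
  qed
qed

lemma mem_l_coset_iff:
  assumes "group G" "g \<in> carrier G" "A \<subseteq> carrier G"
  shows "x \<in> g <#\<^bsub>G\<^esub> A \<longleftrightarrow> x \<in> carrier G \<and> inv\<^bsub>G\<^esub> g \<otimes>\<^bsub>G\<^esub> x \<in> A"
proof -
  interpret group G by fact
  show ?thesis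
  proof
    assume "x \<in> g <#\<^bsub>G\<^esub> A"
    then obtain a where "a \<in> A" "x = g \<otimes>\<^bsub>G\<^esub> a" by (auto simp: l_coset_def)
    then show "x \<in> carrier G \<and> inv\<^bsub>G\<^esub> g \<otimes>\<^bsub>G\<^esub> x \<in> A"
      using assms by (auto simp: m_assoc[symmetric] subset_iff)
  next
    assume x: "x \<in> carrier G \<and> inv\<^bsub>G\<^esub> g \<otimes>\<^bsub>G\<^esub> x \<in> A"
    then have "x = g \<otimes>\<^bsub>G\<^esub> (inv\<^bsub>G\<^esub> g \<otimes>\<^bsub>G\<^esub> x)"
      using assms by (simp add: m_assoc[symmetric])
    then show "x \<in> g <#\<^bsub>G\<^esub> A" using x unfolding l_coset_def by blast
  qed
qed

lemma constr_ideal_subset: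
  assumes "group G" "submonoid P G"
  shows "constr_ideal G P \<alpha> \<subseteq> P"
proof -
  interpret group G by fact
  have "P \<subseteq> carrier G" using assms(2) by (simp add: submonoid.subset)
  then have "\<one>\<^bsub>G\<^esub> <#\<^bsub>G\<^esub> P = P" by (rule lcos_mult_one)
  then show ?thesis by (force simp: constr_ideal_def)
qed

lemma constr_ideal_rev:
  assumes "group G" "submonoid P G" "\<alpha> \<in> words_over G P g"
  shows "g <#\<^bsub>G\<^esub> constr_ideal G P \<alpha> = constr_ideal G P (rev \<alpha>)"
proof -
  interpret group G by fact
  have P: "P \<subseteq> carrier G" using assms(2) by (simp add: submonoid.subset)
  have \<alpha>: "set \<alpha> \<subseteq> P" "set \<alpha> \<subseteq> carrier G" "even (length \<alpha>)" and g: "word_eval G \<alpha> = g"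
    using assms(3) P by (auto simp: words_over_def words_def)
  have gG: "g \<in> carrier G" using word_eval_closed[OF assms(1) \<alpha>(2)] g by simp
  have K: "constr_ideal G P \<alpha> \<subseteq> carrier G" using constr_ideal_subset[OF assms(1,2)] P by blast
  define k where "k = length \<alpha> div 2"
  define a where "a i = word_eval G (take (2 * i) (rev \<alpha>))" for i
  define b where "b i = word_eval G (take (2 * i) \<alpha>)" for i
  have aG: "a i \<in> carrier G" for i
    unfolding a_def using \<alpha>(2) by (intro word_eval_closed[OF assms(1)]) (auto dest!: in_set_takeD)
  have bG: "b i \<in> carrier G" for i
    unfolding b_def using \<alpha>(2) by (intro word_eval_closed[OF assms(1)]) (auto dest!: in_set_takeD)
  have ab: "g \<otimes>\<^bsub>G\<^esub> a i = b (k - i)" if i: "i \<le> k" for i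
  proof -
    have len: "length \<alpha> = 2 * k" using \<alpha>(3) by (simp add: k_def)
    define u where "u = take (2 * (k - i)) \<alpha>"
    define v where "v = drop (2 * (k - i)) \<alpha>"
    have uv: "\<alpha> = u @ v" by (simp add: u_def v_def)
    have sub: "set u \<subseteq> carrier G" "set v \<subseteq> carrier G" using \<alpha>(2) uv by auto
    have ev: "even (length u)" "even (length v)" using len by (auto simp: u_def v_def)
    have "take (2 * i) (rev \<alpha>) = rev v"
      using i len by (simp add: take_rev v_def right_diff_distrib')
    then have "a i = inv\<^bsub>G\<^esub> word_eval G v"
      using word_eval_rev[OF assms(1) sub(2) ev(2)] by (simp add: a_def)
    moreover have "g = word_eval G u \<otimes>\<^bsub>G\<^esub> word_eval G v"
      using word_eval_append[OF assms(1) sub ev(1)] g uv by simp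
    ultimately show ?thesis
      using word_eval_closed[OF assms(1) sub(1)] word_eval_closed[OF assms(1) sub(2)]
      by (simp add: b_def u_def[symmetric] m_assoc)
  qed
  have *: "x \<in> a i <#\<^bsub>G\<^esub> P \<longleftrightarrow> g \<otimes>\<^bsub>G\<^esub> x \<in> b (k - i) <#\<^bsub>G\<^esub> P" if "i \<le> k" "x \<in> carrier G" for i x
  proof -
    have "inv\<^bsub>G\<^esub> b (k - i) \<otimes>\<^bsub>G\<^esub> (g \<otimes>\<^bsub>G\<^esub> x) = inv\<^bsub>G\<^esub> a i \<otimes>\<^bsub>G\<^esub> x"
      unfolding ab[OF that(1), symmetric] using aG[of i] gG that(2)
      by (simp add: inv_mult_group m_assoc inv_solve_left')
    then show ?thesis
      using that aG bG gG by (simp add: mem_l_coset_iff[OF assms(1) _ P])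
  qed
  have Ka: "constr_ideal G P \<alpha> = (\<Inter>i\<in>{..k}. a i <#\<^bsub>G\<^esub> P)"
    by (simp add: constr_ideal_def a_def k_def)
  have Kb: "constr_ideal G P (rev \<alpha>) = (\<Inter>i\<in>{..k}. b i <#\<^bsub>G\<^esub> P)"
    by (simp add: constr_ideal_def b_def k_def)
  have Kb': "constr_ideal G P (rev \<alpha>) \<subseteq> carrier G"
    using constr_ideal_subset[OF assms(1,2)] P by blast
  have "x \<in> g <#\<^bsub>G\<^esub> constr_ideal G P \<alpha> \<longleftrightarrow> x \<in> constr_ideal G P (rev \<alpha>)" for x
  proof (cases "x \<in> carrier G")
    case True
    have gx: "g \<otimes>\<^bsub>G\<^esub> (inv\<^bsub>G\<^esub> g \<otimes>\<^bsub>G\<^esub> x) = x" using gG True by (simp add: m_assoc[symmetric])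
    have "x \<in> g <#\<^bsub>G\<^esub> constr_ideal G P \<alpha> \<longleftrightarrow> (\<forall>i\<le>k. inv\<^bsub>G\<^esub> g \<otimes>\<^bsub>G\<^esub> x \<in> a i <#\<^bsub>G\<^esub> P)"
      unfolding mem_l_coset_iff[OF assms(1) gG K] using True by (auto simp: Ka)
    also have "\<dots> \<longleftrightarrow> (\<forall>i\<le>k. x \<in> b (k - i) <#\<^bsub>G\<^esub> P)"
      using * gx gG True by simp
    also have "\<dots> \<longleftrightarrow> (\<forall>i\<le>k. x \<in> b i <#\<^bsub>G\<^esub> P)"
      by (metis diff_diff_cancel diff_le_self)
    finally show ?thesis by (auto simp: Kb)
  next
    case False
    then show ?thesis using mem_l_coset_iff[OF assms(1) gG K] Kb' by blast
  qed
  then show ?thesis by blast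
qed

lemma canonical_action_char_fun:
  assumes "group G" "submonoid P G" "\<alpha> \<in> words_over G P g"
  shows "canonical_action G P g (char_fun P (constr_ideal G P \<alpha>)) =
    char_fun P (g <#\<^bsub>G\<^esub> constr_ideal G P \<alpha>)"
proof -
  have P: "P \<subseteq> carrier G" using assms(2) by (simp add: submonoid.subset)
  have g: "g \<in> carrier G"
    using assms(3) P word_eval_closed[OF assms(1)] by (auto simp: words_over_def words_def)
  have K: "constr_ideal G P \<alpha> \<subseteq> P" by (rule constr_ideal_subset[OF assms(1,2)])
  show ?thesis
    using P K mem_l_coset_iff[OF assms(1) g, of "constr_ideal G P \<alpha>"]
    by (intro ext) (auto simp: canonical_action_def char_fun_def restrict_def)
qed

lemma ell_infty_minus:
  assumes "f \<in> carrier (ell_infty X)" "h \<in> carrier (ell_infty X)"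
  shows "f \<ominus>\<^bsub>ell_infty X\<^esub> h = (\<lambda>x\<in>X. f x - h x)"
proof -
  have neg: "(\<lambda>x\<in>X. - h x) \<in> carrier (ell_infty X)"
    using assms(2) by (auto simp: ell_infty_def cong: image_cong_simp)
  have "\<ominus>\<^bsub>ell_infty X\<^esub> h = (\<lambda>x\<in>X. - h x)"
    unfolding a_inv_def m_inv_def
  proof (rule the_equality)
    show "(\<lambda>x\<in>X. - h x) \<in> carrier (add_monoid (ell_infty X)) \<and>
      h \<otimes>\<^bsub>add_monoid (ell_infty X)\<^esub> (\<lambda>x\<in>X. - h x) = \<one>\<^bsub>add_monoid (ell_infty X)\<^esub> \<and>
      (\<lambda>x\<in>X. - h x) \<otimes>\<^bsub>add_monoid (ell_infty X)\<^esub> h = \<one>\<^bsub>add_monoid (ell_infty X)\<^esub>"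
      using neg by (auto simp: ell_infty_def fun_eq_iff restrict_def)
  next
    fix y
    assume y: "y \<in> carrier (add_monoid (ell_infty X)) \<and>
      h \<otimes>\<^bsub>add_monoid (ell_infty X)\<^esub> y = \<one>\<^bsub>add_monoid (ell_infty X)\<^esub> \<and>
      y \<otimes>\<^bsub>add_monoid (ell_infty X)\<^esub> h = \<one>\<^bsub>add_monoid (ell_infty X)\<^esub>"
    then have ext: "y \<in> extensional X" and *: "(\<lambda>x\<in>X. y x + h x) = (\<lambda>x\<in>X. 0)"
      by (auto simp: ell_infty_def PiE_def)
    show "y = (\<lambda>x\<in>X. - h x)"
    proof
      fix x
      show "y x = (\<lambda>x\<in>X. - h x) x"
        using ext fun_cong[OF *, of x]
        by (cases "x \<in> X") (auto simp: extensional_def eq_neg_iff_add_eq_0)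
    qed
  qed
  then show ?thesis by (auto simp: a_minus_def ell_infty_def fun_eq_iff restrict_def)
qed

lemma lin_span_carrier:
  assumes "S \<subseteq> carrier (ell_infty X)" "f \<in> lin_span (ell_infty X) S"
  shows "f \<in> carrier (ell_infty X)"
  using assms(2)
proof induction
  case lin_span_zero
  show ?case by (auto simp: ell_infty_def cong: image_cong_simp)
next
  case (lin_span_base x)
  then show ?case using assms(1) by blast
next
  case (lin_span_add f h)
  then obtain a b where "\<forall>x\<in>X. cmod (f x) \<le> a" "\<forall>x\<in>X. cmod (h x) \<le> b"
    by (auto simp: ell_infty_def bdd_above_def)
  then have "\<forall>x\<in>X. cmod (f x + h x) \<le> a + b"
    by (meson add_mono norm_triangle_ineq order_trans)
  then show ?case by (auto simp: ell_infty_def bdd_above_def)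
next
  case (lin_span_scale f c)
  then obtain a where "\<forall>x\<in>X. cmod (f x) \<le> a"
    by (auto simp: ell_infty_def bdd_above_def)
  then have "\<forall>x\<in>X. cmod (c * f x) \<le> cmod c * a"
    by (simp add: norm_mult mult_left_mono)
  then show ?case by (auto simp: ell_infty_def bdd_above_def)
qed

lemma char_fun_carrier: "char_fun X K \<in> carrier (ell_infty X)"
proof -
  have "bdd_above ((\<lambda>x. cmod (char_fun X K x)) ` X)"
    by (rule bdd_aboveI2[of _ _ 1]) (simp add: char_fun_def)
  then show ?thesis by (simp add: ell_infty_def char_fun_def)
qed

lemma ell_infty_norm_ge:
  assumes "f \<in> carrier (ell_infty X)" "x \<in> X"
  shows "cmod (f x) \<le> cnorm (ell_infty X) f"
  using assms by (auto simp: ell_infty_def intro: cSUP_upper)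

lemma ell_infty_norm_le:
  assumes "X \<noteq> {}" "\<And>x. x \<in> X \<Longrightarrow> cmod (f x) \<le> c"
  shows "cnorm (ell_infty X) f \<le> c"
  using assms by (auto simp: ell_infty_def intro: cSUP_least)

lemma diag_ideal_carrier: "diag_ideal G P g \<subseteq> carrier (ell_infty P)"
  by (auto simp: diag_ideal_def norm_closure_def)

lemma diag_ideal_support:
  assumes "group G" "submonoid P G" "g \<in> carrier G" "f \<in> diag_ideal G P g"
    "x \<in> P" "inv\<^bsub>G\<^esub> g \<otimes>\<^bsub>G\<^esub> x \<notin> P"
  shows "f x = 0"
proof -
  interpret group G by fact
  have P: "P \<subseteq> carrier G" using assms(2) by (simp add: submonoid.subset)
  let ?S = "(\<lambda>\<alpha>. char_fun P (constr_ideal G P \<alpha>)) ` words_over G P (inv\<^bsub>G\<^esub> g)"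
  have x_notin: "x \<notin> constr_ideal G P \<alpha>" if "\<alpha> \<in> words_over G P (inv\<^bsub>G\<^esub> g)" for \<alpha>
  proof
    assume "x \<in> constr_ideal G P \<alpha>"
    then have "x \<in> word_eval G (take (2 * (length \<alpha> div 2)) (rev \<alpha>)) <#\<^bsub>G\<^esub> P"
      by (auto simp: constr_ideal_def)
    moreover have "even (length \<alpha>)" "set \<alpha> \<subseteq> carrier G" "word_eval G \<alpha> = inv\<^bsub>G\<^esub> g"
      using that P by (auto simp: words_over_def words_def)
    ultimately have "x \<in> g <#\<^bsub>G\<^esub> P"
      using word_eval_rev[OF assms(1)] assms(3) by simp
    then show False using mem_l_coset_iff[OF assms(1,3) P] assms(6) by blast
  qed
  have span: "h x = 0" if "h \<in> lin_span (ell_infty P) ?S" for h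
    using that
  proof induction
    case (lin_span_base h)
    then show ?case using x_notin assms(5) by (auto simp: char_fun_def)
  qed (use assms(5) in \<open>auto simp: ell_infty_def\<close>)
  have S: "?S \<subseteq> carrier (ell_infty P)" using char_fun_carrier by blast
  have "cmod (f x) < \<epsilon>" if eps: "\<epsilon> > 0" for \<epsilon>
  proof -
    have f: "f \<in> carrier (ell_infty P)" by (rule subsetD[OF diag_ideal_carrier assms(4)])
    obtain h where h: "h \<in> lin_span (ell_infty P) ?S"
      "cnorm (ell_infty P) (f \<ominus>\<^bsub>ell_infty P\<^esub> h) < \<epsilon>"
      using assms(4) eps unfolding diag_ideal_def norm_closure_def by blast
    have hc: "h \<in> carrier (ell_infty P)" using lin_span_carrier[OF S h(1)] .
    obtain a b where "\<forall>x\<in>P. cmod (f x) \<le> a" "\<forall>x\<in>P. cmod (h x) \<le> b"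
      using f hc by (auto simp: ell_infty_def bdd_above_def)
    then have "\<forall>x\<in>P. cmod (f x - h x) \<le> a + b"
      by (meson add_mono norm_triangle_ineq4 order_trans)
    then have "(\<lambda>x\<in>P. f x - h x) \<in> carrier (ell_infty P)"
      by (auto simp: ell_infty_def bdd_above_def)
    from ell_infty_norm_ge[OF this assms(5)] h(2) assms(5) span[OF h(1)]
    show ?thesis by (simp add: ell_infty_minus[OF f hc])
  qed
  then show ?thesis by (metis norm_le_zero_iff not_le order_less_irrefl)
qed

lemma canonical_action_norm_le:
  assumes "P \<noteq> {}" "f \<in> carrier (ell_infty P)"
  shows "cnorm (ell_infty P) (canonical_action G P g f) \<le> cnorm (ell_infty P) f"
proof (rule ell_infty_norm_le[OF assms(1)])
  obtain y where "y \<in> P" using assms(1) by blast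
  then have "0 \<le> cnorm (ell_infty P) f"
    using ell_infty_norm_ge[OF assms(2)] norm_ge_zero order_trans by blast
  then show "cmod (canonical_action G P g f x) \<le> cnorm (ell_infty P) f" if "x \<in> P" for x
    using that ell_infty_norm_ge[OF assms(2)] by (auto simp: canonical_action_def)
qed

lemma canonical_action_carrier:
  assumes "P \<noteq> {}" "f \<in> carrier (ell_infty P)"
  shows "canonical_action G P g f \<in> carrier (ell_infty P)"
proof -
  obtain a where a: "\<forall>x\<in>P. cmod (f x) \<le> a" using assms(2) by (auto simp: ell_infty_def bdd_above_def)
  obtain y where "y \<in> P" using assms(1) by blast
  then have "0 \<le> a" using a norm_ge_zero order_trans by blast
  then have "\<forall>x\<in>P. cmod (canonical_action G P g f x) \<le> a"
    using a by (auto simp: canonical_action_def)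
  then have "bdd_above ((\<lambda>x. cmod (canonical_action G P g f x)) ` P)" by (auto intro!: bdd_aboveI)
  then show ?thesis
    by (auto simp: ell_infty_def canonical_action_def)
qed

lemma canonical_action_mem:
  assumes "group G" "submonoid P G" "g \<in> carrier G" "f \<in> diag_ideal G P (inv\<^bsub>G\<^esub> g)"
  shows "canonical_action G P g f \<in> diag_ideal G P g"
proof -
  interpret group G by fact
  have P: "P \<subseteq> carrier G" "P \<noteq> {}"
    using assms(2) submonoid.subset submonoid.one_closed by blast+
  let ?S = "\<lambda>g. (\<lambda>\<alpha>. char_fun P (constr_ideal G P \<alpha>)) ` words_over G P g"
  let ?T = "canonical_action G P g"
  have S: "?S h \<subseteq> carrier (ell_infty P)" for h using char_fun_carrier by blast
  have span: "?T h \<in> lin_span (ell_infty P) (?S (inv\<^bsub>G\<^esub> g))" if "h \<in> lin_span (ell_infty P) (?S g)" for h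
    using that
  proof induction
    case lin_span_zero
    have "?T \<zero>\<^bsub>ell_infty P\<^esub> = \<zero>\<^bsub>ell_infty P\<^esub>"
      by (auto simp: canonical_action_def ell_infty_def fun_eq_iff restrict_def)
    then show ?case by (simp add: lin_span.lin_span_zero)
  next
    case (lin_span_base h)
    then obtain \<alpha> where \<alpha>: "\<alpha> \<in> words_over G P g" "h = char_fun P (constr_ideal G P \<alpha>)" by blast
    have "rev \<alpha> \<in> words_over G P (inv\<^bsub>G\<^esub> g)"
      using \<alpha>(1) P word_eval_rev[OF assms(1), of \<alpha>] by (auto simp: words_over_def words_def)
    moreover have "?T h = char_fun P (constr_ideal G P (rev \<alpha>))"
      using canonical_action_char_fun[OF assms(1,2) \<alpha>(1)] constr_ideal_rev[OF assms(1,2) \<alpha>(1)] \<alpha>(2)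
      by simp
    ultimately show ?case by (intro lin_span.lin_span_base) blast
  next
    case (lin_span_add h k)
    have "?T (h \<oplus>\<^bsub>ell_infty P\<^esub> k) = ?T h \<oplus>\<^bsub>ell_infty P\<^esub> ?T k"
      by (auto simp: canonical_action_def ell_infty_def fun_eq_iff restrict_def)
    then show ?case using lin_span_add by (simp add: lin_span.lin_span_add)
  next
    case (lin_span_scale h c)
    have "?T (cscale (ell_infty P) c h) = cscale (ell_infty P) c (?T h)"
      by (auto simp: canonical_action_def ell_infty_def fun_eq_iff restrict_def)
    then show ?case using lin_span_scale by (simp add: lin_span.lin_span_scale)
  qed
  have f: "f \<in> carrier (ell_infty P)" by (rule subsetD[OF diag_ideal_carrier assms(4)])
  have "\<exists>k\<in>lin_span (ell_infty P) (?S (inv\<^bsub>G\<^esub> g)).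
      cnorm (ell_infty P) (?T f \<ominus>\<^bsub>ell_infty P\<^esub> k) < \<epsilon>" if eps: "\<epsilon> > 0" for \<epsilon>
  proof -
    obtain h where h: "h \<in> lin_span (ell_infty P) (?S g)"
      "cnorm (ell_infty P) (f \<ominus>\<^bsub>ell_infty P\<^esub> h) < \<epsilon>"
      using assms(4) eps unfolding diag_ideal_def norm_closure_def inv_inv[OF assms(3)] by blast
    have hc: "h \<in> carrier (ell_infty P)" using lin_span_carrier[OF S h(1)] .
    obtain a b where "\<forall>x\<in>P. cmod (f x) \<le> a" "\<forall>x\<in>P. cmod (h x) \<le> b"
      using f hc by (auto simp: ell_infty_def bdd_above_def)
    then have "\<forall>x\<in>P. cmod (f x - h x) \<le> a + b"
      by (meson add_mono norm_triangle_ineq4 order_trans)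
    then have fh: "f \<ominus>\<^bsub>ell_infty P\<^esub> h \<in> carrier (ell_infty P)"
      unfolding ell_infty_minus[OF f hc] by (auto simp: ell_infty_def bdd_above_def)
    moreover have "?T f \<ominus>\<^bsub>ell_infty P\<^esub> ?T h = ?T (f \<ominus>\<^bsub>ell_infty P\<^esub> h)"
      unfolding ell_infty_minus[OF f hc]
        ell_infty_minus[OF canonical_action_carrier[OF P(2) f] canonical_action_carrier[OF P(2) hc]]
      by (auto simp: canonical_action_def fun_eq_iff restrict_def)
    ultimately have "cnorm (ell_infty P) (?T f \<ominus>\<^bsub>ell_infty P\<^esub> ?T h) < \<epsilon>"
      using order_le_less_trans[OF canonical_action_norm_le[OF P(2) fh] h(2)] by simp
    then show ?thesis using span[OF h(1)] by blast
  qed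
  then show ?thesis
    using canonical_action_carrier[OF P(2) f] unfolding diag_ideal_def norm_closure_def by blast
qed

lemma canonical_action_inverse:
  assumes "group G" "submonoid P G" "g \<in> carrier G" "f \<in> diag_ideal G P (inv\<^bsub>G\<^esub> g)"
  shows "canonical_action G P (inv\<^bsub>G\<^esub> g) (canonical_action G P g f) = f"
proof
  interpret group G by fact
  fix x
  have P: "P \<subseteq> carrier G" using assms(2) by (simp add: submonoid.subset)
  have f: "f \<in> carrier (ell_infty P)" by (rule subsetD[OF diag_ideal_carrier assms(4)])
  show "canonical_action G P (inv\<^bsub>G\<^esub> g) (canonical_action G P g f) x = f x"
  proof (cases "x \<in> P")
    case True
    then have "inv\<^bsub>G\<^esub> g \<otimes>\<^bsub>G\<^esub> (g \<otimes>\<^bsub>G\<^esub> x) = x" using P assms(3) by (auto simp: m_assoc[symmetric])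
    then show ?thesis
      using True assms(3) diag_ideal_support[OF assms(1,2) inv_closed[OF assms(3)] assms(4) True]
      by (auto simp: canonical_action_def)
  next
    case False
    then show ?thesis using f by (auto simp: canonical_action_def ell_infty_def PiE_def extensional_def)
  qed
qed

lemma canonical_action_iso:
  assumes "group G" "submonoid P G" "g \<in> carrier G"
  shows "cstar_iso ((ell_infty P)\<lparr>carrier := diag_ideal G P (inv\<^bsub>G\<^esub> g)\<rparr>)
    ((ell_infty P)\<lparr>carrier := diag_ideal G P g\<rparr>) (canonical_action G P g)"
proof -
  interpret group G by fact
  have P: "P \<noteq> {}" using assms(2) submonoid.one_closed by blast
  let ?T = "canonical_action G P g" and ?S = "canonical_action G P (inv\<^bsub>G\<^esub> g)"
  have g': "inv\<^bsub>G\<^esub> g \<in> carrier G" using assms(3) by simp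
  have T: "?T f \<in> diag_ideal G P g" "?S (?T f) = f" if "f \<in> diag_ideal G P (inv\<^bsub>G\<^esub> g)" for f
    using canonical_action_mem[OF assms that] canonical_action_inverse[OF assms that] by auto
  have S: "?S f \<in> diag_ideal G P (inv\<^bsub>G\<^esub> g)" "?T (?S f) = f" if "f \<in> diag_ideal G P g" for f
    using canonical_action_mem[OF assms(1,2) g'] canonical_action_inverse[OF assms(1,2) g'] that assms(3)
    by auto
  have bij: "bij_betw ?T (diag_ideal G P (inv\<^bsub>G\<^esub> g)) (diag_ideal G P g)"
    by (rule bij_betwI[of _ _ _ ?S]) (use T S in auto)
  have norm: "cnorm (ell_infty P) (?T f) = cnorm (ell_infty P) f"
    if "f \<in> diag_ideal G P (inv\<^bsub>G\<^esub> g)" for f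
  proof (rule antisym)
    have f: "f \<in> carrier (ell_infty P)" by (rule subsetD[OF diag_ideal_carrier that])
    show "cnorm (ell_infty P) (?T f) \<le> cnorm (ell_infty P) f"
      by (rule canonical_action_norm_le[OF P f])
    show "cnorm (ell_infty P) f \<le> cnorm (ell_infty P) (?T f)"
      using canonical_action_norm_le[OF P canonical_action_carrier[OF P f], of G "inv\<^bsub>G\<^esub> g" G g] T(2)[OF that]
      by simp
  qed
  show ?thesis
    unfolding cstar_iso_def
    using bij norm by (auto simp: canonical_action_def ell_infty_def fun_eq_iff restrict_def)
qed

definition canonical_bundle ::
  "('g, 'm) monoid_scheme \<Rightarrow> 'g set \<Rightarrow> ('g, 'g \<Rightarrow> complex) fell_bundle" where
  "canonical_bundle G P =
     semidirect_bundle G (reduced_diagonal G P) (diag_ideal G P) (canonical_action G P)"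

end

theory Submission
  imports Defs "HOL-Analysis.Weierstrass_Theorems"
begin

text \<open>The product of the sections \<open>1\<^bsub>pP\<^esub>\<delta>\<^sub>p\<close> and their adjoints along a word \<open>\<alpha>\<close> is a characteristic function
  over the value of \<open>\<alpha>\<close>, so these sections satisfy (T1)--(T4). Conversely, (T3) makes the
  elements \<open>t\<^sub>\<alpha>\<close> of the neutral words commuting projections, and by (T4) the norm of a linear
  combination of them is at most the supremum of the same combination of the functions
  \<open>1\<^bsub>K(\<alpha>)\<^esub>\<close>. The C*-identity extends this to words with a common value \<open>g\<close>. Hence the universal
  seminorm on *-polynomials in the generators is dominated by the 1-norm of the section they define, so it
  descends to sections and agrees with the largest C*-seminorm there.

  In the reduced case, the regular representation of the bundle acts on every column of a
  square-summable section as the corresponding operator acts on \<open>\<ell>\<^sup>2(P)\<close>, so it is isometric on the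
  algebra generated by the \<open>L\<^sub>p\<close> as soon as every vector of \<open>\<ell>\<^sup>2(P)\<close> occurs as a column.\<close>

section \<open>Seminormed *-algebras\<close>

text \<open>Each isomorphism compares two C*-norms on the dense image of one *-algebra: the free
  *-algebra on \<open>P\<close> in the full case, the finitely supported sections in the reduced
  case. The obstacle in the full case is that the homomorphism \<open>\<Phi>\<close> from the free
  algebra to sections is in general neither injective nor onto, a fiber being the closure of a span.
  The 1-norm estimate repairs both defects: it makes the universal seminorm vanish on the kernel of
  \<open>\<Phi>\<close>, and it makes the seminorm uniformly continuous on the image, so that it
  extends to all sections by limits. The estimate is elementary. A projection commuting with an
  element splits its norm into a maximum over two corners, and a repeated C*-identity removes the
  factor 2 of the triangle inequality; (T2) and (T4) enter at the end, to annihilate a corner that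
  lies over the empty set. In the reduced case the module-valued inner product, evaluated at a point
  of \<open>P\<close>, is an ordinary inner product of columns, so the norm of the module is a
  supremum of Hilbert space norms. Boundedness of adjointable maps is proved by uniform boundedness,
  since operators are defined by having an adjoint and nothing more.\<close>

locale star_alg = ring A for A :: "('a, 'm) star_algebra_scheme" (structure) +
  assumes scale_closed [simp, intro]: "x \<in> carrier A \<Longrightarrow> cscale A c x \<in> carrier A"
    and scale_add_right: "\<lbrakk>x \<in> carrier A; y \<in> carrier A\<rbrakk> \<Longrightarrow> cscale A c (x \<oplus> y) = cscale A c x \<oplus> cscale A c y"
    and scale_add_left: "x \<in> carrier A \<Longrightarrow> cscale A (c + d) x = cscale A c x \<oplus> cscale A d x"
    and scale_scale: "x \<in> carrier A \<Longrightarrow> cscale A c (cscale A d x) = cscale A (c * d) x"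
    and scale_one [simp]: "x \<in> carrier A \<Longrightarrow> cscale A 1 x = x"
    and scale_mult_left: "\<lbrakk>x \<in> carrier A; y \<in> carrier A\<rbrakk> \<Longrightarrow> cscale A c x \<otimes> y = cscale A c (x \<otimes> y)"
    and scale_mult_right: "\<lbrakk>x \<in> carrier A; y \<in> carrier A\<rbrakk> \<Longrightarrow> x \<otimes> cscale A c y = cscale A c (x \<otimes> y)"
    and star_closed [simp, intro]: "x \<in> carrier A \<Longrightarrow> star A x \<in> carrier A"
    and star_add: "\<lbrakk>x \<in> carrier A; y \<in> carrier A\<rbrakk> \<Longrightarrow> star A (x \<oplus> y) = star A x \<oplus> star A y"
    and star_scale: "x \<in> carrier A \<Longrightarrow> star A (cscale A c x) = cscale A (cnj c) (star A x)"
    and star_mult: "\<lbrakk>x \<in> carrier A; y \<in> carrier A\<rbrakk> \<Longrightarrow> star A (x \<otimes> y) = star A y \<otimes> star A x"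
    and star_star [simp]: "x \<in> carrier A \<Longrightarrow> star A (star A x) = x"
begin

lemma scale_zero_left [simp]: "x \<in> carrier A \<Longrightarrow> cscale A 0 x = \<zero>"
  using scale_add_left[of x 0 0] by (metis add.right_neutral add.l_cancel_one scale_closed)

lemma scale_zero_right [simp]: "cscale A c \<zero> = \<zero>"
  using scale_scale[of \<zero> c 0] by simp

lemma minus_eq_scale: "x \<in> carrier A \<Longrightarrow> \<ominus> x = cscale A (-1) x"
  using scale_add_left[of x "-1" 1] by (intro minus_equality) auto

lemma diff_eq: "\<lbrakk>x \<in> carrier A; y \<in> carrier A\<rbrakk> \<Longrightarrow> x \<ominus> y = x \<oplus> cscale A (-1) y"
  by (simp add: a_minus_def minus_eq_scale)

lemma star_zero [simp]: "star A \<zero> = \<zero>"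
  using star_scale[of \<zero> 0] by simp

lemma star_one [simp]: "star A \<one> = \<one>"
  using star_mult[of \<one> "star A \<one>"] by simp

lemma star_diff: "\<lbrakk>x \<in> carrier A; y \<in> carrier A\<rbrakk> \<Longrightarrow> star A (x \<ominus> y) = star A x \<ominus> star A y"
  by (simp add: diff_eq star_add star_scale)

lemma scale_diff: "\<lbrakk>x \<in> carrier A; y \<in> carrier A\<rbrakk> \<Longrightarrow> cscale A c (x \<ominus> y) = cscale A c x \<ominus> cscale A c y"
  by (simp add: diff_eq scale_add_right scale_scale)

lemma diff_self [simp]: "x \<in> carrier A \<Longrightarrow> x \<ominus> x = \<zero>"
  by (simp add: a_minus_def r_neg)

lemma diff_zero [simp]: "x \<in> carrier A \<Longrightarrow> x \<ominus> \<zero> = x"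
  by (simp add: a_minus_def)

lemma add_diff_add:
  "\<lbrakk>x \<in> carrier A; y \<in> carrier A; x' \<in> carrier A; y' \<in> carrier A\<rbrakk> \<Longrightarrow>
    (x \<oplus> y) \<ominus> (x' \<oplus> y') = (x \<ominus> x') \<oplus> (y \<ominus> y')"
  by (simp add: diff_eq scale_add_right a_ac)

lemma diff_add_diff:
  "\<lbrakk>x \<in> carrier A; y \<in> carrier A; z \<in> carrier A\<rbrakk> \<Longrightarrow> (x \<ominus> y) \<oplus> (y \<ominus> z) = x \<ominus> z"
  by (simp add: a_minus_def a_assoc r_neg2 r_neg1)

lemma mult_diff_mult:
  assumes "x \<in> carrier A" "y \<in> carrier A" "x' \<in> carrier A" "y' \<in> carrier A"
  shows "x \<otimes> y \<ominus> x' \<otimes> y' = (x \<ominus> x') \<otimes> y \<oplus> x' \<otimes> (y \<ominus> y')"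
proof -
  have "(x \<ominus> x') \<otimes> y \<oplus> x' \<otimes> (y \<ominus> y') = (x \<otimes> y \<ominus> x' \<otimes> y) \<oplus> (x' \<otimes> y \<ominus> x' \<otimes> y')"
    using assms by (simp add: a_minus_def l_distr r_distr l_minus r_minus)
  then show ?thesis using assms by (simp add: diff_add_diff)
qed

lemma diff_eq_zero: "\<lbrakk>x \<in> carrier A; y \<in> carrier A; x \<ominus> y = \<zero>\<rbrakk> \<Longrightarrow> x = y"
  by (metis a_minus_def add.inv_closed minus_equality minus_minus)

lemma add_diff_cancel: "\<lbrakk>x \<in> carrier A; y \<in> carrier A\<rbrakk> \<Longrightarrow> y \<oplus> (x \<ominus> y) = x"
  by (simp add: a_minus_def a_lcomm[of y x] r_neg)

end

text \<open>The involution mirrors every one-sided law: the right unit law, the other distributive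
  law and the second compatibility with scalars follow by applying \<open>star\<close>. Additive
  inverses come from the scalar -1 together with \<open>scale_zero\<close>.\<close>

lemma star_algI:
  fixes A :: "('a, 'm) star_algebra_scheme" (structure)
  assumes zero: "\<zero> \<in> carrier A" and one: "\<one> \<in> carrier A"
    and add: "\<And>x y. \<lbrakk>x \<in> carrier A; y \<in> carrier A\<rbrakk> \<Longrightarrow> x \<oplus> y \<in> carrier A"
    and mult: "\<And>x y. \<lbrakk>x \<in> carrier A; y \<in> carrier A\<rbrakk> \<Longrightarrow> x \<otimes> y \<in> carrier A"
    and scale: "\<And>c x. x \<in> carrier A \<Longrightarrow> cscale A c x \<in> carrier A"
    and star: "\<And>x. x \<in> carrier A \<Longrightarrow> star A x \<in> carrier A"
    and add_assoc: "\<And>x y z. \<lbrakk>x \<in> carrier A; y \<in> carrier A; z \<in> carrier A\<rbrakk> \<Longrightarrow> (x \<oplus> y) \<oplus> z = x \<oplus> (y \<oplus> z)"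
    and add_comm: "\<And>x y. \<lbrakk>x \<in> carrier A; y \<in> carrier A\<rbrakk> \<Longrightarrow> x \<oplus> y = y \<oplus> x"
    and zero_add: "\<And>x. x \<in> carrier A \<Longrightarrow> \<zero> \<oplus> x = x"
    and scale_add_right: "\<And>c x y. \<lbrakk>x \<in> carrier A; y \<in> carrier A\<rbrakk> \<Longrightarrow> cscale A c (x \<oplus> y) = cscale A c x \<oplus> cscale A c y"
    and scale_add_left: "\<And>c d x. x \<in> carrier A \<Longrightarrow> cscale A (c + d) x = cscale A c x \<oplus> cscale A d x"
    and scale_scale: "\<And>c d x. x \<in> carrier A \<Longrightarrow> cscale A c (cscale A d x) = cscale A (c * d) x"
    and scale_one: "\<And>x. x \<in> carrier A \<Longrightarrow> cscale A 1 x = x"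
    and scale_zero: "\<And>x. x \<in> carrier A \<Longrightarrow> cscale A 0 x = \<zero>"
    and mult_assoc: "\<And>x y z. \<lbrakk>x \<in> carrier A; y \<in> carrier A; z \<in> carrier A\<rbrakk> \<Longrightarrow> (x \<otimes> y) \<otimes> z = x \<otimes> (y \<otimes> z)"
    and one_mult: "\<And>x. x \<in> carrier A \<Longrightarrow> \<one> \<otimes> x = x"
    and distrib: "\<And>x y z. \<lbrakk>x \<in> carrier A; y \<in> carrier A; z \<in> carrier A\<rbrakk> \<Longrightarrow> (x \<oplus> y) \<otimes> z = x \<otimes> z \<oplus> y \<otimes> z"
    and scale_mult: "\<And>c x y. \<lbrakk>x \<in> carrier A; y \<in> carrier A\<rbrakk> \<Longrightarrow> cscale A c x \<otimes> y = cscale A c (x \<otimes> y)"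
    and star_add: "\<And>x y. \<lbrakk>x \<in> carrier A; y \<in> carrier A\<rbrakk> \<Longrightarrow> star A (x \<oplus> y) = star A x \<oplus> star A y"
    and star_scale: "\<And>c x. x \<in> carrier A \<Longrightarrow> star A (cscale A c x) = cscale A (cnj c) (star A x)"
    and star_mult: "\<And>x y. \<lbrakk>x \<in> carrier A; y \<in> carrier A\<rbrakk> \<Longrightarrow> star A (x \<otimes> y) = star A y \<otimes> star A x"
    and star_star: "\<And>x. x \<in> carrier A \<Longrightarrow> star A (star A x) = x"
  shows "star_alg A"
proof -
  \<comment> \<open>Apply the involution to \<open>\<one> \<otimes> star A \<one>\<close>: both
    sides collapse by the left unit law.\<close>
  have star_one: "star A \<one> = \<one>"
    using star_mult[of \<one> "star A \<one>"] one star star_star one_mult by metis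
  have neg: "\<exists>y\<in>carrier A. y \<oplus> x = \<zero>" if "x \<in> carrier A" for x
    using scale_add_left[OF that, of "-1" 1] scale_zero[OF that] scale_one[OF that] scale[OF that]
    by (intro bexI[of _ "cscale A (-1) x"]) auto
  have ag: "abelian_group A"
    using zero add add_assoc add_comm zero_add neg by (intro abelian_groupI) auto
  have mult_one: "x \<otimes> \<one> = x" if "x \<in> carrier A" for x
    using star_mult[OF one star[OF that]] star_star[OF that] one_mult[OF star[OF that]] star_one by simp
  have m: "monoid A"
    using mult one mult_assoc one_mult mult_one by (intro monoidI) auto
  have ldistr: "z \<otimes> (x \<oplus> y) = z \<otimes> x \<oplus> z \<otimes> y"
    if "x \<in> carrier A" "y \<in> carrier A" "z \<in> carrier A" for x y z
  proof -
    have "star A (z \<otimes> (x \<oplus> y)) = star A (z \<otimes> x \<oplus> z \<otimes> y)"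
      using that by (simp add: star_mult star_add add mult star distrib)
    then show ?thesis using that by (metis add mult star_star)
  qed
  interpret ring A using ag m distrib ldistr by (intro ringI) auto
  have scale_mult_right: "x \<otimes> cscale A c y = cscale A c (x \<otimes> y)" if "x \<in> carrier A" "y \<in> carrier A" for c x y
  proof -
    have "star A (x \<otimes> cscale A c y) = star A (cscale A c (x \<otimes> y))"
      using that by (simp add: star_mult star_scale scale mult star scale_mult)
    then show ?thesis using that by (metis scale mult star_star)
  qed
  show ?thesis
    by unfold_locales (use assms scale_mult_right in auto)
qed

text \<open>An isometric involution stands in place of the C*-identity, so that the 1-norm of
  sections is covered together with C*-seminorms and operator norms.\<close>

locale seminormed_star_alg = star_alg A for A :: "('a, 'm) star_algebra_scheme" (structure) +
  fixes \<nu> :: "'a \<Rightarrow> real"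
  assumes norm_nonneg [simp]: "x \<in> carrier A \<Longrightarrow> 0 \<le> \<nu> x"
    and norm_triangle: "\<lbrakk>x \<in> carrier A; y \<in> carrier A\<rbrakk> \<Longrightarrow> \<nu> (x \<oplus> y) \<le> \<nu> x + \<nu> y"
    and norm_scale: "x \<in> carrier A \<Longrightarrow> \<nu> (cscale A c x) = cmod c * \<nu> x"
    and norm_mult: "\<lbrakk>x \<in> carrier A; y \<in> carrier A\<rbrakk> \<Longrightarrow> \<nu> (x \<otimes> y) \<le> \<nu> x * \<nu> y"
    and norm_star: "x \<in> carrier A \<Longrightarrow> \<nu> (star A x) = \<nu> x"
begin

text \<open>The limit is determined only up to elements of seminorm zero, so convergence is a
  relation and not a limit operator.\<close>

definition tends :: "(nat \<Rightarrow> 'a) \<Rightarrow> 'a \<Rightarrow> bool" where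
  "tends s x \<longleftrightarrow> range s \<subseteq> carrier A \<and> x \<in> carrier A \<and> (\<lambda>n. \<nu> (s n \<ominus> x)) \<longlonglongrightarrow> 0"

lemma norm_zero [simp]: "\<nu> \<zero> = 0"
  using norm_scale[of \<zero> 0] by simp

lemma norm_minus: "\<lbrakk>x \<in> carrier A; y \<in> carrier A\<rbrakk> \<Longrightarrow> \<nu> (x \<ominus> y) = \<nu> (y \<ominus> x)"
  using norm_scale[of "y \<ominus> x" "-1"] by (simp add: diff_eq scale_add_right scale_scale a_comm)

lemma norm_diff_triangle:
  "\<lbrakk>x \<in> carrier A; y \<in> carrier A; z \<in> carrier A\<rbrakk> \<Longrightarrow> \<nu> (x \<ominus> z) \<le> \<nu> (x \<ominus> y) + \<nu> (y \<ominus> z)"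
  using norm_triangle[of "x \<ominus> y" "y \<ominus> z"] by (simp add: diff_add_diff)

lemma norm_triangle_diff: "\<lbrakk>x \<in> carrier A; y \<in> carrier A\<rbrakk> \<Longrightarrow> \<nu> x \<le> \<nu> y + \<nu> (x \<ominus> y)"
  using norm_triangle[of y "x \<ominus> y"] by (simp add: add_diff_cancel)

lemma abs_norm_diff: "\<lbrakk>x \<in> carrier A; y \<in> carrier A\<rbrakk> \<Longrightarrow> \<bar>\<nu> x - \<nu> y\<bar> \<le> \<nu> (x \<ominus> y)"
  using norm_triangle_diff[of x y] norm_triangle_diff[of y x] norm_minus[of x y] by simp

lemma norm_mult_diff:
  assumes "x \<in> carrier A" "y \<in> carrier A" "x' \<in> carrier A" "y' \<in> carrier A"
  shows "\<nu> (x \<otimes> y \<ominus> x' \<otimes> y') \<le> \<nu> (x \<ominus> x') * \<nu> y + \<nu> x' * \<nu> (y \<ominus> y')"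
proof -
  have "\<nu> (x \<otimes> y \<ominus> x' \<otimes> y') \<le> \<nu> ((x \<ominus> x') \<otimes> y) + \<nu> (x' \<otimes> (y \<ominus> y'))"
    using assms by (simp add: mult_diff_mult norm_triangle)
  also have "\<dots> \<le> \<nu> (x \<ominus> x') * \<nu> y + \<nu> x' * \<nu> (y \<ominus> y')"
    using assms by (intro add_mono norm_mult) auto
  finally show ?thesis .
qed

lemma tends_const: "x \<in> carrier A \<Longrightarrow> tends (\<lambda>_. x) x"
  by (auto simp: tends_def)

lemma tends_carrier: "tends s x \<Longrightarrow> s n \<in> carrier A" "tends s x \<Longrightarrow> x \<in> carrier A"
  by (auto simp: tends_def)

lemma tends_eventually:
  assumes "tends s x" "\<epsilon> > 0"
  shows "\<exists>N. \<forall>n\<ge>N. \<nu> (s n \<ominus> x) < \<epsilon>"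
proof -
  have "\<forall>\<^sub>F n in sequentially. \<nu> (s n \<ominus> x) < \<epsilon>"
    using assms order_tendstoD(2) unfolding tends_def by blast
  then show ?thesis by (simp add: eventually_sequentially)
qed

lemma tends_norm:
  assumes "tends s x"
  shows "(\<lambda>n. \<nu> (s n)) \<longlonglongrightarrow> \<nu> x"
proof -
  have "(\<lambda>n. \<nu> (s n) - \<nu> x) \<longlonglongrightarrow> 0"
  proof (rule Lim_null_comparison[of _ "\<lambda>n. \<nu> (s n \<ominus> x)"])
    show "\<forall>\<^sub>F n in sequentially. norm (\<nu> (s n) - \<nu> x) \<le> \<nu> (s n \<ominus> x)"
      using abs_norm_diff tends_carrier[OF assms] by simp
    show "(\<lambda>n. \<nu> (s n \<ominus> x)) \<longlonglongrightarrow> 0" using assms by (simp add: tends_def)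
  qed
  then show ?thesis by (simp add: LIM_zero_iff)
qed

lemma tendsI:
  assumes "range s \<subseteq> carrier A" "x \<in> carrier A" "\<And>n. \<nu> (s n \<ominus> x) \<le> e n" "e \<longlonglongrightarrow> 0"
  shows "tends s x"
proof -
  have "norm (\<nu> (s n \<ominus> x)) \<le> e n" for n
    using assms(1,2) assms(3)[of n] by (auto simp: image_subset_iff)
  then have "(\<lambda>n. \<nu> (s n \<ominus> x)) \<longlonglongrightarrow> 0"
    by (intro Lim_null_comparison[OF _ assms(4)]) simp
  then show ?thesis using assms(1,2) by (simp add: tends_def)
qed

lemma tends_add:
  assumes "tends s x" "tends t y"
  shows "tends (\<lambda>n. s n \<oplus> t n) (x \<oplus> y)"
proof (rule tendsI)
  show "\<nu> ((s n \<oplus> t n) \<ominus> (x \<oplus> y)) \<le> \<nu> (s n \<ominus> x) + \<nu> (t n \<ominus> y)" for n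
    using tends_carrier[OF assms(1)] tends_carrier[OF assms(2)] by (simp add: add_diff_add norm_triangle)
  show "(\<lambda>n. \<nu> (s n \<ominus> x) + \<nu> (t n \<ominus> y)) \<longlonglongrightarrow> 0"
    using assms by (auto simp: tends_def intro: tendsto_add_zero)
qed (use tends_carrier[OF assms(1)] tends_carrier[OF assms(2)] in auto)

lemma tends_mult:
  assumes "tends s x" "tends t y"
  shows "tends (\<lambda>n. s n \<otimes> t n) (x \<otimes> y)"
proof (rule tendsI)
  show "\<nu> ((s n \<otimes> t n) \<ominus> (x \<otimes> y)) \<le> \<nu> (s n \<ominus> x) * \<nu> (t n) + \<nu> x * \<nu> (t n \<ominus> y)" for n
    using tends_carrier[OF assms(1)] tends_carrier[OF assms(2)] by (simp add: norm_mult_diff)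
  have "(\<lambda>n. \<nu> (s n \<ominus> x) * \<nu> (t n)) \<longlonglongrightarrow> 0 * \<nu> y"
    using assms tends_norm[OF assms(2)] by (intro tendsto_mult) (auto simp: tends_def)
  moreover have "(\<lambda>n. \<nu> x * \<nu> (t n \<ominus> y)) \<longlonglongrightarrow> \<nu> x * 0"
    using assms by (intro tendsto_mult) (auto simp: tends_def)
  ultimately show "(\<lambda>n. \<nu> (s n \<ominus> x) * \<nu> (t n) + \<nu> x * \<nu> (t n \<ominus> y)) \<longlonglongrightarrow> 0"
    by (auto intro: tendsto_add_zero)
qed (use tends_carrier[OF assms(1)] tends_carrier[OF assms(2)] in auto)

lemma tends_scale:
  assumes "tends s x"
  shows "tends (\<lambda>n. cscale A c (s n)) (cscale A c x)"
proof (rule tendsI)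
  show "\<nu> (cscale A c (s n) \<ominus> cscale A c x) \<le> cmod c * \<nu> (s n \<ominus> x)" for n
    using tends_carrier[OF assms(1)] by (simp add: scale_diff[symmetric] norm_scale)
  show "(\<lambda>n. cmod c * \<nu> (s n \<ominus> x)) \<longlonglongrightarrow> 0"
    using assms by (auto simp: tends_def intro: tendsto_mult_right_zero)
qed (use tends_carrier[OF assms(1)] in auto)

lemma tends_star:
  assumes "tends s x"
  shows "tends (\<lambda>n. star A (s n)) (star A x)"
proof (rule tendsI)
  show "\<nu> (star A (s n) \<ominus> star A x) \<le> \<nu> (s n \<ominus> x)" for n
    using tends_carrier[OF assms(1)] by (simp add: star_diff[symmetric] norm_star)
  show "(\<lambda>n. \<nu> (s n \<ominus> x)) \<longlonglongrightarrow> 0"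
    using assms by (auto simp: tends_def)
qed (use tends_carrier[OF assms(1)] in auto)

lemma tends_cauchy:
  assumes "tends s x"
  shows "s \<in> seminorm_cauchy A \<nu>"
  unfolding seminorm_cauchy_def
proof (intro CollectI conjI allI impI)
  show "range s \<subseteq> carrier A" using assms by (simp add: tends_def)
  fix \<epsilon> :: real assume "\<epsilon> > 0"
  then obtain N where N: "\<forall>n\<ge>N. \<nu> (s n \<ominus> x) < \<epsilon> / 2"
    using tends_eventually[OF assms, of "\<epsilon> / 2"] by auto
  have "\<nu> (s m \<ominus> s n) < \<epsilon>" if "m \<ge> N" "n \<ge> N" for m n
  proof -
    have "\<nu> (s m \<ominus> s n) \<le> \<nu> (s m \<ominus> x) + \<nu> (s n \<ominus> x)"
      using norm_diff_triangle[of "s m" x "s n"] norm_minus[of x "s n"] tends_carrier[OF assms] by simp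
    then show ?thesis using N[rule_format, OF that(1)] N[rule_format, OF that(2)] by linarith
  qed
  then show "\<exists>N. \<forall>m\<ge>N. \<forall>n\<ge>N. \<nu> (s m \<ominus> s n) < \<epsilon>" by blast
qed

end

locale banach_star_alg = seminormed_star_alg A "cnorm A"
  for A :: "('a, 'm) normed_star_algebra_scheme" (structure) +
  assumes norm_zero_imp: "\<lbrakk>x \<in> carrier A; cnorm A x = 0\<rbrakk> \<Longrightarrow> x = \<zero>"
    and norm_complete: "s \<in> seminorm_cauchy A (cnorm A) \<Longrightarrow> \<exists>x. tends s x"
begin

lemma norm_closure_iff:
  assumes "S \<subseteq> carrier A"
  shows "x \<in> norm_closure A S \<longleftrightarrow> (\<exists>s. range s \<subseteq> S \<and> tends s x)"
proof
  assume x: "x \<in> norm_closure A S"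
  then have "\<forall>n. \<exists>y\<in>S. cnorm A (x \<ominus> y) < 1 / real (Suc n)"
    unfolding norm_closure_def by simp
  then obtain s where s: "\<And>n. s n \<in> S" "\<And>n. cnorm A (x \<ominus> s n) < 1 / real (Suc n)" by metis
  have xc: "x \<in> carrier A" using x by (simp add: norm_closure_def)
  have "tends s x"
  proof (rule tendsI[of _ _ "\<lambda>n. 1 / real (Suc n)"])
    show "cnorm A (s n \<ominus> x) \<le> 1 / real (Suc n)" for n
      using s(2)[of n] s(1)[of n] assms norm_minus[of x "s n"] xc by (auto simp: subset_iff)
    show "(\<lambda>n. 1 / real (Suc n)) \<longlonglongrightarrow> 0"
      using LIMSEQ_inverse_real_of_nat by (simp add: inverse_eq_divide)
  qed (use s assms xc in auto)
  then show "\<exists>s. range s \<subseteq> S \<and> tends s x" using s by blast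
next
  assume "\<exists>s. range s \<subseteq> S \<and> tends s x"
  then obtain s where s: "range s \<subseteq> S" "tends s x" by blast
  show "x \<in> norm_closure A S"
    unfolding norm_closure_def
  proof (intro CollectI conjI allI impI)
    show x: "x \<in> carrier A" using s tends_carrier by blast
    fix \<epsilon> :: real assume "\<epsilon> > 0"
    then obtain n where "cnorm A (s n \<ominus> x) < \<epsilon>"
      using tends_eventually[OF s(2)] by blast
    then show "\<exists>y\<in>S. cnorm A (x \<ominus> y) < \<epsilon>"
      using s(1) norm_minus[OF x tends_carrier(1)[OF s(2)], of n] by (intro bexI[of _ "s n"]) auto
  qed
qed

end

text \<open>The graph of the isomorphism is the closure of \<^term>\<open>R\<close>.\<close>

theorem dense_iso:
  fixes A :: "('a, 'm) normed_star_algebra_scheme" and B :: "('b, 'n) normed_star_algebra_scheme"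
  assumes "banach_star_alg A" "banach_star_alg B"
    and R: "R \<subseteq> carrier A \<times> carrier B"
    and R_add: "\<And>x y x' y'. \<lbrakk>(x, y) \<in> R; (x', y') \<in> R\<rbrakk> \<Longrightarrow> (x \<oplus>\<^bsub>A\<^esub> x', y \<oplus>\<^bsub>B\<^esub> y') \<in> R"
    and R_mult: "\<And>x y x' y'. \<lbrakk>(x, y) \<in> R; (x', y') \<in> R\<rbrakk> \<Longrightarrow> (x \<otimes>\<^bsub>A\<^esub> x', y \<otimes>\<^bsub>B\<^esub> y') \<in> R"
    and R_scale: "\<And>x y c. (x, y) \<in> R \<Longrightarrow> (cscale A c x, cscale B c y) \<in> R"
    and R_star: "\<And>x y. (x, y) \<in> R \<Longrightarrow> (star A x, star B y) \<in> R"
    and R_norm: "\<And>x y. (x, y) \<in> R \<Longrightarrow> cnorm A x = cnorm B y"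
  shows "\<exists>\<phi>. cstar_iso (A\<lparr>carrier := norm_closure A (Domain R)\<rparr>) (B\<lparr>carrier := norm_closure B (Range R)\<rparr>) \<phi>
    \<and> (\<forall>(x, y)\<in>R. \<phi> x = y)"
proof -
  interpret A: banach_star_alg A by fact
  interpret B: banach_star_alg B by fact
  define C where "C x y \<longleftrightarrow> (\<exists>s t. (\<forall>n. (s n, t n) \<in> R) \<and> A.tends s x \<and> B.tends t y)" for x y
  have CI: "C x y" if "\<And>n. (s n, t n) \<in> R" "A.tends s x" "B.tends t y" for s t x y
    unfolding C_def using that by blast
  have CE: thesis if "C x y" "\<And>s t. (\<And>n. (s n, t n) \<in> R) \<Longrightarrow> A.tends s x \<Longrightarrow> B.tends t y \<Longrightarrow> thesis"
    for thesis x y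
    using that unfolding C_def by blast
  have C_base: "C x y" if "(x, y) \<in> R" for x y
    using that R by (intro CI[of "\<lambda>_. x" "\<lambda>_. y"] A.tends_const B.tends_const) auto
  have C_add: "C (x \<oplus>\<^bsub>A\<^esub> x') (y \<oplus>\<^bsub>B\<^esub> y')" if C: "C x y" "C x' y'" for x y x' y'
    by (rule CE[OF C(1)], rule CE[OF C(2)], rule CI, rule R_add, assumption, assumption,
        rule A.tends_add, assumption, assumption, rule B.tends_add)
  have C_mult: "C (x \<otimes>\<^bsub>A\<^esub> x') (y \<otimes>\<^bsub>B\<^esub> y')" if C: "C x y" "C x' y'" for x y x' y'
    by (rule CE[OF C(1)], rule CE[OF C(2)], rule CI, rule R_mult, assumption, assumption,
        rule A.tends_mult, assumption, assumption, rule B.tends_mult)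
  have C_scale: "C (cscale A c x) (cscale B c y)" if C: "C x y" for x y c
    by (rule CE[OF C], rule CI, rule R_scale, assumption, rule A.tends_scale, assumption,
        rule B.tends_scale)
  have C_star: "C (star A x) (star B y)" if C: "C x y" for x y
    by (rule CE[OF C], rule CI, rule R_star, assumption, rule A.tends_star, assumption,
        rule B.tends_star)
  have C_norm: "cnorm A x = cnorm B y" if C: "C x y" for x y
  proof -
    obtain s t where st: "\<And>n. (s n, t n) \<in> R" "A.tends s x" "B.tends t y" using C C_def by auto
    have "(\<lambda>n. cnorm A (s n)) = (\<lambda>n. cnorm B (t n))" using st R_norm by auto
    then show ?thesis
      using A.tends_norm[OF st(2)] B.tends_norm[OF st(3)] LIMSEQ_unique by metis
  qed
  have C_carrier: "x \<in> carrier A" "y \<in> carrier B" if "C x y" for x y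
    using that A.tends_carrier B.tends_carrier unfolding C_def by blast+
  have C_diff: "C (x \<ominus>\<^bsub>A\<^esub> x') (y \<ominus>\<^bsub>B\<^esub> y')" if "C x y" "C x' y'" for x y x' y'
    using C_add[OF that(1) C_scale[OF that(2), of "-1"]] C_carrier[OF that(1)] C_carrier[OF that(2)]
    by (simp add: A.diff_eq B.diff_eq)
  \<comment> \<open>\<open>C\<close> is linear and norm preserving, so a pair with one zero entry
    has both entries zero. Applied to differences, this gives single-valuedness here and injectivity
    below.\<close>
  have C_fun: "y = y'" if C: "C x y" "C x y'" for x y y'
  proof -
    have "cnorm B (y \<ominus>\<^bsub>B\<^esub> y') = 0"
      using C_norm[OF C_diff[OF C]] A.diff_self[OF C_carrier(1)[OF C(1)]] A.norm_zero by metis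
    then show ?thesis
      using C_carrier[OF C(1)] C_carrier[OF C(2)]
      by (auto intro: B.diff_eq_zero[OF _ _ B.norm_zero_imp])
  qed
  have C_inj: "x = x'" if C: "C x y" "C x' y" for x x' y
  proof -
    have "cnorm A (x \<ominus>\<^bsub>A\<^esub> x') = 0"
      using C_norm[OF C_diff[OF C]] B.diff_self[OF C_carrier(2)[OF C(1)]] B.norm_zero by metis
    then show ?thesis
      using C_carrier[OF C(1)] C_carrier[OF C(2)]
      by (auto intro: A.diff_eq_zero[OF _ _ A.norm_zero_imp])
  qed
  have R_diff: "cnorm A (x \<ominus>\<^bsub>A\<^esub> x') = cnorm B (y \<ominus>\<^bsub>B\<^esub> y')" if "(x, y) \<in> R" "(x', y') \<in> R" for x y x' y'
    by (rule C_norm[OF C_diff[OF C_base[OF that(1)] C_base[OF that(2)]]])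
  have RA: "Domain R \<subseteq> carrier A" and RB: "Range R \<subseteq> carrier B" using R by auto
  have dom: "x \<in> norm_closure A (Domain R) \<longleftrightarrow> (\<exists>y. C x y)" for x
  proof
    assume "x \<in> norm_closure A (Domain R)"
    then obtain s where s: "range s \<subseteq> Domain R" "A.tends s x"
      using A.norm_closure_iff[OF RA] by blast
    then have "\<forall>n. \<exists>y. (s n, y) \<in> R" by auto
    then obtain t where t: "\<And>n. (s n, t n) \<in> R" by metis
    \<comment> \<open>Equality of norms on differences transfers the Cauchy property from
      \<open>s\<close> to its partners, and completeness of \<open>B\<close> supplies the value at
      \<open>x\<close>.\<close>
    have "t \<in> seminorm_cauchy B (cnorm B)"
      using A.tends_cauchy[OF s(2)] R_diff[OF t t] t R unfolding seminorm_cauchy_def by auto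
    then obtain y where "B.tends t y" using B.norm_complete by blast
    then show "\<exists>y. C x y" using CI[OF t s(2)] by blast
  next
    assume "\<exists>y. C x y"
    then obtain y where "C x y" by blast
    then obtain s t where st: "\<And>n. (s n, t n) \<in> R" "A.tends s x" "B.tends t y" using C_def by auto
    have "range s \<subseteq> Domain R" using st(1) by (auto intro: DomainI[OF st(1)])
    then show "x \<in> norm_closure A (Domain R)"
      unfolding A.norm_closure_iff[OF RA] using st(2) by blast
  qed
  have ran: "y \<in> norm_closure B (Range R) \<longleftrightarrow> (\<exists>x. C x y)" for y
  proof
    assume "y \<in> norm_closure B (Range R)"
    then obtain t where t: "range t \<subseteq> Range R" "B.tends t y"
      using B.norm_closure_iff[OF RB] by blast
    then have "\<forall>n. \<exists>x. (x, t n) \<in> R" by auto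
    then obtain s where s: "\<And>n. (s n, t n) \<in> R" by metis
    have "s \<in> seminorm_cauchy A (cnorm A)"
      using B.tends_cauchy[OF t(2)] R_diff[OF s s] s R unfolding seminorm_cauchy_def by auto
    then obtain x where "A.tends s x" using A.norm_complete by blast
    then show "\<exists>x. C x y" using CI[OF s _ t(2)] by blast
  next
    assume "\<exists>x. C x y"
    then obtain x where "C x y" by blast
    then obtain s t where st: "\<And>n. (s n, t n) \<in> R" "A.tends s x" "B.tends t y" using C_def by auto
    have "range t \<subseteq> Range R" using st(1) by (auto intro: RangeI[OF st(1)])
    then show "y \<in> norm_closure B (Range R)"
      unfolding B.norm_closure_iff[OF RB] using st(3) by blast
  qed
  define \<phi> where "\<phi> x = (THE y. C x y)" for x
  have \<phi>: "\<phi> x = y" if "C x y" for x y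
    unfolding \<phi>_def using that C_fun by (intro the_equality) auto
  have C\<phi>: "C x (\<phi> x)" if "x \<in> norm_closure A (Domain R)" for x
    using that dom \<phi> by metis
  have "bij_betw \<phi> (norm_closure A (Domain R)) (norm_closure B (Range R))"
    unfolding bij_betw_def
  proof
    show "inj_on \<phi> (norm_closure A (Domain R))"
      by (rule inj_onI) (metis C\<phi> C_inj)
    show "\<phi> ` norm_closure A (Domain R) = norm_closure B (Range R)"
    proof (intro equalityI subsetI)
      fix y assume "y \<in> norm_closure B (Range R)"
      then obtain x where x: "C x y" using ran by blast
      then have "x \<in> norm_closure A (Domain R)" using dom by blast
      then show "y \<in> \<phi> ` norm_closure A (Domain R)" using \<phi>[OF x] by blast
    qed (use C\<phi> ran in blast)
  qed
  then have "cstar_iso (A\<lparr>carrier := norm_closure A (Domain R)\<rparr>) (B\<lparr>carrier := norm_closure B (Range R)\<rparr>) \<phi>"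
    unfolding cstar_iso_def
    using C_add C_mult C_scale C_star C_norm[symmetric] C\<phi> \<phi> by simp
  moreover have "\<forall>(x, y)\<in>R. \<phi> x = y" using C_base \<phi> by auto
  ultimately show ?thesis by blast
qed

subsection \<open>Completion\<close>

context seminormed_star_alg
begin

abbreviation "cauchy \<equiv> seminorm_cauchy A \<nu>"
abbreviation "cl \<equiv> completion_class A \<nu>"

lemma cauchyI:
  "\<lbrakk>\<And>n. s n \<in> carrier A; \<And>\<epsilon>. \<epsilon> > 0 \<Longrightarrow> \<exists>N. \<forall>m\<ge>N. \<forall>n\<ge>N. \<nu> (s m \<ominus> s n) < \<epsilon>\<rbrakk> \<Longrightarrow> s \<in> cauchy"
  by (auto simp: seminorm_cauchy_def)

lemma cauchy_carrier: "s \<in> cauchy \<Longrightarrow> s n \<in> carrier A"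
  by (auto simp: seminorm_cauchy_def)

lemma cauchyD: "\<lbrakk>s \<in> cauchy; \<epsilon> > 0\<rbrakk> \<Longrightarrow> \<exists>N. \<forall>m\<ge>N. \<forall>n\<ge>N. \<nu> (s m \<ominus> s n) < \<epsilon>"
  by (auto simp: seminorm_cauchy_def)

lemma cauchy_norm_convergent:
  assumes "s \<in> cauchy"
  shows "convergent (\<lambda>n. \<nu> (s n))"
proof -
  have "Cauchy (\<lambda>n. \<nu> (s n))"
    unfolding Cauchy_def dist_real_def
  proof (intro allI impI)
    fix e :: real assume "e > 0"
    from cauchyD[OF assms this] obtain N where "\<forall>m\<ge>N. \<forall>n\<ge>N. \<nu> (s m \<ominus> s n) < e" by blast
    then show "\<exists>M. \<forall>m\<ge>M. \<forall>n\<ge>M. \<bar>\<nu> (s m) - \<nu> (s n)\<bar> < e"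
      using abs_norm_diff[OF cauchy_carrier[OF assms] cauchy_carrier[OF assms]]
      by (meson le_less_trans)
  qed
  then show ?thesis by (simp add: Cauchy_convergent_iff)
qed

lemma cauchy_bound:
  assumes "s \<in> cauchy"
  shows "\<exists>M>0. \<forall>n. \<nu> (s n) \<le> M"
proof -
  obtain K where "K > 0" "\<And>n. norm (\<nu> (s n)) \<le> K"
    using cauchy_norm_convergent[OF assms] convergent_imp_Bseq Bseq_def by metis
  then have "\<nu> (s n) \<le> K" for n by (metis abs_le_D1 real_norm_def)
  then show ?thesis using \<open>K > 0\<close> by blast
qed

text \<open>Every algebraic operation is Lipschitz along Cauchy sequences, which are bounded in the
  case of products; this single estimate then serves all of them.\<close>

lemma cauchy_comb:
  assumes "s \<in> cauchy" "t \<in> cauchy" "\<And>n. u n \<in> carrier A"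
    and "K \<ge> 0" "L \<ge> 0" "\<And>m n. \<nu> (u m \<ominus> u n) \<le> K * \<nu> (s m \<ominus> s n) + L * \<nu> (t m \<ominus> t n)"
  shows "u \<in> cauchy"
proof (rule cauchyI[OF assms(3)])
  fix \<epsilon> :: real assume e: "\<epsilon> > 0"
  \<comment> \<open>The summand 1 keeps the denominator positive when \<open>K\<close> and
    \<open>L\<close> vanish, and makes the final inequality strict.\<close>
  define d where "d = \<epsilon> / (K + L + 1)"
  have d: "d > 0" "(K + L + 1) * d = \<epsilon>" using e assms(4,5) by (auto simp: d_def)
  obtain N1 N2 where N: "\<forall>m\<ge>N1. \<forall>n\<ge>N1. \<nu> (s m \<ominus> s n) < d" "\<forall>m\<ge>N2. \<forall>n\<ge>N2. \<nu> (t m \<ominus> t n) < d"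
    using cauchyD[OF assms(1) d(1)] cauchyD[OF assms(2) d(1)] by blast
  have "\<nu> (u m \<ominus> u n) < \<epsilon>" if "m \<ge> max N1 N2" "n \<ge> max N1 N2" for m n
  proof -
    have "K * \<nu> (s m \<ominus> s n) \<le> K * d" "L * \<nu> (t m \<ominus> t n) \<le> L * d"
      using N(1)[rule_format, of m n] N(2)[rule_format, of m n] that assms(4,5) by (auto simp: mult_left_mono)
    then have "\<nu> (u m \<ominus> u n) \<le> K * d + L * d" using assms(6)[of m n] by linarith
    also have "\<dots> < \<epsilon>" unfolding d(2)[symmetric] using d(1) by (simp add: algebra_simps)
    finally show ?thesis .
  qed
  then show "\<exists>N. \<forall>m\<ge>N. \<forall>n\<ge>N. \<nu> (u m \<ominus> u n) < \<epsilon>" by blast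
qed

lemma cauchy_const: "x \<in> carrier A \<Longrightarrow> (\<lambda>_. x) \<in> cauchy"
  by (rule cauchyI) auto

lemma cauchy_add:
  assumes "s \<in> cauchy" "t \<in> cauchy"
  shows "(\<lambda>n. s n \<oplus> t n) \<in> cauchy"
  by (rule cauchy_comb[OF assms, of _ 1 1])
    (use cauchy_carrier[OF assms(1)] cauchy_carrier[OF assms(2)] in \<open>auto simp: add_diff_add norm_triangle\<close>)

lemma cauchy_scale:
  assumes "s \<in> cauchy"
  shows "(\<lambda>n. cscale A c (s n)) \<in> cauchy"
  by (rule cauchy_comb[OF assms assms, of _ "cmod c" 0])
    (use cauchy_carrier[OF assms] in \<open>auto simp: scale_diff[symmetric] norm_scale\<close>)

lemma cauchy_star:
  assumes "s \<in> cauchy"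
  shows "(\<lambda>n. star A (s n)) \<in> cauchy"
  by (rule cauchy_comb[OF assms assms, of _ 1 0])
    (use cauchy_carrier[OF assms] in \<open>auto simp: star_diff[symmetric] norm_star\<close>)

lemma cauchy_mult:
  assumes "s \<in> cauchy" "t \<in> cauchy"
  shows "(\<lambda>n. s n \<otimes> t n) \<in> cauchy"
proof -
  obtain K where K: "K > 0" "\<And>n. \<nu> (s n) \<le> K" using cauchy_bound[OF assms(1)] by blast
  obtain L where L: "L > 0" "\<And>n. \<nu> (t n) \<le> L" using cauchy_bound[OF assms(2)] by blast
  note c = cauchy_carrier[OF assms(1)] cauchy_carrier[OF assms(2)]
  have "\<nu> (s m \<otimes> t m \<ominus> s n \<otimes> t n) \<le> L * \<nu> (s m \<ominus> s n) + K * \<nu> (t m \<ominus> t n)" for m n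
  proof -
    have "\<nu> (s m \<otimes> t m \<ominus> s n \<otimes> t n) \<le> \<nu> (s m \<ominus> s n) * \<nu> (t m) + \<nu> (s n) * \<nu> (t m \<ominus> t n)"
      using c by (intro norm_mult_diff) auto
    also have "\<dots> \<le> \<nu> (s m \<ominus> s n) * L + K * \<nu> (t m \<ominus> t n)"
      using c K L by (intro add_mono mult_mono) auto
    finally show ?thesis by (simp add: mult.commute)
  qed
  then show ?thesis using K L c by (intro cauchy_comb[OF assms, of _ L K]) auto
qed

lemma cl_eqI:
  assumes "s \<in> cauchy" "t \<in> cauchy" "(\<lambda>n. \<nu> (s n \<ominus> t n)) \<longlonglongrightarrow> 0"
  shows "cl s = cl t"
proof -
  note c = cauchy_carrier[OF assms(1)] cauchy_carrier[OF assms(2)]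
  have "(\<lambda>n. \<nu> (u n \<ominus> s n)) \<longlonglongrightarrow> 0 \<longleftrightarrow> (\<lambda>n. \<nu> (u n \<ominus> t n)) \<longlonglongrightarrow> 0" if "u \<in> cauchy" for u
  proof
    note u = cauchy_carrier[OF that]
    assume "(\<lambda>n. \<nu> (u n \<ominus> s n)) \<longlonglongrightarrow> 0"
    then have "(\<lambda>n. \<nu> (u n \<ominus> s n) + \<nu> (s n \<ominus> t n)) \<longlonglongrightarrow> 0" by (rule tendsto_add_zero[OF _ assms(3)])
    then show "(\<lambda>n. \<nu> (u n \<ominus> t n)) \<longlonglongrightarrow> 0"
      by (rule Lim_null_comparison[rotated]) (use norm_diff_triangle c u in auto)
  next
    note u = cauchy_carrier[OF that]
    assume "(\<lambda>n. \<nu> (u n \<ominus> t n)) \<longlonglongrightarrow> 0"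
    then have "(\<lambda>n. \<nu> (u n \<ominus> t n) + \<nu> (s n \<ominus> t n)) \<longlonglongrightarrow> 0" by (rule tendsto_add_zero[OF _ assms(3)])
    then have "(\<lambda>n. \<nu> (u n \<ominus> t n) + \<nu> (t n \<ominus> s n)) \<longlonglongrightarrow> 0" using norm_minus c by simp
    then show "(\<lambda>n. \<nu> (u n \<ominus> s n)) \<longlonglongrightarrow> 0"
      by (rule Lim_null_comparison[rotated]) (use norm_diff_triangle c u in auto)
  qed
  then show ?thesis unfolding completion_class_def by blast
qed

lemma cl_self: "s \<in> cauchy \<Longrightarrow> s \<in> cl s"
  using cauchy_carrier[of s] by (simp add: completion_class_def)

lemma cl_mem: "s' \<in> cl s \<Longrightarrow> s' \<in> cauchy" "s' \<in> cl s \<Longrightarrow> (\<lambda>n. \<nu> (s' n \<ominus> s n)) \<longlonglongrightarrow> 0"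
  by (auto simp: completion_class_def)

lemma completion_carrier: "carrier (completion A \<nu>) = cl ` cauchy"
  by (simp add: completion_def)

text \<open>Operations on the completion are unions over all representatives. Once the class of the
  result does not depend on the choice, the union collapses because the classes are
  nonempty.\<close>

lemma UN_cl2_eq:
  assumes "s \<in> cauchy" "t \<in> cauchy" "\<And>s' t'. \<lbrakk>s' \<in> cl s; t' \<in> cl t\<rbrakk> \<Longrightarrow> f s' t' = X"
  shows "(\<Union>s'\<in>cl s. \<Union>t'\<in>cl t. f s' t') = X"
proof -
  have "(\<Union>s'\<in>cl s. \<Union>t'\<in>cl t. f s' t') = (\<Union>s'\<in>cl s. \<Union>t'\<in>cl t. X)"
    using assms(3) by simp
  then show ?thesis using cl_self[OF assms(1)] cl_self[OF assms(2)] by auto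
qed

lemma completion_add:
  assumes "s \<in> cauchy" "t \<in> cauchy"
  shows "cl s \<oplus>\<^bsub>completion A \<nu>\<^esub> cl t = cl (\<lambda>n. s n \<oplus> t n)"
proof -
  have *: "cl (\<lambda>n. s' n \<oplus> t' n) = cl (\<lambda>n. s n \<oplus> t n)" if "s' \<in> cl s" "t' \<in> cl t" for s' t'
  proof (rule cl_eqI)
    note s' = cl_mem[OF that(1)] and t' = cl_mem[OF that(2)]
    show "(\<lambda>n. \<nu> (s' n \<oplus> t' n \<ominus> (s n \<oplus> t n))) \<longlonglongrightarrow> 0"
      by (rule Lim_null_comparison[OF _ tendsto_add_zero[OF s'(2) t'(2)]])
        (use cauchy_carrier assms s'(1) t'(1) in \<open>auto simp: add_diff_add norm_triangle\<close>)
  qed (use assms cl_mem that in \<open>auto intro: cauchy_add\<close>)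
  have "cl s \<oplus>\<^bsub>completion A \<nu>\<^esub> cl t = (\<Union>s'\<in>cl s. \<Union>t'\<in>cl t. cl (\<lambda>n. s' n \<oplus> t' n))"
    by (simp add: completion_def)
  also have "\<dots> = cl (\<lambda>n. s n \<oplus> t n)" by (rule UN_cl2_eq[OF assms *])
  finally show ?thesis .
qed

lemma completion_mult:
  assumes "s \<in> cauchy" "t \<in> cauchy"
  shows "cl s \<otimes>\<^bsub>completion A \<nu>\<^esub> cl t = cl (\<lambda>n. s n \<otimes> t n)"
proof -
  have *: "cl (\<lambda>n. s' n \<otimes> t' n) = cl (\<lambda>n. s n \<otimes> t n)" if "s' \<in> cl s" "t' \<in> cl t" for s' t'
  proof (rule cl_eqI)
    note s' = cl_mem[OF that(1)] and t' = cl_mem[OF that(2)]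
    note c = cauchy_carrier[OF assms(1)] cauchy_carrier[OF assms(2)] cauchy_carrier[OF s'(1)] cauchy_carrier[OF t'(1)]
    obtain K where K: "K > 0" "\<And>n. \<nu> (s n) \<le> K" using cauchy_bound[OF assms(1)] by blast
    obtain L where L: "L > 0" "\<And>n. \<nu> (t' n) \<le> L" using cauchy_bound[OF t'(1)] by blast
    have lim: "(\<lambda>n. \<nu> (s' n \<ominus> s n) * L + K * \<nu> (t' n \<ominus> t n)) \<longlonglongrightarrow> 0"
      by (rule tendsto_add_zero[OF tendsto_mult_left_zero[OF s'(2)] tendsto_mult_right_zero[OF t'(2)]])
    have le: "\<nu> (s' n \<otimes> t' n \<ominus> s n \<otimes> t n) \<le> \<nu> (s' n \<ominus> s n) * L + K * \<nu> (t' n \<ominus> t n)" for n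
    proof -
      have "\<nu> (s' n \<otimes> t' n \<ominus> s n \<otimes> t n) \<le> \<nu> (s' n \<ominus> s n) * \<nu> (t' n) + \<nu> (s n) * \<nu> (t' n \<ominus> t n)"
        using c by (intro norm_mult_diff) auto
      also have "\<dots> \<le> \<nu> (s' n \<ominus> s n) * L + K * \<nu> (t' n \<ominus> t n)"
        using c K L by (intro add_mono mult_mono) auto
      finally show ?thesis .
    qed
    show "(\<lambda>n. \<nu> (s' n \<otimes> t' n \<ominus> (s n \<otimes> t n))) \<longlonglongrightarrow> 0"
      by (rule Lim_null_comparison[OF _ lim]) (use le c in simp)
  qed (use assms cl_mem that in \<open>auto intro: cauchy_mult\<close>)
  have "cl s \<otimes>\<^bsub>completion A \<nu>\<^esub> cl t = (\<Union>s'\<in>cl s. \<Union>t'\<in>cl t. cl (\<lambda>n. s' n \<otimes> t' n))"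
    by (simp add: completion_def)
  also have "\<dots> = cl (\<lambda>n. s n \<otimes> t n)" by (rule UN_cl2_eq[OF assms *])
  finally show ?thesis .
qed

lemma completion_scale:
  assumes "s \<in> cauchy"
  shows "cscale (completion A \<nu>) c (cl s) = cl (\<lambda>n. cscale A c (s n))"
proof -
  have *: "cl (\<lambda>n. cscale A c (s' n)) = cl (\<lambda>n. cscale A c (s n))" if "s' \<in> cl s" for s'
  proof (rule cl_eqI)
    note s' = cl_mem[OF that(1)]
    have "(\<lambda>n. cmod c * \<nu> (s' n \<ominus> s n)) \<longlonglongrightarrow> 0" using s'(2) by (rule tendsto_mult_right_zero)
    then show "(\<lambda>n. \<nu> (cscale A c (s' n) \<ominus> cscale A c (s n))) \<longlonglongrightarrow> 0"
      using cauchy_carrier[OF assms] cauchy_carrier[OF s'(1)] by (simp add: scale_diff[symmetric] norm_scale)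
  qed (use assms cl_mem that in \<open>auto intro: cauchy_scale\<close>)
  have "cscale (completion A \<nu>) c (cl s) = (\<Union>s'\<in>cl s. cl (\<lambda>n. cscale A c (s' n)))"
    by (simp add: completion_def)
  then show ?thesis using * cl_self assms by blast
qed

lemma completion_star:
  assumes "s \<in> cauchy"
  shows "star (completion A \<nu>) (cl s) = cl (\<lambda>n. star A (s n))"
proof -
  have *: "cl (\<lambda>n. star A (s' n)) = cl (\<lambda>n. star A (s n))" if "s' \<in> cl s" for s'
  proof (rule cl_eqI)
    note s' = cl_mem[OF that(1)]
    show "(\<lambda>n. \<nu> (star A (s' n) \<ominus> star A (s n))) \<longlonglongrightarrow> 0"
      using s'(2) cauchy_carrier[OF assms] cauchy_carrier[OF s'(1)] by (simp add: star_diff[symmetric] norm_star)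
  qed (use assms cl_mem that in \<open>auto intro: cauchy_star\<close>)
  have "star (completion A \<nu>) (cl s) = (\<Union>s'\<in>cl s. cl (\<lambda>n. star A (s' n)))"
    by (simp add: completion_def)
  then show ?thesis using * cl_self assms by blast
qed

lemma completion_norm:
  assumes "s \<in> cauchy"
  shows "(\<lambda>n. \<nu> (s n)) \<longlonglongrightarrow> cnorm (completion A \<nu>) (cl s)"
proof -
  obtain r where r: "(\<lambda>n. \<nu> (s n)) \<longlonglongrightarrow> r"
    using cauchy_norm_convergent[OF assms] by (auto simp: convergent_def)
  have *: "(\<lambda>n. \<nu> (s' n)) \<longlonglongrightarrow> r" if "s' \<in> cl s" for s'
  proof -
    have "(\<lambda>n. \<nu> (s' n) - \<nu> (s n)) \<longlonglongrightarrow> 0"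
      by (rule Lim_null_comparison[OF _ cl_mem(2)[OF that]])
        (use abs_norm_diff[OF cauchy_carrier[OF cl_mem(1)[OF that]] cauchy_carrier[OF assms]] in simp)
    from tendsto_add[OF this r] show ?thesis by simp
  qed
  have "cnorm (completion A \<nu>) (cl s) = (THE r. \<forall>s'\<in>cl s. (\<lambda>n. \<nu> (s' n)) \<longlonglongrightarrow> r)"
    by (simp add: completion_def)
  also have "\<dots> = r"
    using * cl_self[OF assms] r LIMSEQ_unique by (intro the_equality) blast+
  finally show ?thesis using r by simp
qed

lemma completion_zero: "\<zero>\<^bsub>completion A \<nu>\<^esub> = cl (\<lambda>_. \<zero>)"
  and completion_one: "\<one>\<^bsub>completion A \<nu>\<^esub> = cl (\<lambda>_. \<one>)"
  by (simp_all add: completion_def)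

lemma completion_norm_eqI: "\<lbrakk>s \<in> cauchy; (\<lambda>n. \<nu> (s n)) \<longlonglongrightarrow> r\<rbrakk> \<Longrightarrow> cnorm (completion A \<nu>) (cl s) = r"
  using completion_norm LIMSEQ_unique by blast

lemma completion_star_alg: "star_alg (completion A \<nu>)"
proof (rule star_algI)
  show "cscale (completion A \<nu>) 0 x = \<zero>\<^bsub>completion A \<nu>\<^esub>" if "x \<in> carrier (completion A \<nu>)" for x
  proof -
    obtain s where "x = cl s" "s \<in> cauchy" using \<open>x \<in> _\<close> by (auto simp: completion_carrier)
    then show ?thesis using cauchy_carrier[of s] by (simp add: completion_scale completion_zero)
  qed
  show "x \<oplus>\<^bsub>completion A \<nu>\<^esub> y = y \<oplus>\<^bsub>completion A \<nu>\<^esub> x"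
    if xy: "x \<in> carrier (completion A \<nu>)" "y \<in> carrier (completion A \<nu>)" for x y
  proof -
    obtain s t where "x = cl s" "s \<in> cauchy" "y = cl t" "t \<in> cauchy"
      using xy by (auto simp: completion_carrier)
    then show ?thesis using cauchy_carrier[of s] cauchy_carrier[of t] by (simp add: completion_add a_comm)
  qed
qed (auto simp: completion_carrier completion_zero completion_one completion_add completion_mult
    completion_scale completion_star cauchy_const cauchy_add cauchy_mult cauchy_scale cauchy_star
    cauchy_carrier a_assoc m_assoc scale_add_right scale_add_left scale_scale l_distr scale_mult_left
    star_add star_scale star_mult intro!: imageI)

lemma completion_seminormed: "seminormed_star_alg (completion A \<nu>) (cnorm (completion A \<nu>))"
proof -
  interpret C: star_alg "completion A \<nu>" by (rule completion_star_alg)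
  show ?thesis
  proof
    fix x assume "x \<in> carrier (completion A \<nu>)"
    then obtain s where s: "x = cl s" "s \<in> cauchy" by (auto simp: completion_carrier)
    note sc = cauchy_carrier[OF s(2)]
    show "0 \<le> cnorm (completion A \<nu>) x"
      using completion_norm[OF s(2)] sc unfolding s(1) by (intro LIMSEQ_le_const) auto
    show "cnorm (completion A \<nu>) (cscale (completion A \<nu>) c x) = cmod c * cnorm (completion A \<nu>) x" for c
      unfolding s(1) completion_scale[OF s(2)]
      by (rule completion_norm_eqI[OF cauchy_scale[OF s(2)]])
        (use sc completion_norm[OF s(2)] in \<open>auto simp: norm_scale intro!: tendsto_mult_left\<close>)
    show "cnorm (completion A \<nu>) (star (completion A \<nu>) x) = cnorm (completion A \<nu>) x"
      unfolding s(1) completion_star[OF s(2)]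
      by (rule completion_norm_eqI[OF cauchy_star[OF s(2)]])
        (use sc completion_norm[OF s(2)] in \<open>auto simp: norm_star\<close>)
    fix y assume "y \<in> carrier (completion A \<nu>)"
    then obtain t where t: "y = cl t" "t \<in> cauchy" by (auto simp: completion_carrier)
    note tc = cauchy_carrier[OF t(2)]
    show "cnorm (completion A \<nu>) (x \<oplus>\<^bsub>completion A \<nu>\<^esub> y) \<le> cnorm (completion A \<nu>) x + cnorm (completion A \<nu>) y"
      unfolding s(1) t(1) completion_add[OF s(2) t(2)]
      by (rule LIMSEQ_le[OF completion_norm[OF cauchy_add[OF s(2) t(2)]]
            tendsto_add[OF completion_norm[OF s(2)] completion_norm[OF t(2)]]])
        (use sc tc norm_triangle in auto)
    show "cnorm (completion A \<nu>) (x \<otimes>\<^bsub>completion A \<nu>\<^esub> y) \<le> cnorm (completion A \<nu>) x * cnorm (completion A \<nu>) y"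
      unfolding s(1) t(1) completion_mult[OF s(2) t(2)]
      by (rule LIMSEQ_le[OF completion_norm[OF cauchy_mult[OF s(2) t(2)]]
            tendsto_mult[OF completion_norm[OF s(2)] completion_norm[OF t(2)]]])
        (use sc tc norm_mult in auto)
  qed
qed

lemma completion_diff:
  assumes "s \<in> cauchy" "t \<in> cauchy"
  shows "cl s \<ominus>\<^bsub>completion A \<nu>\<^esub> cl t = cl (\<lambda>n. s n \<ominus> t n)"
proof -
  interpret C: star_alg "completion A \<nu>" by (rule completion_star_alg)
  show ?thesis
    using assms cauchy_carrier[OF assms(1)] cauchy_carrier[OF assms(2)]
    by (simp add: C.diff_eq completion_carrier completion_scale completion_add cauchy_scale diff_eq)
qed

abbreviation "emb \<equiv> completion_embed A \<nu>"

lemma emb_carrier: "x \<in> carrier A \<Longrightarrow> emb x \<in> carrier (completion A \<nu>)"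
  by (simp add: completion_embed_def completion_carrier cauchy_const)

lemma emb_norm: "x \<in> carrier A \<Longrightarrow> cnorm (completion A \<nu>) (emb x) = \<nu> x"
  unfolding completion_embed_def by (rule completion_norm_eqI) (auto simp: cauchy_const)

lemma emb_add: "\<lbrakk>x \<in> carrier A; y \<in> carrier A\<rbrakk> \<Longrightarrow> emb (x \<oplus> y) = emb x \<oplus>\<^bsub>completion A \<nu>\<^esub> emb y"
  and emb_mult: "\<lbrakk>x \<in> carrier A; y \<in> carrier A\<rbrakk> \<Longrightarrow> emb (x \<otimes> y) = emb x \<otimes>\<^bsub>completion A \<nu>\<^esub> emb y"
  and emb_scale: "x \<in> carrier A \<Longrightarrow> emb (cscale A c x) = cscale (completion A \<nu>) c (emb x)"
  and emb_star: "x \<in> carrier A \<Longrightarrow> emb (star A x) = star (completion A \<nu>) (emb x)"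
  and emb_one: "emb \<one> = \<one>\<^bsub>completion A \<nu>\<^esub>"
  by (simp_all add: completion_embed_def completion_add completion_mult completion_scale
      completion_star completion_one cauchy_const)

lemma emb_diff: "\<lbrakk>x \<in> carrier A; y \<in> carrier A\<rbrakk> \<Longrightarrow> emb (x \<ominus> y) = emb x \<ominus>\<^bsub>completion A \<nu>\<^esub> emb y"
  by (simp add: completion_embed_def completion_diff cauchy_const)

lemma emb_dense:
  assumes "X \<in> carrier (completion A \<nu>)" "\<epsilon> > 0"
  shows "\<exists>x\<in>carrier A. cnorm (completion A \<nu>) (X \<ominus>\<^bsub>completion A \<nu>\<^esub> emb x) < \<epsilon>"
proof -
  obtain s where s: "X = cl s" "s \<in> cauchy" using assms by (auto simp: completion_carrier)
  obtain N where N: "\<forall>m\<ge>N. \<forall>n\<ge>N. \<nu> (s m \<ominus> s n) < \<epsilon> / 2"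
    using cauchyD[OF s(2), of "\<epsilon> / 2"] assms(2) by auto
  note sc = cauchy_carrier[OF s(2)]
  have c: "(\<lambda>n. s n \<ominus> s N) \<in> cauchy"
    using cauchy_add[OF s(2) cauchy_scale[OF cauchy_const[OF sc[of N]], of "-1"]] sc
    by (simp add: diff_eq)
  have "cnorm (completion A \<nu>) (X \<ominus>\<^bsub>completion A \<nu>\<^esub> emb (s N)) \<le> \<epsilon> / 2"
    unfolding s(1) completion_embed_def completion_diff[OF s(2) cauchy_const[OF sc]]
    by (rule LIMSEQ_le_const2[OF completion_norm[OF c]]) (use N in \<open>auto intro!: exI[of _ N] less_imp_le\<close>)
  then show ?thesis using sc assms(2) by (intro bexI[of _ "s N"]) auto
qed

text \<open>Each member of a Cauchy sequence of classes is replaced by an embedded element at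
  distance less than \<open>1 / Suc n\<close>. The replacements form a Cauchy sequence in
  \<open>A\<close>, and its class is the limit.\<close>

lemma completion_banach: "banach_star_alg (completion A \<nu>)"
proof -
  let ?C = "completion A \<nu>"
  interpret C: seminormed_star_alg ?C "cnorm ?C" by (rule completion_seminormed)
  show ?thesis
  proof
    fix X assume X: "X \<in> carrier ?C" "cnorm ?C X = 0"
    then obtain s where s: "X = cl s" "s \<in> cauchy" by (auto simp: completion_carrier)
    then have "(\<lambda>n. \<nu> (s n)) \<longlonglongrightarrow> 0" using completion_norm[OF s(2)] X(2) by simp
    then show "X = \<zero>\<^bsub>?C\<^esub>"
      unfolding s(1) completion_zero using s(2) cauchy_carrier[OF s(2)]
      by (intro cl_eqI) (auto simp: cauchy_const)
  next
    fix X assume X: "X \<in> seminorm_cauchy ?C (cnorm ?C)"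
    then have Xc: "X n \<in> carrier ?C" for n by (auto simp: seminorm_cauchy_def)
    have "\<exists>x\<in>carrier A. cnorm ?C (X n \<ominus>\<^bsub>?C\<^esub> emb x) < 1 / real (Suc n)" for n
      using emb_dense[OF Xc] by simp
    then obtain a where a: "\<And>n. a n \<in> carrier A" "\<And>n. cnorm ?C (X n \<ominus>\<^bsub>?C\<^esub> emb (a n)) < 1 / real (Suc n)"
      by metis
    note ec = emb_carrier[OF a(1)]
    have inv_lim: "(\<lambda>n. 1 / real (Suc n)) \<longlonglongrightarrow> 0"
      using LIMSEQ_inverse_real_of_nat by (simp add: inverse_eq_divide)
    have small: "\<exists>N. \<forall>n\<ge>N. 1 / real (Suc n) < e" if "e > 0" for e :: real
      using order_tendstoD(2)[OF inv_lim that] by (simp add: eventually_sequentially)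
    have ac: "a \<in> cauchy"
    proof (rule cauchyI[OF a(1)])
      fix \<epsilon> :: real assume e: "\<epsilon> > 0"
      obtain N where N: "\<forall>m\<ge>N. \<forall>n\<ge>N. cnorm ?C (X m \<ominus>\<^bsub>?C\<^esub> X n) < \<epsilon> / 3"
        using C.cauchyD[OF X, of "\<epsilon> / 3"] e by auto
      obtain M where M: "\<forall>n\<ge>M. 1 / real (Suc n) < \<epsilon> / 3" using small[of "\<epsilon> / 3"] e by auto
      have "\<nu> (a m \<ominus> a n) < \<epsilon>" if "m \<ge> max M N" "n \<ge> max M N" for m n
      proof -
        have "\<nu> (a m \<ominus> a n) = cnorm ?C (emb (a m) \<ominus>\<^bsub>?C\<^esub> emb (a n))"
          using a(1) by (simp add: emb_norm[symmetric] emb_diff)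
        also have "\<dots> \<le> cnorm ?C (X m \<ominus>\<^bsub>?C\<^esub> emb (a m)) + cnorm ?C (X m \<ominus>\<^bsub>?C\<^esub> X n) + cnorm ?C (X n \<ominus>\<^bsub>?C\<^esub> emb (a n))"
          using C.norm_diff_triangle[OF ec[of m] Xc[of m] ec[of n]]
            C.norm_diff_triangle[OF Xc[of m] Xc[of n] ec[of n]] C.norm_minus[OF ec[of m] Xc[of m]]
          by linarith
        also have "\<dots> < \<epsilon>"
          using a(2)[of m] a(2)[of n] M[rule_format, of m] M[rule_format, of n] N[rule_format, of m n] that
          by simp
        finally show ?thesis .
      qed
      then show "\<exists>N. \<forall>m\<ge>N. \<forall>n\<ge>N. \<nu> (a m \<ominus> a n) < \<epsilon>" by blast
    qed
    have Y: "cl a \<in> carrier ?C" using ac by (simp add: completion_carrier)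
    have "C.tends (\<lambda>n. emb (a n)) (cl a)"
      unfolding C.tends_def
    proof (intro conjI)
      show "(\<lambda>n. cnorm ?C (emb (a n) \<ominus>\<^bsub>?C\<^esub> cl a)) \<longlonglongrightarrow> 0"
      proof (rule LIMSEQ_I)
        fix r :: real assume r: "r > 0"
        obtain N where N: "\<forall>m\<ge>N. \<forall>n\<ge>N. \<nu> (a m \<ominus> a n) < r / 2"
          using cauchyD[OF ac, of "r / 2"] r by auto
        have "norm (cnorm ?C (emb (a n) \<ominus>\<^bsub>?C\<^esub> cl a) - 0) < r" if "n \<ge> N" for n
        proof -
          have d: "emb (a n) \<ominus>\<^bsub>?C\<^esub> cl a = cl (\<lambda>m. a n \<ominus> a m)"
            unfolding completion_embed_def completion_diff[OF cauchy_const[OF a(1)] ac] ..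
          have "(\<lambda>m. a n \<ominus> a m) \<in> cauchy"
            using cauchy_add[OF cauchy_const[OF a(1)[of n]] cauchy_scale[OF ac, of "-1"]] a(1)
            by (simp add: diff_eq)
          from LIMSEQ_le_const2[OF completion_norm[OF this]] N that
          have "cnorm ?C (emb (a n) \<ominus>\<^bsub>?C\<^esub> cl a) \<le> r / 2"
            unfolding d by (meson less_imp_le)
          then show ?thesis using r C.norm_nonneg[of "emb (a n) \<ominus>\<^bsub>?C\<^esub> cl a"] ec Y by auto
        qed
        then show "\<exists>no. \<forall>n\<ge>no. norm (cnorm ?C (emb (a n) \<ominus>\<^bsub>?C\<^esub> cl a) - 0) < r" by blast
      qed
    qed (use ec Y in auto)
    then have lim2: "(\<lambda>n. 1 / real (Suc n) + cnorm ?C (emb (a n) \<ominus>\<^bsub>?C\<^esub> cl a)) \<longlonglongrightarrow> 0"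
      unfolding C.tends_def using inv_lim by (auto intro: tendsto_add_zero)
    have "C.tends X (cl a)"
    proof (rule C.tendsI[OF _ Y _ lim2])
      show "cnorm ?C (X n \<ominus>\<^bsub>?C\<^esub> cl a) \<le> 1 / real (Suc n) + cnorm ?C (emb (a n) \<ominus>\<^bsub>?C\<^esub> cl a)" for n
        using C.norm_diff_triangle[OF Xc[of n] ec[of n] Y] a(2)[of n] by linarith
    qed (use Xc in auto)
    then show "\<exists>x. C.tends X x" by blast
  qed
qed

lemma completion_cstar:
  assumes "\<And>x. x \<in> carrier A \<Longrightarrow> \<nu> (star A x \<otimes> x) = (\<nu> x)\<^sup>2" "X \<in> carrier (completion A \<nu>)"
  shows "cnorm (completion A \<nu>) (star (completion A \<nu>) X \<otimes>\<^bsub>completion A \<nu>\<^esub> X) = (cnorm (completion A \<nu>) X)\<^sup>2"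
proof -
  obtain s where s: "X = cl s" "s \<in> cauchy" using assms by (auto simp: completion_carrier)
  show ?thesis
    unfolding s(1) completion_star[OF s(2)] completion_mult[OF cauchy_star[OF s(2)] s(2)]
    by (rule completion_norm_eqI[OF cauchy_mult[OF cauchy_star[OF s(2)] s(2)]])
      (use completion_norm[OF s(2)] cauchy_carrier[OF s(2)] in \<open>auto simp: assms(1) intro!: tendsto_power\<close>)
qed

end

subsection \<open>C*-seminorms\<close>

locale cstar_seminormed_alg = seminormed_star_alg +
  assumes norm_star_mult: "x \<in> carrier A \<Longrightarrow> \<nu> (star A x \<otimes> x) = (\<nu> x)\<^sup>2"

text \<open>The C*-identity and submultiplicativity give
  \<open>\<nu> x * \<nu> x \<le> \<nu> (star A x) * \<nu> x\<close>; cancelling and applying this to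
  \<open>star A x\<close> as well makes the involution isometric.\<close>

lemma (in star_alg) cstar_seminormedI:
  assumes "cstar_seminorm A \<nu>"
  shows "cstar_seminormed_alg A \<nu>"
proof -
  have le: "\<nu> x \<le> \<nu> (star A x)" if "x \<in> carrier A" for x
  proof (cases "\<nu> x = 0")
    case True
    then show ?thesis using assms that by (simp add: cstar_seminorm_def)
  next
    case False
    have "\<nu> x * \<nu> x \<le> \<nu> (star A x) * \<nu> x"
      using assms that unfolding cstar_seminorm_def power2_eq_square by (metis star_closed)
    moreover have "\<nu> x > 0" using False assms that unfolding cstar_seminorm_def by force
    ultimately show ?thesis by simp
  qed
  show ?thesis
  proof unfold_locales
    show "\<nu> (star A x) = \<nu> x" if "x \<in> carrier A" for x
      using le[OF that] le[OF star_closed[OF that]] that by simp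
  qed (use assms in \<open>auto simp: cstar_seminorm_def\<close>)
qed

text \<open>The seminorm of the unit equals its own square, hence is 0 or 1; the value 0 occurs for
  the zero seminorm.\<close>

lemma (in cstar_seminormed_alg) norm_one_le: "\<nu> \<one> \<le> 1"
  using norm_star_mult[of \<one>] by (auto simp: power2_eq_square)

lemma max_cstar_seminorm_upper:
  assumes "\<And>x. x \<in> carrier A \<Longrightarrow> \<exists>M. \<forall>\<nu>. cstar_seminorm A \<nu> \<and> (\<forall>r\<in>R. \<nu> r = 0) \<longrightarrow> \<nu> x \<le> M"
    and "cstar_seminorm A \<nu>" "\<And>r. r \<in> R \<Longrightarrow> \<nu> r = 0" "x \<in> carrier A"
  shows "\<nu> x \<le> max_cstar_seminorm A R x"
proof -
  obtain M where M: "\<forall>\<nu>. cstar_seminorm A \<nu> \<and> (\<forall>r\<in>R. \<nu> r = 0) \<longrightarrow> \<nu> x \<le> M"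
    using assms(1,4) by blast
  show ?thesis
    unfolding max_cstar_seminorm_def using assms(2,3) M
    by (intro cSUP_upper bdd_aboveI2[of _ _ M]) auto
qed

text \<open>The zero seminorm belongs to the family, so the supremum is taken over a nonempty
  set.\<close>

lemma max_cstar_seminorm_least:
  assumes "\<And>\<nu>. \<lbrakk>cstar_seminorm A \<nu>; \<forall>r\<in>R. \<nu> r = 0\<rbrakk> \<Longrightarrow> \<nu> x \<le> M"
  shows "max_cstar_seminorm A R x \<le> M"
proof -
  have "cstar_seminorm A (\<lambda>_. 0)" by (simp add: cstar_seminorm_def)
  then show ?thesis unfolding max_cstar_seminorm_def using assms by (intro cSUP_least) auto
qed

text \<open>All the laws pass to the supremum; for the C*-identity this works because squaring is
  monotone on nonnegative numbers. The boundedness assumption makes each supremum finite.\<close>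

lemma (in star_alg) max_cstar_seminorm_cstar:
  assumes bdd: "\<And>x. x \<in> carrier A \<Longrightarrow> \<exists>M. \<forall>\<nu>. cstar_seminorm A \<nu> \<and> (\<forall>r\<in>R. \<nu> r = 0) \<longrightarrow> \<nu> x \<le> M"
  shows "cstar_seminorm A (max_cstar_seminorm A R)"
proof -
  let ?\<mu> = "max_cstar_seminorm A R"
  note upper = max_cstar_seminorm_upper[where A = A and R = R, OF bdd]
  have z: "cstar_seminorm A (\<lambda>_. 0)" by (simp add: cstar_seminorm_def)
  have nonneg: "0 \<le> ?\<mu> x" if "x \<in> carrier A" for x
    using upper[OF _ z _ that] by simp
  have scale_le: "?\<mu> (cscale A c x) \<le> cmod c * ?\<mu> x" if "x \<in> carrier A" for c x
    using upper[OF _ _ _ that]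
    by (intro max_cstar_seminorm_least) (auto simp: cstar_seminorm_def that intro!: mult_left_mono)
  show ?thesis
    unfolding cstar_seminorm_def
  proof (intro conjI ballI allI)
    fix x assume x: "x \<in> carrier A"
    show "0 \<le> ?\<mu> x" by (rule nonneg[OF x])
    fix y assume y: "y \<in> carrier A"
    show "?\<mu> (x \<oplus> y) \<le> ?\<mu> x + ?\<mu> y"
    proof (rule max_cstar_seminorm_least)
      fix \<nu> assume \<nu>: "cstar_seminorm A \<nu>" "\<forall>r\<in>R. \<nu> r = 0"
      then have "\<nu> (x \<oplus> y) \<le> \<nu> x + \<nu> y" using x y by (simp add: cstar_seminorm_def)
      then show "\<nu> (x \<oplus> y) \<le> ?\<mu> x + ?\<mu> y"
        using upper[OF _ \<nu>(1) _ x] upper[OF _ \<nu>(1) _ y] \<nu>(2) by fastforce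
    qed
    show "?\<mu> (x \<otimes> y) \<le> ?\<mu> x * ?\<mu> y"
    proof (rule max_cstar_seminorm_least)
      fix \<nu> assume \<nu>: "cstar_seminorm A \<nu>" "\<forall>r\<in>R. \<nu> r = 0"
      then have "\<nu> (x \<otimes> y) \<le> \<nu> x * \<nu> y" using x y by (simp add: cstar_seminorm_def)
      also have "\<dots> \<le> ?\<mu> x * ?\<mu> y"
        using upper[OF _ \<nu>(1) _ x] upper[OF _ \<nu>(1) _ y] \<nu> nonneg[OF x] y
        by (intro mult_mono) (auto simp: cstar_seminorm_def)
      finally show "\<nu> (x \<otimes> y) \<le> ?\<mu> x * ?\<mu> y" .
    qed
  next
    fix c x assume x: "x \<in> carrier A"
    show "?\<mu> (cscale A c x) = cmod c * ?\<mu> x"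
    proof (cases "c = 0")
      case True
      then show ?thesis using scale_le[OF x, of 0] nonneg[of "cscale A 0 x"] x by simp
    next
      case False
      have "?\<mu> x = ?\<mu> (cscale A (inverse c) (cscale A c x))" using False x by (simp add: scale_scale)
      also have "\<dots> \<le> cmod (inverse c) * ?\<mu> (cscale A c x)" using x by (intro scale_le) auto
      finally have "cmod c * ?\<mu> x \<le> ?\<mu> (cscale A c x)"
        using False by (simp add: norm_divide norm_inverse field_simps)
      then show ?thesis using scale_le[OF x, of c] by simp
    qed
  next
    fix x assume x: "x \<in> carrier A"
    show "?\<mu> (star A x \<otimes> x) = (?\<mu> x)\<^sup>2"
    proof (rule antisym)
      show "?\<mu> (star A x \<otimes> x) \<le> (?\<mu> x)\<^sup>2"
      proof (rule max_cstar_seminorm_least)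
        fix \<nu> assume \<nu>: "cstar_seminorm A \<nu>" "\<forall>r\<in>R. \<nu> r = 0"
        then have "\<nu> (star A x \<otimes> x) = (\<nu> x)\<^sup>2" using x by (simp add: cstar_seminorm_def)
        also have "\<dots> \<le> (?\<mu> x)\<^sup>2"
          using upper[OF _ \<nu>(1) _ x] \<nu> x by (intro power_mono) (auto simp: cstar_seminorm_def)
        finally show "\<nu> (star A x \<otimes> x) \<le> (?\<mu> x)\<^sup>2" .
      qed
      have "?\<mu> x \<le> sqrt (?\<mu> (star A x \<otimes> x))"
      proof (rule max_cstar_seminorm_least)
        fix \<nu> assume \<nu>: "cstar_seminorm A \<nu>" "\<forall>r\<in>R. \<nu> r = 0"
        then have "(\<nu> x)\<^sup>2 = \<nu> (star A x \<otimes> x)" using x by (simp add: cstar_seminorm_def)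
        also have "\<dots> \<le> ?\<mu> (star A x \<otimes> x)" using upper[OF _ \<nu>(1)] \<nu>(2) x by simp
        finally show "\<nu> x \<le> sqrt (?\<mu> (star A x \<otimes> x))" by (rule real_le_rsqrt)
      qed
      then show "(?\<mu> x)\<^sup>2 \<le> ?\<mu> (star A x \<otimes> x)"
        using nonneg[OF x] nonneg[of "star A x \<otimes> x"] x by (simp add: real_le_lsqrt sqrt_le_D real_sqrt_le_iff)
          (metis power_mono real_sqrt_pow2 m_closed star_closed)
    qed
  qed
qed

subsection \<open>Homomorphisms\<close>

locale star_hom = A: star_alg A + B: star_alg B
  for A :: "('a, 'm) star_algebra_scheme" and B :: "('b, 'n) star_algebra_scheme" +
  fixes h :: "'a \<Rightarrow> 'b"
  assumes hom_closed [simp, intro]: "x \<in> carrier A \<Longrightarrow> h x \<in> carrier B"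
    and hom_add: "\<lbrakk>x \<in> carrier A; y \<in> carrier A\<rbrakk> \<Longrightarrow> h (x \<oplus>\<^bsub>A\<^esub> y) = h x \<oplus>\<^bsub>B\<^esub> h y"
    and hom_mult: "\<lbrakk>x \<in> carrier A; y \<in> carrier A\<rbrakk> \<Longrightarrow> h (x \<otimes>\<^bsub>A\<^esub> y) = h x \<otimes>\<^bsub>B\<^esub> h y"
    and hom_scale: "x \<in> carrier A \<Longrightarrow> h (cscale A c x) = cscale B c (h x)"
    and hom_star: "x \<in> carrier A \<Longrightarrow> h (star A x) = star B (h x)"
    and hom_one: "h \<one>\<^bsub>A\<^esub> = \<one>\<^bsub>B\<^esub>"
begin

lemma hom_zero [simp]: "h \<zero>\<^bsub>A\<^esub> = \<zero>\<^bsub>B\<^esub>"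
  using hom_scale[of "\<zero>\<^bsub>A\<^esub>" 0] by simp

lemma hom_diff: "\<lbrakk>x \<in> carrier A; y \<in> carrier A\<rbrakk> \<Longrightarrow> h (x \<ominus>\<^bsub>A\<^esub> y) = h x \<ominus>\<^bsub>B\<^esub> h y"
  by (simp add: A.diff_eq B.diff_eq hom_add hom_scale)

lemma cstar_seminorm_comp:
  assumes "cstar_seminorm B \<mu>"
  shows "cstar_seminorm A (\<lambda>x. \<mu> (h x))"
  using assms by (simp add: cstar_seminorm_def hom_add hom_mult hom_scale hom_star)

end

lemma star_hom_comp:
  assumes "star_hom A B h" "star_hom B C k"
  shows "star_hom A C (\<lambda>x. k (h x))"
proof -
  interpret h: star_hom A B h by fact
  interpret k: star_hom B C k by fact
  show ?thesis
    by unfold_locales (simp_all add: h.hom_add k.hom_add h.hom_mult k.hom_mult h.hom_scale k.hom_scale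
        h.hom_star k.hom_star h.hom_one k.hom_one)
qed

lemma (in seminormed_star_alg) emb_hom: "star_hom A (completion A \<nu>) emb"
proof -
  interpret C: star_alg "completion A \<nu>" by (rule completion_star_alg)
  show ?thesis
    by unfold_locales (simp_all add: emb_carrier emb_add emb_mult emb_scale emb_star emb_one)
qed

text \<open>The form in which both isomorphisms are obtained. The pairs \<open>(h x, k x)\<close>
  satisfy the assumptions of \<open>dense_iso\<close>; working with pairs leaves open whether
  \<open>h\<close> and \<open>k\<close> are injective.\<close>

lemma dense_hom_iso:
  assumes "star_hom F A h" "star_hom F B k" "banach_star_alg A" "banach_star_alg B"
    and norm: "\<And>x. x \<in> carrier F \<Longrightarrow> cnorm A (h x) = cnorm B (k x)"
  shows "\<exists>\<phi>. cstar_iso (A\<lparr>carrier := norm_closure A (h ` carrier F)\<rparr>) (B\<lparr>carrier := norm_closure B (k ` carrier F)\<rparr>) \<phi>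
    \<and> (\<forall>x\<in>carrier F. \<phi> (h x) = k x)"
proof -
  interpret h: star_hom F A h by fact
  interpret k: star_hom F B k by fact
  define R where "R = (\<lambda>x. (h x, k x)) ` carrier F"
  have RI: "(a, b) \<in> R" if "x \<in> carrier F" "a = h x" "b = k x" for a b x
    using that by (auto simp: R_def)
  have RE: "\<exists>x\<in>carrier F. a = h x \<and> b = k x" if "(a, b) \<in> R" for a b
    using that by (auto simp: R_def)
  have "\<exists>\<phi>. cstar_iso (A\<lparr>carrier := norm_closure A (Domain R)\<rparr>) (B\<lparr>carrier := norm_closure B (Range R)\<rparr>) \<phi>
    \<and> (\<forall>(x, y)\<in>R. \<phi> x = y)"
  proof (rule dense_iso[OF assms(3,4)])
    show "R \<subseteq> carrier A \<times> carrier B" by (auto simp: R_def)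
  next
    fix a b a' b' assume "(a, b) \<in> R" "(a', b') \<in> R"
    then obtain x y where x: "x \<in> carrier F" "a = h x" "b = k x"
      and y: "y \<in> carrier F" "a' = h y" "b' = k y" using RE by meson
    show "(a \<oplus>\<^bsub>A\<^esub> a', b \<oplus>\<^bsub>B\<^esub> b') \<in> R"
      by (rule RI[of "x \<oplus>\<^bsub>F\<^esub> y"]) (simp_all add: x y h.hom_add k.hom_add)
    show "(a \<otimes>\<^bsub>A\<^esub> a', b \<otimes>\<^bsub>B\<^esub> b') \<in> R"
      by (rule RI[of "x \<otimes>\<^bsub>F\<^esub> y"]) (simp_all add: x y h.hom_mult k.hom_mult)
  next
    fix a b c assume "(a, b) \<in> R"
    then obtain x where x: "x \<in> carrier F" "a = h x" "b = k x" using RE by meson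
    show "(cscale A c a, cscale B c b) \<in> R"
      by (rule RI[of "cscale F c x"]) (simp_all add: x h.hom_scale k.hom_scale)
    show "(star A a, star B b) \<in> R"
      by (rule RI[of "star F x"]) (simp_all add: x h.hom_star k.hom_star)
    show "cnorm A a = cnorm B b" using x norm by simp
  qed
  moreover have "Domain R = h ` carrier F" "Range R = k ` carrier F" by (auto simp: R_def)
  moreover have "\<phi> (h x) = k x" if "\<forall>(x, y)\<in>R. \<phi> x = y" "x \<in> carrier F" for \<phi> x
    using bspec[OF that(1) RI[OF that(2) refl refl]] by simp
  ultimately show ?thesis by auto
qed

section \<open>Words and Toeplitz relators under *-homomorphisms\<close>

lemma (in star_alg) word_star_eval_closed:
  assumes "w ` P \<subseteq> carrier A" "set \<alpha> \<subseteq> P"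
  shows "word_star_eval A w \<alpha> \<in> carrier A"
  using assms(2)
proof (induction "length \<alpha>" arbitrary: \<alpha> rule: less_induct)
  case less
  consider "\<alpha> = []" | p where "\<alpha> = [p]" | p q \<alpha>' where "\<alpha> = p # q # \<alpha>'"
    by (metis list.exhaust)
  then show ?case
  proof cases
    case (3 p q \<alpha>')
    then have "word_star_eval A w \<alpha>' \<in> carrier A" "w p \<in> carrier A" "w q \<in> carrier A"
      using less assms(1) by auto
    then show ?thesis using 3 by simp
  qed auto
qed

lemma (in star_alg) foldr_mult_closed:
  assumes "\<And>x. x \<in> set xs \<Longrightarrow> f x \<in> carrier A"
  shows "foldr (\<lambda>x y. f x \<otimes> y) xs \<one> \<in> carrier A"
  using assms by (induction xs) auto

lemma (in star_hom) hom_word_star_eval: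
  assumes "w ` P \<subseteq> carrier A" "set \<alpha> \<subseteq> P"
  shows "h (word_star_eval A w \<alpha>) = word_star_eval B (\<lambda>p. h (w p)) \<alpha>"
  using assms(2)
proof (induction "length \<alpha>" arbitrary: \<alpha> rule: less_induct)
  case less
  consider "\<alpha> = []" | p where "\<alpha> = [p]" | p q \<alpha>' where "\<alpha> = p # q # \<alpha>'"
    by (metis list.exhaust)
  then show ?case
  proof cases
    case (3 p q \<alpha>')
    have "word_star_eval A w \<alpha>' \<in> carrier A"
      using 3 less.prems by (intro A.word_star_eval_closed[OF assms(1)]) auto
    moreover have "w p \<in> carrier A" "w q \<in> carrier A" using 3 less.prems assms(1) by auto
    moreover have "h (word_star_eval A w \<alpha>') = word_star_eval B (\<lambda>p. h (w p)) \<alpha>'"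
      using 3 less by simp
    ultimately show ?thesis using 3 by (simp add: hom_mult hom_star)
  qed (auto simp: hom_one)
qed

lemma (in star_hom) hom_foldr_mult:
  assumes "\<And>x. x \<in> set xs \<Longrightarrow> f x \<in> carrier A"
  shows "h (foldr (\<lambda>x y. f x \<otimes>\<^bsub>A\<^esub> y) xs \<one>\<^bsub>A\<^esub>) = foldr (\<lambda>x y. h (f x) \<otimes>\<^bsub>B\<^esub> y) xs \<one>\<^bsub>B\<^esub>"
  using assms by (induction xs) (auto simp: hom_one hom_mult A.foldr_mult_closed)

text \<open>As a union of images, the set of relators can be pushed through a homomorphism by the
  rules for images.\<close>

lemma toeplitz_relators_image:
  "toeplitz_relators G P A w =
    insert (w \<one>\<^bsub>G\<^esub> \<ominus>\<^bsub>A\<^esub> \<one>\<^bsub>A\<^esub>)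
      (word_star_eval A w ` {\<alpha> \<in> neutral_words G P. constr_ideal G P \<alpha> = {}} \<union>
       (\<lambda>(\<alpha>, \<beta>). word_star_eval A w \<alpha> \<ominus>\<^bsub>A\<^esub> word_star_eval A w \<beta>) `
         {(\<alpha>, \<beta>). \<alpha> \<in> neutral_words G P \<and> \<beta> \<in> neutral_words G P \<and> constr_ideal G P \<alpha> = constr_ideal G P \<beta>} \<union>
       (\<lambda>(\<alpha>, F). foldr (\<lambda>\<beta> x. (word_star_eval A w \<alpha> \<ominus>\<^bsub>A\<^esub> word_star_eval A w \<beta>) \<otimes>\<^bsub>A\<^esub> x) F \<one>\<^bsub>A\<^esub>) `
         {(\<alpha>, F). \<alpha> \<in> neutral_words G P \<and> distinct F \<and> F \<noteq> [] \<and> set F \<subseteq> neutral_words G P \<and>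
           constr_ideal G P \<alpha> = (\<Union>\<beta>\<in>set F. constr_ideal G P \<beta>)})"
  unfolding toeplitz_relators_def by (intro equalityI subsetI) (fastforce simp: image_iff)+

text \<open>Relators are *-polynomials in the family, so a unital *-homomorphism carries them to the
  relators of the image family. This is used for \<open>\<Phi>\<close> and for the embedding into
  the completion.\<close>

lemma (in star_hom) hom_toeplitz_relators:
  assumes w: "w ` P \<subseteq> carrier A" and one: "\<one>\<^bsub>G\<^esub> \<in> P"
  shows "toeplitz_relators G P B (\<lambda>p. h (w p)) = h ` toeplitz_relators G P A w"
    and "toeplitz_relators G P A w \<subseteq> carrier A"
proof -
  have set: "set \<alpha> \<subseteq> P" if "\<alpha> \<in> neutral_words G P" for \<alpha>
    using that by (auto simp: words_over_def words_def)
  note cl = A.word_star_eval_closed[OF w set] and ev = hom_word_star_eval[OF w set]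
  have one': "w \<one>\<^bsub>G\<^esub> \<in> carrier A" using w one by blast
  have fold: "foldr (\<lambda>\<beta> x. (word_star_eval A w \<alpha> \<ominus>\<^bsub>A\<^esub> word_star_eval A w \<beta>) \<otimes>\<^bsub>A\<^esub> x) F \<one>\<^bsub>A\<^esub> \<in> carrier A"
    "h (foldr (\<lambda>\<beta> x. (word_star_eval A w \<alpha> \<ominus>\<^bsub>A\<^esub> word_star_eval A w \<beta>) \<otimes>\<^bsub>A\<^esub> x) F \<one>\<^bsub>A\<^esub>) =
      foldr (\<lambda>\<beta> x. (word_star_eval B (\<lambda>p. h (w p)) \<alpha> \<ominus>\<^bsub>B\<^esub> word_star_eval B (\<lambda>p. h (w p)) \<beta>) \<otimes>\<^bsub>B\<^esub> x) F \<one>\<^bsub>B\<^esub>"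
    if "\<alpha> \<in> neutral_words G P" "set F \<subseteq> neutral_words G P" for \<alpha> F
  proof -
    have c: "word_star_eval A w \<alpha> \<ominus>\<^bsub>A\<^esub> word_star_eval A w \<beta> \<in> carrier A" if "\<beta> \<in> set F" for \<beta>
      using cl[OF \<open>\<alpha> \<in> _\<close>] cl[of \<beta>] that \<open>set F \<subseteq> _\<close> by auto
    show "foldr (\<lambda>\<beta> x. (word_star_eval A w \<alpha> \<ominus>\<^bsub>A\<^esub> word_star_eval A w \<beta>) \<otimes>\<^bsub>A\<^esub> x) F \<one>\<^bsub>A\<^esub> \<in> carrier A"
      by (rule A.foldr_mult_closed) (rule c)
    show "h (foldr (\<lambda>\<beta> x. (word_star_eval A w \<alpha> \<ominus>\<^bsub>A\<^esub> word_star_eval A w \<beta>) \<otimes>\<^bsub>A\<^esub> x) F \<one>\<^bsub>A\<^esub>) =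
      foldr (\<lambda>\<beta> x. (word_star_eval B (\<lambda>p. h (w p)) \<alpha> \<ominus>\<^bsub>B\<^esub> word_star_eval B (\<lambda>p. h (w p)) \<beta>) \<otimes>\<^bsub>B\<^esub> x) F \<one>\<^bsub>B\<^esub>"
      by (subst hom_foldr_mult[OF c])
        (use that cl ev in \<open>auto simp: hom_diff subset_iff intro!: foldr_cong\<close>)
  qed
  show "toeplitz_relators G P B (\<lambda>p. h (w p)) = h ` toeplitz_relators G P A w"
    unfolding toeplitz_relators_image image_insert image_Un image_image
    by (intro arg_cong2[of _ _ _ _ insert] arg_cong2[of _ _ _ _ "(\<union>)"] image_cong refl)
      (use one' cl ev fold in \<open>auto simp: hom_diff hom_one\<close>)
  show "toeplitz_relators G P A w \<subseteq> carrier A"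
    unfolding toeplitz_relators_image using one' cl fold(1) by auto
qed

section \<open>The free unital *-algebra\<close>

definition monomial :: "'w \<Rightarrow> 'w \<Rightarrow> complex" where
  "monomial w = (\<lambda>v. if v = w then 1 else 0)"

lemma free_gen_monomial: "free_gen x = monomial [(x, False)]"
  by (simp add: free_gen_def monomial_def)

lemma free_carrier_iff:
  "f \<in> carrier (free_star_algebra X) \<longleftrightarrow> finite {w. f w \<noteq> 0} \<and> {w. f w \<noteq> 0} \<subseteq> lists (X \<times> UNIV)"
  by (simp add: free_star_algebra_def)

lemma free_ops [simp]:
  "f \<otimes>\<^bsub>free_star_algebra X\<^esub> g = (\<lambda>w. \<Sum>i\<le>length w. f (take i w) * g (drop i w))"
  "f \<oplus>\<^bsub>free_star_algebra X\<^esub> g = (\<lambda>w. f w + g w)"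
  "cscale (free_star_algebra X) c f = (\<lambda>w. c * f w)"
  "star (free_star_algebra X) f = (\<lambda>w. cnj (f (rev (map (\<lambda>(x, b). (x, \<not> b)) w))))"
  "\<zero>\<^bsub>free_star_algebra X\<^esub> = (\<lambda>w. 0)"
  by (simp_all add: free_star_algebra_def)

lemma free_one: "\<one>\<^bsub>free_star_algebra X\<^esub> = monomial []"
  by (simp add: free_star_algebra_def monomial_def)

lemma monomial_carrier: "monomial w \<in> carrier (free_star_algebra X) \<longleftrightarrow> w \<in> lists (X \<times> UNIV)"
  by (auto simp: free_carrier_iff monomial_def)

lemma monomial_mult: "monomial u \<otimes>\<^bsub>free_star_algebra X\<^esub> monomial v = monomial (u @ v)"
proof
  fix w
  have "(\<Sum>i\<le>length w. monomial u (take i w) * monomial v (drop i w)) =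
      (\<Sum>i\<le>length w. if i = length u \<and> w = u @ v then 1 else 0)"
    by (rule sum.cong) (auto simp: monomial_def append_eq_conv_conj min_def)
  also have "\<dots> = monomial (u @ v) w"
    by (auto simp: monomial_def)
  finally show "(monomial u \<otimes>\<^bsub>free_star_algebra X\<^esub> monomial v) w = monomial (u @ v) w" by simp
qed

lemma flip_flip: "rev (map (\<lambda>(x, b). (x, \<not> b)) (rev (map (\<lambda>(x, b). (x, \<not> b)) w))) = w"
  by (induction w) auto

lemma flip_lists: "w \<in> lists (X \<times> UNIV) \<Longrightarrow> rev (map (\<lambda>(x, b). (x, \<not> b)) w) \<in> lists (X \<times> UNIV)"
  by (auto simp: lists_eq_set)

lemma monomial_star: "star (free_star_algebra X) (monomial w) = monomial (rev (map (\<lambda>(x, b). (x, \<not> b)) w))"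
  by (auto simp: monomial_def fun_eq_iff flip_flip)

lemma free_induct [consumes 1, case_names zero add scale monomial]:
  assumes "x \<in> carrier (free_star_algebra X)"
    and "Q \<zero>\<^bsub>free_star_algebra X\<^esub>"
    and "\<And>x y. \<lbrakk>x \<in> carrier (free_star_algebra X); y \<in> carrier (free_star_algebra X); Q x; Q y\<rbrakk> \<Longrightarrow> Q (x \<oplus>\<^bsub>free_star_algebra X\<^esub> y)"
    and "\<And>c x. \<lbrakk>x \<in> carrier (free_star_algebra X); Q x\<rbrakk> \<Longrightarrow> Q (cscale (free_star_algebra X) c x)"
    and "\<And>w. w \<in> lists (X \<times> UNIV) \<Longrightarrow> Q (monomial w)"
  shows "Q x"
proof -
  let ?F = "free_star_algebra X"
  have "finite W \<Longrightarrow> x \<in> carrier ?F \<Longrightarrow> {w. x w \<noteq> 0} = W \<Longrightarrow> Q x" for W and x :: "('a \<times> bool) list \<Rightarrow> complex"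
  proof (induction W arbitrary: x rule: finite_induct)
    case empty
    then have "x = \<zero>\<^bsub>?F\<^esub>" by auto
    then show ?case using assms(2) by simp
  next
    case (insert w W)
    define y where "y = x(w := 0)"
    have w: "w \<in> lists (X \<times> UNIV)" using insert.prems by (auto simp: free_carrier_iff)
    have W: "{v. y v \<noteq> 0} = W" using insert.prems(2) insert.hyps by (auto simp: y_def)
    then have y: "y \<in> carrier ?F" using insert.prems insert.hyps by (auto simp: free_carrier_iff)
    have m: "monomial w \<in> carrier ?F" "cscale ?F (x w) (monomial w) \<in> carrier ?F"
      using w by (auto simp: free_carrier_iff monomial_def)
    have "x = cscale ?F (x w) (monomial w) \<oplus>\<^bsub>?F\<^esub> y"
      by (auto simp: y_def monomial_def)
    moreover have "Q (cscale ?F (x w) (monomial w) \<oplus>\<^bsub>?F\<^esub> y)"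
      using insert.IH[OF y W] assms(3)[OF m(2) y] assms(4)[OF m(1)] assms(5)[OF w] by blast
    ultimately show ?case by metis
  qed
  then show ?thesis using assms(1) by (auto simp: free_carrier_iff)
qed

lemma free_mult_closed:
  assumes "f \<in> carrier (free_star_algebra X)" "g \<in> carrier (free_star_algebra X)"
  shows "f \<otimes>\<^bsub>free_star_algebra X\<^esub> g \<in> carrier (free_star_algebra X)"
proof -
  have sub: "{w. (\<Sum>i\<le>length w. f (take i w) * g (drop i w)) \<noteq> 0} \<subseteq>
      (\<lambda>(u, v). u @ v) ` ({w. f w \<noteq> 0} \<times> {w. g w \<noteq> 0})"
  proof
    fix w assume "w \<in> {w. (\<Sum>i\<le>length w. f (take i w) * g (drop i w)) \<noteq> 0}"
    then obtain i where "f (take i w) * g (drop i w) \<noteq> 0"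
      using sum.not_neutral_contains_not_neutral by blast
    then show "w \<in> (\<lambda>(u, v). u @ v) ` ({w. f w \<noteq> 0} \<times> {w. g w \<noteq> 0})"
      by (intro image_eqI[of _ _ "(take i w, drop i w)"]) auto
  qed
  have "finite ((\<lambda>(u, v). u @ v) ` ({w. f w \<noteq> 0} \<times> {w. g w \<noteq> 0}))"
    using assms by (simp add: free_carrier_iff)
  moreover have "(\<lambda>(u, v). u @ v) ` ({w. f w \<noteq> 0} \<times> {w. g w \<noteq> 0}) \<subseteq> lists (X \<times> UNIV)"
    using assms by (fastforce simp: free_carrier_iff)
  ultimately show ?thesis
    using finite_subset[OF sub] subset_trans[OF sub] unfolding free_carrier_iff free_ops by simp
qed

text \<open>Both sides sum over all ways to cut \<open>w\<close> into three consecutive pieces. On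
  the left the cut points are \<open>j\<close> and \<open>i\<close>, on the right \<open>j\<close>
  and the length \<open>i - j\<close> of the middle piece.\<close>

lemma free_mult_assoc:
  fixes f g h :: "('x \<times> bool) list \<Rightarrow> complex"
  shows "(f \<otimes>\<^bsub>free_star_algebra X\<^esub> g) \<otimes>\<^bsub>free_star_algebra X\<^esub> h = f \<otimes>\<^bsub>free_star_algebra X\<^esub> (g \<otimes>\<^bsub>free_star_algebra X\<^esub> h)"
proof
  fix w :: "('x \<times> bool) list"
  let ?n = "length w"
  have "((f \<otimes>\<^bsub>free_star_algebra X\<^esub> g) \<otimes>\<^bsub>free_star_algebra X\<^esub> h) w =
      (\<Sum>i\<le>?n. \<Sum>j\<le>i. f (take j w) * g (take (i - j) (drop j w)) * h (drop i w))"
    by (auto simp: sum_distrib_right min_def drop_take intro!: sum.cong)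
  also have "\<dots> = (\<Sum>(i, j)\<in>(SIGMA i:{..?n}. {..i}). f (take j w) * g (take (i - j) (drop j w)) * h (drop i w))"
    by (simp add: sum.Sigma)
  also have "\<dots> = (\<Sum>(j, k)\<in>(SIGMA j:{..?n}. {..?n - j}). f (take j w) * g (take k (drop j w)) * h (drop (j + k) w))"
    by (rule sum.reindex_bij_witness[of _ "\<lambda>(j, k). (j + k, j)" "\<lambda>(i, j). (j, i - j)"]) auto
  also have "\<dots> = (\<Sum>j\<le>?n. \<Sum>k\<le>?n - j. f (take j w) * g (take k (drop j w)) * h (drop (j + k) w))"
    by (simp add: sum.Sigma)
  also have "\<dots> = (f \<otimes>\<^bsub>free_star_algebra X\<^esub> (g \<otimes>\<^bsub>free_star_algebra X\<^esub> h)) w"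
    by (simp add: sum_distrib_left mult.assoc add.commute)
  finally show "((f \<otimes>\<^bsub>free_star_algebra X\<^esub> g) \<otimes>\<^bsub>free_star_algebra X\<^esub> h) w =
      (f \<otimes>\<^bsub>free_star_algebra X\<^esub> (g \<otimes>\<^bsub>free_star_algebra X\<^esub> h)) w" .
qed

lemma free_star_mult:
  "star (free_star_algebra X) (f \<otimes>\<^bsub>free_star_algebra X\<^esub> g) =
    star (free_star_algebra X) g \<otimes>\<^bsub>free_star_algebra X\<^esub> star (free_star_algebra X) f"
proof
  fix w :: "('a \<times> bool) list"
  let ?r = "\<lambda>w :: ('a \<times> bool) list. rev (map (\<lambda>(x, b). (x, \<not> b)) w)"
  have "star (free_star_algebra X) (f \<otimes>\<^bsub>free_star_algebra X\<^esub> g) w =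
      (\<Sum>i\<le>length w. cnj (f (take i (?r w))) * cnj (g (drop i (?r w))))"
    by simp
  \<comment> \<open>Reversing the word turns the cut after \<open>i\<close> letters into the cut
    after \<open>length w - i\<close> letters.\<close>
  also have "\<dots> = (\<Sum>i\<le>length w. cnj (g (?r (take i w))) * cnj (f (?r (drop i w))))"
    by (rule sum.reindex_bij_witness[of _ "\<lambda>i. length w - i" "\<lambda>i. length w - i"])
      (auto simp: take_rev drop_rev take_map drop_map)
  finally show "star (free_star_algebra X) (f \<otimes>\<^bsub>free_star_algebra X\<^esub> g) w =
    (star (free_star_algebra X) g \<otimes>\<^bsub>free_star_algebra X\<^esub> star (free_star_algebra X) f) w" by simp
qed

lemma free_star_closed:
  assumes "f \<in> carrier (free_star_algebra X)"
  shows "star (free_star_algebra X) f \<in> carrier (free_star_algebra X)"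
proof -
  let ?r = "\<lambda>w :: ('a \<times> bool) list. rev (map (\<lambda>(x, b). (x, \<not> b)) w)"
  have *: "{w. f (?r w) \<noteq> 0} = ?r ` {w. f w \<noteq> 0}"
    by (auto simp: image_iff flip_flip) (metis flip_flip)
  show ?thesis
    using assms flip_lists unfolding free_carrier_iff free_ops complex_cnj_zero_iff * by blast
qed

lemma free_star_algebra: "star_alg (free_star_algebra X)"
proof (rule star_algI)
  let ?F = "free_star_algebra X"
  show "x \<oplus>\<^bsub>?F\<^esub> y \<in> carrier ?F" if "x \<in> carrier ?F" "y \<in> carrier ?F" for x y
  proof -
    have "{w. x w + y w \<noteq> 0} \<subseteq> {w. x w \<noteq> 0} \<union> {w. y w \<noteq> 0}" by auto
    then show ?thesis using that finite_subset unfolding free_carrier_iff free_ops by blast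
  qed
  show "cscale ?F c x \<in> carrier ?F" if "x \<in> carrier ?F" for c x
  proof -
    have "{w. c * x w \<noteq> 0} \<subseteq> {w. x w \<noteq> 0}" by auto
    then show ?thesis using that finite_subset unfolding free_carrier_iff free_ops by blast
  qed
  show "\<one>\<^bsub>?F\<^esub> \<otimes>\<^bsub>?F\<^esub> x = x" for x
  proof
    fix w
    have "(\<one>\<^bsub>?F\<^esub> \<otimes>\<^bsub>?F\<^esub> x) w = (\<Sum>i\<le>length w. if i = 0 then x (drop i w) else 0)"
      unfolding free_one free_ops by (rule sum.cong) (auto simp: monomial_def)
    then show "(\<one>\<^bsub>?F\<^esub> \<otimes>\<^bsub>?F\<^esub> x) w = x w" by simp
  qed
qed (simp_all add: free_one monomial_carrier free_mult_closed free_star_closed free_mult_assoc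
    free_star_mult del: free_ops(1,4),
  auto simp: free_carrier_iff fun_eq_iff algebra_simps sum.distrib sum_distrib_left flip_flip)

subsection \<open>Evaluation of noncommutative *-polynomials\<close>

definition monomial_value :: "('b, 'n) star_algebra_scheme \<Rightarrow> ('x \<Rightarrow> 'b) \<Rightarrow> ('x \<times> bool) list \<Rightarrow> 'b" where
  "monomial_value B t w = foldr (\<lambda>(x, b) y. (if b then star B (t x) else t x) \<otimes>\<^bsub>B\<^esub> y) w \<one>\<^bsub>B\<^esub>"

definition free_eval :: "('b, 'n) star_algebra_scheme \<Rightarrow> ('x \<Rightarrow> 'b) \<Rightarrow> (('x \<times> bool) list \<Rightarrow> complex) \<Rightarrow> 'b" where
  "free_eval B t f = finsum B (\<lambda>w. cscale B (f w) (monomial_value B t w)) {w. f w \<noteq> 0}"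

context star_alg
begin

context
  fixes t :: "'x \<Rightarrow> 'a" and X :: "'x set"
  assumes t: "t ` X \<subseteq> carrier A"
begin

lemma monomial_value_closed: "w \<in> lists (X \<times> UNIV) \<Longrightarrow> monomial_value A t w \<in> carrier A"
  using t by (induction w) (auto simp: monomial_value_def)

lemma monomial_value_append:
  "\<lbrakk>u \<in> lists (X \<times> UNIV); v \<in> lists (X \<times> UNIV)\<rbrakk> \<Longrightarrow>
    monomial_value A t (u @ v) = monomial_value A t u \<otimes> monomial_value A t v"
proof (induction u)
  case Nil
  then show ?case using monomial_value_closed[of v] by (simp add: monomial_value_def)
next
  case (Cons l u)
  obtain x b where l: "l = (x, b)" by (cases l)
  have "(if b then star A (t x) else t x) \<in> carrier A" using Cons.prems l t by auto
  moreover have "monomial_value A t (u @ v) = monomial_value A t u \<otimes> monomial_value A t v"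
    using Cons by auto
  moreover have "monomial_value A t (l # w) = (if b then star A (t x) else t x) \<otimes> monomial_value A t w" for w
    by (simp add: monomial_value_def l)
  ultimately show ?case
    using Cons.prems monomial_value_closed[of u] monomial_value_closed[of v] by (simp add: m_assoc)
qed

lemma monomial_value_star:
  "w \<in> lists (X \<times> UNIV) \<Longrightarrow>
    monomial_value A t (rev (map (\<lambda>(x, b). (x, \<not> b)) w)) = star A (monomial_value A t w)"
proof (induction w)
  case Nil
  then show ?case by (simp add: monomial_value_def)
next
  case (Cons l w)
  obtain x b where l: "l = (x, b)" by (cases l)
  have x: "x \<in> X" "t x \<in> carrier A" using Cons.prems l t by auto
  have w: "w \<in> lists (X \<times> UNIV)" using Cons.prems by auto
  then have rw: "rev (map (\<lambda>(x, b). (x, \<not> b)) w) \<in> lists (X \<times> UNIV)" by (auto simp: lists_eq_set)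
  have "monomial_value A t (rev (map (\<lambda>(x, b). (x, \<not> b)) (l # w))) =
      star A (monomial_value A t w) \<otimes> monomial_value A t [(x, \<not> b)]"
    using monomial_value_append[OF rw, of "[(x, \<not> b)]"] Cons w x by (simp add: l)
  also have "\<dots> = star A ((if b then star A (t x) else t x) \<otimes> monomial_value A t w)"
    using x monomial_value_closed[OF w] by (simp add: monomial_value_def star_mult)
  finally show ?case by (simp add: monomial_value_def l)
qed

abbreviation (input) "F \<equiv> free_star_algebra X"

text \<open>Two polynomials can be added termwise only over a common finite set of words, since the
  support of a sum may shrink.\<close>

lemma free_eval_superset:
  assumes "f \<in> carrier F" "finite W" "{w. f w \<noteq> 0} \<subseteq> W" "W \<subseteq> lists (X \<times> UNIV)"
  shows "free_eval A t f = (\<Oplus>w\<in>W. cscale A (f w) (monomial_value A t w))"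
  unfolding free_eval_def
proof (rule add.finprod_mono_neutral_cong_left[OF assms(2,3)])
  have m: "monomial_value A t w \<in> carrier A" if "w \<in> W" for w
    using monomial_value_closed assms(4) that by blast
  then show "cscale A (f w) (monomial_value A t w) = \<zero>" if "w \<in> W - {w. f w \<noteq> 0}" for w
    using that by simp
  show "(\<lambda>w. cscale A (f w) (monomial_value A t w)) \<in> W \<rightarrow> carrier A" using m by auto
qed simp

lemma free_eval_closed: "f \<in> carrier F \<Longrightarrow> free_eval A t f \<in> carrier A"
  unfolding free_eval_def using monomial_value_closed
  by (intro finsum_closed) (auto simp: free_carrier_iff)

lemma free_eval_monomial:
  assumes "w \<in> lists (X \<times> UNIV)"
  shows "free_eval A t (monomial w) = monomial_value A t w"
proof -
  have "free_eval A t (monomial w) = (\<Oplus>v\<in>{w}. cscale A (monomial w v) (monomial_value A t v))"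
    using assms by (intro free_eval_superset) (simp_all add: monomial_carrier, simp add: monomial_def)
  then show ?thesis using monomial_value_closed[OF assms] by (simp add: monomial_def)
qed

lemma finsum_scale:
  "finite W \<Longrightarrow> f ` W \<subseteq> carrier A \<Longrightarrow> (\<Oplus>w\<in>W. cscale A c (f w)) = cscale A c (\<Oplus>w\<in>W. f w)"
  by (induction W rule: finite_induct) (auto simp: Pi_iff image_subset_iff scale_add_right)

lemma free_eval_add:
  assumes "f \<in> carrier F" "g \<in> carrier F"
  shows "free_eval A t (f \<oplus>\<^bsub>F\<^esub> g) = free_eval A t f \<oplus> free_eval A t g"
proof -
  interpret F: star_alg F by (rule free_star_algebra)
  let ?W = "{w. f w \<noteq> 0} \<union> {w. g w \<noteq> 0}"
  have W: "finite ?W" "?W \<subseteq> lists (X \<times> UNIV)" using assms by (auto simp: free_carrier_iff)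
  have m: "monomial_value A t w \<in> carrier A" if "w \<in> ?W" for w
    using monomial_value_closed W(2) that by blast
  have "{w. (f \<oplus>\<^bsub>F\<^esub> g) w \<noteq> 0} \<subseteq> ?W" by auto
  then have "free_eval A t (f \<oplus>\<^bsub>F\<^esub> g) = (\<Oplus>w\<in>?W. cscale A ((f \<oplus>\<^bsub>F\<^esub> g) w) (monomial_value A t w))"
    by (rule free_eval_superset[OF F.a_closed[OF assms] W(1) _ W(2)])
  also have "\<dots> = (\<Oplus>w\<in>?W. cscale A (f w) (monomial_value A t w) \<oplus> cscale A (g w) (monomial_value A t w))"
    by (rule finsum_cong') (use m in \<open>auto simp: scale_add_left\<close>)
  also have "\<dots> = free_eval A t f \<oplus> free_eval A t g"
    unfolding free_eval_superset[OF assms(1) W(1) Un_upper1 W(2)]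
      free_eval_superset[OF assms(2) W(1) Un_upper2 W(2)]
    by (rule finsum_addf) (use m in auto)
  finally show ?thesis .
qed

lemma free_eval_scale:
  assumes "f \<in> carrier F"
  shows "free_eval A t (cscale F c f) = cscale A c (free_eval A t f)"
proof -
  interpret F: star_alg F by (rule free_star_algebra)
  let ?W = "{w. f w \<noteq> 0}"
  have W: "finite ?W" "?W \<subseteq> lists (X \<times> UNIV)" using assms by (auto simp: free_carrier_iff)
  have m: "monomial_value A t w \<in> carrier A" if "w \<in> ?W" for w
    using monomial_value_closed W(2) that by blast
  have "{w. (cscale F c f) w \<noteq> 0} \<subseteq> ?W" by auto
  then have "free_eval A t (cscale F c f) = (\<Oplus>w\<in>?W. cscale A (cscale F c f w) (monomial_value A t w))"
    by (rule free_eval_superset[OF F.scale_closed[OF assms] W(1) _ W(2)])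
  also have "\<dots> = (\<Oplus>w\<in>?W. cscale A c (cscale A (f w) (monomial_value A t w)))"
    by (rule finsum_cong') (use m in \<open>auto simp: scale_scale\<close>)
  finally show ?thesis unfolding free_eval_def using m W by (subst (asm) finsum_scale) auto
qed

text \<open>Multiplicativity is reduced to monomials in one factor at a time: \<open>mult1\<close>
  fixes a monomial on the left and inducts on the right factor, then \<open>mult\<close> inducts on
  the left one.\<close>

lemma free_eval_hom: "star_hom F A (free_eval A t)"
proof -
  interpret F: star_alg F by (rule free_star_algebra)
  have z: "free_eval A t \<zero>\<^bsub>F\<^esub> = \<zero>" by (simp add: free_eval_def)
  note simps = z free_eval_add free_eval_scale free_eval_closed free_eval_monomial
  have mult1: "free_eval A t (monomial u \<otimes>\<^bsub>F\<^esub> g) = monomial_value A t u \<otimes> free_eval A t g"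
    if u: "u \<in> lists (X \<times> UNIV)" and g: "g \<in> carrier F" for u g
    using g
  proof (induction rule: free_induct)
    case zero
    then show ?case using u by (simp add: simps monomial_carrier F.r_null monomial_value_closed del: free_ops)
  next
    case (add x y)
    then show ?case using u
      by (simp add: simps monomial_carrier F.r_distr r_distr monomial_value_closed del: free_ops)
  next
    case (scale c x)
    then show ?case using u
      by (simp add: simps monomial_carrier F.scale_mult_right scale_mult_right monomial_value_closed del: free_ops)
  next
    case (monomial v)
    then show ?case using u monomial_value_append[OF u monomial]
      by (simp add: simps monomial_mult del: free_ops)
  qed
  have mult: "free_eval A t (f \<otimes>\<^bsub>F\<^esub> g) = free_eval A t f \<otimes> free_eval A t g"
    if f: "f \<in> carrier F" and g: "g \<in> carrier F" for f g
    using f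
  proof (induction rule: free_induct)
    case zero
    then show ?case using g by (simp add: simps F.l_null del: free_ops)
  next
    case (add x y)
    then show ?case using g by (simp add: simps F.l_distr l_distr del: free_ops)
  next
    case (scale c x)
    then show ?case using g by (simp add: simps F.scale_mult_left scale_mult_left del: free_ops)
  next
    case (monomial v)
    then show ?case using mult1 g by (simp add: simps del: free_ops)
  qed
  have star: "free_eval A t (star F f) = star A (free_eval A t f)" if f: "f \<in> carrier F" for f
    using f
  proof (induction rule: free_induct)
    case zero
    then show ?case by (simp add: simps F.star_zero del: free_ops)
  next
    case (add x y)
    then show ?case by (simp add: simps F.star_add star_add del: free_ops)
  next
    case (scale c x)
    then show ?case by (simp add: simps F.star_scale star_scale del: free_ops)
  next
    case (monomial v)
    then have "rev (map (\<lambda>(x, b). (x, \<not> b)) v) \<in> lists (X \<times> UNIV)" by (auto simp: lists_eq_set)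
    then show ?case using monomial monomial_value_star by (simp add: simps monomial_star del: free_ops)
  qed
  show ?thesis
    by unfold_locales
      (simp_all add: simps mult star free_one monomial_value_def del: free_ops)
qed

lemma free_eval_gen: "x \<in> X \<Longrightarrow> free_eval A t (free_gen x) = t x"
  using t by (auto simp: free_gen_monomial free_eval_monomial monomial_value_def)

end

end

lemma free_gen_carrier: "x \<in> X \<Longrightarrow> free_gen x \<in> carrier (free_star_algebra X)"
  by (simp add: free_gen_monomial monomial_carrier)

section \<open>The semidirect product bundle\<close>

locale submonoid_of_group = group G for G :: "('g, 'm) monoid_scheme" (structure) +
  fixes P :: "'g set"
  assumes submonoid: "submonoid P G"
begin

lemma P_sub: "P \<subseteq> carrier G" and one_P [simp, intro]: "\<one> \<in> P"
  and P_mult [simp, intro]: "\<lbrakk>x \<in> P; y \<in> P\<rbrakk> \<Longrightarrow> x \<otimes> y \<in> P"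
  using submonoid by (auto simp: submonoid_def)

lemma P_carrier [simp, intro]: "x \<in> P \<Longrightarrow> x \<in> carrier G"
  using P_sub by blast

lemma P_ne: "P \<noteq> {}"
  using one_P by blast

lemma inv_cancel [simp]:
  "\<lbrakk>g \<in> carrier G; x \<in> carrier G\<rbrakk> \<Longrightarrow> inv g \<otimes> (g \<otimes> x) = x"
  "\<lbrakk>g \<in> carrier G; x \<in> carrier G\<rbrakk> \<Longrightarrow> g \<otimes> (inv g \<otimes> x) = x"
  by (simp_all add: m_assoc[symmetric])

abbreviation "K \<equiv> constr_ideal G P"
abbreviation "ev \<equiv> word_eval G"

lemma word_setD: "\<alpha> \<in> words P \<Longrightarrow> set \<alpha> \<subseteq> carrier G" "\<alpha> \<in> words P \<Longrightarrow> even (length \<alpha>)"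
  using P_sub by (auto simp: words_def)

lemma ev_closed [simp, intro]: "\<alpha> \<in> words P \<Longrightarrow> ev \<alpha> \<in> carrier G"
  using word_eval_closed[OF is_group] word_setD by blast

lemma ev_append: "\<lbrakk>\<alpha> \<in> words P; \<beta> \<in> words P\<rbrakk> \<Longrightarrow> ev (\<alpha> @ \<beta>) = ev \<alpha> \<otimes> ev \<beta>"
  using word_eval_append[OF is_group] word_setD by blast

lemma ev_rev: "\<alpha> \<in> words P \<Longrightarrow> ev (rev \<alpha>) = inv (ev \<alpha>)"
  using word_eval_rev[OF is_group] word_setD by blast

lemma words_append [simp, intro]: "\<lbrakk>\<alpha> \<in> words P; \<beta> \<in> words P\<rbrakk> \<Longrightarrow> \<alpha> @ \<beta> \<in> words P"
  by (auto simp: words_def)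

lemma words_rev [simp, intro]: "\<alpha> \<in> words P \<Longrightarrow> rev \<alpha> \<in> words P"
  by (auto simp: words_def)

lemma words_Nil [simp]: "[] \<in> words P"
  by (simp add: words_def)

lemma words_Cons [simp]: "p # q # \<alpha> \<in> words P \<longleftrightarrow> p \<in> P \<and> q \<in> P \<and> \<alpha> \<in> words P"
  by (auto simp: words_def)

lemma words_induct [consumes 1, case_names Nil Cons]:
  assumes "\<alpha> \<in> words P" "Q []" "\<And>p q \<alpha>. \<lbrakk>p \<in> P; q \<in> P; \<alpha> \<in> words P; Q \<alpha>\<rbrakk> \<Longrightarrow> Q (p # q # \<alpha>)"
  shows "Q \<alpha>"
  using assms(1)
proof (induction "length \<alpha>" arbitrary: \<alpha> rule: less_induct)
  case less
  show ?case
  proof (cases "\<alpha> = []")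
    case True
    then show ?thesis using assms(2) by simp
  next
    case False
    with less.prems obtain p q \<alpha>' where \<alpha>: "\<alpha> = p # q # \<alpha>'"
      by (cases \<alpha>; cases "tl \<alpha>") (auto simp: words_def)
    then show ?thesis using less assms(3) by simp
  qed
qed

lemma K_sub: "K \<alpha> \<subseteq> P"
  by (rule constr_ideal_subset[OF is_group submonoid])

lemma mem_K_carrier: "x \<in> K \<alpha> \<Longrightarrow> x \<in> P"
  using K_sub by blast

lemma K_Nil [simp]: "K [] = P"
  using lcos_mult_one[OF P_sub] by (simp add: constr_ideal_def)

text \<open>The definition reads a word from its end, so two letters in front add exactly one set to
  the intersection: the one for the value of the whole word. Consequently \<open>K \<alpha>\<close>
  is the domain in \<open>P\<close> of the partial translation by \<open>\<alpha>\<close>, whose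
  letters act from the right.\<close>

lemma mem_K_Cons:
  assumes "p \<in> P" "q \<in> P" "\<alpha> \<in> words P"
  shows "x \<in> K (p # q # \<alpha>) \<longleftrightarrow> x \<in> K \<alpha> \<and> inv p \<otimes> q \<otimes> ev \<alpha> \<otimes> x \<in> P"
proof -
  let ?n = "length \<alpha> div 2"
  have len: "length \<alpha> = 2 * ?n" using word_setD(2)[OF assms(3)] by simp
  have a: "p # q # \<alpha> \<in> words P" using assms by simp
  have "{..length (p # q # \<alpha>) div 2} = insert (Suc ?n) {..?n}" by auto
  then have "K (p # q # \<alpha>) =
      (ev (take (2 * Suc ?n) (rev (p # q # \<alpha>))) <# P) \<inter> (\<Inter>i\<in>{..?n}. ev (take (2 * i) (rev (p # q # \<alpha>))) <# P)"
    unfolding constr_ideal_def by (simp only: INT_insert)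
  also have "take (2 * Suc ?n) (rev (p # q # \<alpha>)) = rev (p # q # \<alpha>)"
    using len by (intro take_all) simp
  also have "(\<Inter>i\<in>{..?n}. ev (take (2 * i) (rev (p # q # \<alpha>))) <# P) = K \<alpha>"
    unfolding constr_ideal_def using len by (intro INF_cong) auto
  also have "ev (rev (p # q # \<alpha>)) = inv (inv p \<otimes> q \<otimes> ev \<alpha>)"
    using ev_rev[OF a] by simp
  finally have K: "K (p # q # \<alpha>) = (inv (inv p \<otimes> q \<otimes> ev \<alpha>) <# P) \<inter> K \<alpha>" .
  have "x \<in> inv (inv p \<otimes> q \<otimes> ev \<alpha>) <# P \<longleftrightarrow> inv p \<otimes> q \<otimes> ev \<alpha> \<otimes> x \<in> P" if "x \<in> K \<alpha>"
    using assms mem_K_carrier[OF that] by (subst mem_l_coset_iff[OF is_group _ P_sub]) auto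
  then show ?thesis unfolding K by auto
qed

text \<open>The domain of a composite of partial translations. The case of an empty
  \<open>\<alpha>\<close> says that translation by \<open>\<beta>\<close> maps
  \<open>K \<beta>\<close> into \<open>P\<close>.\<close>

lemma mem_K_append:
  assumes "\<alpha> \<in> words P" "\<beta> \<in> words P"
  shows "x \<in> K (\<alpha> @ \<beta>) \<longleftrightarrow> x \<in> K \<beta> \<and> ev \<beta> \<otimes> x \<in> K \<alpha>"
  using assms(1)
proof (induction rule: words_induct)
  case Nil
  have "ev \<beta> \<otimes> x \<in> P" if x: "x \<in> K \<beta>"
    using assms(2) x
  proof (cases rule: words_induct[where Q = "\<lambda>\<beta>. x \<in> K \<beta> \<longrightarrow> ev \<beta> \<otimes> x \<in> P", THEN mp])
    case (3 p q \<alpha>)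
    then show ?case by (simp add: mem_K_Cons)
  qed auto
  then show ?case by auto
next
  case (Cons p q \<alpha>)
  have "inv p \<otimes> q \<otimes> ev (\<alpha> @ \<beta>) \<otimes> x = inv p \<otimes> q \<otimes> ev \<alpha> \<otimes> (ev \<beta> \<otimes> x)" if "x \<in> K \<beta>"
    using Cons.hyps assms(2) mem_K_carrier[OF that] by (simp add: ev_append m_assoc)
  then show ?case
    using Cons assms(2) by (auto simp: mem_K_Cons)
qed

text \<open>Reversing a word inverts its partial translation, so \<open>K (rev \<alpha>)\<close> is
  the range of the translation with domain \<open>K \<alpha>\<close>.\<close>

lemma ev_mem_K_rev: 
  assumes "\<alpha> \<in> words P" "x \<in> carrier G"
  shows "ev \<alpha> \<otimes> x \<in> K (rev \<alpha>) \<longleftrightarrow> x \<in> K \<alpha>"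
proof -
  have "\<alpha> \<in> words_over G P (ev \<alpha>)" using assms by (simp add: words_over_def)
  from constr_ideal_rev[OF is_group submonoid this]
  show ?thesis
    using mem_l_coset_iff[OF is_group, of "ev \<alpha>" "K \<alpha>" "ev \<alpha> \<otimes> x"] K_sub P_sub assms
    by (metis ev_closed inv_cancel(1) m_closed subset_trans)
qed

lemma words_overD: "\<alpha> \<in> words_over G P g \<Longrightarrow> \<alpha> \<in> words P" "\<alpha> \<in> words_over G P g \<Longrightarrow> ev \<alpha> = g"
  by (auto simp: words_over_def)

subsection \<open>The fibers\<close>

definition fib :: "'g \<Rightarrow> ('g \<Rightarrow> complex) set" where "fib g = diag_ideal G P g"

text \<open>The inverse appears because a fiber over \<open>g\<close> should consist of functions
  living where translation by \<open>inv g\<close> stays in \<open>P\<close>, which is where the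
  ideals of words over \<open>inv g\<close> lie.\<close>

definition span :: "'g \<Rightarrow> ('g \<Rightarrow> complex) set" where
  "span g = lin_span (ell_infty P) ((\<lambda>\<alpha>. char_fun P (K \<alpha>)) ` words_over G P (inv g))"

lemma span_zero: "(\<lambda>x\<in>P. 0) \<in> span g"
  and span_add: "\<lbrakk>a \<in> span g; b \<in> span g\<rbrakk> \<Longrightarrow> (\<lambda>x\<in>P. a x + b x) \<in> span g"
  and span_scale: "a \<in> span g \<Longrightarrow> (\<lambda>x\<in>P. c * a x) \<in> span g"
  and span_base: "\<alpha> \<in> words_over G P (inv g) \<Longrightarrow> char_fun P (K \<alpha>) \<in> span g"
proof -
  let ?S = "((\<lambda>\<alpha>. char_fun P (K \<alpha>)) ` words_over G P (inv g))"
  show "(\<lambda>x\<in>P. 0) \<in> span g"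
    using lin_span.lin_span_zero[of "ell_infty P" ?S] by (simp add: span_def ell_infty_def)
  show "\<lbrakk>a \<in> span g; b \<in> span g\<rbrakk> \<Longrightarrow> (\<lambda>x\<in>P. a x + b x) \<in> span g"
    using lin_span.lin_span_add[of a "ell_infty P" ?S b] by (simp add: span_def ell_infty_def)
  show "a \<in> span g \<Longrightarrow> (\<lambda>x\<in>P. c * a x) \<in> span g"
    using lin_span.lin_span_scale[of a "ell_infty P" ?S c] by (simp add: span_def ell_infty_def)
  show "\<alpha> \<in> words_over G P (inv g) \<Longrightarrow> char_fun P (K \<alpha>) \<in> span g"
    unfolding span_def by (intro lin_span.lin_span_base) blast
qed

lemma span_induct [consumes 1, case_names zero base add scale]:
  assumes "a \<in> span g" "Q (\<lambda>x\<in>P. 0)"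
    and "\<And>\<alpha>. \<alpha> \<in> words_over G P (inv g) \<Longrightarrow> Q (char_fun P (K \<alpha>))"
    and "\<And>a b. \<lbrakk>a \<in> span g; b \<in> span g; Q a; Q b\<rbrakk> \<Longrightarrow> Q (\<lambda>x\<in>P. a x + b x)"
    and "\<And>a c. \<lbrakk>a \<in> span g; Q a\<rbrakk> \<Longrightarrow> Q (\<lambda>x\<in>P. c * a x)"
  shows "Q a"
  using assms(1) unfolding span_def
proof induction
  case lin_span_zero
  have "\<zero>\<^bsub>ell_infty P\<^esub> = (\<lambda>x\<in>P. 0)" by (simp add: ell_infty_def)
  then show ?case using assms(2) by metis
next
  case (lin_span_base x)
  then show ?case using assms(3) by blast
next
  case (lin_span_add a b)
  have "a \<oplus>\<^bsub>ell_infty P\<^esub> b = (\<lambda>x\<in>P. a x + b x)" by (simp add: ell_infty_def)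
  then show ?case using assms(4)[of a b] lin_span_add unfolding span_def by metis
next
  case (lin_span_scale a c)
  have "cscale (ell_infty P) c a = (\<lambda>x\<in>P. c * a x)" by (simp add: ell_infty_def)
  then show ?case using assms(5)[of a c] lin_span_scale unfolding span_def by metis
qed

lemma ell_infty_carrier:
  "f \<in> carrier (ell_infty P) \<longleftrightarrow> f \<in> extensional P \<and> (\<exists>M. \<forall>x\<in>P. cmod (f x) \<le> M)"
  by (auto simp: ell_infty_def bdd_above_def PiE_def)

lemma span_carrier: "a \<in> span g \<Longrightarrow> a \<in> carrier (ell_infty P)"
  unfolding span_def
  by (rule lin_span_carrier[of "(\<lambda>\<alpha>. char_fun P (K \<alpha>)) ` words_over G P (inv g)"])
    (use char_fun_carrier in blast)

text \<open>Norm closure in bounded functions is uniform approximation on \<open>P\<close>; in this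
  form later arguments are pointwise estimates free of the record operations.\<close>

lemma fib_iff:
  "f \<in> fib g \<longleftrightarrow> f \<in> extensional P \<and> (\<forall>\<epsilon>>0. \<exists>h\<in>span g. \<forall>x\<in>P. cmod (f x - h x) \<le> \<epsilon>)"
proof
  assume f: "f \<in> fib g"
  have fc: "f \<in> carrier (ell_infty P)" using f diag_ideal_carrier[of G P g] unfolding fib_def by blast
  have "\<exists>h\<in>span g. \<forall>x\<in>P. cmod (f x - h x) \<le> \<epsilon>" if e: "\<epsilon> > 0" for \<epsilon>
  proof -
    obtain h where h: "h \<in> span g" "cnorm (ell_infty P) (f \<ominus>\<^bsub>ell_infty P\<^esub> h) < \<epsilon>"
      using f e unfolding fib_def diag_ideal_def norm_closure_def span_def by blast
    have hc: "h \<in> carrier (ell_infty P)" by (rule span_carrier[OF h(1)])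
    obtain a b where "\<forall>x\<in>P. cmod (f x) \<le> a" "\<forall>x\<in>P. cmod (h x) \<le> b"
      using fc hc by (auto simp: ell_infty_carrier)
    then have "\<forall>x\<in>P. cmod (f x - h x) \<le> a + b" by (meson add_mono norm_triangle_ineq4 order_trans)
    then have "(\<lambda>x\<in>P. f x - h x) \<in> carrier (ell_infty P)" by (auto simp: ell_infty_carrier)
    from ell_infty_norm_ge[OF this] show ?thesis
      using h ell_infty_minus[OF fc hc] by (intro bexI[OF _ h(1)]) fastforce
  qed
  then show "f \<in> extensional P \<and> (\<forall>\<epsilon>>0. \<exists>h\<in>span g. \<forall>x\<in>P. cmod (f x - h x) \<le> \<epsilon>)"
    using fc by (simp add: ell_infty_carrier)
next
  assume f: "f \<in> extensional P \<and> (\<forall>\<epsilon>>0. \<exists>h\<in>span g. \<forall>x\<in>P. cmod (f x - h x) \<le> \<epsilon>)"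
  \<comment> \<open>A single approximant within 1 already bounds \<open>f\<close>, so membership in
    bounded functions comes from extensionality and approximation.\<close>
  then obtain h where h: "h \<in> span g" "\<forall>x\<in>P. cmod (f x - h x) \<le> 1" using zero_less_one by blast
  obtain M where M: "\<forall>x\<in>P. cmod (h x) \<le> M" using span_carrier[OF h(1)] by (auto simp: ell_infty_carrier)
  have "cmod (f x) \<le> M + 1" if "x \<in> P" for x
    using norm_triangle_ineq[of "h x" "f x - h x"] h(2) M that by fastforce
  then have fc: "f \<in> carrier (ell_infty P)" using f by (auto simp: ell_infty_carrier)
  have "\<exists>y\<in>span g. cnorm (ell_infty P) (f \<ominus>\<^bsub>ell_infty P\<^esub> y) < \<epsilon>" if e: "\<epsilon> > 0" for \<epsilon>
  proof -
    obtain k where k: "k \<in> span g" "\<forall>x\<in>P. cmod (f x - k x) \<le> \<epsilon> / 2"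
      using f e half_gt_zero by blast
    have "cnorm (ell_infty P) (f \<ominus>\<^bsub>ell_infty P\<^esub> k) \<le> \<epsilon> / 2"
      using k by (intro ell_infty_norm_le[OF P_ne]) (simp add: ell_infty_minus[OF fc span_carrier[OF k(1)]])
    then show ?thesis using k(1) e by (intro bexI[of _ k]) auto
  qed
  then show "f \<in> fib g" using fc unfolding fib_def diag_ideal_def norm_closure_def span_def by blast
qed

lemma span_fib: "a \<in> span g \<Longrightarrow> a \<in> fib g"
  using span_carrier[of a g] by (auto simp: fib_iff ell_infty_carrier intro!: bexI[of _ a])

lemma fib_ext: "a \<in> fib g \<Longrightarrow> a \<in> extensional P"
  by (simp add: fib_iff)

lemma fib_bounded: "a \<in> fib g \<Longrightarrow> \<exists>M\<ge>0. \<forall>x\<in>P. cmod (a x) \<le> M"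
  using diag_ideal_carrier[of G P g] one_P norm_ge_zero order_trans
  unfolding fib_def by (metis ell_infty_carrier subsetD)

lemma fib_limit:
  assumes "f \<in> extensional P" "\<And>\<epsilon>. \<epsilon> > 0 \<Longrightarrow> \<exists>h\<in>fib g. \<forall>x\<in>P. cmod (f x - h x) \<le> \<epsilon>"
  shows "f \<in> fib g"
  unfolding fib_iff
proof (intro conjI allI impI assms(1))
  fix \<epsilon> :: real assume e: "\<epsilon> > 0"
  obtain h where h: "h \<in> fib g" "\<forall>x\<in>P. cmod (f x - h x) \<le> \<epsilon> / 2" using assms(2)[of "\<epsilon> / 2"] e by auto
  obtain k where k: "k \<in> span g" "\<forall>x\<in>P. cmod (h x - k x) \<le> \<epsilon> / 2"
    using h(1) e half_gt_zero unfolding fib_iff by blast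
  have "cmod (f x - k x) \<le> \<epsilon>" if "x \<in> P" for x
    using norm_triangle_ineq[of "f x - h x" "h x - k x"] h(2) k(2) that by fastforce
  then show "\<exists>h\<in>span g. \<forall>x\<in>P. cmod (f x - h x) \<le> \<epsilon>" using k(1) by blast
qed

lemma fib_zero: "(\<lambda>x\<in>P. 0) \<in> fib g"
  by (rule span_fib[OF span_zero])

lemma fib_char: "\<alpha> \<in> words_over G P (inv g) \<Longrightarrow> char_fun P (K \<alpha>) \<in> fib g"
  by (rule span_fib[OF span_base])

lemma fib_add:
  assumes "a \<in> fib g" "b \<in> fib g"
  shows "(\<lambda>x\<in>P. a x + b x) \<in> fib g"
  unfolding fib_iff
proof (intro conjI allI impI)
  fix \<epsilon> :: real assume e: "\<epsilon> > 0"
  obtain h where h: "h \<in> span g" "\<forall>x\<in>P. cmod (a x - h x) \<le> \<epsilon> / 2" using assms(1) e half_gt_zero unfolding fib_iff by blast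
  obtain k where k: "k \<in> span g" "\<forall>x\<in>P. cmod (b x - k x) \<le> \<epsilon> / 2" using assms(2) e half_gt_zero unfolding fib_iff by blast
  have "cmod (a x + b x - (h x + k x)) \<le> \<epsilon>" if "x \<in> P" for x
    using norm_triangle_ineq[of "a x - h x" "b x - k x"] h(2) k(2) that by (fastforce simp: algebra_simps)
  then show "\<exists>h\<in>span g. \<forall>x\<in>P. cmod ((\<lambda>x\<in>P. a x + b x) x - h x) \<le> \<epsilon>"
    by (intro bexI[OF _ span_add[OF h(1) k(1)]]) simp
qed simp

lemma fib_scale:
  assumes "a \<in> fib g"
  shows "(\<lambda>x\<in>P. c * a x) \<in> fib g"
  unfolding fib_iff
proof (intro conjI allI impI)
  fix \<epsilon> :: real assume e: "\<epsilon> > 0"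
  define d where "d = \<epsilon> / (cmod c + 1)"
  have c: "cmod c + 1 > 0" by (simp add: add_nonneg_pos)
  have d: "d > 0" "cmod c * d \<le> \<epsilon>" using e c by (auto simp: d_def field_simps)
  obtain h where h: "h \<in> span g" "\<forall>x\<in>P. cmod (a x - h x) \<le> d" using assms(1) d(1) unfolding fib_iff by blast
  have "cmod (c * a x - c * h x) \<le> \<epsilon>" if "x \<in> P" for x
  proof -
    have "cmod (c * a x - c * h x) = cmod c * cmod (a x - h x)" by (simp add: norm_mult[symmetric] algebra_simps)
    also have "\<dots> \<le> cmod c * d" using h that by (intro mult_left_mono) auto
    finally show ?thesis using d by simp
  qed
  then show "\<exists>h\<in>span g. \<forall>x\<in>P. cmod ((\<lambda>x\<in>P. c * a x) x - h x) \<le> \<epsilon>"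
    by (intro bexI[OF _ span_scale[OF h(1), of c]]) simp
qed simp

text \<open>The displayed function is the bundle product of \<open>a\<close> over \<open>s\<close>
  and \<open>b\<close> over \<open>t\<close>. On ideals it is the ideal of
  \<open>\<beta> @ \<alpha>\<close>, in this order because the words lie over inverses and
  \<open>mem_K_append\<close> evaluates the right-hand word before the left-hand one.\<close>

lemma span_conv:
  assumes "s \<in> carrier G" "t \<in> carrier G" "a \<in> span s" "b \<in> span t"
  shows "(\<lambda>x\<in>P. if inv s \<otimes> x \<in> P then a x * b (inv s \<otimes> x) else 0) \<in> span (s \<otimes> t)"
  using assms(3)
proof (induction rule: span_induct)
  case zero
  show ?case by (rule back_subst[of "\<lambda>a. a \<in> span _", OF span_zero]) (auto simp: fun_eq_iff)
next
  case (base \<alpha>)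
  show ?case using assms(4)
  proof (induction rule: span_induct)
    case zero
    show ?case by (rule back_subst[of "\<lambda>a. a \<in> span _", OF span_zero]) (auto simp: fun_eq_iff)
  next
    case (base \<beta>)
    note a = words_overD[OF \<open>\<alpha> \<in> _\<close>] and b = words_overD[OF base]
    have "\<beta> @ \<alpha> \<in> words_over G P (inv (s \<otimes> t))"
      using a b assms(1,2) by (simp add: words_over_def ev_append inv_mult_group)
    moreover have "(\<lambda>x\<in>P. if inv s \<otimes> x \<in> P then char_fun P (K \<alpha>) x * char_fun P (K \<beta>) (inv s \<otimes> x) else 0) =
        char_fun P (K (\<beta> @ \<alpha>))"
      using a b mem_K_carrier[of _ \<beta>] by (auto simp: char_fun_def mem_K_append fun_eq_iff)
    ultimately show ?case using span_base by metis
  next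
    case (add b c)
    from span_add[OF add(3,4)] show ?case
      by (rule back_subst[of "\<lambda>a. a \<in> span _"]) (auto simp: fun_eq_iff algebra_simps)
  next
    case (scale b c)
    from span_scale[OF scale(2), of c] show ?case
      by (rule back_subst[of "\<lambda>a. a \<in> span _"]) (auto simp: fun_eq_iff)
  qed
next
  case (add a c)
  from span_add[OF add(3,4)] show ?case
    by (rule back_subst[of "\<lambda>a. a \<in> span _"]) (auto simp: fun_eq_iff algebra_simps)
next
  case (scale a c)
  from span_scale[OF scale(2), of c] show ?case
    by (rule back_subst[of "\<lambda>a. a \<in> span _"]) (auto simp: fun_eq_iff)
qed

lemma fib_conv:
  assumes "s \<in> carrier G" "t \<in> carrier G" "a \<in> fib s" "b \<in> fib t"
  shows "(\<lambda>x\<in>P. if inv s \<otimes> x \<in> P then a x * b (inv s \<otimes> x) else 0) \<in> fib (s \<otimes> t)"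
proof (rule fib_limit)
  fix \<epsilon> :: real assume e: "\<epsilon> > 0"
  obtain Ma where Ma: "Ma \<ge> 0" "\<forall>x\<in>P. cmod (a x) \<le> Ma" using fib_bounded[OF assms(3)] by blast
  obtain Mb where Mb: "Mb \<ge> 0" "\<forall>x\<in>P. cmod (b x) \<le> Mb" using fib_bounded[OF assms(4)] by blast
  \<comment> \<open>The bound \<open>d \<le> 1\<close> gives
    \<open>\<bar>h x\<bar> \<le> Ma + 1\<close>, so the error of the product is at most
    \<open>d * Mb + (Ma + 1) * d\<close>, which the second bound turns into
    \<open>\<epsilon>\<close>.\<close>
  define d where "d = min 1 (\<epsilon> / (Ma + Mb + 1))"
  have d: "d > 0" "d \<le> 1" using e Ma Mb by (auto simp: d_def)
  have "d \<le> \<epsilon> / (Ma + Mb + 1)" by (simp add: d_def)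
  then have d3: "d * (Ma + Mb + 1) \<le> \<epsilon>" using Ma Mb by (simp add: pos_le_divide_eq)
  obtain h where h: "h \<in> span s" "\<forall>x\<in>P. cmod (a x - h x) \<le> d" using assms(3) d(1) unfolding fib_iff by blast
  obtain k where k: "k \<in> span t" "\<forall>x\<in>P. cmod (b x - k x) \<le> d" using assms(4) d(1) unfolding fib_iff by blast
  have "cmod (a x * b y - h x * k y) \<le> \<epsilon>" if "x \<in> P" "y \<in> P" for x y
  proof -
    have hx: "cmod (h x) \<le> Ma + 1"
      using norm_triangle_ineq4[of "a x" "a x - h x"] Ma h(2) d that by fastforce
    have "a x * b y - h x * k y = (a x - h x) * b y + h x * (b y - k y)" by (simp add: algebra_simps)
    also have "cmod \<dots> \<le> cmod (a x - h x) * cmod (b y) + cmod (h x) * cmod (b y - k y)"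
      by (metis norm_mult norm_triangle_ineq)
    also have "\<dots> \<le> d * Mb + (Ma + 1) * d"
      using h(2) k(2) Mb hx that d(1) Ma(1) by (intro add_mono mult_mono) auto
    also have "\<dots> \<le> \<epsilon>" using d3 by (simp add: algebra_simps)
    finally show ?thesis .
  qed
  then show "\<exists>h\<in>fib (s \<otimes> t). \<forall>x\<in>P. cmod ((\<lambda>x\<in>P. if inv s \<otimes> x \<in> P then a x * b (inv s \<otimes> x) else 0) x - h x) \<le> \<epsilon>"
    using e by (intro bexI[OF _ span_fib[OF span_conv[OF assms(1,2) h(1) k(1)]]]) auto
qed simp

text \<open>The displayed function is the bundle involution of \<open>a\<close>. On ideals it
  amounts to reversing the word, by \<open>ev_mem_K_rev\<close>.\<close>

lemma span_star:
  assumes "s \<in> carrier G" "a \<in> span s"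
  shows "(\<lambda>x\<in>P. if s \<otimes> x \<in> P then cnj (a (s \<otimes> x)) else 0) \<in> span (inv s)"
  using assms(2)
proof (induction rule: span_induct)
  case zero
  show ?case by (rule back_subst[of "\<lambda>a. a \<in> span _", OF span_zero]) (auto simp: fun_eq_iff)
next
  case (base \<alpha>)
  note a = words_overD[OF base]
  have r: "rev \<alpha> \<in> words_over G P (inv (inv s))"
    using a assms(1) by (simp add: words_over_def ev_rev)
  have "s \<otimes> x \<in> K \<alpha> \<longleftrightarrow> x \<in> K (rev \<alpha>)" if "x \<in> carrier G" for x
    using ev_mem_K_rev[of "rev \<alpha>" x] a that assms(1) by (simp add: ev_rev)
  then have "(\<lambda>x\<in>P. if s \<otimes> x \<in> P then cnj (char_fun P (K \<alpha>) (s \<otimes> x)) else 0) = char_fun P (K (rev \<alpha>))"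
    using mem_K_carrier[of _ \<alpha>] by (auto simp: char_fun_def fun_eq_iff)
  then show ?case using span_base[OF r] by simp
next
  case (add a c)
  from span_add[OF add(3,4)] show ?case
    by (rule back_subst[of "\<lambda>a. a \<in> span _"]) (auto simp: fun_eq_iff)
next
  case (scale a c)
  from span_scale[OF scale(2), of "cnj c"] show ?case
    by (rule back_subst[of "\<lambda>a. a \<in> span _"]) (auto simp: fun_eq_iff)
qed

lemma fib_star:
  assumes "s \<in> carrier G" "a \<in> fib s"
  shows "(\<lambda>x\<in>P. if s \<otimes> x \<in> P then cnj (a (s \<otimes> x)) else 0) \<in> fib (inv s)"
proof (rule fib_limit)
  fix \<epsilon> :: real assume e: "\<epsilon> > 0"
  obtain h where h: "h \<in> span s" "\<forall>x\<in>P. cmod (a x - h x) \<le> \<epsilon>" using assms(2) e unfolding fib_iff by blast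
  then show "\<exists>h\<in>fib (inv s). \<forall>x\<in>P. cmod ((\<lambda>x\<in>P. if s \<otimes> x \<in> P then cnj (a (s \<otimes> x)) else 0) x - h x) \<le> \<epsilon>"
    using e by (intro bexI[OF _ span_fib[OF span_star[OF assms(1) h(1)]]])
      (auto simp flip: complex_cnj_diff)
qed simp

lemma fib_support:
  "\<lbrakk>g \<in> carrier G; a \<in> fib g; x \<in> P; inv g \<otimes> x \<notin> P\<rbrakk> \<Longrightarrow> a x = 0"
  unfolding fib_def by (rule diag_ideal_support[OF is_group submonoid])

lemma fib_one: "(\<lambda>x\<in>P. 1) \<in> fib \<one>"
  using fib_char[of "[]" \<one>] by (simp add: words_over_def char_fun_def cong: restrict_cong)

lemma fib_mult: "\<lbrakk>a \<in> fib \<one>; b \<in> fib \<one>\<rbrakk> \<Longrightarrow> (\<lambda>x\<in>P. a x * b x) \<in> fib \<one>"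
  using fib_conv[of \<one> \<one> a b] by (simp cong: restrict_cong)

lemma fib_cnj: "a \<in> fib \<one> \<Longrightarrow> (\<lambda>x\<in>P. cnj (a x)) \<in> fib \<one>"
  using fib_star[of \<one> a] by (simp cong: restrict_cong)

subsection \<open>Finitely supported sections\<close>

abbreviation "bundle \<equiv> canonical_bundle G P"
abbreviation "Sec \<equiv> sections_fin G (canonical_bundle G P)"
abbreviation "supp \<equiv> section_support G (canonical_bundle G P)"
abbreviation "sections \<equiv> \<Pi>\<^sub>E g\<in>carrier G. fib g"
abbreviation "delta \<equiv> delta_section G (canonical_bundle G P)"
abbreviation "sconv \<equiv> section_conv G (canonical_bundle G P)"

lemma bundle_simps:
  "fiber bundle = fib"
  "fadd bundle g a b = (\<lambda>x\<in>P. a x + b x)"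
  "fzero bundle g = (\<lambda>x\<in>P. 0)"
  "fscale bundle g c a = (\<lambda>x\<in>P. c * a x)"
  "fnorm bundle g = cnorm (ell_infty P)"
  "fone bundle = (\<lambda>x\<in>P. 1)"
  by (auto simp: canonical_bundle_def semidirect_bundle_def reduced_diagonal_def ell_infty_def fib_def)

text \<open>The outer translation keeps only the points \<open>x\<close> with
  \<open>inv s \<otimes> x \<in> P\<close>, and there the inner and outer translations of
  \<open>a\<close> cancel. The formula makes sense for arbitrary \<open>a\<close> and
  \<open>b\<close>, in the fibers or not.\<close>

lemma bundle_mult:
  "s \<in> carrier G \<Longrightarrow> fmult bundle s t a b = (\<lambda>x\<in>P. if inv s \<otimes> x \<in> P then a x * b (inv s \<otimes> x) else 0)"
  by (auto simp: canonical_bundle_def semidirect_bundle_def reduced_diagonal_def ell_infty_def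
      canonical_action_def fun_eq_iff)

lemma bundle_star:
  "s \<in> carrier G \<Longrightarrow> fstar bundle s a = (\<lambda>x\<in>P. if s \<otimes> x \<in> P then cnj (a (s \<otimes> x)) else 0)"
  by (auto simp: canonical_bundle_def semidirect_bundle_def reduced_diagonal_def ell_infty_def
      canonical_action_def fun_eq_iff)

lemma supp_def': "supp f = {g \<in> carrier G. f g \<noteq> (\<lambda>x\<in>P. 0)}"
  by (simp add: section_support_def bundle_simps)

lemma supp_carrier: "supp f \<subseteq> carrier G"
  by (auto simp: supp_def')

lemma not_supp: "\<lbrakk>g \<in> carrier G; g \<notin> supp f; x \<in> P\<rbrakk> \<Longrightarrow> f g x = 0"
  by (auto simp: supp_def')

lemma Sec_iff: "f \<in> carrier Sec \<longleftrightarrow> f \<in> sections \<and> finite (supp f)"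
  by (simp add: sections_fin_def bundle_simps)

lemma Sec_fib: "\<lbrakk>f \<in> carrier Sec; g \<in> carrier G\<rbrakk> \<Longrightarrow> f g \<in> fib g"
  by (auto simp: Sec_iff)

lemma Sec_supp: "f \<in> carrier Sec \<Longrightarrow> finite (supp f)"
  by (simp add: Sec_iff)

lemma Sec_add: "f \<oplus>\<^bsub>Sec\<^esub> h = (\<lambda>g\<in>carrier G. \<lambda>x\<in>P. f g x + h g x)"
  and Sec_scale: "cscale Sec c f = (\<lambda>g\<in>carrier G. \<lambda>x\<in>P. c * f g x)"
  and Sec_zero: "\<zero>\<^bsub>Sec\<^esub> = (\<lambda>g\<in>carrier G. \<lambda>x\<in>P. 0)"
  and Sec_one: "\<one>\<^bsub>Sec\<^esub> = delta (\<lambda>x\<in>P. 1) \<one>"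
  and Sec_mult: "f \<otimes>\<^bsub>Sec\<^esub> h = sconv f h"
  by (simp_all add: sections_fin_def bundle_simps)

lemma Sec_star:
  "star Sec f = (\<lambda>g\<in>carrier G. \<lambda>x\<in>P. if inv g \<otimes> x \<in> P then cnj (f (inv g) (inv g \<otimes> x)) else 0)"
  by (simp add: sections_fin_def bundle_star cong: restrict_cong)

lemma delta_def': "delta a g = (\<lambda>h\<in>carrier G. if h = g then a else (\<lambda>x\<in>P. 0))"
  by (simp add: delta_section_def bundle_simps cong: if_cong)

text \<open>Stated for an abstract \<open>M\<close> so that it covers both
  \<open>fiber_monoid\<close>, where convolution takes place, and the additive monoid of the unit
  fiber.\<close>

lemma finprod_pointwise:
  fixes M :: "('g \<Rightarrow> complex, 'k) monoid_scheme"
  assumes M: "carrier M = fib g" "\<And>a b. a \<otimes>\<^bsub>M\<^esub> b = (\<lambda>x\<in>P. a x + b x)" "\<one>\<^bsub>M\<^esub> = (\<lambda>x\<in>P. 0)"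
    and "finite R" "\<And>s. s \<in> R \<Longrightarrow> a s \<in> fib g"
  shows "finprod M a R = (\<lambda>x\<in>P. \<Sum>s\<in>R. a s x)" "(\<lambda>x\<in>P. \<Sum>s\<in>R. a s x) \<in> fib g"
proof -
  interpret M: comm_monoid M
  proof (rule comm_monoidI)
    show "\<one>\<^bsub>M\<^esub> \<otimes>\<^bsub>M\<^esub> a = a" if "a \<in> carrier M" for a
      using fib_ext[of a g] that by (auto simp: M fun_eq_iff extensional_def)
  qed (auto simp: M fib_add fib_zero add.assoc add.commute cong: restrict_cong)
  have *: "finprod M a R = (\<lambda>x\<in>P. \<Sum>s\<in>R. a s x)"
    using assms(4,5)
  proof (induction R rule: finite_induct)
    case empty
    then show ?case by (simp add: M)
  next
    case (insert s R)
    then have "finprod M a (insert s R) = a s \<otimes>\<^bsub>M\<^esub> finprod M a R"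
      by (intro M.finprod_insert) (auto simp: M)
    then show ?case using insert by (auto simp: M fun_eq_iff)
  qed
  have "finprod M a R \<in> carrier M" by (rule M.finprod_closed) (use assms(5) M(1) in auto)
  then show "finprod M a R = (\<lambda>x\<in>P. \<Sum>s\<in>R. a s x)" "(\<lambda>x\<in>P. \<Sum>s\<in>R. a s x) \<in> fib g"
    using * M(1) by auto
qed

lemma section_conv_eq:
  assumes f: "f \<in> carrier Sec" and \<xi>: "\<xi> \<in> sections"
  shows "sconv f \<xi> = (\<lambda>g\<in>carrier G. \<lambda>x\<in>P.
      \<Sum>s\<in>supp f. if inv s \<otimes> x \<in> P then f s x * \<xi> (inv s \<otimes> g) (inv s \<otimes> x) else 0)" (is "_ = ?R")
    and "sconv f \<xi> \<in> sections"
proof -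
  have *: "sconv f \<xi> g = ?R g \<and> ?R g \<in> fib g" if g: "g \<in> carrier G" for g
  proof -
    let ?a = "\<lambda>s. fmult bundle s (inv s \<otimes> g) (f s) (\<xi> (inv s \<otimes> g))"
    have a: "?a s \<in> fib g" if "s \<in> supp f" for s
    proof -
      have s: "s \<in> carrier G" using that supp_carrier by blast
      have "s \<otimes> (inv s \<otimes> g) = g" using s g by simp
      then show ?thesis
        using fib_conv[OF s _ Sec_fib[OF f s], of "inv s \<otimes> g" "\<xi> (inv s \<otimes> g)"] \<xi> s g
        by (auto simp: bundle_mult)
    qed
    have "sconv f \<xi> g = finprod (fiber_monoid bundle g) ?a (supp f)"
      unfolding section_conv_def using g by simp
    also have "\<dots> = (\<lambda>x\<in>P. \<Sum>s\<in>supp f. ?a s x)"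
      by (rule finprod_pointwise(1)[OF _ _ _ Sec_supp[OF f] a]) (simp_all add: fiber_monoid_def bundle_simps)
    also have "\<dots> = ?R g"
      using g supp_carrier by (auto simp: fun_eq_iff bundle_mult subset_iff intro!: sum.cong)
    finally have "sconv f \<xi> g = ?R g" .
    moreover have "(\<lambda>x\<in>P. \<Sum>s\<in>supp f. ?a s x) \<in> fib g"
      by (rule finprod_pointwise(2)[OF _ _ _ Sec_supp[OF f] a, of "fiber_monoid bundle g"])
        (simp_all add: fiber_monoid_def bundle_simps)
    ultimately show ?thesis using \<open>(\<lambda>x\<in>P. \<Sum>s\<in>supp f. ?a s x) = ?R g\<close> by simp
  qed
  then show "sconv f \<xi> = ?R" by (auto simp: fun_eq_iff section_conv_def)
  show "sconv f \<xi> \<in> sections"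
    using * by (auto simp: section_conv_def)
qed

end

section \<open>Sections as matrices over \<open>P\<close>, and the *-algebra they form\<close>

context submonoid_of_group
begin

text \<open>A section \<open>f\<close> is the matrix over \<open>P\<close> with entries \<open>f(zy\<^sup>-\<^sup>1)(z)\<close>; \<open>col\<close> gives its columns and
  \<open>act\<close> its action on functions on \<open>P\<close>.\<close>

definition act :: "('g \<Rightarrow> 'g \<Rightarrow> complex) \<Rightarrow> ('g \<Rightarrow> complex) \<Rightarrow> 'g \<Rightarrow> complex" where
  "act f u x = (\<Sum>s\<in>supp f. if inv s \<otimes> x \<in> P then f s x * u (inv s \<otimes> x) else 0)"

definition col :: "('g \<Rightarrow> 'g \<Rightarrow> complex) \<Rightarrow> 'g \<Rightarrow> 'g \<Rightarrow> complex" where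
  "col \<xi> y z = \<xi> (z \<otimes> inv y) z"

lemma act_superset:
  assumes "finite R" "supp f \<subseteq> R" "R \<subseteq> carrier G" "x \<in> P"
  shows "act f u x = (\<Sum>s\<in>R. if inv s \<otimes> x \<in> P then f s x * u (inv s \<otimes> x) else 0)"
  unfolding act_def using assms not_supp[of _ f x]
  by (intro sum.mono_neutral_left) (auto simp: subset_iff)

lemma act_cong: "(\<And>x. x \<in> P \<Longrightarrow> u x = v x) \<Longrightarrow> act f u x = act f v x"
  unfolding act_def by (rule sum.cong) auto

text \<open>Convolution is matrix multiplication, which treats the columns of the right factor
  separately. Here \<open>\<xi>\<close> may have infinite support, as the Hilbert module
  requires.\<close>

lemma col_conv:
  assumes "f \<in> carrier Sec" "\<xi> \<in> sections" "x \<in> P" "y \<in> P"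
  shows "col (sconv f \<xi>) y x = act f (col \<xi> y) x"
  unfolding section_conv_eq(1)[OF assms(1,2)] col_def act_def
  using assms(3,4) supp_carrier by (auto simp: m_assoc subset_iff intro!: sum.cong)

lemma Sec_pi: "f \<in> carrier Sec \<Longrightarrow> f \<in> sections"
  by (simp add: Sec_iff)

lemma col_mult:
  "\<lbrakk>f \<in> carrier Sec; h \<in> carrier Sec; x \<in> P; y \<in> P\<rbrakk> \<Longrightarrow> col (f \<otimes>\<^bsub>Sec\<^esub> h) y x = act f (col h y) x"
  using col_conv[OF _ Sec_pi] by (simp add: Sec_mult)

lemma Sec_mult_closed:
  assumes "f \<in> carrier Sec" "h \<in> carrier Sec"
  shows "f \<otimes>\<^bsub>Sec\<^esub> h \<in> carrier Sec"
    and "supp (f \<otimes>\<^bsub>Sec\<^esub> h) \<subseteq> (\<lambda>(s, t). s \<otimes> t) ` (supp f \<times> supp h)"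
proof -
  show sub: "supp (f \<otimes>\<^bsub>Sec\<^esub> h) \<subseteq> (\<lambda>(s, t). s \<otimes> t) ` (supp f \<times> supp h)"
  proof
    fix g assume g: "g \<in> supp (f \<otimes>\<^bsub>Sec\<^esub> h)"
    then have gG: "g \<in> carrier G" using supp_carrier by blast
    show "g \<in> (\<lambda>(s, t). s \<otimes> t) ` (supp f \<times> supp h)"
    proof (rule ccontr)
      assume n: "g \<notin> (\<lambda>(s, t). s \<otimes> t) ` (supp f \<times> supp h)"
      have "inv s \<otimes> g \<notin> supp h" if "s \<in> supp f" for s
      proof
        assume "inv s \<otimes> g \<in> supp h"
        moreover have "g = s \<otimes> (inv s \<otimes> g)" using that supp_carrier gG by (auto simp: subset_iff)
        ultimately show False using n that by (auto simp: image_iff)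
      qed
      then have "(f \<otimes>\<^bsub>Sec\<^esub> h) g = (\<lambda>x\<in>P. 0)"
        unfolding Sec_mult section_conv_eq(1)[OF assms(1) Sec_pi[OF assms(2)]]
        using gG not_supp[of _ h] supp_carrier[of f]
        by (auto simp: fun_eq_iff subset_iff intro!: sum.neutral)
      then show False using g by (simp add: supp_def')
    qed
  qed
  have "finite (supp (f \<otimes>\<^bsub>Sec\<^esub> h))"
    using sub assms Sec_supp by (meson finite_SigmaI finite_imageI finite_subset)
  then show "f \<otimes>\<^bsub>Sec\<^esub> h \<in> carrier Sec"
    using section_conv_eq(2)[OF assms(1) Sec_pi[OF assms(2)]] by (simp add: Sec_iff Sec_mult)
qed

lemma Sec_add_closed:
  assumes "f \<in> carrier Sec" "h \<in> carrier Sec"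
  shows "f \<oplus>\<^bsub>Sec\<^esub> h \<in> carrier Sec" "supp (f \<oplus>\<^bsub>Sec\<^esub> h) \<subseteq> supp f \<union> supp h"
proof -
  show "supp (f \<oplus>\<^bsub>Sec\<^esub> h) \<subseteq> supp f \<union> supp h"
    by (auto simp: supp_def' Sec_add)
  then show "f \<oplus>\<^bsub>Sec\<^esub> h \<in> carrier Sec"
    using assms finite_subset by (auto simp: Sec_iff Sec_add PiE_iff intro!: fib_add)
qed

lemma Sec_scale_closed:
  assumes "f \<in> carrier Sec"
  shows "cscale Sec c f \<in> carrier Sec" "supp (cscale Sec c f) \<subseteq> supp f"
proof -
  show "supp (cscale Sec c f) \<subseteq> supp f"
    by (auto simp: supp_def' Sec_scale)
  then show "cscale Sec c f \<in> carrier Sec"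
    using assms finite_subset by (auto simp: Sec_iff Sec_scale PiE_iff intro!: fib_scale)
qed

lemma Sec_star_closed:
  assumes "f \<in> carrier Sec"
  shows "star Sec f \<in> carrier Sec" "supp (star Sec f) \<subseteq> (\<lambda>g. inv g) ` supp f"
proof -
  show sub: "supp (star Sec f) \<subseteq> (\<lambda>g. inv g) ` supp f"
  proof
    fix g assume g: "g \<in> supp (star Sec f)"
    then have gG: "g \<in> carrier G" using supp_carrier by blast
    have "inv g \<in> supp f"
    proof (rule ccontr)
      assume "inv g \<notin> supp f"
      then have "star Sec f g = (\<lambda>x\<in>P. 0)"
        using gG not_supp[of "inv g" f] by (auto simp: Sec_star fun_eq_iff)
      then show False using g by (simp add: supp_def')
    qed
    then show "g \<in> (\<lambda>g. inv g) ` supp f" using gG by (metis image_eqI inv_inv)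
  qed
  have "star Sec f \<in> sections"
    unfolding Sec_star using fib_star[OF inv_closed Sec_fib[OF assms inv_closed]]
    by (auto simp: PiE_iff)
  then show "star Sec f \<in> carrier Sec"
    using finite_subset[OF sub] Sec_supp[OF assms] by (simp add: Sec_iff)
qed

lemma Sec_zero_closed: "\<zero>\<^bsub>Sec\<^esub> \<in> carrier Sec"
  by (auto simp: Sec_iff Sec_zero supp_def' fib_zero)

lemma supp_delta: "supp (delta a g) \<subseteq> {g}"
  by (auto simp: supp_def' delta_def')

lemma delta_closed: "\<lbrakk>g \<in> carrier G; a \<in> fib g\<rbrakk> \<Longrightarrow> delta a g \<in> carrier Sec"
  using finite_subset[OF supp_delta] by (auto simp: Sec_iff delta_def' fib_zero)

lemma Sec_one_closed: "\<one>\<^bsub>Sec\<^esub> \<in> carrier Sec"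
  by (simp add: Sec_one delta_closed fib_one)

text \<open>An entry \<open>f g x\<close> with \<open>inv g \<otimes> x\<close> in \<open>P\<close>
  occurs in a column; every other entry vanishes by \<open>fib_support\<close>.\<close>

lemma sections_eqI:
  assumes f: "f \<in> sections" and h: "h \<in> sections"
    and eq: "\<And>x z. \<lbrakk>x \<in> P; z \<in> P\<rbrakk> \<Longrightarrow> col f z x = col h z x"
  shows "f = h"
proof (rule PiE_ext[OF f h])
  fix g assume g: "g \<in> carrier G"
  have fg: "f g \<in> fib g" and hg: "h g \<in> fib g" using f h g by auto
  show "f g = h g"
  proof (rule extensionalityI[OF fib_ext[OF fg] fib_ext[OF hg]])
    fix x assume x: "x \<in> P"
    show "f g x = h g x"
    proof (cases "inv g \<otimes> x \<in> P")
      case True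
      have "x \<otimes> inv (inv g \<otimes> x) = g" using g x by (simp add: inv_mult_group m_assoc[symmetric])
      then show ?thesis using eq[OF x True] by (simp add: col_def)
    next
      case False
      then show ?thesis using fib_support[OF g fg x] fib_support[OF g hg x] by simp
    qed
  qed
qed

lemma Sec_eqI:
  assumes "f \<in> carrier Sec" "h \<in> carrier Sec"
    and "\<And>x z. \<lbrakk>x \<in> P; z \<in> P\<rbrakk> \<Longrightarrow> col f z x = col h z x"
  shows "f = h"
  using assms(3) by (rule sections_eqI[OF Sec_pi[OF assms(1)] Sec_pi[OF assms(2)]])

lemma act_delta:
  assumes "f \<in> carrier Sec" "x \<in> P" "z \<in> P"
  shows "act f (\<lambda>w. if w = z then 1 else 0) x = col f z x"
proof -
  let ?g = "x \<otimes> inv z"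
  have "act f (\<lambda>w. if w = z then 1 else 0) x = (\<Sum>s\<in>insert ?g (supp f). if s = ?g then f s x else 0)"
  proof (subst act_superset[of "insert ?g (supp f)"])
    have *: "inv s \<otimes> x = z \<longleftrightarrow> s = ?g" if "s \<in> carrier G" for s
      using that assms(2,3) by (metis P_carrier inv_cancel inv_closed inv_inv inv_mult_group m_assoc m_closed r_inv r_one)
    show "(\<Sum>s\<in>insert ?g (supp f). if inv s \<otimes> x \<in> P then f s x * (if inv s \<otimes> x = z then 1 else 0) else 0) =
        (\<Sum>s\<in>insert ?g (supp f). if s = ?g then f s x else 0)"
    proof (rule sum.cong[OF refl])
      fix s assume "s \<in> insert ?g (supp f)"
      then have "s \<in> carrier G" using supp_carrier assms(2,3) by auto
      then show "(if inv s \<otimes> x \<in> P then f s x * (if inv s \<otimes> x = z then 1 else 0) else 0) =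
          (if s = ?g then f s x else 0)"
        using *[of s] assms(3) by auto
    qed
  qed (use assms supp_carrier Sec_supp in auto)
  also have "\<dots> = col f z x" using Sec_supp[OF assms(1)] by (simp add: col_def)
  finally show ?thesis .
qed

text \<open>Acting on point masses recovers the columns, so the action is faithful. The algebraic
  laws for convolution are thereby reduced to laws for operators on functions.\<close>

lemma act_eqI:
  assumes "f \<in> carrier Sec" "h \<in> carrier Sec" "\<And>u x. x \<in> P \<Longrightarrow> act f u x = act h u x"
  shows "f = h"
  by (rule Sec_eqI[OF assms(1,2)]) (metis act_delta assms)

lemma act_add:
  assumes "f \<in> carrier Sec" "h \<in> carrier Sec" "x \<in> P"
  shows "act (f \<oplus>\<^bsub>Sec\<^esub> h) u x = act f u x + act h u x"
proof -
  let ?R = "supp f \<union> supp h"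
  have R: "finite ?R" "?R \<subseteq> carrier G" using Sec_supp assms supp_carrier by auto
  show ?thesis
    unfolding act_superset[OF R(1) Sec_add_closed(2)[OF assms(1,2)] R(2) assms(3)]
      act_superset[OF R(1) Un_upper1 R(2) assms(3)] act_superset[OF R(1) Un_upper2 R(2) assms(3)]
      sum.distrib[symmetric]
    using R(2) assms(3) by (intro sum.cong) (auto simp: Sec_add algebra_simps)
qed

lemma act_scale:
  assumes "f \<in> carrier Sec" "x \<in> P"
  shows "act (cscale Sec c f) u x = c * act f u x"
  unfolding act_superset[OF Sec_supp[OF assms(1)] Sec_scale_closed(2)[OF assms(1)] supp_carrier assms(2)]
  unfolding act_def sum_distrib_left
  using supp_carrier assms(2) by (intro sum.cong) (auto simp: Sec_scale)

lemma act_one: "x \<in> P \<Longrightarrow> act \<one>\<^bsub>Sec\<^esub> u x = u x"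
  unfolding Sec_one using supp_delta
  by (subst act_superset[of "{\<one>}"]) (auto simp: delta_def')

text \<open>The double sum over \<open>s\<close> and the product \<open>r\<close> is exchanged; for
  fixed \<open>s\<close> the substitution of \<open>inv s \<otimes> r\<close> for \<open>r\<close>
  turns the inner sum into the action of \<open>h\<close>. This uses a set \<open>R\<close> larger
  than the support of the product, in which cancellation may occur.\<close>

lemma act_mult:
  assumes "f \<in> carrier Sec" "h \<in> carrier Sec" "x \<in> P"
  shows "act (f \<otimes>\<^bsub>Sec\<^esub> h) u x = act f (act h u) x"
proof -
  define R where "R = (\<lambda>(s, t). s \<otimes> t) ` (supp f \<times> supp h)"
  have R: "finite R" "R \<subseteq> carrier G" "supp (f \<otimes>\<^bsub>Sec\<^esub> h) \<subseteq> R"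
    using Sec_supp assms supp_carrier Sec_mult_closed(2)[OF assms(1,2)] by (fastforce simp: R_def)+
  let ?t = "\<lambda>s r. if inv s \<otimes> x \<in> P then f s x *
      (if inv r \<otimes> x \<in> P then h (inv s \<otimes> r) (inv s \<otimes> x) * u (inv r \<otimes> x) else 0) else 0"
  have "act (f \<otimes>\<^bsub>Sec\<^esub> h) u x =
      (\<Sum>r\<in>R. if inv r \<otimes> x \<in> P then (f \<otimes>\<^bsub>Sec\<^esub> h) r x * u (inv r \<otimes> x) else 0)"
    by (rule act_superset[OF R(1,3,2) assms(3)])
  also have "\<dots> = (\<Sum>r\<in>R. \<Sum>s\<in>supp f. ?t s r)"
    unfolding Sec_mult section_conv_eq(1)[OF assms(1) Sec_pi[OF assms(2)]]
    using R(2) assms(3) by (intro sum.cong) (auto simp: sum_distrib_right if_distrib mult.assoc cong: if_cong intro!: sum.cong)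
  also have "\<dots> = (\<Sum>s\<in>supp f. \<Sum>r\<in>R. ?t s r)"
    by (rule sum.swap)
  also have "\<dots> = act f (act h u) x"
    unfolding act_def[of f]
  proof (rule sum.cong[OF refl])
    fix s assume s: "s \<in> supp f"
    then have sG: "s \<in> carrier G" using supp_carrier by blast
    show "(\<Sum>r\<in>R. ?t s r) = (if inv s \<otimes> x \<in> P then f s x * act h u (inv s \<otimes> x) else 0)"
    proof (cases "inv s \<otimes> x \<in> P")
      case True
      \<comment> \<open>For \<open>s\<close> in the support of \<open>f\<close>, the translate of
        \<open>R\<close> by \<open>inv s\<close> contains the whole support of \<open>h\<close>, so
        summing over it computes \<open>act h u\<close>.\<close>
      let ?y = "inv s \<otimes> x" and ?T = "(\<lambda>r. inv s \<otimes> r) ` R"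
      have T: "finite ?T" "supp h \<subseteq> ?T" "?T \<subseteq> carrier G"
      proof -
        show "supp h \<subseteq> ?T"
        proof
          fix t assume t: "t \<in> supp h"
          then have "t = inv s \<otimes> (s \<otimes> t)" using sG subsetD[OF supp_carrier t] by simp
          then show "t \<in> ?T" using s t by (auto simp: R_def image_iff)
        qed
      qed (use R sG in auto)
      have inj: "inj_on (\<lambda>r. inv s \<otimes> r) R"
        using R(2) sG by (auto intro!: inj_onI simp: subset_iff)
      have "act h u ?y = (\<Sum>r\<in>R. if inv (inv s \<otimes> r) \<otimes> ?y \<in> P then h (inv s \<otimes> r) ?y * u (inv (inv s \<otimes> r) \<otimes> ?y) else 0)"
        unfolding act_superset[OF T True] by (simp add: sum.reindex[OF inj])
      also have "\<dots> = (\<Sum>r\<in>R. if inv r \<otimes> x \<in> P then h (inv s \<otimes> r) ?y * u (inv r \<otimes> x) else 0)"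
      proof (rule sum.cong[OF refl])
        fix r assume "r \<in> R"
        then have "inv (inv s \<otimes> r) \<otimes> ?y = inv r \<otimes> x"
          using R(2) sG assms(3) by (auto simp: inv_mult_group m_assoc subset_iff)
        then show "(if inv (inv s \<otimes> r) \<otimes> ?y \<in> P then h (inv s \<otimes> r) ?y * u (inv (inv s \<otimes> r) \<otimes> ?y) else 0) =
          (if inv r \<otimes> x \<in> P then h (inv s \<otimes> r) ?y * u (inv r \<otimes> x) else 0)" by simp
      qed
      finally show ?thesis using True by (simp add: sum_distrib_left)
    qed simp
  qed
  finally show ?thesis .
qed

text \<open>A row of the matrix of a finitely supported section has finitely many nonzero entries,
  so the action is a finite matrix-vector product. This is what allows transposition.\<close>

lemma act_col:
  assumes f: "f \<in> carrier Sec" and x: "x \<in> P" and Z: "finite Z" "Z \<subseteq> P" "\<And>z. \<lbrakk>z \<in> P; z \<notin> Z\<rbrakk> \<Longrightarrow> col f z x = 0"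
  shows "act f u x = (\<Sum>z\<in>Z. col f z x * u z)"
proof -
  have "act f u x = (\<Sum>s\<in>{s \<in> supp f. inv s \<otimes> x \<in> Z}. f s x * u (inv s \<otimes> x))"
    unfolding act_def
  proof (rule sum.mono_neutral_cong_right)
    show "\<forall>s\<in>supp f - {s \<in> supp f. inv s \<otimes> x \<in> Z}. (if inv s \<otimes> x \<in> P then f s x * u (inv s \<otimes> x) else 0) = 0"
    proof
      fix s assume s: "s \<in> supp f - {s \<in> supp f. inv s \<otimes> x \<in> Z}"
      then have sG: "s \<in> carrier G" using supp_carrier by blast
      have "x \<otimes> inv (inv s \<otimes> x) = s" using sG x by (simp add: inv_mult_group m_assoc[symmetric])
      then have "inv s \<otimes> x \<in> P \<Longrightarrow> f s x = 0" using Z(3)[of "inv s \<otimes> x"] s by (auto simp: col_def)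
      then show "(if inv s \<otimes> x \<in> P then f s x * u (inv s \<otimes> x) else 0) = 0" by simp
    qed
  qed (use Sec_supp[OF f] Z in auto)
  also have "\<dots> = (\<Sum>z\<in>{z \<in> Z. x \<otimes> inv z \<in> supp f}. col f z x * u z)"
  proof (rule sum.reindex_bij_witness[of _ "\<lambda>z. x \<otimes> inv z" "\<lambda>s. inv s \<otimes> x"])
    fix s assume s: "s \<in> {s \<in> supp f. inv s \<otimes> x \<in> Z}"
    then have sG: "s \<in> carrier G" using supp_carrier by blast
    show e: "x \<otimes> inv (inv s \<otimes> x) = s" using sG x by (simp add: inv_mult_group m_assoc[symmetric])
    then show "inv s \<otimes> x \<in> {z \<in> Z. x \<otimes> inv z \<in> supp f}" using s by simp
    show "col f (inv s \<otimes> x) x * u (inv s \<otimes> x) = f s x * u (inv s \<otimes> x)" using e by (simp add: col_def)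
  next
    fix z assume z: "z \<in> {z \<in> Z. x \<otimes> inv z \<in> supp f}"
    then have zP: "z \<in> P" using Z by auto
    show e: "inv (x \<otimes> inv z) \<otimes> x = z" using zP x by (simp add: inv_mult_group m_assoc)
    then show "x \<otimes> inv z \<in> {s \<in> supp f. inv s \<otimes> x \<in> Z}" using z by simp
  qed
  also have "\<dots> = (\<Sum>z\<in>Z. col f z x * u z)"
    using Z x not_supp[of _ f x] by (intro sum.mono_neutral_left) (auto simp: col_def subset_iff)
  finally show ?thesis .
qed

lemma col_gcol_finite:
  assumes "f \<in> carrier Sec" "x \<in> P"
  shows "finite {z \<in> P. col f z x \<noteq> 0}"
proof (rule finite_subset)
  show "{z \<in> P. col f z x \<noteq> 0} \<subseteq> (\<lambda>s. inv s \<otimes> x) ` supp f"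
  proof
    fix z assume z: "z \<in> {z \<in> P. col f z x \<noteq> 0}"
    then have "x \<otimes> inv z \<in> supp f" using not_supp[of "x \<otimes> inv z" f x] assms(2) by (auto simp: col_def)
    moreover have "z = inv (x \<otimes> inv z) \<otimes> x" using z assms(2) by (simp add: inv_mult_group m_assoc)
    ultimately show "z \<in> (\<lambda>s. inv s \<otimes> x) ` supp f" by blast
  qed
qed (use Sec_supp assms in auto)

text \<open>The involution of sections is the conjugate transpose, because
  \<open>inv (x \<otimes> inv z) = z \<otimes> inv x\<close>.\<close>

lemma col_star:
  assumes "x \<in> P" "z \<in> P"
  shows "col (star Sec f) z x = cnj (col f x z)"
proof -
  have "inv (x \<otimes> inv z) = z \<otimes> inv x" "inv (x \<otimes> inv z) \<otimes> x = z"
    using assms by (simp_all add: inv_mult_group m_assoc)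
  then show ?thesis using assms by (simp add: col_def Sec_star)
qed

text \<open>The rule for the conjugate transpose of a product of matrices. The finite set
  \<open>Z\<close> collects the indices at which either of the two rows involved has a nonzero
  entry, so that both products are sums over it.\<close>

lemma Sec_star_mult:
  assumes "f \<in> carrier Sec" "h \<in> carrier Sec"
  shows "star Sec (f \<otimes>\<^bsub>Sec\<^esub> h) = star Sec h \<otimes>\<^bsub>Sec\<^esub> star Sec f"
proof (rule Sec_eqI)
  note sf = Sec_star_closed(1)[OF assms(1)] and sh = Sec_star_closed(1)[OF assms(2)]
  show "star Sec (f \<otimes>\<^bsub>Sec\<^esub> h) \<in> carrier Sec" "star Sec h \<otimes>\<^bsub>Sec\<^esub> star Sec f \<in> carrier Sec"
    using assms sf sh by (simp_all add: Sec_star_closed Sec_mult_closed)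
  fix x z assume x: "x \<in> P" and z: "z \<in> P"
  define Z where "Z = {w \<in> P. col f w z \<noteq> 0} \<union> {w \<in> P. col (star Sec h) w x \<noteq> 0}"
  have Z: "finite Z" "Z \<subseteq> P" using col_gcol_finite assms sh x z by (auto simp: Z_def)
  have "col (star Sec (f \<otimes>\<^bsub>Sec\<^esub> h)) z x = cnj (act f (col h x) z)"
    using col_star[OF x z] col_mult[OF assms z x] by simp
  also have "\<dots> = cnj (\<Sum>w\<in>Z. col f w z * col h x w)"
    by (subst act_col[OF assms(1) z Z]) (auto simp: Z_def)
  also have "\<dots> = (\<Sum>w\<in>Z. col (star Sec h) w x * col (star Sec f) z w)"
    using Z x z by (simp add: col_star subset_iff mult.commute)
  also have "\<dots> = act (star Sec h) (col (star Sec f) z) x"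
    by (subst act_col[OF sh x Z]) (auto simp: Z_def)
  also have "\<dots> = col (star Sec h \<otimes>\<^bsub>Sec\<^esub> star Sec f) z x"
    using col_mult[OF sh sf x z] by simp
  finally show "col (star Sec (f \<otimes>\<^bsub>Sec\<^esub> h)) z x = col (star Sec h \<otimes>\<^bsub>Sec\<^esub> star Sec f) z x" .
qed

lemma Sec_ext: "\<lbrakk>f \<in> carrier Sec; g \<in> carrier G\<rbrakk> \<Longrightarrow> f g \<in> extensional P"
  using Sec_fib fib_ext by blast

lemma Sec_star_alg: "star_alg Sec"
proof (rule star_algI)
  show "\<zero>\<^bsub>Sec\<^esub> \<oplus>\<^bsub>Sec\<^esub> f = f" "cscale Sec 1 f = f" if f: "f \<in> carrier Sec" for f
    using Sec_ext[OF f] Sec_pi[OF f]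
    by (auto simp: Sec_add Sec_zero Sec_scale fun_eq_iff PiE_def extensional_def)
  show "star Sec (star Sec f) = f" if f: "f \<in> carrier Sec" for f
    by (rule Sec_eqI) (simp_all add: Sec_star_closed f col_star)
  show "(f \<otimes>\<^bsub>Sec\<^esub> h) \<otimes>\<^bsub>Sec\<^esub> k = f \<otimes>\<^bsub>Sec\<^esub> (h \<otimes>\<^bsub>Sec\<^esub> k)"
    if "f \<in> carrier Sec" "h \<in> carrier Sec" "k \<in> carrier Sec" for f h k
  proof (rule act_eqI)
    fix u x assume "x \<in> P"
    have "act f (act (h \<otimes>\<^bsub>Sec\<^esub> k) u) x = act f (act h (act k u)) x"
      by (rule act_cong) (simp add: act_mult that)
    then show "act (f \<otimes>\<^bsub>Sec\<^esub> h \<otimes>\<^bsub>Sec\<^esub> k) u x = act (f \<otimes>\<^bsub>Sec\<^esub> (h \<otimes>\<^bsub>Sec\<^esub> k)) u x"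
      using \<open>x \<in> P\<close> that by (simp add: act_mult Sec_mult_closed)
  qed (simp_all add: that Sec_mult_closed)
  show "\<one>\<^bsub>Sec\<^esub> \<otimes>\<^bsub>Sec\<^esub> f = f" if "f \<in> carrier Sec" for f
    by (rule act_eqI) (simp_all add: that Sec_mult_closed Sec_one_closed act_mult act_one)
  show "(f \<oplus>\<^bsub>Sec\<^esub> h) \<otimes>\<^bsub>Sec\<^esub> k = f \<otimes>\<^bsub>Sec\<^esub> k \<oplus>\<^bsub>Sec\<^esub> h \<otimes>\<^bsub>Sec\<^esub> k"
    if "f \<in> carrier Sec" "h \<in> carrier Sec" "k \<in> carrier Sec" for f h k
    by (rule act_eqI) (simp_all add: that Sec_mult_closed Sec_add_closed act_mult act_add)
  show "cscale Sec c f \<otimes>\<^bsub>Sec\<^esub> k = cscale Sec c (f \<otimes>\<^bsub>Sec\<^esub> k)"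
    if "f \<in> carrier Sec" "k \<in> carrier Sec" for c f k
    by (rule act_eqI) (simp_all add: that Sec_mult_closed Sec_scale_closed act_mult act_scale)
qed (simp_all add: Sec_zero_closed Sec_one_closed Sec_add_closed Sec_mult_closed Sec_scale_closed
    Sec_star_closed Sec_star_mult,
  auto simp: Sec_add Sec_scale Sec_star Sec_zero fun_eq_iff algebra_simps)

sublocale Sec: star_alg Sec
  by (rule Sec_star_alg)

subsection \<open>The 1-norm\<close>

abbreviation "supn \<equiv> cnorm (ell_infty P)"

definition norm1 :: "('g \<Rightarrow> 'g \<Rightarrow> complex) \<Rightarrow> real" where
  "norm1 f = (\<Sum>g\<in>supp f. supn (f g))"

lemma fib_carrier: "a \<in> fib g \<Longrightarrow> a \<in> carrier (ell_infty P)"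
  using diag_ideal_carrier[of G P g] unfolding fib_def by blast

lemma supn_ge: "\<lbrakk>a \<in> fib g; x \<in> P\<rbrakk> \<Longrightarrow> cmod (a x) \<le> supn a"
  by (rule ell_infty_norm_ge[OF fib_carrier])

lemma supn_le: "(\<And>x. x \<in> P \<Longrightarrow> cmod (a x) \<le> c) \<Longrightarrow> supn a \<le> c"
  by (rule ell_infty_norm_le[OF P_ne])

lemma supn_nonneg: "a \<in> fib g \<Longrightarrow> 0 \<le> supn a"
  using supn_ge[OF _ one_P] norm_ge_zero order_trans by blast

lemma supn_zero: "supn (\<lambda>x\<in>P. 0) = 0"
  using supn_le[of "\<lambda>x\<in>P. 0" 0] supn_nonneg[OF fib_zero] by (simp add: order_antisym)

lemma norm1_superset:
  assumes "finite R" "supp f \<subseteq> R" "R \<subseteq> carrier G"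
  shows "norm1 f = (\<Sum>g\<in>R. supn (f g))"
  unfolding norm1_def using assms supn_zero
  by (intro sum.mono_neutral_left) (auto simp: supp_def' subset_iff)

lemma norm1_le:
  assumes "finite R" "supp f \<subseteq> R" "R \<subseteq> carrier G" "\<And>g. g \<in> R \<Longrightarrow> supn (f g) \<le> c g"
  shows "norm1 f \<le> (\<Sum>g\<in>R. c g)"
  unfolding norm1_superset[OF assms(1-3)] using assms(4) by (rule sum_mono)

lemma norm1_nonneg: "f \<in> carrier Sec \<Longrightarrow> 0 \<le> norm1 f"
  unfolding norm1_def using supn_nonneg Sec_fib supp_carrier by (meson subsetD sum_nonneg)

text \<open>The sup norms of the fibers of a product are dominated by the convolution of the sup
  norms of the factors, and summing over \<open>R\<close> for fixed \<open>s\<close> meets each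
  fiber of \<open>h\<close> at most once.\<close>

lemma norm1_mult:
  assumes "f \<in> carrier Sec" "h \<in> carrier Sec"
  shows "norm1 (f \<otimes>\<^bsub>Sec\<^esub> h) \<le> norm1 f * norm1 h"
proof -
  define R where "R = (\<lambda>(s, t). s \<otimes> t) ` (supp f \<times> supp h)"
  have R: "finite R" "R \<subseteq> carrier G" "supp (f \<otimes>\<^bsub>Sec\<^esub> h) \<subseteq> R"
    using Sec_supp assms supp_carrier Sec_mult_closed(2)[OF assms] by (fastforce simp: R_def)+
  have nn: "0 \<le> supn (f s)" "0 \<le> supn (h s)" if "s \<in> carrier G" for s
    using supn_nonneg Sec_fib assms that by blast+
  have "norm1 (f \<otimes>\<^bsub>Sec\<^esub> h) \<le> (\<Sum>g\<in>R. \<Sum>s\<in>supp f. supn (f s) * supn (h (inv s \<otimes> g)))"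
  proof (rule norm1_le[OF R(1,3,2)], rule supn_le)
    fix g x assume g: "g \<in> R" and x: "x \<in> P"
    then have gG: "g \<in> carrier G" using R(2) by blast
    have "cmod ((f \<otimes>\<^bsub>Sec\<^esub> h) g x) =
        cmod (\<Sum>s\<in>supp f. if inv s \<otimes> x \<in> P then f s x * h (inv s \<otimes> g) (inv s \<otimes> x) else 0)"
      unfolding Sec_mult section_conv_eq(1)[OF assms(1) Sec_pi[OF assms(2)]] using gG x by simp
    also have "\<dots> \<le> (\<Sum>s\<in>supp f. supn (f s) * supn (h (inv s \<otimes> g)))"
    proof (rule sum_norm_le)
      fix s assume "s \<in> supp f"
      then have s: "s \<in> carrier G" using supp_carrier by blast
      show "cmod (if inv s \<otimes> x \<in> P then f s x * h (inv s \<otimes> g) (inv s \<otimes> x) else 0) \<le>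
          supn (f s) * supn (h (inv s \<otimes> g))"
        using nn[OF s] nn[of "inv s \<otimes> g"] s gG x supn_ge[OF Sec_fib[OF assms(1) s] x]
          supn_ge[OF Sec_fib[OF assms(2)], of "inv s \<otimes> g" "inv s \<otimes> x"]
        by (auto simp: norm_mult intro!: mult_mono)
    qed
    finally show "cmod ((f \<otimes>\<^bsub>Sec\<^esub> h) g x) \<le> (\<Sum>s\<in>supp f. supn (f s) * supn (h (inv s \<otimes> g)))" .
  qed
  also have "\<dots> = (\<Sum>s\<in>supp f. supn (f s) * (\<Sum>g\<in>R. supn (h (inv s \<otimes> g))))"
    by (subst sum.swap) (simp add: sum_distrib_left)
  also have "\<dots> \<le> (\<Sum>s\<in>supp f. supn (f s) * norm1 h)"
  proof (intro sum_mono mult_left_mono)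
    fix s assume "s \<in> supp f"
    then have s: "s \<in> carrier G" using supp_carrier by blast
    show "0 \<le> supn (f s)" by (rule nn(1)[OF s])
    have inj: "inj_on (\<lambda>r. inv s \<otimes> r) R" using R(2) s by (auto intro!: inj_onI simp: subset_iff)
    let ?T = "(\<lambda>r. inv s \<otimes> r) ` R"
    have "(\<Sum>g\<in>R. supn (h (inv s \<otimes> g))) = (\<Sum>t\<in>?T. supn (h t))"
      by (simp add: sum.reindex[OF inj])
    also have "\<dots> \<le> (\<Sum>t\<in>?T \<union> supp h. supn (h t))"
      using R s Sec_supp[OF assms(2)] supp_carrier[of h] by (intro sum_mono2) (auto intro!: nn)
    also have "\<dots> = norm1 h"
      using R s Sec_supp[OF assms(2)] supp_carrier[of h] by (intro norm1_superset[symmetric]) auto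
    finally show "(\<Sum>g\<in>R. supn (h (inv s \<otimes> g))) \<le> norm1 h" .
  qed
  finally show ?thesis by (simp add: norm1_def sum_distrib_right)
qed

lemma norm1_star_le:
  assumes "f \<in> carrier Sec"
  shows "norm1 (star Sec f) \<le> norm1 f"
proof -
  have inj: "inj_on (\<lambda>g. inv g) (supp f)" using supp_carrier[of f] by (auto intro!: inj_onI simp: subset_iff)
  have "norm1 (star Sec f) \<le> (\<Sum>g\<in>(\<lambda>g. inv g) ` supp f. supn (f (inv g)))"
  proof (rule norm1_le[OF _ Sec_star_closed(2)[OF assms]], goal_cases)
    case (3 g)
    then have g: "g \<in> carrier G" using supp_carrier[of f] by auto
    note a = Sec_fib[OF assms inv_closed[OF g]]
    show ?case
      using supn_ge[OF a] supn_nonneg[OF a] g by (intro supn_le) (auto simp: Sec_star)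
  qed (use Sec_supp[OF assms] supp_carrier[of f] in auto)
  also have "\<dots> = norm1 f"
    using supp_carrier[of f] by (auto simp: sum.reindex[OF inj] norm1_def subset_iff intro!: sum.cong)
  finally show ?thesis .
qed

lemma norm1_seminormed: "seminormed_star_alg Sec norm1"
proof
  fix f assume f: "f \<in> carrier Sec"
  show "0 \<le> norm1 f" by (rule norm1_nonneg[OF f])
  show "norm1 (star Sec f) = norm1 f"
    using norm1_star_le[OF f] norm1_star_le[OF Sec_star_closed(1)[OF f]] f by simp
  show "norm1 (cscale Sec c f) = cmod c * norm1 f" for c
  proof -
    have "supn (cscale Sec c f g) = cmod c * supn (f g)" if g: "g \<in> carrier G" for g
    proof (rule antisym)
      note a = Sec_fib[OF f g]
      show "supn (cscale Sec c f g) \<le> cmod c * supn (f g)"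
        using supn_ge[OF a] g by (intro supn_le) (auto simp: Sec_scale norm_mult intro!: mult_left_mono)
      show "cmod c * supn (f g) \<le> supn (cscale Sec c f g)"
      proof (cases "c = 0")
        case True
        then show ?thesis using g supn_zero by (simp add: Sec_scale cong: restrict_cong)
      next
        case False
        have "supn (f g) \<le> supn (cscale Sec c f g) / cmod c"
          using supn_ge[OF Sec_fib[OF Sec_scale_closed(1)[OF f, of c] g]] g False
          by (intro supn_le) (auto simp: Sec_scale norm_mult field_simps)
        then show ?thesis using False by (simp add: field_simps)
      qed
    qed
    then show ?thesis
      unfolding norm1_superset[OF Sec_supp[OF f] Sec_scale_closed(2)[OF f] supp_carrier]
      unfolding norm1_def
      using supp_carrier[of f] by (auto simp: sum_distrib_left subset_iff intro!: sum.cong)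
  qed
  fix h assume h: "h \<in> carrier Sec"
  show "norm1 (f \<otimes>\<^bsub>Sec\<^esub> h) \<le> norm1 f * norm1 h" by (rule norm1_mult[OF f h])
  show "norm1 (f \<oplus>\<^bsub>Sec\<^esub> h) \<le> norm1 f + norm1 h"
  proof -
    let ?R = "supp f \<union> supp h"
    have R: "finite ?R" "?R \<subseteq> carrier G" using Sec_supp f h supp_carrier by auto
    have "norm1 (f \<oplus>\<^bsub>Sec\<^esub> h) \<le> (\<Sum>g\<in>?R. supn (f g) + supn (h g))"
    proof (rule norm1_le[OF R(1) Sec_add_closed(2)[OF f h] R(2)], rule supn_le)
      fix g x assume "g \<in> ?R" and x: "x \<in> P"
      then have g: "g \<in> carrier G" using R(2) by blast
      have "cmod (f g x + h g x) \<le> cmod (f g x) + cmod (h g x)" by (rule norm_triangle_ineq)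
      then show "cmod ((f \<oplus>\<^bsub>Sec\<^esub> h) g x) \<le> supn (f g) + supn (h g)"
        using supn_ge[OF Sec_fib[OF f g] x] supn_ge[OF Sec_fib[OF h g] x] g x by (simp add: Sec_add)
    qed
    then show ?thesis
      by (simp add: sum.distrib norm1_superset[OF R(1) Un_upper1 R(2)] norm1_superset[OF R(1) Un_upper2 R(2)])
  qed
qed

sublocale Sec1: seminormed_star_alg Sec norm1
  by (rule norm1_seminormed)

lemma act_delta_section:
  "\<lbrakk>r \<in> carrier G; x \<in> P\<rbrakk> \<Longrightarrow>
    act (delta e r) u x = (if inv r \<otimes> x \<in> P then e x * u (inv r \<otimes> x) else 0)"
  using act_superset[OF _ supp_delta[of e r]] by (simp add: delta_def')

lemma delta_mult:
  assumes "s \<in> carrier G" "t \<in> carrier G" "a \<in> fib s" "b \<in> fib t"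
  shows "delta a s \<otimes>\<^bsub>Sec\<^esub> delta b t =
    delta (\<lambda>x\<in>P. if inv s \<otimes> x \<in> P then a x * b (inv s \<otimes> x) else 0) (s \<otimes> t)"
    (is "?a \<otimes>\<^bsub>Sec\<^esub> ?b = ?c")
proof (rule act_eqI)
  have c: "(\<lambda>x\<in>P. if inv s \<otimes> x \<in> P then a x * b (inv s \<otimes> x) else 0) \<in> fib (s \<otimes> t)"
    by (rule fib_conv[OF assms])
  have cl: "?a \<in> carrier Sec" "?b \<in> carrier Sec" using assms by (auto intro: delta_closed)
  then show "?a \<otimes>\<^bsub>Sec\<^esub> ?b \<in> carrier Sec" by (rule Sec_mult_closed)
  show "?c \<in> carrier Sec" using c assms by (intro delta_closed) auto
  fix u x assume x: "x \<in> P"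
  have i: "inv (s \<otimes> t) \<otimes> x = inv t \<otimes> (inv s \<otimes> x)" using assms x by (simp add: inv_mult_group m_assoc)
  have "inv t \<otimes> (inv s \<otimes> x) \<notin> P \<or> inv s \<otimes> x \<notin> P \<Longrightarrow>
     inv s \<otimes> x \<in> P \<Longrightarrow> b (inv s \<otimes> x) = 0"
    using fib_support[OF assms(2,4)] by blast
  then show "act (?a \<otimes>\<^bsub>Sec\<^esub> ?b) u x = act ?c u x"
    using assms x cl by (auto simp: act_mult act_delta_section i)
qed

lemma delta_star:
  assumes "s \<in> carrier G"
  shows "star Sec (delta a s) =
    delta (\<lambda>x\<in>P. if s \<otimes> x \<in> P then cnj (a (s \<otimes> x)) else 0) (inv s)"
proof -
  have "inv g = s \<longleftrightarrow> g = inv s" if "g \<in> carrier G" for g using that assms by (metis inv_inv)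
  then show ?thesis using assms by (auto simp: Sec_star delta_def' fun_eq_iff)
qed

subsection \<open>C*-seminorms are dominated by the 1-norm\<close>

lemma fib_polynomial:
  assumes "real_polynomial_function p" "(\<lambda>x\<in>P. complex_of_real (r x)) \<in> fib \<one>"
  shows "(\<lambda>x\<in>P. complex_of_real (p (r x))) \<in> fib \<one>"
  using assms(1)
proof induction
  case (linear f)
  interpret bounded_linear f by fact
  \<comment> \<open>A linear map on the reals is multiplication by its value at 1.\<close>
  have f1: "f 1 * y = f y" for y using scaleR[of y 1] by simp
  have "complex_of_real (f 1) * complex_of_real (r x) = complex_of_real (f (r x))" for x
    unfolding of_real_mult[symmetric] f1 ..
  then show ?case
    by (intro back_subst[of "\<lambda>a. a \<in> fib \<one>", OF fib_scale[OF assms(2), of "complex_of_real (f 1)"]])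
      (auto simp: fun_eq_iff)
next
  case (const c)
  show ?case
    by (intro back_subst[of "\<lambda>a. a \<in> fib \<one>", OF fib_scale[OF fib_one, of "complex_of_real c"]])
      (auto simp: fun_eq_iff)
next
  case (add p q)
  show ?case
    by (intro back_subst[of "\<lambda>a. a \<in> fib \<one>", OF fib_add[OF add.IH]]) (auto simp: fun_eq_iff)
next
  case (mult p q)
  show ?case
    by (intro back_subst[of "\<lambda>a. a \<in> fib \<one>", OF fib_mult[OF mult.IH]]) (auto simp: fun_eq_iff)
qed

text \<open>The unit fiber is a uniformly closed algebra of functions with unit, so Weierstrass
  approximation endows its real contractions with a continuous functional calculus.\<close>

lemma fib_continuous:
  assumes "continuous_on {-1..1} \<phi>" "(\<lambda>x\<in>P. complex_of_real (r x)) \<in> fib \<one>" "\<And>x. x \<in> P \<Longrightarrow> \<bar>r x\<bar> \<le> 1"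
  shows "(\<lambda>x\<in>P. complex_of_real (\<phi> (r x))) \<in> fib \<one>"
proof (rule fib_limit)
  fix \<epsilon> :: real assume "\<epsilon> > 0"
  then obtain p where p: "real_polynomial_function p" "\<And>x. x \<in> {-1..1} \<Longrightarrow> \<bar>\<phi> x - p x\<bar> < \<epsilon>"
    using Stone_Weierstrass_real_polynomial_function[OF compact_Icc assms(1)] by blast
  have "cmod (complex_of_real (\<phi> (r x)) - complex_of_real (p (r x))) \<le> \<epsilon>" if "x \<in> P" for x
    using p(2)[of "r x"] assms(3)[OF that] unfolding of_real_diff[symmetric] norm_of_real
    by (auto simp: abs_le_iff)
  then show "\<exists>h\<in>fib \<one>. \<forall>x\<in>P. cmod ((\<lambda>x\<in>P. complex_of_real (\<phi> (r x))) x - h x) \<le> \<epsilon>"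
    by (intro bexI[OF _ fib_polynomial[OF p(1) assms(2)]]) simp
qed simp

text \<open>A self-adjoint contraction \<open>a\<close> is the average of the two unitaries \<open>a \<plusminus> \<i>\<surd>(1 - a\<^sup>2)\<close>.\<close>

lemma cstar_seminorm_selfadjoint_le:
  assumes "cstar_seminorm Sec \<mu>" "(\<lambda>x\<in>P. complex_of_real (r x)) \<in> fib \<one>" "\<And>x. x \<in> P \<Longrightarrow> \<bar>r x\<bar> \<le> 1"
  shows "\<mu> (delta (\<lambda>x\<in>P. complex_of_real (r x)) \<one>) \<le> 1"
proof -
  interpret M: cstar_seminormed_alg Sec \<mu> by (rule Sec.cstar_seminormedI[OF assms(1)])
  let ?D = "\<lambda>a. delta a \<one>"
  define b where "b = (\<lambda>x\<in>P. complex_of_real (sqrt (1 - (r x)\<^sup>2)))"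
  have b: "b \<in> fib \<one>"
    unfolding b_def
    by (rule fib_continuous[where \<phi> = "\<lambda>t. sqrt (1 - t\<^sup>2)"]) (use assms in \<open>auto intro!: continuous_intros\<close>)
  define u where "u = (\<lambda>x\<in>P. complex_of_real (r x) + \<i> * b x)"
  have u: "u \<in> fib \<one>"
    using fib_add[OF assms(2) fib_scale[OF b, of \<i>]] by (simp add: u_def cong: restrict_cong)
  have sq: "(r x)\<^sup>2 \<le> 1" if "x \<in> P" for x using assms(3)[OF that] by (simp add: abs_square_le_1)
  have nu: "cnj (u x) * u x = 1" if "x \<in> P" for x
    using sq[OF that] that by (auto simp: u_def b_def complex_eq_iff power2_eq_square)
  have star_u: "star Sec (?D u) = ?D (\<lambda>x\<in>P. cnj (u x))"
    unfolding delta_star[OF one_closed] by (simp cong: restrict_cong)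
  have "star Sec (?D u) \<otimes>\<^bsub>Sec\<^esub> ?D u = \<one>\<^bsub>Sec\<^esub>"
    unfolding star_u delta_mult[OF one_closed one_closed fib_cnj[OF u] u] Sec_one
    using nu by (simp cong: restrict_cong)
  then have "(\<mu> (?D u))\<^sup>2 \<le> 1"
    using M.norm_star_mult[of "?D u"] delta_closed[OF one_closed u] M.norm_one_le by simp
  then have mu: "\<mu> (?D u) \<le> 1" by (simp add: abs_square_le_1 abs_le_iff)
  have "?D (\<lambda>x\<in>P. complex_of_real (r x)) = cscale Sec (1/2) (?D u \<oplus>\<^bsub>Sec\<^esub> star Sec (?D u))"
    unfolding star_u by (auto simp: delta_def' Sec_add Sec_scale fun_eq_iff u_def b_def complex_eq_iff)
  then have "\<mu> (?D (\<lambda>x\<in>P. complex_of_real (r x))) =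
      \<mu> (cscale Sec (1/2) (?D u \<oplus>\<^bsub>Sec\<^esub> star Sec (?D u)))" by (rule arg_cong)
  also have "\<dots> \<le> 1/2 * (\<mu> (?D u) + \<mu> (star Sec (?D u)))"
    using M.norm_triangle[of "?D u" "star Sec (?D u)"] delta_closed[OF one_closed u]
    by (simp add: M.norm_scale)
  also have "\<dots> \<le> 1" using mu delta_closed[OF one_closed u] by (simp add: M.norm_star)
  finally show ?thesis .
qed

text \<open>By the C*-identity it suffices to bound the product of the section with its adjoint, a
  nonnegative function in the unit fiber with values at most the square of \<open>supn a\<close>.
  Divided by the square of \<open>c\<close> it is a self-adjoint contraction; taking
  \<open>c\<close> strictly above \<open>supn a\<close> makes the division legitimate even for the
  zero function.\<close>

lemma cstar_seminorm_delta_le: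
  assumes "cstar_seminorm Sec \<mu>" "g \<in> carrier G" "a \<in> fib g"
  shows "\<mu> (delta a g) \<le> supn a"
proof -
  interpret M: cstar_seminormed_alg Sec \<mu> by (rule Sec.cstar_seminormedI[OF assms(1)])
  let ?d = "delta a g"
  have dc: "?d \<in> carrier Sec" by (rule delta_closed[OF assms(2,3)])
  have le: "\<mu> ?d \<le> c" if c: "c > supn a" for c
  proof -
    have c0: "c > 0" using supn_nonneg[OF assms(3)] c by linarith
    define r where "r x = (if g \<otimes> x \<in> P then (cmod (a (g \<otimes> x)))\<^sup>2 / c\<^sup>2 else 0)" for x
    define e where "e = (\<lambda>x\<in>P. if g \<otimes> x \<in> P then cnj (a (g \<otimes> x)) else 0)"
    have e: "e \<in> fib (inv g)" unfolding e_def by (rule fib_star[OF assms(2,3)])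
    let ?p = "\<lambda>x\<in>P. if inv (inv g) \<otimes> x \<in> P then e x * a (inv (inv g) \<otimes> x) else 0"
    have p: "?p \<in> fib \<one>" using fib_conv[OF inv_closed[OF assms(2)] assms(2) e assms(3)] assms(2) by simp
    have r: "(\<lambda>x\<in>P. complex_of_real (r x)) = (\<lambda>x\<in>P. complex_of_real (1 / c\<^sup>2) * ?p x)"
    proof -
      have "(complex_of_real (cmod z))\<^sup>2 = z * cnj z" for z
        using complex_norm_square[of z] by simp
      then show ?thesis using assms(2) by (auto simp: r_def e_def fun_eq_iff mult.commute)
    qed
    have rf: "(\<lambda>x\<in>P. complex_of_real (r x)) \<in> fib \<one>" unfolding r by (rule fib_scale[OF p])
    have r1: "\<bar>r x\<bar> \<le> 1" if "x \<in> P" for x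
    proof (cases "g \<otimes> x \<in> P")
      case True
      have "cmod (a (g \<otimes> x)) \<le> c" using supn_ge[OF assms(3) True] c by linarith
      then have "(cmod (a (g \<otimes> x)))\<^sup>2 \<le> c\<^sup>2" by (intro power_mono) auto
      then show ?thesis using True c0 by (simp add: r_def)
    qed (simp add: r_def)
    have "star Sec ?d \<otimes>\<^bsub>Sec\<^esub> ?d = delta ?p \<one>"
      unfolding delta_star[OF assms(2)] e_def[symmetric]
      by (subst delta_mult[OF inv_closed[OF assms(2)] assms(2) e assms(3)]) (use assms(2) in simp)
    also have "\<dots> = cscale Sec (complex_of_real (c\<^sup>2)) (delta (\<lambda>x\<in>P. complex_of_real (r x)) \<one>)"
      unfolding r using c0 by (auto simp: Sec_scale delta_def' fun_eq_iff)
    finally have "(\<mu> ?d)\<^sup>2 = c\<^sup>2 * \<mu> (delta (\<lambda>x\<in>P. complex_of_real (r x)) \<one>)"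
      using M.norm_star_mult[OF dc] delta_closed[OF one_closed rf] c0
      by (simp add: M.norm_scale norm_power del: of_real_power)
    also have "\<dots> \<le> c\<^sup>2"
      using cstar_seminorm_selfadjoint_le[OF assms(1) rf r1] mult_left_mono[of _ 1 "c\<^sup>2"] by simp
    finally show ?thesis using c0 by (simp add: power2_le_iff_abs_le)
  qed
  then show ?thesis by (rule dense_ge)
qed

text \<open>This makes the supremum defining the full cross-sectional norm finite, and bounds the
  operator norm of any representation of sections.\<close>

lemma cstar_seminorm_le_norm1:
  assumes "cstar_seminorm Sec \<mu>" "f \<in> carrier Sec"
  shows "\<mu> f \<le> norm1 f"
proof -
  interpret M: cstar_seminormed_alg Sec \<mu> by (rule Sec.cstar_seminormedI[OF assms(1)])
  have "finite S \<Longrightarrow> supp f \<subseteq> S \<Longrightarrow> S \<subseteq> carrier G \<Longrightarrow> f \<in> carrier Sec \<Longrightarrow> \<mu> f \<le> (\<Sum>g\<in>S. supn (f g))" for S f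
  proof (induction S arbitrary: f rule: finite_induct)
    case empty
    then have "f = \<zero>\<^bsub>Sec\<^esub>" using Sec_pi[of f] by (auto simp: supp_def' Sec_zero fun_eq_iff)
    then show ?case by simp
  next
    case (insert g S)
    have g: "g \<in> carrier G" using insert by simp
    note fg = Sec_fib[OF insert.prems(3) g]
    define h where "h = (\<lambda>s\<in>carrier G. if s = g then (\<lambda>x\<in>P. 0) else f s)"
    have hs: "supp h \<subseteq> S" using insert.prems(1) by (auto simp: h_def supp_def' split: if_splits)
    have hc: "h \<in> carrier Sec"
      using finite_subset[OF hs insert.hyps(1)] Sec_fib[OF insert.prems(3)]
      by (auto simp: Sec_iff h_def fib_zero)
    have "f = delta (f g) g \<oplus>\<^bsub>Sec\<^esub> h"
      using Sec_pi[OF insert.prems(3)] Sec_ext[OF insert.prems(3)] g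
      by (auto simp: Sec_add delta_def' h_def fun_eq_iff PiE_def extensional_def)
    then have "\<mu> f \<le> \<mu> (delta (f g) g) + \<mu> h"
      using M.norm_triangle[OF delta_closed[OF g fg] hc] by metis
    also have "\<dots> \<le> supn (f g) + (\<Sum>s\<in>S. supn (h s))"
      using cstar_seminorm_delta_le[OF assms(1) g fg] insert.IH[OF hs _ hc] insert.prems by simp
    also have "(\<Sum>s\<in>S. supn (h s)) = (\<Sum>s\<in>S. supn (f s))"
      using insert by (intro sum.cong) (auto simp: h_def)
    finally show ?case using insert by simp
  qed
  then show ?thesis unfolding norm1_def using Sec_supp supp_carrier assms(2) by blast
qed

end

section \<open>Toeplitz families\<close>

text \<open>Words consist of pairs whose first entry is starred, so a single letter is padded:
  \<open>p\<close> becomes \<open>[e, p]\<close> and its adjoint \<open>[p, e]\<close>. With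
  \<open>e\<close> sent to the unit the value is unchanged.\<close>

fun free_word :: "'g \<Rightarrow> ('g \<times> bool) list \<Rightarrow> 'g list" where
  "free_word e [] = []"
| "free_word e ((p, b) # w) = (if b then [p, e] else [e, p]) @ free_word e w"

lemma free_word_set: "w \<in> lists (P \<times> UNIV) \<Longrightarrow> e \<in> P \<Longrightarrow> set (free_word e w) \<subseteq> P \<and> even (length (free_word e w))"
  by (induction e w rule: free_word.induct) auto

context star_alg
begin

lemma word_star_eval_append:
  assumes "w ` P \<subseteq> carrier A" "set \<alpha> \<subseteq> P" "set \<beta> \<subseteq> P" "even (length \<alpha>)"
  shows "word_star_eval A w (\<alpha> @ \<beta>) = word_star_eval A w \<alpha> \<otimes> word_star_eval A w \<beta>"
  using assms(2,4)
proof (induction "length \<alpha>" arbitrary: \<alpha> rule: less_induct)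
  case less
  note cl = word_star_eval_closed[OF assms(1)]
  show ?case
  proof (cases "\<alpha> = []")
    case True
    then show ?thesis using cl[OF assms(3)] by simp
  next
    case False
    with less.prems obtain p q \<alpha>' where \<alpha>: "\<alpha> = p # q # \<alpha>'"
      by (cases \<alpha>; cases "tl \<alpha>") auto
    have "w p \<in> carrier A" "w q \<in> carrier A" using less.prems \<alpha> assms(1) by auto
    moreover have "word_star_eval A w (\<alpha>' @ \<beta>) = word_star_eval A w \<alpha>' \<otimes> word_star_eval A w \<beta>"
      using less \<alpha> by simp
    ultimately show ?thesis using \<alpha> less.prems cl[of \<alpha>'] cl[OF assms(3)] by (simp add: m_assoc)
  qed
qed

lemma word_star_eval_rev:
  assumes "w ` P \<subseteq> carrier A" "set \<alpha> \<subseteq> P" "even (length \<alpha>)"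
  shows "word_star_eval A w (rev \<alpha>) = star A (word_star_eval A w \<alpha>)"
  using assms(2,3)
proof (induction "length \<alpha>" arbitrary: \<alpha> rule: less_induct)
  case less
  note cl = word_star_eval_closed[OF assms(1)]
  show ?case
  proof (cases "\<alpha> = []")
    case False
    with less.prems obtain p q \<alpha>' where \<alpha>: "\<alpha> = p # q # \<alpha>'"
      by (cases \<alpha>; cases "tl \<alpha>") auto
    have w: "w p \<in> carrier A" "w q \<in> carrier A" using less.prems \<alpha> assms(1) by auto
    have "word_star_eval A w (rev \<alpha>' @ [q, p]) = word_star_eval A w (rev \<alpha>') \<otimes> word_star_eval A w [q, p]"
      using less.prems \<alpha> by (intro word_star_eval_append[OF assms(1)]) auto
    also have "word_star_eval A w (rev \<alpha>') = star A (word_star_eval A w \<alpha>')"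
      using less \<alpha> by simp
    finally show ?thesis using \<alpha> less.prems cl[of \<alpha>'] w by (simp add: star_mult m_assoc)
  qed simp
qed

lemma monomial_value_word:
  assumes "t ` P \<subseteq> carrier A" "e \<in> P" "t e = \<one>" "w \<in> lists (P \<times> UNIV)"
  shows "monomial_value A t w = word_star_eval A t (free_word e w)"
  using assms(4)
proof (induction w rule: list.induct)
  case (Cons l w)
  obtain p b where l: "l = (p, b)" by (cases l)
  have p: "p \<in> P" "t p \<in> carrier A" using Cons.prems l assms(1) by auto
  have w: "set (free_word e w) \<subseteq> P" using Cons.prems assms(2) by (simp add: free_word_set)
  have c: "word_star_eval A t (free_word e w) \<in> carrier A" by (rule word_star_eval_closed[OF assms(1) w])
  have "monomial_value A t (l # w) = (if b then star A (t p) else t p) \<otimes> monomial_value A t w"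
    by (simp add: monomial_value_def l)
  also have "monomial_value A t w = word_star_eval A t (free_word e w)"
    using Cons by simp
  finally show ?case using p c assms(3) by (simp add: l)
qed (simp add: monomial_value_def)

text \<open>Formal linear combinations are kept as lists, so that the same coefficients and words
  can be evaluated in different algebras and also as functions on \<open>P\<close>.\<close>

fun lin :: "('g \<Rightarrow> 'a) \<Rightarrow> (complex \<times> 'g list) list \<Rightarrow> 'a" where
  "lin t [] = \<zero>"
| "lin t ((c, \<alpha>) # xs) = cscale A c (word_star_eval A t \<alpha>) \<oplus> lin t xs"

end

definition comb_words :: "'g set \<Rightarrow> (complex \<times> 'g list) list \<Rightarrow> bool" where
  "comb_words P xs \<longleftrightarrow> (\<forall>(c, \<alpha>)\<in>set xs. set \<alpha> \<subseteq> P \<and> even (length \<alpha>))"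

lemma comb_words_simps [simp]:
  "comb_words P []"
  "comb_words P ((c, \<alpha>) # xs) \<longleftrightarrow> set \<alpha> \<subseteq> P \<and> even (length \<alpha>) \<and> comb_words P xs"
  "comb_words P (xs @ ys) \<longleftrightarrow> comb_words P xs \<and> comb_words P ys"
  by (auto simp: comb_words_def)

definition comb_scale :: "complex \<Rightarrow> (complex \<times> 'g list) list \<Rightarrow> (complex \<times> 'g list) list" where
  "comb_scale d xs = map (\<lambda>(c, \<alpha>). (d * c, \<alpha>)) xs"

definition comb_star :: "(complex \<times> 'g list) list \<Rightarrow> (complex \<times> 'g list) list" where
  "comb_star xs = map (\<lambda>(c, \<alpha>). (cnj c, rev \<alpha>)) xs"

fun comb_mult :: "(complex \<times> 'g list) list \<Rightarrow> (complex \<times> 'g list) list \<Rightarrow> (complex \<times> 'g list) list" where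
  "comb_mult [] ys = []"
| "comb_mult ((c, \<alpha>) # xs) ys = map (\<lambda>(d, \<beta>). (c * d, \<alpha> @ \<beta>)) ys @ comb_mult xs ys"

context star_alg
begin

context
  fixes t :: "'g \<Rightarrow> 'a" and P :: "'g set"
  assumes t: "t ` P \<subseteq> carrier A"
begin

lemma lin_closed: "comb_words P xs \<Longrightarrow> lin t xs \<in> carrier A"
  by (induction xs) (auto simp: word_star_eval_closed[OF t])

lemma lin_append: "\<lbrakk>comb_words P xs; comb_words P ys\<rbrakk> \<Longrightarrow> lin t (xs @ ys) = lin t xs \<oplus> lin t ys"
  by (induction xs)
    (auto simp: lin_closed a_assoc word_star_eval_closed[OF t])

lemma lin_scale: "comb_words P xs \<Longrightarrow> comb_words P (comb_scale d xs) \<and> lin t (comb_scale d xs) = cscale A d (lin t xs)"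
  by (induction xs)
    (auto simp: comb_scale_def lin_closed scale_add_right scale_scale word_star_eval_closed[OF t])

lemma lin_star: "comb_words P xs \<Longrightarrow> comb_words P (comb_star xs) \<and> lin t (comb_star xs) = star A (lin t xs)"
  by (induction xs)
    (auto simp: comb_star_def lin_closed star_add star_scale word_star_eval_closed[OF t]
      word_star_eval_rev[OF t])

lemma lin_mult_word:
  assumes "set \<alpha> \<subseteq> P" "even (length \<alpha>)" "comb_words P ys"
  shows "comb_words P (map (\<lambda>(d, \<beta>). (c * d, \<alpha> @ \<beta>)) ys) \<and>
    lin t (map (\<lambda>(d, \<beta>). (c * d, \<alpha> @ \<beta>)) ys) = cscale A c (word_star_eval A t \<alpha>) \<otimes> lin t ys"
  using assms(3)
proof (induction ys)
  case Nil
  then show ?case using assms by (simp add: word_star_eval_closed[OF t])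
next
  case (Cons y ys)
  obtain d \<beta> where y: "y = (d, \<beta>)" by (cases y)
  have \<beta>: "set \<beta> \<subseteq> P" "even (length \<beta>)" "comb_words P ys" using Cons.prems y by auto
  note c = word_star_eval_closed[OF t assms(1)] word_star_eval_closed[OF t \<beta>(1)] lin_closed[OF \<beta>(3)]
  show ?case
    using Cons.IH[OF \<beta>(3)] \<beta> assms c
    by (simp add: y word_star_eval_append[OF t] r_distr scale_mult_left scale_mult_right scale_scale mult.commute)
qed

lemma lin_mult:
  "\<lbrakk>comb_words P xs; comb_words P ys\<rbrakk> \<Longrightarrow>
    comb_words P (comb_mult xs ys) \<and> lin t (comb_mult xs ys) = lin t xs \<otimes> lin t ys"
proof (induction xs ys rule: comb_mult.induct)
  case (1 ys)
  then show ?case by (simp add: lin_closed)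
next
  case (2 c \<alpha> xs ys)
  then have \<alpha>: "set \<alpha> \<subseteq> P" "even (length \<alpha>)" "comb_words P xs" by auto
  show ?case
    using lin_mult_word[OF \<alpha>(1,2) "2.prems"(2), of c] 2 \<alpha>
    by (simp add: lin_append l_distr lin_closed word_star_eval_closed[OF t])
qed

end

end

section \<open>Projections and commuting elements for a C*-seminorm\<close>

context cstar_seminormed_alg
begin

definition proj :: "'a \<Rightarrow> bool" where
  "proj p \<longleftrightarrow> p \<in> carrier A \<and> star A p = p \<and> p \<otimes> p = p"

lemma proj_compl:
  assumes "proj p"
  shows "proj (\<one> \<ominus> p)"
proof -
  have p: "p \<in> carrier A" "star A p = p" "p \<otimes> p = p" using assms by (auto simp: proj_def)
  have "(\<one> \<ominus> p) \<otimes> (\<one> \<ominus> p) = \<one> \<ominus> p"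
    using p by (simp add: a_minus_def l_distr r_distr l_minus r_minus a_assoc r_neg)
  then show ?thesis using p by (simp add: proj_def star_diff)
qed

lemma proj_norm_le: "proj p \<Longrightarrow> \<nu> p \<le> 1"
  using norm_star_mult[of p] by (auto simp: proj_def power2_eq_square)

text \<open>A self-adjoint \<open>p\<close> commuting with \<open>w\<close> also commutes with the
  adjoint of \<open>w\<close>, so passing from \<open>w\<close> to
  \<open>star A w \<otimes> w\<close> squares the norm of the corner and keeps the commutation. This
  is the induction step of the next lemma.\<close>

lemma norm_star_mult_proj:
  assumes "proj p" "w \<in> carrier A" "w \<otimes> p = p \<otimes> w"
  shows "\<nu> (star A w \<otimes> w \<otimes> p) = (\<nu> (w \<otimes> p))\<^sup>2"
    and "star A w \<otimes> w \<otimes> p = p \<otimes> (star A w \<otimes> w)"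
proof -
  have p: "p \<in> carrier A" "star A p = p" "p \<otimes> p = p" using assms by (auto simp: proj_def)
  have sw: "p \<otimes> star A w = star A w \<otimes> p"
    using star_mult[OF assms(2) p(1)] star_mult[OF p(1) assms(2)] assms(3) p by simp
  show c: "star A w \<otimes> w \<otimes> p = p \<otimes> (star A w \<otimes> w)"
    using assms p sw by (metis m_assoc star_closed)
  have "star A (w \<otimes> p) \<otimes> (w \<otimes> p) = p \<otimes> (star A w \<otimes> w) \<otimes> p"
    using assms(2) p by (simp add: star_mult m_assoc)
  also have "\<dots> = star A w \<otimes> w \<otimes> p"
    unfolding c[symmetric] using assms(2) p by (simp add: m_assoc)
  finally show "\<nu> (star A w \<otimes> w \<otimes> p) = (\<nu> (w \<otimes> p))\<^sup>2"
    using norm_star_mult[of "w \<otimes> p"] assms(2) p by simp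
qed

text \<open>The triangle inequality over the two corners gives the bound \<open>2 * M\<close>.
  Replacing \<open>w\<close> by \<open>star A w \<otimes> w\<close> and \<open>M\<close> by its
  square doubles the exponents on both sides but leaves the factor 2 alone.\<close>

lemma norm_power_le_proj:
  assumes "proj p" "w \<in> carrier A" "w \<otimes> p = p \<otimes> w"
    and "\<nu> (w \<otimes> p) \<le> M" "\<nu> (w \<otimes> (\<one> \<ominus> p)) \<le> M"
  shows "\<nu> w ^ (2 ^ k) \<le> 2 * M ^ (2 ^ k)"
  using assms(2-5)
proof (induction k arbitrary: w M)
  case 0
  have p: "p \<in> carrier A" using assms(1) by (simp add: proj_def)
  have "w = w \<otimes> p \<oplus> w \<otimes> (\<one> \<ominus> p)"
    using r_distr[of p "\<one> \<ominus> p" w] add_diff_cancel[of "\<one>" p] 0(1) p by simp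
  then have "\<nu> w \<le> \<nu> (w \<otimes> p) + \<nu> (w \<otimes> (\<one> \<ominus> p))"
    using norm_triangle[of "w \<otimes> p" "w \<otimes> (\<one> \<ominus> p)"] 0 p by simp
  then show ?case using 0 by simp
next
  case (Suc k)
  have p: "p \<in> carrier A" using assms(1) by (simp add: proj_def)
  let ?h = "star A w \<otimes> w"
  have cq: "w \<otimes> (\<one> \<ominus> p) = (\<one> \<ominus> p) \<otimes> w"
    using Suc.prems p by (simp add: a_minus_def r_distr l_distr r_minus l_minus)
  note 1 = norm_star_mult_proj[OF assms(1) Suc.prems(1,2)]
  note 2 = norm_star_mult_proj[OF proj_compl[OF assms(1)] Suc.prems(1) cq]
  have "\<nu> ?h ^ (2 ^ k) \<le> 2 * (M\<^sup>2) ^ (2 ^ k)"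
    using 1 2 Suc.prems p by (intro Suc.IH) (auto intro!: power_mono)
  moreover have "\<nu> ?h = (\<nu> w)\<^sup>2" using norm_star_mult Suc.prems by simp
  ultimately show ?case by (simp add: power_mult[symmetric])
qed

text \<open>The norm on an orthogonal direct sum is the maximum of the norms on the summands: the
  constant 2 is independent of \<open>k\<close>, and a ratio above 1 would have unbounded
  powers.\<close>

lemma norm_le_proj:
  assumes "proj p" "w \<in> carrier A" "w \<otimes> p = p \<otimes> w"
    and "\<nu> (w \<otimes> p) \<le> M" "\<nu> (w \<otimes> (\<one> \<ominus> p)) \<le> M"
  shows "\<nu> w \<le> M"
proof (rule ccontr)
  assume n: "\<not> \<nu> w \<le> M"
  have p: "p \<in> carrier A" using assms(1) by (simp add: proj_def)
  have M0: "0 \<le> M" using assms(4) norm_nonneg[of "w \<otimes> p"] assms(2) p by (meson m_closed order_trans)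
  note b = norm_power_le_proj[OF assms]
  show False
  proof (cases "M = 0")
    case True
    then show False using b[of 0] n by simp
  next
    case False
    define r where "r = \<nu> w / M"
    have r: "r > 1" using n M0 False by (simp add: r_def)
    obtain k where k: "2 < r ^ k" using real_arch_pow[OF r] by blast
    also have "r ^ k \<le> r ^ (2 ^ k)" using r by (intro power_increasing) auto
    also have "\<dots> \<le> 2" using b[of k] M0 False by (simp add: r_def power_divide field_simps)
    finally show False by simp
  qed
qed

definition commutes :: "'a \<Rightarrow> 'a \<Rightarrow> bool" where
  "commutes p x \<longleftrightarrow> x \<in> carrier A \<and> x \<otimes> p = p \<otimes> x"

lemma commutes_simps:
  assumes "p \<in> carrier A"
  shows "commutes p \<one>" "commutes p \<zero>"
    and "\<lbrakk>commutes p x; commutes p y\<rbrakk> \<Longrightarrow> commutes p (x \<oplus> y)"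
    and "\<lbrakk>commutes p x; commutes p y\<rbrakk> \<Longrightarrow> commutes p (x \<ominus> y)"
    and "commutes p x \<Longrightarrow> commutes p (cscale A c x)"
    and "\<lbrakk>commutes p x; commutes p y\<rbrakk> \<Longrightarrow> commutes p (x \<otimes> y)"
proof -
  show "\<lbrakk>commutes p x; commutes p y\<rbrakk> \<Longrightarrow> commutes p (x \<otimes> y)"
    using assms unfolding commutes_def by (metis m_assoc m_closed)
qed (use assms in \<open>auto simp: commutes_def l_distr r_distr scale_mult_left scale_mult_right
      a_minus_def l_minus r_minus\<close>)

end

section \<open>Families satisfying (T1) to (T4), and the projections of neutral words\<close>

locale toeplitz_family = submonoid_of_group G P + C: cstar_seminormed_alg C "cnorm C"
  for G :: "('g, 'm) monoid_scheme" (structure) and P :: "'g set"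
    and C :: "('a, 'n) normed_star_algebra_scheme" +
  fixes t :: "'g \<Rightarrow> 'a"
  assumes t_closed: "t ` P \<subseteq> carrier C"
    and relators: "toeplitz_relators G P C t \<subseteq> {\<zero>\<^bsub>C\<^esub>}"
begin

abbreviation "\<tau> \<equiv> word_star_eval C t"

lemma words_set: "\<alpha> \<in> words P \<longleftrightarrow> set \<alpha> \<subseteq> P \<and> even (length \<alpha>)"
  by (simp add: words_def)

lemma neutral_iff: "\<alpha> \<in> neutral_words G P \<longleftrightarrow> \<alpha> \<in> words P \<and> ev \<alpha> = \<one>"
  by (simp add: words_over_def)

lemma \<tau>_closed [simp, intro]: "\<alpha> \<in> words P \<Longrightarrow> \<tau> \<alpha> \<in> carrier C"
  using C.word_star_eval_closed[OF t_closed] by (simp add: words_set)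

lemma \<tau>_append: "\<lbrakk>\<alpha> \<in> words P; \<beta> \<in> words P\<rbrakk> \<Longrightarrow> \<tau> (\<alpha> @ \<beta>) = \<tau> \<alpha> \<otimes>\<^bsub>C\<^esub> \<tau> \<beta>"
  using C.word_star_eval_append[OF t_closed] by (simp add: words_set)

lemma \<tau>_rev: "\<alpha> \<in> words P \<Longrightarrow> \<tau> (rev \<alpha>) = star C (\<tau> \<alpha>)"
  using C.word_star_eval_rev[OF t_closed] by (simp add: words_set)

lemma T1: "t \<one> = \<one>\<^bsub>C\<^esub>"
proof -
  have "t \<one> \<ominus>\<^bsub>C\<^esub> \<one>\<^bsub>C\<^esub> \<in> toeplitz_relators G P C t" by (simp add: toeplitz_relators_image)
  then have "t \<one> \<ominus>\<^bsub>C\<^esub> \<one>\<^bsub>C\<^esub> = \<zero>\<^bsub>C\<^esub>" using relators by blast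
  moreover have "t \<one> \<in> carrier C" using t_closed one_P by blast
  ultimately show ?thesis by (auto intro: C.diff_eq_zero)
qed

lemma T2: "\<lbrakk>\<alpha> \<in> neutral_words G P; K \<alpha> = {}\<rbrakk> \<Longrightarrow> \<tau> \<alpha> = \<zero>\<^bsub>C\<^esub>"
  using relators unfolding toeplitz_relators_image by blast

lemma T3:
  assumes "\<alpha> \<in> neutral_words G P" "\<beta> \<in> neutral_words G P" "K \<alpha> = K \<beta>"
  shows "\<tau> \<alpha> = \<tau> \<beta>"
proof -
  have "\<tau> \<alpha> \<ominus>\<^bsub>C\<^esub> \<tau> \<beta> = \<zero>\<^bsub>C\<^esub>"
    using relators assms unfolding toeplitz_relators_def by blast
  moreover have "\<tau> \<alpha> \<in> carrier C" "\<tau> \<beta> \<in> carrier C" using assms by (auto simp: neutral_iff)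
  ultimately show ?thesis by (auto intro: C.diff_eq_zero)
qed

lemma T4:
  assumes "\<alpha> \<in> neutral_words G P" "distinct F" "F \<noteq> []" "set F \<subseteq> neutral_words G P" "K \<alpha> = (\<Union>\<beta>\<in>set F. K \<beta>)"
  shows "foldr (\<lambda>\<beta> x. (\<tau> \<alpha> \<ominus>\<^bsub>C\<^esub> \<tau> \<beta>) \<otimes>\<^bsub>C\<^esub> x) F \<one>\<^bsub>C\<^esub> = \<zero>\<^bsub>C\<^esub>"
  using relators assms unfolding toeplitz_relators_def by blast

lemma neutral_append: "\<lbrakk>\<alpha> \<in> neutral_words G P; \<beta> \<in> neutral_words G P\<rbrakk> \<Longrightarrow> \<alpha> @ \<beta> \<in> neutral_words G P"
  by (simp add: neutral_iff ev_append)

lemma neutral_K_append: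
  "\<lbrakk>\<alpha> \<in> neutral_words G P; \<beta> \<in> neutral_words G P\<rbrakk> \<Longrightarrow> K (\<alpha> @ \<beta>) = K \<alpha> \<inter> K \<beta>"
  using mem_K_carrier[of _ \<beta>] by (auto simp: neutral_iff mem_K_append)

lemma neutral_rev: "\<alpha> \<in> neutral_words G P \<Longrightarrow> rev \<alpha> \<in> neutral_words G P \<and> K (rev \<alpha>) = K \<alpha>"
  using ev_mem_K_rev[of \<alpha>] mem_K_carrier[of _ \<alpha>] mem_K_carrier[of _ "rev \<alpha>"]
  by (auto simp: neutral_iff ev_rev)

text \<open>For neutral words concatenation intersects the ideals and reversal preserves them.
  Through (T3) the projections \<open>\<tau> \<alpha>\<close> inherit from sets their idempotence,
  and likewise self-adjointness and commutation in the two lemmas that follow.\<close>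

lemma \<tau>_idem: "\<alpha> \<in> neutral_words G P \<Longrightarrow> \<tau> \<alpha> \<otimes>\<^bsub>C\<^esub> \<tau> \<alpha> = \<tau> \<alpha>"
  using T3[OF neutral_append[of \<alpha> \<alpha>], of \<alpha>] neutral_K_append[of \<alpha> \<alpha>] by (simp add: \<tau>_append neutral_iff)

lemma \<tau>_selfadjoint: "\<alpha> \<in> neutral_words G P \<Longrightarrow> star C (\<tau> \<alpha>) = \<tau> \<alpha>"
  using T3[of "rev \<alpha>" \<alpha>] neutral_rev[of \<alpha>] by (simp add: \<tau>_rev neutral_iff)

lemma \<tau>_comm:
  "\<lbrakk>\<alpha> \<in> neutral_words G P; \<beta> \<in> neutral_words G P\<rbrakk> \<Longrightarrow> \<tau> \<alpha> \<otimes>\<^bsub>C\<^esub> \<tau> \<beta> = \<tau> \<beta> \<otimes>\<^bsub>C\<^esub> \<tau> \<alpha>"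
  using T3[OF neutral_append[of \<alpha> \<beta>] neutral_append[of \<beta> \<alpha>]] neutral_K_append[of \<alpha> \<beta>] neutral_K_append[of \<beta> \<alpha>]
  by (simp add: \<tau>_append neutral_iff Int_commute)

subsection \<open>The norm of a linear combination of words\<close>

text \<open>Plays the role of the characteristic function of the complement of all ideals in the
  list, that is, of the part of \<open>P\<close> where every word treated so far has been
  excluded.\<close>

definition Q :: "'g list list \<Rightarrow> 'a" where
  "Q bs = foldr (\<lambda>\<beta> y. (\<one>\<^bsub>C\<^esub> \<ominus>\<^bsub>C\<^esub> \<tau> \<beta>) \<otimes>\<^bsub>C\<^esub> y) bs \<one>\<^bsub>C\<^esub>"

lemma Q_simps [simp]: "Q [] = \<one>\<^bsub>C\<^esub>" "Q (\<beta> # bs) = (\<one>\<^bsub>C\<^esub> \<ominus>\<^bsub>C\<^esub> \<tau> \<beta>) \<otimes>\<^bsub>C\<^esub> Q bs"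
  by (simp_all add: Q_def)

lemma \<tau>_commutes: "\<lbrakk>\<alpha> \<in> neutral_words G P; \<beta> \<in> neutral_words G P\<rbrakk> \<Longrightarrow> C.commutes (\<tau> \<alpha>) (\<tau> \<beta>)"
  using \<tau>_comm by (auto simp: C.commutes_def neutral_iff)

lemma \<tau>_commutes_compl:
  "\<lbrakk>\<alpha> \<in> neutral_words G P; \<beta> \<in> neutral_words G P\<rbrakk> \<Longrightarrow> C.commutes (\<tau> \<alpha>) (\<one>\<^bsub>C\<^esub> \<ominus>\<^bsub>C\<^esub> \<tau> \<beta>)"
  by (intro C.commutes_simps \<tau>_commutes) (auto simp: neutral_iff)

lemma Q_closed: "set bs \<subseteq> neutral_words G P \<Longrightarrow> Q bs \<in> carrier C"
  by (induction bs) (auto simp: neutral_iff)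

lemma Q_commutes: "\<lbrakk>\<alpha> \<in> neutral_words G P; set bs \<subseteq> neutral_words G P\<rbrakk> \<Longrightarrow> C.commutes (\<tau> \<alpha>) (Q bs)"
proof (induction bs)
  case Nil
  then show ?case by (auto simp: neutral_iff intro: C.commutes_simps)
next
  case (Cons \<beta> bs)
  then show ?case
    by (auto intro!: C.commutes_simps(6) \<tau>_commutes_compl simp: neutral_iff)
qed

lemma \<tau>_proj: "\<alpha> \<in> neutral_words G P \<Longrightarrow> C.proj (\<tau> \<alpha>)"
  using \<tau>_idem \<tau>_selfadjoint by (auto simp: C.proj_def neutral_iff)

lemma Q_norm_le: "set bs \<subseteq> neutral_words G P \<Longrightarrow> cnorm C (Q bs) \<le> 1"
proof (induction bs)
  case Nil
  have "C.proj \<one>\<^bsub>C\<^esub>" by (simp add: C.proj_def)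
  then show ?case by (simp add: C.proj_norm_le)
next
  case (Cons \<beta> bs)
  let ?q = "\<one>\<^bsub>C\<^esub> \<ominus>\<^bsub>C\<^esub> \<tau> \<beta>"
  have q: "C.proj ?q" using Cons.prems by (intro C.proj_compl \<tau>_proj) auto
  have "cnorm C (Q (\<beta> # bs)) \<le> cnorm C ?q * cnorm C (Q bs)"
    using Cons.prems q by (auto intro!: C.norm_mult Q_closed simp: C.proj_def)
  also have "\<dots> \<le> 1 * 1"
    using Cons C.proj_norm_le[OF q] Q_closed[of bs] q by (intro mult_mono) (auto simp: C.proj_def)
  finally show ?case by simp
qed

lemma Q_absorb:
  assumes "\<beta> \<in> set bs" "set bs \<subseteq> neutral_words G P"
  shows "(\<one>\<^bsub>C\<^esub> \<ominus>\<^bsub>C\<^esub> \<tau> \<beta>) \<otimes>\<^bsub>C\<^esub> Q bs = Q bs"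
  using assms
proof (induction bs)
  case (Cons \<gamma> bs)
  let ?q = "\<lambda>\<beta>. \<one>\<^bsub>C\<^esub> \<ominus>\<^bsub>C\<^esub> \<tau> \<beta>"
  have n: "\<beta> \<in> neutral_words G P" "\<gamma> \<in> neutral_words G P" "set bs \<subseteq> neutral_words G P"
    using Cons.prems by auto
  have q: "C.proj (?q \<beta>)" "C.proj (?q \<gamma>)" using n by (auto intro: C.proj_compl \<tau>_proj)
  have c: "?q \<beta> \<in> carrier C" "?q \<gamma> \<in> carrier C" "Q bs \<in> carrier C" using q n Q_closed by (auto simp: C.proj_def)
  show ?case
  proof (cases "\<beta> = \<gamma>")
    case True
    have "?q \<gamma> \<otimes>\<^bsub>C\<^esub> (?q \<gamma> \<otimes>\<^bsub>C\<^esub> Q bs) = ?q \<gamma> \<otimes>\<^bsub>C\<^esub> Q bs"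
      using q(2) c by (simp add: C.m_assoc[symmetric] C.proj_def)
    then show ?thesis using True by simp
  next
    case False
    then have IH: "?q \<beta> \<otimes>\<^bsub>C\<^esub> Q bs = Q bs" using Cons by auto
    have "C.commutes (?q \<beta>) (?q \<gamma>)"
      using \<tau>_commutes_compl[OF n(2,1)] n by (intro C.commutes_simps c) (auto simp: C.commutes_def neutral_iff)
    then have "?q \<beta> \<otimes>\<^bsub>C\<^esub> (?q \<gamma> \<otimes>\<^bsub>C\<^esub> Q bs) = ?q \<gamma> \<otimes>\<^bsub>C\<^esub> (?q \<beta> \<otimes>\<^bsub>C\<^esub> Q bs)"
      using c by (metis C.m_assoc C.commutes_def)
    then show ?thesis using IH by simp
  qed
qed simp

text \<open>(T4) speaks of enumerations without repetition, whereas a list accumulated along a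
  linear combination may contain a word twice.\<close>

lemma Q_remdups: "set bs \<subseteq> neutral_words G P \<Longrightarrow> Q (remdups bs) = Q bs"
  by (induction bs) (auto simp: Q_absorb)

text \<open>Each factor equals \<open>\<tau> \<alpha>\<close> times the complement of
  \<open>\<tau> \<beta>\<close>; the copies of \<open>\<tau> \<alpha>\<close> are moved to the front
  and merged by idempotence. On the empty list the left side would be the unit instead of
  \<open>\<tau> \<alpha>\<close>.\<close>

lemma \<tau>_Q_eq_foldr:
  assumes "\<alpha> \<in> neutral_words G P" "set bs \<subseteq> neutral_words G P" "bs \<noteq> []"
  shows "foldr (\<lambda>\<beta> y. (\<tau> \<alpha> \<ominus>\<^bsub>C\<^esub> \<tau> (\<alpha> @ \<beta>)) \<otimes>\<^bsub>C\<^esub> y) bs \<one>\<^bsub>C\<^esub> = \<tau> \<alpha> \<otimes>\<^bsub>C\<^esub> Q bs"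
  using assms(2,3)
proof (induction bs)
  case (Cons \<beta> bs)
  let ?q = "\<one>\<^bsub>C\<^esub> \<ominus>\<^bsub>C\<^esub> \<tau> \<beta>" and ?f = "foldr (\<lambda>\<beta> y. (\<tau> \<alpha> \<ominus>\<^bsub>C\<^esub> \<tau> (\<alpha> @ \<beta>)) \<otimes>\<^bsub>C\<^esub> y) bs \<one>\<^bsub>C\<^esub>"
  have n: "\<beta> \<in> neutral_words G P" "set bs \<subseteq> neutral_words G P" using Cons.prems by auto
  have c: "\<tau> \<alpha> \<in> carrier C" "\<tau> \<beta> \<in> carrier C" "?q \<in> carrier C" "Q bs \<in> carrier C"
    using n assms(1) Q_closed by (auto simp: neutral_iff)
  have e: "\<tau> \<alpha> \<ominus>\<^bsub>C\<^esub> \<tau> (\<alpha> @ \<beta>) = \<tau> \<alpha> \<otimes>\<^bsub>C\<^esub> ?q"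
    using n assms(1) c by (simp add: \<tau>_append neutral_iff a_minus_def C.r_distr C.r_minus)
  show ?case
  proof (cases "bs = []")
    case True
    then show ?thesis using e c by simp
  next
    case False
    then have "?f = \<tau> \<alpha> \<otimes>\<^bsub>C\<^esub> Q bs" using Cons n by simp
    then have "(\<tau> \<alpha> \<ominus>\<^bsub>C\<^esub> \<tau> (\<alpha> @ \<beta>)) \<otimes>\<^bsub>C\<^esub> ?f = \<tau> \<alpha> \<otimes>\<^bsub>C\<^esub> (?q \<otimes>\<^bsub>C\<^esub> \<tau> \<alpha>) \<otimes>\<^bsub>C\<^esub> Q bs"
      using c e by (simp add: C.m_assoc)
    also have "?q \<otimes>\<^bsub>C\<^esub> \<tau> \<alpha> = \<tau> \<alpha> \<otimes>\<^bsub>C\<^esub> ?q"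
      using \<tau>_commutes_compl[OF assms(1) n(1)] by (simp add: C.commutes_def)
    also have "\<tau> \<alpha> \<otimes>\<^bsub>C\<^esub> (\<tau> \<alpha> \<otimes>\<^bsub>C\<^esub> ?q) = \<tau> \<alpha> \<otimes>\<^bsub>C\<^esub> ?q"
      using c \<tau>_idem[OF assms(1)] by (simp add: C.m_assoc[symmetric])
    finally show ?thesis using c by (simp add: C.m_assoc)
  qed
qed simp

text \<open>A corner over the empty set vanishes. The ideals of the words
  \<open>\<alpha> @ \<beta>\<close> are the intersections with \<open>K \<alpha>\<close>, so a
  covering becomes the equality of ideals demanded by (T4); an empty list means that
  \<open>K \<alpha>\<close> is empty, which is the case of (T2).\<close>

lemma \<tau>_Q_zero:
  assumes "\<alpha> \<in> neutral_words G P" "set bs \<subseteq> neutral_words G P" "K \<alpha> \<subseteq> (\<Union>\<beta>\<in>set bs. K \<beta>)"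
  shows "\<tau> \<alpha> \<otimes>\<^bsub>C\<^esub> Q bs = \<zero>\<^bsub>C\<^esub>"
proof (cases "bs = []")
  case True
  then show ?thesis using T2[OF assms(1)] assms(3) by simp
next
  case False
  let ?r = "remdups bs"
  have "\<tau> \<alpha> \<otimes>\<^bsub>C\<^esub> Q bs = \<tau> \<alpha> \<otimes>\<^bsub>C\<^esub> Q ?r"
    using Q_remdups[OF assms(2)] by simp
  also have "\<dots> = foldr (\<lambda>\<beta> y. (\<tau> \<alpha> \<ominus>\<^bsub>C\<^esub> \<tau> (\<alpha> @ \<beta>)) \<otimes>\<^bsub>C\<^esub> y) ?r \<one>\<^bsub>C\<^esub>"
    using \<tau>_Q_eq_foldr[OF assms(1), of ?r] assms(2) False by simp
  also have "\<dots> = foldr (\<lambda>\<beta> y. (\<tau> \<alpha> \<ominus>\<^bsub>C\<^esub> \<tau> \<beta>) \<otimes>\<^bsub>C\<^esub> y) (map (\<lambda>\<beta>. \<alpha> @ \<beta>) ?r) \<one>\<^bsub>C\<^esub>"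
    by (simp add: foldr_map comp_def)
  also have "\<dots> = \<zero>\<^bsub>C\<^esub>"
  proof (rule T4[OF assms(1)])
    show "distinct (map (\<lambda>\<beta>. \<alpha> @ \<beta>) ?r)" by (simp add: distinct_map inj_on_def)
    show "set (map (\<lambda>\<beta>. \<alpha> @ \<beta>) ?r) \<subseteq> neutral_words G P"
      using assms(1,2) neutral_append by auto
    show "K \<alpha> = (\<Union>\<beta>\<in>set (map (\<lambda>\<beta>. \<alpha> @ \<beta>) ?r). K \<beta>)"
      using assms neutral_K_append[OF assms(1)] by (auto simp: subset_iff)
  qed (use False in simp)
  finally show ?thesis .
qed

definition val :: "(complex \<times> 'g list) list \<Rightarrow> 'g \<Rightarrow> complex" where
  "val xs x = (\<Sum>(c, \<alpha>)\<leftarrow>xs. if x \<in> K \<alpha> then c else 0)"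

lemma val_simps [simp]:
  "val [] x = 0"
  "val ((c, \<alpha>) # xs) x = (if x \<in> K \<alpha> then c else 0) + val xs x"
  by (simp_all add: val_def)

lemma comb_words_iff: "comb_words P xs \<longleftrightarrow> (\<forall>(c, \<alpha>)\<in>set xs. \<alpha> \<in> words P)"
  by (auto simp: comb_words_def words_set)

text \<open>The induction splits the unit as \<open>\<tau> \<alpha> + (1 - \<tau> \<alpha>)\<close> for each word in turn.\<close>

lemma neutral_norm_le:
  assumes "\<forall>(c, \<alpha>)\<in>set xs. \<alpha> \<in> neutral_words G P" "\<beta> \<in> neutral_words G P" "set bs \<subseteq> neutral_words G P" "0 \<le> M"
    and "\<And>x. \<lbrakk>x \<in> K \<beta>; x \<notin> (\<Union>\<beta>\<in>set bs. K \<beta>)\<rbrakk> \<Longrightarrow> cmod (c0 + val xs x) \<le> M"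
  shows "cnorm C ((cscale C c0 \<one>\<^bsub>C\<^esub> \<oplus>\<^bsub>C\<^esub> C.lin t xs) \<otimes>\<^bsub>C\<^esub> (\<tau> \<beta> \<otimes>\<^bsub>C\<^esub> Q bs)) \<le> M"
  using assms
proof (induction xs arbitrary: c0 \<beta> bs)
  case Nil
  have c: "\<tau> \<beta> \<in> carrier C" "Q bs \<in> carrier C" using Nil.prems Q_closed by (auto simp: neutral_iff)
  have e: "(cscale C c0 \<one>\<^bsub>C\<^esub> \<oplus>\<^bsub>C\<^esub> C.lin t []) \<otimes>\<^bsub>C\<^esub> (\<tau> \<beta> \<otimes>\<^bsub>C\<^esub> Q bs) = cscale C c0 (\<tau> \<beta> \<otimes>\<^bsub>C\<^esub> Q bs)"
    using c by (simp add: C.scale_mult_left)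
  show ?case
  \<comment> \<open>Either the corner lies over the empty set and vanishes, or it contains a point,
    at which the hypothesis bounds the remaining constant \<open>c0\<close>.\<close>
  proof (cases "K \<beta> \<subseteq> (\<Union>\<beta>\<in>set bs. K \<beta>)")
    case True
    then show ?thesis using \<tau>_Q_zero[OF Nil.prems(2,3)] Nil.prems(4) e by simp
  next
    case False
    then obtain x where "x \<in> K \<beta>" "x \<notin> (\<Union>\<beta>\<in>set bs. K \<beta>)" by blast
    then have c0: "cmod c0 \<le> M" using Nil.prems(5)[of x] by simp
    have "cnorm C (\<tau> \<beta> \<otimes>\<^bsub>C\<^esub> Q bs) \<le> cnorm C (\<tau> \<beta>) * cnorm C (Q bs)" using c by (rule C.norm_mult)
    also have "\<dots> \<le> 1 * 1"
      using C.proj_norm_le[OF \<tau>_proj[OF Nil.prems(2)]] Q_norm_le[OF Nil.prems(3)] c by (intro mult_mono) auto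
    finally have "cmod c0 * cnorm C (\<tau> \<beta> \<otimes>\<^bsub>C\<^esub> Q bs) \<le> M * 1"
      using c0 Nil.prems(4) c by (intro mult_mono) auto
    then show ?thesis unfolding e using c by (simp add: C.norm_scale)
  qed
next
  case (Cons y xs)
  obtain c \<alpha> where y: "y = (c, \<alpha>)" by (cases y)
  have n: "\<alpha> \<in> neutral_words G P" "\<forall>(c, \<alpha>)\<in>set xs. \<alpha> \<in> neutral_words G P" using Cons.prems y by auto
  have w: "comb_words P xs" using n(2) by (auto simp: comb_words_iff neutral_iff)
  let ?p = "\<tau> \<alpha>" and ?l = "C.lin t xs" and ?b = "\<tau> \<beta>" and ?Q = "Q bs"
  let ?q = "\<one>\<^bsub>C\<^esub> \<ominus>\<^bsub>C\<^esub> ?p"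
  have cl: "?p \<in> carrier C" "?l \<in> carrier C" "?b \<in> carrier C" "?Q \<in> carrier C" "?q \<in> carrier C"
    using n Cons.prems Q_closed C.lin_closed[OF t_closed w] by (auto simp: neutral_iff)
  have pj: "C.proj ?p" by (rule \<tau>_proj[OF n(1)])
  have pp: "?p \<otimes>\<^bsub>C\<^esub> ?p = ?p" using pj by (simp add: C.proj_def)
  have pq: "?p \<otimes>\<^bsub>C\<^esub> ?q = \<zero>\<^bsub>C\<^esub>"
    using cl pp by (simp add: a_minus_def C.r_distr C.r_minus C.r_neg)
  have lcomm: "C.commutes ?p ?l"
    using n(2) w
  proof (induction xs)
    case Nil
    then show ?case using cl by (auto intro: C.commutes_simps)
  next
    case (Cons z xs)
    then show ?case using n(1) cl
      by (cases z) (auto intro!: C.commutes_simps(3,5) \<tau>_commutes)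
  qed
  have bcomm: "C.commutes ?p ?b" "C.commutes ?p ?Q"
    using \<tau>_commutes[OF n(1) Cons.prems(2)] Q_commutes[OF n(1) Cons.prems(3)] by auto
  let ?y = "cscale C c0 \<one>\<^bsub>C\<^esub> \<oplus>\<^bsub>C\<^esub> (cscale C c ?p \<oplus>\<^bsub>C\<^esub> ?l)"
  let ?w = "?y \<otimes>\<^bsub>C\<^esub> (?b \<otimes>\<^bsub>C\<^esub> ?Q)"
  have yc: "?y \<in> carrier C" using cl by simp
  have wcomm: "C.commutes ?p ?w"
  proof -
    have "C.commutes ?p ?p" using cl by (simp add: C.commutes_def)
    then show ?thesis using lcomm bcomm by (intro C.commutes_simps cl)
  qed
  \<comment> \<open>On the corner of \<open>\<tau> \<alpha>\<close> the word acts as the unit, so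
    its coefficient joins the constant \<open>c0\<close>; on the complementary corner it disappears.
    The bookkeeping is the same as for the function \<open>val\<close>.\<close>
  have yp: "?y \<otimes>\<^bsub>C\<^esub> ?p = (cscale C (c0 + c) \<one>\<^bsub>C\<^esub> \<oplus>\<^bsub>C\<^esub> ?l) \<otimes>\<^bsub>C\<^esub> ?p"
    using cl pp by (simp add: C.l_distr C.scale_mult_left C.scale_add_left C.a_assoc)
  have yq: "?y \<otimes>\<^bsub>C\<^esub> ?q = (cscale C c0 \<one>\<^bsub>C\<^esub> \<oplus>\<^bsub>C\<^esub> ?l) \<otimes>\<^bsub>C\<^esub> ?q"
    using cl pq by (simp add: C.l_distr C.scale_mult_left)
  have "?w \<otimes>\<^bsub>C\<^esub> ?p = ?y \<otimes>\<^bsub>C\<^esub> ?p \<otimes>\<^bsub>C\<^esub> (?b \<otimes>\<^bsub>C\<^esub> ?Q)"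
  proof -
    have "C.commutes ?p (?b \<otimes>\<^bsub>C\<^esub> ?Q)" using bcomm by (intro C.commutes_simps cl)
    then have "(?b \<otimes>\<^bsub>C\<^esub> ?Q) \<otimes>\<^bsub>C\<^esub> ?p = ?p \<otimes>\<^bsub>C\<^esub> (?b \<otimes>\<^bsub>C\<^esub> ?Q)" by (simp add: C.commutes_def)
    then show ?thesis using yc cl by (simp only: C.m_assoc C.m_closed)
  qed
  also have "\<dots> = (cscale C (c0 + c) \<one>\<^bsub>C\<^esub> \<oplus>\<^bsub>C\<^esub> ?l) \<otimes>\<^bsub>C\<^esub> (\<tau> (\<alpha> @ \<beta>) \<otimes>\<^bsub>C\<^esub> ?Q)"
    unfolding yp using cl n(1) Cons.prems(2) by (simp add: \<tau>_append neutral_iff C.m_assoc)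
  finally have e1: "?w \<otimes>\<^bsub>C\<^esub> ?p = (cscale C (c0 + c) \<one>\<^bsub>C\<^esub> \<oplus>\<^bsub>C\<^esub> ?l) \<otimes>\<^bsub>C\<^esub> (\<tau> (\<alpha> @ \<beta>) \<otimes>\<^bsub>C\<^esub> ?Q)" .
  have "cmod (c0 + c + val xs x) \<le> M" if "x \<in> K (\<alpha> @ \<beta>)" "x \<notin> (\<Union>\<beta>\<in>set bs. K \<beta>)" for x
    using Cons.prems(5)[of x] that neutral_K_append[OF n(1) Cons.prems(2)] by (auto simp: y add.assoc)
  then have wp: "cnorm C (?w \<otimes>\<^bsub>C\<^esub> ?p) \<le> M"
    unfolding e1 using Cons.prems n by (intro Cons.IH neutral_append) auto
  have "?w \<otimes>\<^bsub>C\<^esub> ?q = ?y \<otimes>\<^bsub>C\<^esub> ?q \<otimes>\<^bsub>C\<^esub> (?b \<otimes>\<^bsub>C\<^esub> ?Q)"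
  proof -
    have "C.commutes ?q (?b \<otimes>\<^bsub>C\<^esub> ?Q)"
    proof -
      have "C.commutes ?p (?b \<otimes>\<^bsub>C\<^esub> ?Q)" using bcomm by (intro C.commutes_simps cl)
      then show ?thesis using cl
        by (auto simp: C.commutes_def a_minus_def C.l_distr C.r_distr C.l_minus C.r_minus)
    qed
    then have "(?b \<otimes>\<^bsub>C\<^esub> ?Q) \<otimes>\<^bsub>C\<^esub> ?q = ?q \<otimes>\<^bsub>C\<^esub> (?b \<otimes>\<^bsub>C\<^esub> ?Q)" by (simp add: C.commutes_def)
    then show ?thesis using yc cl by (simp only: C.m_assoc C.m_closed)
  qed
  also have "\<dots> = (cscale C c0 \<one>\<^bsub>C\<^esub> \<oplus>\<^bsub>C\<^esub> ?l) \<otimes>\<^bsub>C\<^esub> (?b \<otimes>\<^bsub>C\<^esub> Q (\<alpha> # bs))"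
  proof -
    have "?q \<otimes>\<^bsub>C\<^esub> ?b = ?b \<otimes>\<^bsub>C\<^esub> ?q"
      using \<tau>_commutes_compl[OF Cons.prems(2) n(1)] by (simp add: C.commutes_def)
    then have "?q \<otimes>\<^bsub>C\<^esub> (?b \<otimes>\<^bsub>C\<^esub> ?Q) = ?b \<otimes>\<^bsub>C\<^esub> (?q \<otimes>\<^bsub>C\<^esub> ?Q)"
      using cl by (simp add: C.m_assoc[symmetric])
    then show ?thesis unfolding yq using cl by (simp add: C.m_assoc)
  qed
  finally have e2: "?w \<otimes>\<^bsub>C\<^esub> ?q = (cscale C c0 \<one>\<^bsub>C\<^esub> \<oplus>\<^bsub>C\<^esub> ?l) \<otimes>\<^bsub>C\<^esub> (?b \<otimes>\<^bsub>C\<^esub> Q (\<alpha> # bs))" .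
  have "cmod (c0 + val xs x) \<le> M" if "x \<in> K \<beta>" "x \<notin> (\<Union>\<beta>\<in>set (\<alpha> # bs). K \<beta>)" for x
    using Cons.prems(5)[of x] that by (auto simp: y)
  then have wq: "cnorm C (?w \<otimes>\<^bsub>C\<^esub> ?q) \<le> M"
    unfolding e2 using Cons.prems n by (intro Cons.IH) auto
  \<comment> \<open>Both corners obey the same bound \<open>M\<close>, so the power argument
    reassembles them without a factor.\<close>
  have "cnorm C ?w \<le> M"
    using wcomm by (intro C.norm_le_proj[OF pj _ _ wp wq]) (auto simp: C.commutes_def)
  then show ?case by (simp add: y)
qed

text \<open>When \<open>\<alpha>\<close> and \<open>\<beta>\<close> have the same value, translation
  by \<open>\<beta>\<close> followed by the inverse translation of \<open>\<alpha>\<close> is the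
  identity on \<open>K \<alpha> \<inter> K \<beta>\<close>. So the functions of the combinations
  multiply pointwise.\<close>

lemma val_map_word:
  assumes "\<alpha> \<in> words P" "\<forall>(d, \<beta>)\<in>set ys. \<beta> \<in> words P \<and> ev \<beta> = ev \<alpha>"
  shows "val (map (\<lambda>(d, \<beta>). (c * d, rev \<alpha> @ \<beta>)) ys) x = (if x \<in> K \<alpha> then c else 0) * val ys x"
  using assms(2)
proof (induction ys)
  case (Cons y ys)
  obtain d \<beta> where y: "y = (d, \<beta>)" by (cases y)
  have \<beta>: "\<beta> \<in> words P" "ev \<beta> = ev \<alpha>" using Cons.prems y by auto
  have "x \<in> K (rev \<alpha> @ \<beta>) \<longleftrightarrow> x \<in> K \<beta> \<and> x \<in> K \<alpha>"
    using mem_K_append[OF words_rev[OF assms(1)] \<beta>(1), of x] ev_mem_K_rev[OF assms(1), of x]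
      mem_K_carrier[of x \<beta>] \<beta>(2) by auto
  then show ?case using Cons y by (auto simp: algebra_simps)
qed simp

lemma val_append: "val (xs @ ys) x = val xs x + val ys x"
  by (simp add: val_def)

lemma val_star_mult:
  assumes "\<forall>(c, \<alpha>)\<in>set xs. \<alpha> \<in> words P \<and> ev \<alpha> = g" "\<forall>(c, \<alpha>)\<in>set ys. \<alpha> \<in> words P \<and> ev \<alpha> = g"
  shows "val (comb_mult (comb_star xs) ys) x = cnj (val xs x) * val ys x"
  using assms(1)
proof (induction xs)
  case (Cons z xs)
  obtain c \<alpha> where z: "z = (c, \<alpha>)" by (cases z)
  have "val (map (\<lambda>(d, \<beta>). (cnj c * d, rev \<alpha> @ \<beta>)) ys) x = (if x \<in> K \<alpha> then cnj c else 0) * val ys x"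
    using Cons.prems assms(2) z by (intro val_map_word) auto
  then show ?case using Cons z by (simp add: comb_star_def val_append algebra_simps)
qed (simp add: comb_star_def)

lemma neutral_star_mult:
  assumes "\<forall>(c, \<alpha>)\<in>set xs. \<alpha> \<in> words P \<and> ev \<alpha> = g" "\<forall>(c, \<alpha>)\<in>set ys. \<alpha> \<in> words P \<and> ev \<alpha> = g"
  shows "\<forall>(c, \<alpha>)\<in>set (comb_mult (comb_star xs) ys). \<alpha> \<in> neutral_words G P"
  using assms(1)
proof (induction xs)
  case (Cons z xs)
  obtain c \<alpha> where z: "z = (c, \<alpha>)" by (cases z)
  have "rev \<alpha> @ \<beta> \<in> neutral_words G P" if "(d, \<beta>) \<in> set ys" for d \<beta>
  proof -
    have "\<beta> \<in> words P" "ev \<beta> = g" "\<alpha> \<in> words P" "ev \<alpha> = g" using that Cons.prems assms(2) z by auto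
    then show ?thesis by (simp add: neutral_iff ev_append ev_rev) (metis ev_closed l_inv)
  qed
  then show ?case using Cons z by (auto simp: comb_star_def)
qed (simp add: comb_star_def)

text \<open>For words over one \<open>g\<close>, the adjoint times the combination is a combination
  of neutral words whose function is the squared modulus of \<open>val xs\<close>. The estimate for
  neutral words with the bound \<open>M\<^sup>2\<close> then gives the claim by the
  C*-identity.\<close>

lemma lin_norm_le:
  assumes "\<forall>(c, \<alpha>)\<in>set xs. \<alpha> \<in> words P \<and> ev \<alpha> = g" "0 \<le> M" "\<And>x. x \<in> P \<Longrightarrow> cmod (val xs x) \<le> M"
  shows "cnorm C (C.lin t xs) \<le> M"
proof -
  let ?ys = "comb_mult (comb_star xs) xs"
  have w: "comb_words P xs" using assms(1) by (auto simp: comb_words_iff)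
  note z = C.lin_closed[OF t_closed w]
  have ys: "C.lin t ?ys = star C (C.lin t xs) \<otimes>\<^bsub>C\<^esub> C.lin t xs" "comb_words P ?ys"
    using C.lin_star[OF t_closed w] C.lin_mult[OF t_closed _ w, of "comb_star xs"] by auto
  \<comment> \<open>The trivial start of the induction: constant 0, and the empty word and empty
    list, whose factors are the unit.\<close>
  have "cnorm C ((cscale C 0 \<one>\<^bsub>C\<^esub> \<oplus>\<^bsub>C\<^esub> C.lin t ?ys) \<otimes>\<^bsub>C\<^esub> (\<tau> [] \<otimes>\<^bsub>C\<^esub> Q [])) \<le> M\<^sup>2"
  proof (rule neutral_norm_le[OF neutral_star_mult[OF assms(1,1)]])
    fix x assume "x \<in> K []"
    then have "cmod (val xs x) \<le> M" using assms(3) by simp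
    then have "(cmod (val xs x))\<^sup>2 \<le> M\<^sup>2" by (intro power_mono) auto
    then show "cmod (0 + val ?ys x) \<le> M\<^sup>2"
      by (simp add: val_star_mult[OF assms(1,1)] norm_mult power2_eq_square)
  qed (auto simp: neutral_iff)
  then have "(cnorm C (C.lin t xs))\<^sup>2 \<le> M\<^sup>2"
    using ys z by (simp add: C.norm_star_mult)
  then show ?thesis using assms(2) by (rule power2_le_imp_le)
qed

end

section \<open>The universal Toeplitz algebra and the full cross-sectional algebra\<close>

lemma (in star_hom) hom_monomial_value:
  assumes "t ` X \<subseteq> carrier A" "w \<in> lists (X \<times> UNIV)"
  shows "h (monomial_value A t w) = monomial_value B (\<lambda>x. h (t x)) w"
  using assms(2)
proof (induction w rule: list.induct)
  case (Cons l w)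
  obtain p b where l: "l = (p, b)" by (cases l)
  have "t p \<in> carrier A" "monomial_value A t w \<in> carrier A"
    using Cons.prems l assms(1) A.monomial_value_closed[OF assms(1), of w] by auto
  then show ?case using Cons l by (auto simp: monomial_value_def hom_mult hom_star)
qed (simp add: monomial_value_def hom_one)

lemma monomial_value_free: "monomial_value (free_star_algebra X) free_gen w = monomial w"
proof (induction w)
  case (Cons l w)
  obtain p b where l: "l = (p, b)" by (cases l)
  have "monomial_value (free_star_algebra X) free_gen (l # w) =
    (if b then star (free_star_algebra X) (free_gen p) else free_gen p) \<otimes>\<^bsub>free_star_algebra X\<^esub>
      monomial_value (free_star_algebra X) free_gen w"
    by (simp add: monomial_value_def l)
  also have "\<dots> = monomial [l] \<otimes>\<^bsub>free_star_algebra X\<^esub> monomial w"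
    unfolding Cons.IH free_gen_monomial monomial_star by (simp add: l)
  finally show ?case by (simp only: monomial_mult) simp
qed (simp add: monomial_value_def free_one)

section \<open>The sections attached to words satisfy the Toeplitz relations\<close>

context submonoid_of_group
begin

definition sgen :: "'g \<Rightarrow> 'g \<Rightarrow> 'g \<Rightarrow> complex" where
  "sgen p = delta (char_fun P (p <# P)) p"

text \<open>The reversal appears because the coefficient over \<open>ev \<alpha>\<close> must be
  supported on the range of the partial translation, not on its domain
  \<open>K \<alpha>\<close>.\<close>

definition wsec :: "'g list \<Rightarrow> 'g \<Rightarrow> 'g \<Rightarrow> complex" where
  "wsec \<alpha> = delta (char_fun P (K (rev \<alpha>))) (ev \<alpha>)"

lemma wsec_closed [simp, intro]:
  assumes "\<alpha> \<in> words P"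
  shows "wsec \<alpha> \<in> carrier Sec"
proof -
  have "rev \<alpha> \<in> words_over G P (inv (ev \<alpha>))" using assms by (simp add: words_over_def ev_rev)
  then show ?thesis using assms unfolding wsec_def by (intro delta_closed fib_char) auto
qed

text \<open>On functions the section acts as the partial translation of the word, moving functions
  from \<open>K \<alpha>\<close> to \<open>K (rev \<alpha>)\<close>; for a single generator this is
  left translation by it.\<close>

lemma act_wsec:
  assumes "\<alpha> \<in> words P" "x \<in> P"
  shows "act (wsec \<alpha>) u x = (if x \<in> K (rev \<alpha>) then u (ev (rev \<alpha>) \<otimes> x) else 0)"
proof -
  have "x \<in> K (rev \<alpha>) \<Longrightarrow> ev (rev \<alpha>) \<otimes> x \<in> P"
    using ev_mem_K_rev[of "rev \<alpha>" x] assms mem_K_carrier by auto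
  then show ?thesis
    using assms by (auto simp: wsec_def act_delta_section char_fun_def ev_rev)
qed

lemma wsec_mult:
  assumes "\<alpha> \<in> words P" "\<beta> \<in> words P"
  shows "wsec \<alpha> \<otimes>\<^bsub>Sec\<^esub> wsec \<beta> = wsec (\<alpha> @ \<beta>)"
proof (rule act_eqI)
  fix u x assume x: "x \<in> P"
  have "x \<in> K (rev \<alpha>) \<Longrightarrow> ev (rev \<alpha>) \<otimes> x \<in> P"
    using ev_mem_K_rev[of "rev \<alpha>" x] assms mem_K_carrier x by auto
  then show "act (wsec \<alpha> \<otimes>\<^bsub>Sec\<^esub> wsec \<beta>) u x = act (wsec (\<alpha> @ \<beta>)) u x"
    using assms x by (auto simp: act_mult act_wsec mem_K_append ev_append m_assoc)
qed (use assms in auto)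

lemma wsec_star:
  assumes "\<alpha> \<in> words P"
  shows "star Sec (wsec \<alpha>) = wsec (rev \<alpha>)"
proof -
  have "(\<lambda>x\<in>P. if ev \<alpha> \<otimes> x \<in> P then cnj (char_fun P (K (rev \<alpha>)) (ev \<alpha> \<otimes> x)) else 0) = char_fun P (K \<alpha>)"
    using assms ev_mem_K_rev[OF assms] mem_K_carrier[of _ "rev \<alpha>"] by (auto simp: char_fun_def fun_eq_iff)
  then show ?thesis using assms by (simp add: wsec_def delta_star ev_rev)
qed

lemma sgen_wsec:
  assumes "p \<in> P"
  shows "sgen p = wsec [\<one>, p]"
proof -
  have "x \<in> p <# P \<longleftrightarrow> x \<in> K [p, \<one>]" if "x \<in> P" for x
    using that assms by (subst mem_l_coset_iff[OF is_group _ P_sub]) (auto simp: mem_K_Cons)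
  then have "char_fun P (p <# P) = char_fun P (K [p, \<one>])" by (auto simp: char_fun_def fun_eq_iff)
  then show ?thesis using assms by (simp add: sgen_def wsec_def)
qed

lemma sgen_closed: "sgen ` P \<subseteq> carrier Sec"
  using sgen_wsec by auto

lemma word_star_eval_Sec:
  assumes "\<And>p. p \<in> P \<Longrightarrow> w p = sgen p" "\<alpha> \<in> words P"
  shows "word_star_eval Sec w \<alpha> = wsec \<alpha>"
  using assms(2)
proof (induction rule: words_induct)
  case Nil
  show ?case by (simp add: wsec_def Sec_one char_fun_def cong: restrict_cong)
next
  case (Cons p q \<alpha>)
  have "word_star_eval Sec w (p # q # \<alpha>) = star Sec (wsec [\<one>, p]) \<otimes>\<^bsub>Sec\<^esub> wsec [\<one>, q] \<otimes>\<^bsub>Sec\<^esub> wsec \<alpha>"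
    using Cons assms(1) sgen_wsec by simp
  also have "star Sec (wsec [\<one>, p]) \<otimes>\<^bsub>Sec\<^esub> wsec [\<one>, q] = wsec [p, \<one>, \<one>, q]"
    using Cons by (simp add: wsec_star wsec_mult)
  \<comment> \<open>The padding units meet in the middle and cancel; the extra condition they
    impose, that translation by \<open>q\<close> stays in \<open>P\<close>, holds anyway.\<close>
  also have "\<dots> = wsec [p, q]"
    by (rule act_eqI) (use Cons in \<open>auto simp: act_wsec mem_K_Cons m_assoc\<close>)
  also have "\<dots> \<otimes>\<^bsub>Sec\<^esub> wsec \<alpha> = wsec (p # q # \<alpha>)"
    using Cons by (simp add: wsec_mult)
  finally show ?case .
qed

lemma act_zero: "act \<zero>\<^bsub>Sec\<^esub> u x = 0"
proof -
  have "supp \<zero>\<^bsub>Sec\<^esub> = {}" by (auto simp: supp_def' Sec_zero)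
  then show ?thesis by (simp add: act_def)
qed

lemma act_diff:
  "\<lbrakk>f \<in> carrier Sec; h \<in> carrier Sec; x \<in> P\<rbrakk> \<Longrightarrow> act (f \<ominus>\<^bsub>Sec\<^esub> h) u x = act f u x - act h u x"
  by (simp add: Sec.diff_eq act_add act_scale)

lemma act_wsec_neutral:
  assumes "\<alpha> \<in> neutral_words G P" "x \<in> P"
  shows "act (wsec \<alpha>) u x = (if x \<in> K \<alpha> then u x else 0)"
proof -
  have a: "\<alpha> \<in> words P" "ev \<alpha> = \<one>" using assms(1) by (auto simp: words_over_def)
  have "x \<in> K (rev \<alpha>) \<longleftrightarrow> x \<in> K \<alpha>" using ev_mem_K_rev[OF a(1), of x] a(2) assms(2) by simp
  then show ?thesis using a assms(2) by (simp add: act_wsec ev_rev)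
qed

lemma Sec_eq_zeroI: "\<lbrakk>f \<in> carrier Sec; \<And>u x. x \<in> P \<Longrightarrow> act f u x = 0\<rbrakk> \<Longrightarrow> f = \<zero>\<^bsub>Sec\<^esub>"
  by (rule act_eqI) (simp_all add: act_zero)

text \<open>Neutral words act as multiplication by the characteristic functions of their ideals, so
  every relation can be tested at each point \<open>x\<close>. In (T4) some factor vanishes at
  \<open>x\<close>: one with \<open>x \<in> K \<beta>\<close> when
  \<open>x \<in> K \<alpha>\<close>, and any factor otherwise.\<close>

lemma Sec_relators:
  assumes w: "\<And>p. p \<in> P \<Longrightarrow> w p = sgen p"
  shows "toeplitz_relators G P Sec w \<subseteq> {\<zero>\<^bsub>Sec\<^esub>}"
proof -
  let ?E = "word_star_eval Sec w"
  have E: "?E \<alpha> = wsec \<alpha>" "wsec \<alpha> \<in> carrier Sec" if "\<alpha> \<in> neutral_words G P" for \<alpha>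
    using that word_star_eval_Sec[OF w] by (auto simp: words_over_def)
  have eq1: "w \<one> \<ominus>\<^bsub>Sec\<^esub> \<one>\<^bsub>Sec\<^esub> = \<zero>\<^bsub>Sec\<^esub>"
    by (rule Sec_eq_zeroI) (auto simp: w sgen_wsec act_diff act_one act_wsec mem_K_Cons)
  have eq2: "?E \<alpha> = \<zero>\<^bsub>Sec\<^esub>" if "\<alpha> \<in> neutral_words G P" "K \<alpha> = {}" for \<alpha>
    using that E[OF that(1)] by (intro Sec_eq_zeroI) (auto simp: act_wsec_neutral)
  have eq3: "?E \<alpha> \<ominus>\<^bsub>Sec\<^esub> ?E \<beta> = \<zero>\<^bsub>Sec\<^esub>"
    if "\<alpha> \<in> neutral_words G P" "\<beta> \<in> neutral_words G P" "K \<alpha> = K \<beta>" for \<alpha> \<beta>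
    using that E[OF that(1)] E[OF that(2)]
    by (intro Sec_eq_zeroI) (auto simp: act_wsec_neutral act_diff)
  have eq4: "foldr (\<lambda>\<beta> x. (?E \<alpha> \<ominus>\<^bsub>Sec\<^esub> ?E \<beta>) \<otimes>\<^bsub>Sec\<^esub> x) F \<one>\<^bsub>Sec\<^esub> = \<zero>\<^bsub>Sec\<^esub>"
    if a: "\<alpha> \<in> neutral_words G P" "F \<noteq> []" "set F \<subseteq> neutral_words G P" "K \<alpha> = (\<Union>\<beta>\<in>set F. K \<beta>)" for \<alpha> F
  proof -
    define d where "d \<beta> x = (if x \<in> K \<alpha> then 1 else 0) - (if x \<in> K \<beta> then 1 else (0::complex))" for \<beta> x
    have *: "foldr (\<lambda>\<beta> x. (?E \<alpha> \<ominus>\<^bsub>Sec\<^esub> ?E \<beta>) \<otimes>\<^bsub>Sec\<^esub> x) F \<one>\<^bsub>Sec\<^esub> \<in> carrier Sec \<and>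
      (\<forall>u. \<forall>x\<in>P. act (foldr (\<lambda>\<beta> x. (?E \<alpha> \<ominus>\<^bsub>Sec\<^esub> ?E \<beta>) \<otimes>\<^bsub>Sec\<^esub> x) F \<one>\<^bsub>Sec\<^esub>) u x = prod_list (map (\<lambda>\<beta>. d \<beta> x) F) * u x)"
      if "set F \<subseteq> neutral_words G P" for F
      using that
    proof (induction F)
      case Nil
      then show ?case by (simp add: act_one)
    next
      case (Cons \<beta> F)
      have b: "\<beta> \<in> neutral_words G P" using Cons.prems by simp
      have c: "?E \<alpha> \<ominus>\<^bsub>Sec\<^esub> ?E \<beta> \<in> carrier Sec" using E[OF a(1)] E[OF b] by simp
      have "act (?E \<alpha> \<ominus>\<^bsub>Sec\<^esub> ?E \<beta>) u x = d \<beta> x * u x" if "x \<in> P" for u x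
        using that a(1) b E[OF a(1)] E[OF b] by (simp add: act_diff act_wsec_neutral d_def)
      then show ?case using Cons c by (simp add: act_mult)
    qed
    have "prod_list (map (\<lambda>\<beta>. d \<beta> x) F) = 0" for x
    proof -
      have "\<exists>\<beta>\<in>set F. d \<beta> x = 0"
      proof (cases "x \<in> K \<alpha>")
        case True
        then show ?thesis using a(4) by (auto simp: d_def)
      next
        case False
        \<comment> \<open>Outside \<open>K \<alpha>\<close> all factors vanish; the first one exists
          because \<open>F\<close> is nonempty.\<close>
        then have "d (hd F) x = 0" using a(2,4) by (auto simp: d_def)
        then show ?thesis using a(2) by (meson hd_in_set)
      qed
      then show ?thesis by (auto simp: prod_list_zero_iff image_iff)
    qed
    then show ?thesis using *[OF a(3)] by (intro Sec_eq_zeroI) auto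
  qed
  show ?thesis
    unfolding toeplitz_relators_image insert_subset Un_subset_iff image_subset_iff
  proof (intro conjI ballI, goal_cases)
    case 1
    show ?case using eq1 by simp
  next
    case (2 x)
    then show ?case using eq2 by simp
  next
    case (3 x)
    obtain \<alpha> \<beta> where "x = (\<alpha>, \<beta>)" by (cases x)
    then show ?case using 3 eq3[of \<alpha> \<beta>] by simp
  next
    case (4 x)
    obtain \<alpha> F where "x = (\<alpha>, F)" by (cases x)
    then show ?case using 4 eq4[of \<alpha> F] by simp
  qed
qed

section \<open>From the free *-algebra to sections, and the finiteness of both seminorms\<close>

abbreviation "FA \<equiv> free_star_algebra P"
abbreviation "Rels \<equiv> toeplitz_relators G P (free_star_algebra P) free_gen"
abbreviation "\<nu>F \<equiv> max_cstar_seminorm (free_star_algebra P) (toeplitz_relators G P (free_star_algebra P) free_gen)"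
abbreviation "\<nu>B \<equiv> max_cstar_seminorm (sections_fin G (canonical_bundle G P)) {}"
abbreviation "\<Phi> \<equiv> free_eval (sections_fin G (canonical_bundle G P)) sgen"

lemma Phi_hom: "star_hom FA Sec \<Phi>"
  by (rule Sec.free_eval_hom[OF sgen_closed])

lemma free_gen_sub: "free_gen ` P \<subseteq> carrier FA"
  by (intro image_subsetI free_gen_carrier)

lemma Phi_gen: "p \<in> P \<Longrightarrow> \<Phi> (free_gen p) = sgen p"
  by (rule Sec.free_eval_gen[OF sgen_closed])

lemma Phi_relators:
  assumes "r \<in> Rels"
  shows "\<Phi> r = \<zero>\<^bsub>Sec\<^esub>"
proof -
  have "\<Phi> r \<in> toeplitz_relators G P Sec (\<lambda>p. \<Phi> (free_gen p))"
    unfolding star_hom.hom_toeplitz_relators(1)[OF Phi_hom free_gen_sub one_P]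
    using assms by (rule imageI)
  then show ?thesis using Sec_relators[of "\<lambda>p. \<Phi> (free_gen p)", OF Phi_gen] by auto
qed

lemma Rels_sub: "Rels \<subseteq> carrier FA"
  by (rule star_hom.hom_toeplitz_relators(2)[OF Phi_hom free_gen_sub one_P])

text \<open>The generators are forced to be isometries, so a monomial has seminorm at most 1, and an
  arbitrary polynomial is bounded by the moduli of its coefficients, uniformly in the
  seminorm.\<close>

lemma free_seminorm_bounded:
  assumes "x \<in> carrier FA"
  shows "\<exists>M. \<forall>\<nu>. cstar_seminorm FA \<nu> \<and> (\<forall>r\<in>Rels. \<nu> r = 0) \<longrightarrow> \<nu> x \<le> M"
  using assms
proof (induction rule: free_induct)
  case zero
  show ?case
  proof (intro exI allI impI)
    fix \<nu> assume \<nu>: "cstar_seminorm FA \<nu> \<and> (\<forall>r\<in>Rels. \<nu> r = 0)"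
    interpret N: cstar_seminormed_alg FA \<nu> using star_alg.cstar_seminormedI[OF free_star_algebra] \<nu> by blast
    show "\<nu> \<zero>\<^bsub>FA\<^esub> \<le> 0" using N.norm_zero by (simp del: free_ops)
  qed
next
  case (add x y)
  then obtain M N where "\<forall>\<nu>. cstar_seminorm FA \<nu> \<and> (\<forall>r\<in>Rels. \<nu> r = 0) \<longrightarrow> \<nu> x \<le> M"
    "\<forall>\<nu>. cstar_seminorm FA \<nu> \<and> (\<forall>r\<in>Rels. \<nu> r = 0) \<longrightarrow> \<nu> y \<le> N" by blast
  then have MN: "\<nu> x \<le> M" "\<nu> y \<le> N" if "cstar_seminorm FA \<nu> \<and> (\<forall>r\<in>Rels. \<nu> r = 0)" for \<nu>
    using that by auto
  have "\<nu> (x \<oplus>\<^bsub>FA\<^esub> y) \<le> M + N" if \<nu>: "cstar_seminorm FA \<nu> \<and> (\<forall>r\<in>Rels. \<nu> r = 0)" for \<nu>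
  proof -
    have "\<nu> (x \<oplus>\<^bsub>FA\<^esub> y) \<le> \<nu> x + \<nu> y" using \<nu> add(1,2) unfolding cstar_seminorm_def by blast
    then show ?thesis using MN[OF \<nu>] by linarith
  qed
  then show ?case by blast
next
  case (scale c x)
  then obtain M where "\<forall>\<nu>. cstar_seminorm FA \<nu> \<and> (\<forall>r\<in>Rels. \<nu> r = 0) \<longrightarrow> \<nu> x \<le> M" by blast
  then have M: "\<nu> x \<le> M" if "cstar_seminorm FA \<nu> \<and> (\<forall>r\<in>Rels. \<nu> r = 0)" for \<nu>
    using that by auto
  have "\<nu> (cscale FA c x) \<le> cmod c * M" if \<nu>: "cstar_seminorm FA \<nu> \<and> (\<forall>r\<in>Rels. \<nu> r = 0)" for \<nu>
  proof -
    have "\<nu> (cscale FA c x) = cmod c * \<nu> x" using \<nu> scale(1) unfolding cstar_seminorm_def by blast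
    then show ?thesis using M[OF \<nu>] by (simp add: mult_left_mono)
  qed
  then show ?case by blast
next
  case (monomial w)
  show ?case
  proof (intro exI allI impI)
    fix \<nu> assume \<nu>: "cstar_seminorm FA \<nu> \<and> (\<forall>r\<in>Rels. \<nu> r = 0)"
    interpret N: cstar_seminormed_alg FA \<nu> using star_alg.cstar_seminormedI[OF free_star_algebra] \<nu> by blast
    have gen: "\<nu> (free_gen p) \<le> 1" if p: "p \<in> P" for p
    proof -
      let ?E = "word_star_eval FA free_gen"
      note g = free_gen_carrier[OF p]
      \<comment> \<open>The words \<open>[p, p]\<close> and \<open>[]\<close> are neutral with ideal
        \<open>P\<close>, so (T3) identifies the product of the adjoint generator with the generator
        and the unit.\<close>
      have "[p, p] \<in> neutral_words G P" "[] \<in> neutral_words G P" "K [p, p] = K []"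
        using p by (auto simp: words_over_def mem_K_Cons)
      then have "?E [p, p] \<ominus>\<^bsub>FA\<^esub> ?E [] \<in> Rels"
        unfolding toeplitz_relators_def by blast
      then have "\<nu> (?E [p, p] \<ominus>\<^bsub>FA\<^esub> ?E []) = 0" using \<nu> by blast
      moreover have "?E [p, p] = star FA (free_gen p) \<otimes>\<^bsub>FA\<^esub> free_gen p" "?E [] = \<one>\<^bsub>FA\<^esub>"
        using g by (simp_all del: free_ops)
      moreover have "\<nu> (star FA (free_gen p) \<otimes>\<^bsub>FA\<^esub> free_gen p) \<le>
          \<nu> \<one>\<^bsub>FA\<^esub> + \<nu> (star FA (free_gen p) \<otimes>\<^bsub>FA\<^esub> free_gen p \<ominus>\<^bsub>FA\<^esub> \<one>\<^bsub>FA\<^esub>)"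
        using g by (intro N.norm_triangle_diff) (auto simp del: free_ops)
      ultimately have "(\<nu> (free_gen p))\<^sup>2 \<le> 1"
        using N.norm_star_mult[OF g] N.norm_one_le by simp
      then show ?thesis by (simp add: abs_square_le_1 abs_le_iff)
    qed
    show "\<nu> (monomial w) \<le> 1"
      using monomial
    proof (induction w rule: list.induct)
      case Nil
      then show ?case using N.norm_one_le by (simp add: free_one)
    next
      case (Cons l w)
      obtain p b where l: "l = (p, b)" by (cases l)
      have p: "p \<in> P" and w: "w \<in> lists (P \<times> UNIV)" using Cons.prems l by auto
      have "monomial [l] = (if b then star FA (free_gen p) else free_gen p)"
        unfolding l free_gen_monomial monomial_star by simp
      then have "\<nu> (monomial [l]) \<le> 1" using gen[OF p] N.norm_star[OF free_gen_carrier[OF p]] by auto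
      moreover have m: "monomial [l] \<in> carrier FA" "monomial w \<in> carrier FA"
        using Cons.prems w by (auto simp: monomial_carrier)
      ultimately have "\<nu> (monomial [l]) * \<nu> (monomial w) \<le> 1 * 1"
        using Cons.IH[OF w] by (intro mult_mono) auto
      moreover have "\<nu> (monomial (l # w)) \<le> \<nu> (monomial [l]) * \<nu> (monomial w)"
        using N.norm_mult[OF m] by (simp only: monomial_mult) simp
      ultimately show ?case by linarith
    qed
  qed
qed

lemma Sec_seminorm_bounded:
  "x \<in> carrier Sec \<Longrightarrow> \<exists>M. \<forall>\<nu>. cstar_seminorm Sec \<nu> \<and> (\<forall>r\<in>{}. \<nu> r = 0) \<longrightarrow> \<nu> x \<le> M"
  using cstar_seminorm_le_norm1 by blast

lemma nuF_cstar: "cstar_seminorm FA \<nu>F"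
  by (rule star_alg.max_cstar_seminorm_cstar[OF free_star_algebra free_seminorm_bounded])

lemma nuB_cstar: "cstar_seminorm Sec \<nu>B"
  by (rule Sec.max_cstar_seminorm_cstar[OF Sec_seminorm_bounded])

lemma nuF_relators:
  assumes "r \<in> Rels"
  shows "\<nu>F r = 0"
proof (rule antisym)
  show "\<nu>F r \<le> 0" using assms by (intro max_cstar_seminorm_least) auto
  show "0 \<le> \<nu>F r" using nuF_cstar Rels_sub assms unfolding cstar_seminorm_def by blast
qed

sublocale FA: cstar_seminormed_alg FA \<nu>F
  by (rule star_alg.cstar_seminormedI[OF free_star_algebra nuF_cstar])

sublocale SB: cstar_seminormed_alg Sec \<nu>B
  by (rule Sec.cstar_seminormedI[OF nuB_cstar])

sublocale Phi: star_hom FA Sec \<Phi>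
  by (rule Phi_hom)

text \<open>A C*-seminorm on sections pulled back along \<open>\<Phi>\<close> vanishes on the
  relators, hence takes part in the supremum defining \<open>\<nu>F\<close>.\<close>

lemma nuB_Phi_le:
  assumes "x \<in> carrier FA"
  shows "\<nu>B (\<Phi> x) \<le> \<nu>F x"
proof (rule max_cstar_seminorm_least)
  fix \<mu> assume \<mu>: "cstar_seminorm Sec \<mu>"
  interpret M: cstar_seminormed_alg Sec \<mu> by (rule Sec.cstar_seminormedI[OF \<mu>])
  show "\<mu> (\<Phi> x) \<le> \<nu>F x"
    by (rule max_cstar_seminorm_upper[of FA Rels "\<lambda>x. \<mu> (\<Phi> x)" x])
      (use free_seminorm_bounded Phi.cstar_seminorm_comp[OF \<mu>] Phi_relators assms in auto)
qed

abbreviation "UT \<equiv> completion (free_star_algebra P) (max_cstar_seminorm (free_star_algebra P) Rels)"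
abbreviation "ugen \<equiv> \<lambda>p. FA.emb (free_gen p)"

text \<open>In the free algebra the relators merely have seminorm zero; in the separated completion
  they are zero, as the locale asks.\<close>

lemma completion_family: "toeplitz_family G P UT ugen"
proof -
  let ?C = UT
  interpret C: banach_star_alg ?C by (rule FA.completion_banach)
  interpret e: star_hom FA ?C FA.emb by (rule FA.emb_hom)
  show ?thesis
  proof
    show "ugen ` P \<subseteq> carrier ?C"
      by (intro image_subsetI FA.emb_carrier free_gen_carrier)
    show "cnorm ?C (star ?C x \<otimes>\<^bsub>?C\<^esub> x) = (cnorm ?C x)\<^sup>2" if "x \<in> carrier ?C" for x
      using that by (intro FA.completion_cstar FA.norm_star_mult)
    have "FA.emb r = \<zero>\<^bsub>?C\<^esub>" if "r \<in> Rels" for r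
      using FA.emb_norm[of r] nuF_relators[OF that] Rels_sub that by (intro C.norm_zero_imp) auto
    then show "toeplitz_relators G P ?C ugen \<subseteq> {\<zero>\<^bsub>?C\<^esub>}"
      unfolding e.hom_toeplitz_relators(1)[OF free_gen_sub one_P] by blast
  qed
qed

lemma Phi_word: "\<alpha> \<in> words P \<Longrightarrow> \<Phi> (word_star_eval FA free_gen \<alpha>) = wsec \<alpha>"
  using Phi.hom_word_star_eval[OF free_gen_sub, of \<alpha>] word_star_eval_Sec[of "\<lambda>p. \<Phi> (free_gen p)" \<alpha>] Phi_gen
  by (simp add: words_def)

lemma sgen_one: "sgen \<one> = \<one>\<^bsub>Sec\<^esub>"
  using lcos_mult_one[OF P_sub] by (simp add: sgen_def Sec_one char_fun_def cong: restrict_cong)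

subsection \<open>The norm of a noncommutative polynomial\<close>

interpretation TF: toeplitz_family G P UT ugen
  by (rule completion_family)

text \<open>One list serves both evaluations, so the norm of the first can be compared with the
  functions given by the second. The padding of monomials into words works on both sides because
  both families send \<open>\<one>\<close> to the unit.\<close>

lemma lin_representation:
  assumes "x \<in> carrier FA"
  shows "\<exists>xs. comb_words P xs \<and> FA.emb x = TF.C.lin ugen xs \<and> \<Phi> x = Sec.lin sgen xs"
  using assms
proof (induction rule: free_induct)
  interpret e: star_hom FA UT FA.emb by (rule FA.emb_hom)
  {
    case zero
    show ?case using e.hom_zero Phi.hom_zero by (intro exI[of _ "[]"]) (simp del: free_ops)
  next
    case (add x y)
    then obtain xs ys where xs: "comb_words P xs" "FA.emb x = TF.C.lin ugen xs" "\<Phi> x = Sec.lin sgen xs"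
      and ys: "comb_words P ys" "FA.emb y = TF.C.lin ugen ys" "\<Phi> y = Sec.lin sgen ys" by blast
    show ?case
      using add(1,2) xs ys
      by (intro exI[of _ "xs @ ys"])
        (simp add: e.hom_add Phi.hom_add TF.C.lin_append[OF TF.t_closed] Sec.lin_append[OF sgen_closed] del: free_ops)
  next
    case (scale c x)
    then obtain xs where xs: "comb_words P xs" "FA.emb x = TF.C.lin ugen xs" "\<Phi> x = Sec.lin sgen xs" by blast
    show ?case
      using scale(1) xs
      by (intro exI[of _ "comb_scale c xs"])
        (simp add: e.hom_scale Phi.hom_scale TF.C.lin_scale[OF TF.t_closed] Sec.lin_scale[OF sgen_closed] del: free_ops)
  next
    case (monomial w)
    let ?\<alpha> = "free_word \<one> w"
    have \<alpha>: "set ?\<alpha> \<subseteq> P" "even (length ?\<alpha>)" using free_word_set[OF monomial one_P] by auto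
    have m: "monomial w = monomial_value FA free_gen w" by (simp add: monomial_value_free)
    have "FA.emb (monomial w) = word_star_eval UT ugen ?\<alpha>"
      unfolding m e.hom_monomial_value[OF free_gen_sub monomial]
      by (rule TF.C.monomial_value_word[OF TF.t_closed one_P TF.T1 monomial])
    moreover have "\<Phi> (monomial w) = word_star_eval Sec sgen ?\<alpha>"
      unfolding Sec.free_eval_monomial[OF sgen_closed monomial]
      by (rule Sec.monomial_value_word[OF sgen_closed one_P sgen_one monomial])
    ultimately show ?case
      using \<alpha> TF.C.word_star_eval_closed[OF TF.t_closed \<alpha>(1)] Sec.word_star_eval_closed[OF sgen_closed \<alpha>(1)]
      by (intro exI[of _ "[(1, ?\<alpha>)]"]) simp
  }
qed

text \<open>The function \<open>val\<close> lives on the domain of translation by \<open>g\<close>,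
  the fiber of the section on its range; hence the evaluation at \<open>g \<otimes> x\<close> on one
  side and at \<open>x\<close> on the other.\<close>

lemma lin_Sec_eq:
  assumes "comb_words P xs" "g \<in> carrier G" "x \<in> P" "g \<otimes> x \<in> P"
  shows "Sec.lin sgen xs g (g \<otimes> x) = TF.val (filter (\<lambda>(c, \<alpha>). ev \<alpha> = g) xs) x"
  using assms(1)
proof (induction xs)
  case Nil
  then show ?case using assms by (simp add: Sec_zero)
next
  case (Cons y xs)
  obtain c \<alpha> where y: "y = (c, \<alpha>)" by (cases y)
  have \<alpha>: "\<alpha> \<in> words P" using Cons.prems y by (auto simp: words_def)
  have "wsec \<alpha> g (g \<otimes> x) = (if ev \<alpha> = g \<and> x \<in> K \<alpha> then 1 else 0)"
    using assms ev_mem_K_rev[OF \<alpha>, of x] by (auto simp: wsec_def delta_def' char_fun_def)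
  then show ?case
    using Cons y assms word_star_eval_Sec[OF refl \<alpha>] by (auto simp: Sec_add Sec_scale)
qed

lemma filter_norm_le:
  assumes "comb_words P xs" "g \<in> carrier G" "Sec.lin sgen xs g \<in> fib g"
  shows "cnorm UT (TF.C.lin ugen (filter (\<lambda>(c, \<alpha>). ev \<alpha> = g) xs))
    \<le> supn (Sec.lin sgen xs g)"
proof (rule TF.lin_norm_le)
  show "\<forall>(c, \<alpha>)\<in>set (filter (\<lambda>(c, \<alpha>). ev \<alpha> = g) xs). \<alpha> \<in> words P \<and> ev \<alpha> = g"
    using assms(1) by (auto simp: TF.comb_words_iff)
  show nn: "0 \<le> supn (Sec.lin sgen xs g)" by (rule supn_nonneg[OF assms(3)])
  fix x assume x: "x \<in> P"
  let ?ys = "filter (\<lambda>(c, \<alpha>). ev \<alpha> = g) xs"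
  show "cmod (TF.val ?ys x) \<le> supn (Sec.lin sgen xs g)"
  proof (cases "g \<otimes> x \<in> P")
    case True
    then show ?thesis using supn_ge[OF assms(3) True] lin_Sec_eq[OF assms(1,2) x True] by simp
  next
    case False
    \<comment> \<open>The ideal of a word over \<open>g\<close> is mapped into \<open>P\<close> by
      \<open>g\<close>, so it cannot contain this \<open>x\<close>.\<close>
    have "TF.val (filter (\<lambda>(c, \<alpha>). ev \<alpha> = g) xs) x = 0"
      using assms(1)
    proof (induction xs)
      case (Cons y xs)
      obtain c \<alpha> where y: "y = (c, \<alpha>)" by (cases y)
      have "\<alpha> \<in> words P" using Cons.prems y by (auto simp: words_def)
      then have "ev \<alpha> = g \<Longrightarrow> x \<notin> K \<alpha>"
        using ev_mem_K_rev[of \<alpha> x] mem_K_carrier[of _ "rev \<alpha>"] x False by auto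
      then show ?case using Cons y by auto
    qed simp
    then show ?thesis using nn by simp
  qed
qed

lemma lin_norm_le_sum:
  assumes "comb_words P xs" "finite S" "(\<lambda>(c, \<alpha>). ev \<alpha>) ` set xs \<subseteq> S"
  shows "cnorm UT (TF.C.lin ugen xs) \<le>
    (\<Sum>g\<in>S. cnorm UT (TF.C.lin ugen (filter (\<lambda>(c, \<alpha>). ev \<alpha> = g) xs)))"
  using assms(2,1,3)
proof (induction S arbitrary: xs rule: finite_induct)
  case empty
  then show ?case by simp
next
  case (insert g S)
  let ?l = "TF.C.lin ugen" and ?N = "cnorm UT"
  let ?ys = "filter (\<lambda>(c, \<alpha>). ev \<alpha> = g) xs" and ?zs = "filter (\<lambda>(c, \<alpha>). ev \<alpha> \<noteq> g) xs"
  have w: "comb_words P ?ys" "comb_words P ?zs" using insert.prems(1) by (auto simp: comb_words_def)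
  note cl = TF.C.lin_closed[OF TF.t_closed]
  have "?l xs = ?l ?ys \<oplus>\<^bsub>UT\<^esub> ?l ?zs"
    using insert.prems(1)
  proof (induction xs)
    case (Cons y xs)
    obtain c \<alpha> where y: "y = (c, \<alpha>)" by (cases y)
    have a: "word_star_eval UT ugen \<alpha> \<in> carrier UT"
      using Cons.prems y TF.C.word_star_eval_closed[OF TF.t_closed] by auto
    have "comb_words P (filter (\<lambda>(c, \<alpha>). ev \<alpha> = g) xs)" "comb_words P (filter (\<lambda>(c, \<alpha>). ev \<alpha> \<noteq> g) xs)"
      using Cons.prems by (auto simp: comb_words_def)
    then show ?case using Cons y a cl by (auto simp: TF.C.a_ac)
  qed simp
  then have "?N (?l xs) \<le> ?N (?l ?ys) + ?N (?l ?zs)"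
    using TF.C.norm_triangle[OF cl[OF w(1)] cl[OF w(2)]] by simp
  also have "?N (?l ?zs) \<le> (\<Sum>h\<in>S. ?N (?l (filter (\<lambda>(c, \<alpha>). ev \<alpha> = h) ?zs)))"
    using insert.prems by (intro insert.IH[OF w(2)]) auto
  also have "\<dots> = (\<Sum>h\<in>S. ?N (?l (filter (\<lambda>(c, \<alpha>). ev \<alpha> = h) xs)))"
  proof (rule sum.cong[OF refl])
    fix h assume "h \<in> S"
    then have "h \<noteq> g" using insert.hyps by blast
    then have "filter (\<lambda>(c, \<alpha>). ev \<alpha> = h) ?zs = filter (\<lambda>(c, \<alpha>). ev \<alpha> = h) xs"
      by (auto intro: filter_cong)
    then show "?N (?l (filter (\<lambda>(c, \<alpha>). ev \<alpha> = h) ?zs)) = ?N (?l (filter (\<lambda>(c, \<alpha>). ev \<alpha> = h) xs))" by simp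
  qed
  finally show ?case using insert.hyps by simp
qed

text \<open>Words are grouped by their values, one group per fiber, and each group is bounded by the
  sup norm of the fiber it produces. In particular the universal seminorm vanishes on the kernel of
  \<open>\<Phi>\<close>.\<close>

lemma nuF_le_norm1:
  assumes "x \<in> carrier FA"
  shows "\<nu>F x \<le> norm1 (\<Phi> x)"
proof -
  obtain xs where xs: "comb_words P xs" "FA.emb x = TF.C.lin ugen xs" "\<Phi> x = Sec.lin sgen xs"
    using lin_representation[OF assms] by blast
  have c: "\<Phi> x \<in> carrier Sec" using assms by (rule Phi.hom_closed)
  \<comment> \<open>The values of all words are included, also those whose fibers vanish by
    cancellation; such fibers add zero to the 1-norm.\<close>
  let ?S = "(\<lambda>(c, \<alpha>). ev \<alpha>) ` set xs \<union> supp (\<Phi> x)"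
  have S: "finite ?S" "?S \<subseteq> carrier G"
    using Sec_supp[OF c] supp_carrier xs(1) by (auto simp: TF.comb_words_iff)
  have "\<nu>F x = cnorm UT (TF.C.lin ugen xs)"
    using FA.emb_norm[OF assms] xs(2) by simp
  also have "\<dots> \<le> (\<Sum>g\<in>?S. cnorm UT (TF.C.lin ugen (filter (\<lambda>(c, \<alpha>). ev \<alpha> = g) xs)))"
    by (rule lin_norm_le_sum[OF xs(1) S(1)]) blast
  also have "\<dots> \<le> (\<Sum>g\<in>?S. supn (\<Phi> x g))"
    using filter_norm_le[OF xs(1)] Sec_fib[OF c] S(2) xs(3) by (intro sum_mono) (auto simp: subset_iff)
  also have "\<dots> = norm1 (\<Phi> x)"
    using S by (intro norm1_superset[symmetric]) auto
  finally show ?thesis .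
qed

end

section \<open>Density of the polynomial sections and descent of the universal seminorm\<close>

context submonoid_of_group
begin

lemma Sec_induct [consumes 1, case_names zero delta add]:
  assumes "f \<in> carrier Sec" "Q \<zero>\<^bsub>Sec\<^esub>"
    and "\<And>g a. \<lbrakk>g \<in> carrier G; a \<in> fib g\<rbrakk> \<Longrightarrow> Q (delta a g)"
    and "\<And>f h. \<lbrakk>f \<in> carrier Sec; h \<in> carrier Sec; Q f; Q h\<rbrakk> \<Longrightarrow> Q (f \<oplus>\<^bsub>Sec\<^esub> h)"
  shows "Q f"
proof -
  have "finite S \<Longrightarrow> supp f \<subseteq> S \<Longrightarrow> S \<subseteq> carrier G \<Longrightarrow> f \<in> carrier Sec \<Longrightarrow> Q f" for S f
  proof (induction S arbitrary: f rule: finite_induct)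
    case empty
    then have "f = \<zero>\<^bsub>Sec\<^esub>" using Sec_pi[of f] by (auto simp: supp_def' Sec_zero fun_eq_iff)
    then show ?case using assms(2) by simp
  next
    case (insert g S)
    have g: "g \<in> carrier G" using insert by simp
    note fg = Sec_fib[OF insert.prems(3) g]
    define h where "h = (\<lambda>s\<in>carrier G. if s = g then (\<lambda>x\<in>P. 0) else f s)"
    have hs: "supp h \<subseteq> S" using insert.prems(1) by (auto simp: h_def supp_def' split: if_splits)
    have hc: "h \<in> carrier Sec"
      using finite_subset[OF hs insert.hyps(1)] Sec_fib[OF insert.prems(3)]
      by (auto simp: Sec_iff h_def fib_zero)
    have "f = delta (f g) g \<oplus>\<^bsub>Sec\<^esub> h"
      using Sec_pi[OF insert.prems(3)] Sec_ext[OF insert.prems(3)] g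
      by (auto simp: Sec_add delta_def' h_def fun_eq_iff PiE_def extensional_def)
    moreover have "Q (delta (f g) g \<oplus>\<^bsub>Sec\<^esub> h)"
      using insert.IH[OF hs _ hc] insert.prems assms(3)[OF g fg]
      by (intro assms(4) delta_closed g fg hc) auto
    ultimately show ?case by metis
  qed
  then show ?thesis using Sec_supp supp_carrier assms(1) by blast
qed

lemma delta_add: "g \<in> carrier G \<Longrightarrow>
    delta (\<lambda>x\<in>P. a x + b x) g = delta a g \<oplus>\<^bsub>Sec\<^esub> delta b g"
  and delta_scale: "g \<in> carrier G \<Longrightarrow>
    delta (\<lambda>x\<in>P. c * a x) g = cscale Sec c (delta a g)"
  and delta_zero: "g \<in> carrier G \<Longrightarrow> delta (\<lambda>x\<in>P. 0) g = \<zero>\<^bsub>Sec\<^esub>"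
  by (auto simp: delta_def' Sec_add Sec_scale Sec_zero fun_eq_iff)

lemma norm1_delta_le: "g \<in> carrier G \<Longrightarrow> norm1 (delta a g) \<le> supn a"
  using norm1_le[of "{g}" "delta a g" "\<lambda>_. supn a"] supp_delta by (simp add: delta_def')

lemma span_Phi:
  assumes "g \<in> carrier G" "a \<in> span g"
  shows "\<exists>x\<in>carrier FA. \<Phi> x = delta a g"
  using assms(2)
proof (induction rule: span_induct)
  case zero
  show ?case using assms(1) Phi.hom_zero FA.zero_closed by (metis delta_zero)
next
  case (base \<alpha>)
  note a = words_overD[OF base]
  have "wsec (rev \<alpha>) = delta (char_fun P (K \<alpha>)) g"
    using a assms(1) by (simp add: wsec_def ev_rev)
  moreover have "word_star_eval FA free_gen (rev \<alpha>) \<in> carrier FA"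
    using FA.word_star_eval_closed[OF free_gen_sub] a(1) by (simp add: words_def)
  ultimately show ?case using Phi_word[OF words_rev[OF a(1)]] by metis
next
  case (add a b)
  then obtain x y where "x \<in> carrier FA" "\<Phi> x = delta a g"
    "y \<in> carrier FA" "\<Phi> y = delta b g" by blast
  then show ?case unfolding delta_add[OF assms(1)]
    by (intro bexI[of _ "x \<oplus>\<^bsub>FA\<^esub> y"]) (simp_all add: Phi.hom_add del: free_ops)
next
  case (scale a c)
  then obtain x where "x \<in> carrier FA" "\<Phi> x = delta a g" by blast
  then show ?case unfolding delta_scale[OF assms(1)]
    by (intro bexI[of _ "cscale FA c x"]) (simp_all add: Phi.hom_scale del: free_ops)
qed

text \<open>The image of \<open>\<Phi>\<close> contains the algebraic spans in all fibers. These are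
  uniformly dense, and a finitely supported section needs only finitely many approximations.\<close>

lemma Phi_dense:
  assumes "f \<in> carrier Sec" "\<epsilon> > 0"
  shows "\<exists>x\<in>carrier FA. norm1 (f \<ominus>\<^bsub>Sec\<^esub> \<Phi> x) < \<epsilon>"
  using assms
proof (induction arbitrary: \<epsilon> rule: Sec_induct)
  case zero
  then show ?case by (intro bexI[of _ "\<zero>\<^bsub>FA\<^esub>"]) (simp_all add: Phi.hom_zero Sec1.norm_zero del: free_ops)
next
  case (delta g a)
  obtain h where h: "h \<in> span g" "\<forall>x\<in>P. cmod (a x - h x) \<le> \<epsilon> / 2"
    using delta(2,3) half_gt_zero unfolding fib_iff by blast
  obtain x where x: "x \<in> carrier FA" "\<Phi> x = delta h g" using span_Phi[OF delta(1) h(1)] by blast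
  let ?b = "\<lambda>x\<in>P. a x + (\<lambda>x\<in>P. (-1) * h x) x"
  have "delta a g \<ominus>\<^bsub>Sec\<^esub> \<Phi> x = delta ?b g"
    unfolding x(2) delta_add[OF delta(1)] delta_scale[OF delta(1)]
    using delta span_fib[OF h(1)] by (intro Sec.diff_eq delta_closed) auto
  moreover have "supn ?b \<le> \<epsilon> / 2" using h(2) by (intro supn_le) auto
  ultimately show ?case using norm1_delta_le[OF delta(1), of ?b] delta(3) x(1) by (intro bexI[of _ x]) auto
next
  case (add f h)
  obtain x where x: "x \<in> carrier FA" "norm1 (f \<ominus>\<^bsub>Sec\<^esub> \<Phi> x) < \<epsilon> / 2" using add(3)[of "\<epsilon> / 2"] add(5) by auto
  obtain y where y: "y \<in> carrier FA" "norm1 (h \<ominus>\<^bsub>Sec\<^esub> \<Phi> y) < \<epsilon> / 2" using add(4)[of "\<epsilon> / 2"] add(5) by auto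
  have "norm1 ((f \<oplus>\<^bsub>Sec\<^esub> h) \<ominus>\<^bsub>Sec\<^esub> \<Phi> (x \<oplus>\<^bsub>FA\<^esub> y)) \<le> norm1 (f \<ominus>\<^bsub>Sec\<^esub> \<Phi> x) + norm1 (h \<ominus>\<^bsub>Sec\<^esub> \<Phi> y)"
    using add(1,2) x(1) y(1) by (simp add: Phi.hom_add Sec.add_diff_add Sec1.norm_triangle del: free_ops)
  then show ?case using x y by (intro bexI[of _ "x \<oplus>\<^bsub>FA\<^esub> y"]) (auto simp del: free_ops)
qed

lemma Phi_approx:
  assumes "f \<in> carrier Sec"
  shows "\<exists>s. (\<forall>n. s n \<in> carrier FA) \<and> Sec1.tends (\<lambda>n. \<Phi> (s n)) f"
proof -
  have "\<forall>n. \<exists>x\<in>carrier FA. norm1 (f \<ominus>\<^bsub>Sec\<^esub> \<Phi> x) < 1 / real (Suc n)"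
    using Phi_dense[OF assms] by simp
  then obtain s where s: "\<And>n. s n \<in> carrier FA" "\<And>n. norm1 (f \<ominus>\<^bsub>Sec\<^esub> \<Phi> (s n)) < 1 / real (Suc n)" by metis
  have "Sec1.tends (\<lambda>n. \<Phi> (s n)) f"
  proof (rule Sec1.tendsI[of _ _ "\<lambda>n. 1 / real (Suc n)"])
    show "norm1 (\<Phi> (s n) \<ominus>\<^bsub>Sec\<^esub> f) \<le> 1 / real (Suc n)" for n
      using s(2)[of n] Sec1.norm_minus[OF assms Phi.hom_closed[OF s(1)]] by (simp add: less_imp_le)
    show "(\<lambda>n. 1 / real (Suc n)) \<longlonglongrightarrow> 0"
      using LIMSEQ_inverse_real_of_nat by (simp add: inverse_eq_divide)
  qed (use s assms in auto)
  then show ?thesis using s(1) by blast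
qed

text \<open>The largest seminorm on sections that agrees with \<open>\<nu>F\<close> on the image of \<open>\<Phi>\<close> and is
  1-Lipschitz for \<open>norm1\<close>.\<close>

definition ext_norm :: "('g \<Rightarrow> 'g \<Rightarrow> complex) \<Rightarrow> real" where
  "ext_norm f = (INF x\<in>carrier FA. \<nu>F x + norm1 (f \<ominus>\<^bsub>Sec\<^esub> \<Phi> x))"

text \<open>\<open>nuF_le_norm1\<close>, applied to differences, shows that the universal seminorm
  is 1-Lipschitz for the 1-norm of the image. This keeps the infimum from dropping below it; for
  \<open>f = \<Phi> x\<close> the right side is zero and the two seminorms agree.\<close>

lemma ext_norm_dist:
  assumes "f \<in> carrier Sec" "x \<in> carrier FA"
  shows "\<bar>\<nu>F x - ext_norm f\<bar> \<le> norm1 (f \<ominus>\<^bsub>Sec\<^esub> \<Phi> x)"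
proof -
  have "bdd_below ((\<lambda>x. \<nu>F x + norm1 (f \<ominus>\<^bsub>Sec\<^esub> \<Phi> x)) ` carrier FA)"
    using assms(1) by (intro bdd_belowI2[of _ 0] add_nonneg_nonneg FA.norm_nonneg norm1_nonneg) auto
  then have 1: "ext_norm f \<le> \<nu>F x + norm1 (f \<ominus>\<^bsub>Sec\<^esub> \<Phi> x)"
    unfolding ext_norm_def using assms(2) by (rule cINF_lower)
  have 2: "\<nu>F x - norm1 (f \<ominus>\<^bsub>Sec\<^esub> \<Phi> x) \<le> ext_norm f"
    unfolding ext_norm_def
  proof (rule cINF_greatest)
    fix y assume y: "y \<in> carrier FA"
    note c = Phi.hom_closed[OF assms(2)] Phi.hom_closed[OF y]
    have "\<nu>F x \<le> \<nu>F y + \<nu>F (x \<ominus>\<^bsub>FA\<^esub> y)" by (rule FA.norm_triangle_diff[OF assms(2) y])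
    also have "\<nu>F (x \<ominus>\<^bsub>FA\<^esub> y) \<le> norm1 (\<Phi> x \<ominus>\<^bsub>Sec\<^esub> \<Phi> y)"
      using nuF_le_norm1[of "x \<ominus>\<^bsub>FA\<^esub> y"] assms(2) y by (simp add: Phi.hom_diff)
    also have "\<dots> \<le> norm1 (f \<ominus>\<^bsub>Sec\<^esub> \<Phi> x) + norm1 (f \<ominus>\<^bsub>Sec\<^esub> \<Phi> y)"
      using Sec1.norm_diff_triangle[OF c(1) assms(1) c(2)] Sec1.norm_minus[OF c(1) assms(1)] by simp
    finally show "\<nu>F x - norm1 (f \<ominus>\<^bsub>Sec\<^esub> \<Phi> x) \<le> \<nu>F y + norm1 (f \<ominus>\<^bsub>Sec\<^esub> \<Phi> y)" by simp
  qed (use assms(2) in blast)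
  show ?thesis using 1 2 by linarith
qed

lemma ext_norm_tends:
  assumes "\<And>n. s n \<in> carrier FA" "Sec1.tends (\<lambda>n. \<Phi> (s n)) f"
  shows "(\<lambda>n. \<nu>F (s n)) \<longlonglongrightarrow> ext_norm f"
proof -
  note f = Sec1.tends_carrier(2)[OF assms(2)]
  have "(\<lambda>n. \<nu>F (s n) - ext_norm f) \<longlonglongrightarrow> 0"
  proof (rule Lim_null_comparison[of _ "\<lambda>n. norm1 (\<Phi> (s n) \<ominus>\<^bsub>Sec\<^esub> f)"])
    show "\<forall>\<^sub>F n in sequentially. norm (\<nu>F (s n) - ext_norm f) \<le> norm1 (\<Phi> (s n) \<ominus>\<^bsub>Sec\<^esub> f)"
      using ext_norm_dist[OF f assms(1)] Sec1.norm_minus[OF f Phi.hom_closed[OF assms(1)]] by simp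
    show "(\<lambda>n. norm1 (\<Phi> (s n) \<ominus>\<^bsub>Sec\<^esub> f)) \<longlonglongrightarrow> 0" using assms(2) by (simp add: Sec1.tends_def)
  qed
  then show ?thesis by (simp add: LIM_zero_iff)
qed

text \<open>By \<open>ext_norm_tends\<close> any approximating sequence of polynomials computes the
  extension, and the operations are continuous for the 1-norm. The laws of a C*-seminorm therefore
  pass to the limit from \<open>\<nu>F\<close>.\<close>

lemma ext_norm_cstar: "cstar_seminorm Sec ext_norm"
  unfolding cstar_seminorm_def
proof (intro conjI ballI allI)
  fix f assume f: "f \<in> carrier Sec"
  obtain s where s: "\<And>n. s n \<in> carrier FA" "Sec1.tends (\<lambda>n. \<Phi> (s n)) f" using Phi_approx[OF f] by blast
  note ls = ext_norm_tends[OF s]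
  show "0 \<le> ext_norm f" using s(1) by (intro LIMSEQ_le_const[OF ls]) auto
  have star: "Sec1.tends (\<lambda>n. \<Phi> (star FA (s n) \<otimes>\<^bsub>FA\<^esub> s n)) (star Sec f \<otimes>\<^bsub>Sec\<^esub> f)"
    using Sec1.tends_mult[OF Sec1.tends_star[OF s(2)] s(2)] s(1) by (simp add: Phi.hom_mult Phi.hom_star del: free_ops)
  have "(\<lambda>n. \<nu>F (star FA (s n) \<otimes>\<^bsub>FA\<^esub> s n)) \<longlonglongrightarrow> ext_norm (star Sec f \<otimes>\<^bsub>Sec\<^esub> f)"
    by (rule ext_norm_tends[OF _ star]) (intro FA.m_closed FA.star_closed s(1))
  moreover have "(\<lambda>n. \<nu>F (star FA (s n) \<otimes>\<^bsub>FA\<^esub> s n)) \<longlonglongrightarrow> (ext_norm f)\<^sup>2"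
    unfolding FA.norm_star_mult[OF s(1)] by (intro tendsto_power ls)
  ultimately show "ext_norm (star Sec f \<otimes>\<^bsub>Sec\<^esub> f) = (ext_norm f)\<^sup>2" by (rule LIMSEQ_unique)
  fix h assume h: "h \<in> carrier Sec"
  obtain t where t: "\<And>n. t n \<in> carrier FA" "Sec1.tends (\<lambda>n. \<Phi> (t n)) h" using Phi_approx[OF h] by blast
  note lt = ext_norm_tends[OF t]
  have add: "Sec1.tends (\<lambda>n. \<Phi> (s n \<oplus>\<^bsub>FA\<^esub> t n)) (f \<oplus>\<^bsub>Sec\<^esub> h)"
    using Sec1.tends_add[OF s(2) t(2)] s(1) t(1) by (simp add: Phi.hom_add del: free_ops)
  have "(\<lambda>n. \<nu>F (s n \<oplus>\<^bsub>FA\<^esub> t n)) \<longlonglongrightarrow> ext_norm (f \<oplus>\<^bsub>Sec\<^esub> h)"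
    by (rule ext_norm_tends[OF _ add]) (intro FA.a_closed s(1) t(1))
  then show "ext_norm (f \<oplus>\<^bsub>Sec\<^esub> h) \<le> ext_norm f + ext_norm h"
    by (rule LIMSEQ_le[OF _ tendsto_add[OF ls lt]]) (use FA.norm_triangle[OF s(1) t(1)] in blast)
  have mult: "Sec1.tends (\<lambda>n. \<Phi> (s n \<otimes>\<^bsub>FA\<^esub> t n)) (f \<otimes>\<^bsub>Sec\<^esub> h)"
    using Sec1.tends_mult[OF s(2) t(2)] s(1) t(1) by (simp add: Phi.hom_mult del: free_ops)
  have "(\<lambda>n. \<nu>F (s n \<otimes>\<^bsub>FA\<^esub> t n)) \<longlonglongrightarrow> ext_norm (f \<otimes>\<^bsub>Sec\<^esub> h)"
    by (rule ext_norm_tends[OF _ mult]) (intro FA.m_closed s(1) t(1))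
  then show "ext_norm (f \<otimes>\<^bsub>Sec\<^esub> h) \<le> ext_norm f * ext_norm h"
    by (rule LIMSEQ_le[OF _ tendsto_mult[OF ls lt]]) (use FA.norm_mult[OF s(1) t(1)] in blast)
next
  fix c f assume f: "f \<in> carrier Sec"
  obtain s where s: "\<And>n. s n \<in> carrier FA" "Sec1.tends (\<lambda>n. \<Phi> (s n)) f" using Phi_approx[OF f] by blast
  have sc: "Sec1.tends (\<lambda>n. \<Phi> (cscale FA c (s n))) (cscale Sec c f)"
    using Sec1.tends_scale[OF s(2)] s(1) by (simp add: Phi.hom_scale del: free_ops)
  have "(\<lambda>n. \<nu>F (cscale FA c (s n))) \<longlonglongrightarrow> ext_norm (cscale Sec c f)"
    by (rule ext_norm_tends[OF _ sc]) (intro FA.scale_closed s(1))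
  moreover have "(\<lambda>n. \<nu>F (cscale FA c (s n))) \<longlonglongrightarrow> cmod c * ext_norm f"
    unfolding FA.norm_scale[OF s(1)] by (intro tendsto_mult_left ext_norm_tends s)
  ultimately show "ext_norm (cscale Sec c f) = cmod c * ext_norm f" by (rule LIMSEQ_unique)
qed

text \<open>The reverse inequality holds because \<open>ext_norm\<close> is itself one of the
  C*-seminorms in the supremum defining \<open>\<nu>B\<close>.\<close>

lemma nuB_Phi:
  assumes "x \<in> carrier FA"
  shows "\<nu>B (\<Phi> x) = \<nu>F x"
proof (rule antisym[OF nuB_Phi_le[OF assms]])
  note c = Phi.hom_closed[OF assms]
  have "\<nu>F x = ext_norm (\<Phi> x)"
    using ext_norm_dist[OF c assms] c by (simp add: Sec1.norm_zero)
  also have "\<dots> \<le> \<nu>B (\<Phi> x)"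
    by (rule max_cstar_seminorm_upper[OF Sec_seminorm_bounded ext_norm_cstar _ c]) auto
  finally show "\<nu>F x \<le> \<nu>B (\<Phi> x)" .
qed

lemma nuB_le_norm1: "f \<in> carrier Sec \<Longrightarrow> \<nu>B f \<le> norm1 f"
  by (intro max_cstar_seminorm_least cstar_seminorm_le_norm1)

theorem full_isomorphism:
  "\<exists>\<phi>. cstar_iso (universal_toeplitz G P) (full_cross_sectional G bundle) \<phi> \<and>
     (\<forall>p\<in>P. \<phi> (toeplitz_gen G P p) = full_embed G bundle (delta (char_fun P (p <# P)) p))"
proof -
  let ?A = "completion FA \<nu>F" and ?B = "completion Sec \<nu>B"
  let ?S = "FA.emb ` carrier FA" and ?T = "(\<lambda>x. SB.emb (\<Phi> x)) ` carrier FA"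
  interpret B: banach_star_alg ?B by (rule SB.completion_banach)
  have "cnorm ?A (FA.emb x) = cnorm ?B (SB.emb (\<Phi> x))" if "x \<in> carrier FA" for x
    using that by (simp add: FA.emb_norm SB.emb_norm nuB_Phi)
  from dense_hom_iso[OF FA.emb_hom star_hom_comp[OF Phi_hom SB.emb_hom] FA.completion_banach SB.completion_banach this]
  obtain \<phi> where \<phi>: "cstar_iso (?A\<lparr>carrier := norm_closure ?A ?S\<rparr>) (?B\<lparr>carrier := norm_closure ?B ?T\<rparr>) \<phi>"
    "\<forall>x\<in>carrier FA. \<phi> (FA.emb x) = SB.emb (\<Phi> x)" by auto
  have "norm_closure ?A ?S = carrier ?A"
    using FA.emb_dense by (fastforce simp: norm_closure_def)
  \<comment> \<open>Two approximations are combined: an element of the completion by a section, and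
    the section by an image of \<open>\<Phi>\<close> in the 1-norm, which dominates
    \<open>\<nu>B\<close>.\<close>
  moreover have "norm_closure ?B ?T = carrier ?B"
  proof (intro equalityI subsetI)
    fix X assume X: "X \<in> carrier ?B"
    show "X \<in> norm_closure ?B ?T"
      unfolding norm_closure_def
    proof (intro CollectI conjI X allI impI)
      fix \<epsilon> :: real assume e: "\<epsilon> > 0"
      obtain f where f: "f \<in> carrier Sec" "cnorm ?B (X \<ominus>\<^bsub>?B\<^esub> SB.emb f) < \<epsilon> / 2"
        using SB.emb_dense[OF X, of "\<epsilon> / 2"] e by auto
      obtain x where x: "x \<in> carrier FA" "norm1 (f \<ominus>\<^bsub>Sec\<^esub> \<Phi> x) < \<epsilon> / 2"
        using Phi_dense[OF f(1), of "\<epsilon> / 2"] e by auto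
      note c = Phi.hom_closed[OF x(1)]
      have "cnorm ?B (SB.emb f \<ominus>\<^bsub>?B\<^esub> SB.emb (\<Phi> x)) = \<nu>B (f \<ominus>\<^bsub>Sec\<^esub> \<Phi> x)"
        using f(1) c by (simp add: SB.emb_diff[symmetric] SB.emb_norm)
      also have "\<dots> \<le> norm1 (f \<ominus>\<^bsub>Sec\<^esub> \<Phi> x)" using f(1) c by (intro nuB_le_norm1) auto
      finally have "cnorm ?B (X \<ominus>\<^bsub>?B\<^esub> SB.emb (\<Phi> x)) < \<epsilon>"
        using B.norm_diff_triangle[OF X SB.emb_carrier[OF f(1)] SB.emb_carrier[OF c]] f(2) x(2) by linarith
      then show "\<exists>y\<in>?T. cnorm ?B (X \<ominus>\<^bsub>?B\<^esub> y) < \<epsilon>" using x(1) by blast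
    qed
  qed (simp add: norm_closure_def)
  ultimately have "cstar_iso ?A ?B \<phi>" using \<phi>(1) by simp
  moreover have "\<phi> (FA.emb (free_gen p)) = SB.emb (sgen p)" if "p \<in> P" for p
    using \<phi>(2) free_gen_carrier[OF that] Phi_gen[OF that] by metis
  ultimately show ?thesis
    unfolding universal_toeplitz_def full_cross_sectional_def enveloping_cstar_def toeplitz_gen_def
      full_embed_def enveloping_embed_def sgen_def
    by blast
qed

end

section \<open>Hilbert modules with an inner product of functions\<close>

text \<open>The inner product takes values in functions on \<^term>\<open>I\<close>, and \<^term>\<open>ip i\<close> is its value
  at \<^term>\<open>i\<close>.\<close>

locale hilbert_mod =
  fixes E :: "('h, 'a, 'm) hilbert_module_scheme" and I :: "'i set" and ip :: "'i \<Rightarrow> 'h \<Rightarrow> 'h \<Rightarrow> complex"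
  assumes hzero_closed [simp, intro]: "hzero E \<in> carrier E"
    and hadd_closed [simp, intro]: "\<lbrakk>x \<in> carrier E; y \<in> carrier E\<rbrakk> \<Longrightarrow> hadd E x y \<in> carrier E"
    and hscale_closed [simp, intro]: "x \<in> carrier E \<Longrightarrow> hscale E c x \<in> carrier E"
    and ip_zero [simp]: "\<lbrakk>i \<in> I; z \<in> carrier E\<rbrakk> \<Longrightarrow> ip i z (hzero E) = 0"
    and ip_add [simp]: "\<lbrakk>i \<in> I; x \<in> carrier E; y \<in> carrier E; z \<in> carrier E\<rbrakk> \<Longrightarrow> ip i z (hadd E x y) = ip i z x + ip i z y"
    and ip_scale [simp]: "\<lbrakk>i \<in> I; x \<in> carrier E; z \<in> carrier E\<rbrakk> \<Longrightarrow> ip i z (hscale E c x) = c * ip i z x"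
    and ip_sym: "\<lbrakk>i \<in> I; x \<in> carrier E; y \<in> carrier E\<rbrakk> \<Longrightarrow> ip i y x = cnj (ip i x y)"
    and ip_pos: "\<lbrakk>i \<in> I; x \<in> carrier E\<rbrakk> \<Longrightarrow> 0 \<le> Re (ip i x x)"
    and hinner_eq_iff: "\<lbrakk>x \<in> carrier E; y \<in> carrier E; x' \<in> carrier E; y' \<in> carrier E\<rbrakk> \<Longrightarrow>
      hinner E x y = hinner E x' y' \<longleftrightarrow> (\<forall>i\<in>I. ip i x y = ip i x' y')"
    and hnorm_nonneg [simp]: "x \<in> carrier E \<Longrightarrow> 0 \<le> hnorm E x"
    and hnorm_le_iff: "\<lbrakk>x \<in> carrier E; 0 \<le> r\<rbrakk> \<Longrightarrow> hnorm E x \<le> r \<longleftrightarrow> (\<forall>i\<in>I. Re (ip i x x) \<le> r\<^sup>2)"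
    and definite: "\<lbrakk>x \<in> carrier E; y \<in> carrier E; hnorm E (hadd E x (hscale E (-1) y)) = 0\<rbrakk> \<Longrightarrow> x = y"
    and hcomplete: "\<lbrakk>\<And>n. s n \<in> carrier E;
      \<And>\<epsilon>. \<epsilon> > 0 \<Longrightarrow> \<exists>N. \<forall>m\<ge>N. \<forall>n\<ge>N. hnorm E (hadd E (s m) (hscale E (-1) (s n))) < \<epsilon>\<rbrakk> \<Longrightarrow>
      \<exists>x\<in>carrier E. (\<lambda>n. hnorm E (hadd E (s n) (hscale E (-1) x))) \<longlonglongrightarrow> 0"
begin

abbreviation hsub :: "'h \<Rightarrow> 'h \<Rightarrow> 'h" where "hsub x y \<equiv> hadd E x (hscale E (-1) y)"

lemma ip_zero_left [simp]: "\<lbrakk>i \<in> I; z \<in> carrier E\<rbrakk> \<Longrightarrow> ip i (hzero E) z = 0"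
  using ip_sym[of i z "hzero E"] by simp

lemma ip_add_left [simp]:
  "\<lbrakk>i \<in> I; x \<in> carrier E; y \<in> carrier E; z \<in> carrier E\<rbrakk> \<Longrightarrow> ip i (hadd E x y) z = ip i x z + ip i y z"
  using ip_sym[of i z "hadd E x y"] ip_sym[of i z x] ip_sym[of i z y] by simp

lemma ip_scale_left [simp]:
  "\<lbrakk>i \<in> I; x \<in> carrier E; z \<in> carrier E\<rbrakk> \<Longrightarrow> ip i (hscale E c x) z = cnj c * ip i x z"
  using ip_sym[of i z "hscale E c x"] ip_sym[of i z x] by simp

lemma vec_eqI:
  assumes "x \<in> carrier E" "y \<in> carrier E" "\<And>i z. \<lbrakk>i \<in> I; z \<in> carrier E\<rbrakk> \<Longrightarrow> ip i z x = ip i z y"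
  shows "x = y"
proof (rule definite[OF assms(1,2)])
  have d: "hsub x y \<in> carrier E" using assms by simp
  have "hnorm E (hsub x y) \<le> 0"
    unfolding hnorm_le_iff[OF d order_refl]
    using assms by simp
  then show "hnorm E (hsub x y) = 0" using hnorm_nonneg[OF d] by simp
qed

lemma ip_self_le: "\<lbrakk>i \<in> I; x \<in> carrier E\<rbrakk> \<Longrightarrow> Re (ip i x x) \<le> (hnorm E x)\<^sup>2"
  using hnorm_le_iff[of x "hnorm E x"] by simp

text \<open>At a fixed \<open>i\<close> the form is only positive semidefinite, so a vector of
  length zero need not be zero and the case \<open>?b = 0\<close> is separate.\<close>

lemma cauchy_schwarz_ip:
  assumes "i \<in> I" "x \<in> carrier E" "y \<in> carrier E"
  shows "(cmod (ip i x y))\<^sup>2 \<le> Re (ip i x x) * Re (ip i y y)"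
proof -
  let ?a = "Re (ip i x x)" and ?b = "Re (ip i y y)" and ?c = "ip i x y"
  have yx: "ip i y x = cnj ?c" by (rule ip_sym) (use assms in auto)
  have key: "0 \<le> ?a + 2 * Re (l * ?c) + (cmod l)\<^sup>2 * ?b" for l
  proof -
    let ?z = "hadd E x (hscale E l y)"
    have "ip i ?z ?z = ip i x x + l * ?c + cnj l * (cnj ?c + l * ip i y y)"
      using assms yx by (simp add: algebra_simps)
    also have "cnj l * (cnj ?c + l * ip i y y) = cnj (l * ?c) + complex_of_real ((cmod l)\<^sup>2) * ip i y y"
      unfolding complex_norm_square by (simp add: algebra_simps)
    finally have "Re (ip i ?z ?z) = ?a + 2 * Re (l * ?c) + (cmod l)\<^sup>2 * ?b" by simp
    then show ?thesis using ip_pos[OF assms(1), of ?z] assms by simp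
  qed
  have cc: "cnj ?c * ?c = complex_of_real ((cmod ?c)\<^sup>2)" by (metis complex_norm_square mult.commute)
  \<comment> \<open>The multiplier \<open>l = - t * cnj ?c\<close> makes the cross term real and
    negative for positive \<open>t\<close>; what remains is a quadratic in \<open>t\<close>, minimal
    at \<open>1 / ?b\<close>.\<close>
  have key2: "0 \<le> ?a - 2 * t * (cmod ?c)\<^sup>2 + t\<^sup>2 * (cmod ?c)\<^sup>2 * ?b" for t :: real
  proof -
    have "complex_of_real (-t) * cnj ?c * ?c = complex_of_real (- t * (cmod ?c)\<^sup>2)"
      using cc by (simp add: mult.assoc)
    then have "Re (complex_of_real (-t) * cnj ?c * ?c) = - t * (cmod ?c)\<^sup>2" by (metis Re_complex_of_real)
    then show ?thesis using key[of "complex_of_real (-t) * cnj ?c"]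
      by (simp add: norm_mult power_mult_distrib)
  qed
  show ?thesis
  proof (cases "?b = 0")
    case True
    have "(cmod ?c)\<^sup>2 \<le> 0"
    proof (rule ccontr)
      assume n: "\<not> (cmod ?c)\<^sup>2 \<le> 0"
      \<comment> \<open>With no quadratic term the expression is unbounded below in
        \<open>t\<close>; this \<open>t\<close> makes it equal to \<open>- ?a - 2\<close>.\<close>
      have "0 \<le> ?a - 2 * ((?a + 1) / (cmod ?c)\<^sup>2) * (cmod ?c)\<^sup>2"
        using key2[of "(?a + 1) / (cmod ?c)\<^sup>2"] True by simp
      also have "\<dots> = ?a - 2 * (?a + 1)" using n by simp
      finally show False using ip_pos[OF assms(1,2)] by simp
    qed
    then show ?thesis using True by simp
  next
    case False
    then have b: "?b > 0" using ip_pos[OF assms(1,3)] by simp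
    have "0 \<le> ?a - 2 * (1 / ?b) * (cmod ?c)\<^sup>2 + (1 / ?b)\<^sup>2 * (cmod ?c)\<^sup>2 * ?b" by (rule key2)
    also have "\<dots> = ?a - (cmod ?c)\<^sup>2 / ?b" using b by (simp add: power2_eq_square field_simps)
    finally show ?thesis using b by (simp add: field_simps)
  qed
qed

lemma ip_le:
  assumes "i \<in> I" "x \<in> carrier E" "y \<in> carrier E"
  shows "cmod (ip i x y) \<le> hnorm E x * hnorm E y"
proof -
  have "(cmod (ip i x y))\<^sup>2 \<le> (hnorm E x)\<^sup>2 * (hnorm E y)\<^sup>2"
    using cauchy_schwarz_ip[OF assms] ip_self_le ip_pos assms
    by (meson mult_mono order_trans zero_le_power2)
  then have "(cmod (ip i x y))\<^sup>2 \<le> (hnorm E x * hnorm E y)\<^sup>2" by (simp add: power_mult_distrib)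
  then show ?thesis by (rule power2_le_imp_le) (use assms in simp)
qed

lemma hnorm_triangle:
  assumes "x \<in> carrier E" "y \<in> carrier E"
  shows "hnorm E (hadd E x y) \<le> hnorm E x + hnorm E y"
proof -
  have "Re (ip i (hadd E x y) (hadd E x y)) \<le> (hnorm E x + hnorm E y)\<^sup>2" if i: "i \<in> I" for i
  proof -
    have "Re (ip i (hadd E x y) (hadd E x y)) = Re (ip i x x) + Re (ip i y y) + 2 * Re (ip i x y)"
      using assms i ip_sym[OF i assms] by simp
    also have "\<dots> \<le> (hnorm E x)\<^sup>2 + (hnorm E y)\<^sup>2 + 2 * (hnorm E x * hnorm E y)"
      using ip_self_le[OF i assms(1)] ip_self_le[OF i assms(2)] ip_le[OF i assms]
        complex_Re_le_cmod[of "ip i x y"] by linarith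
    also have "\<dots> = (hnorm E x + hnorm E y)\<^sup>2" by (simp add: power2_sum)
    finally show ?thesis .
  qed
  then show ?thesis using assms by (subst hnorm_le_iff) auto
qed

lemma hnorm_scale_le:
  assumes "x \<in> carrier E"
  shows "hnorm E (hscale E c x) \<le> cmod c * hnorm E x"
proof -
  have "Re (ip i (hscale E c x) (hscale E c x)) \<le> (cmod c * hnorm E x)\<^sup>2" if i: "i \<in> I" for i
  proof -
    have "ip i (hscale E c x) (hscale E c x) = complex_of_real ((cmod c)\<^sup>2) * ip i x x"
      using i assms unfolding complex_norm_square by (simp add: algebra_simps)
    then have "Re (ip i (hscale E c x) (hscale E c x)) = (cmod c)\<^sup>2 * Re (ip i x x)" by simp
    also have "\<dots> \<le> (cmod c)\<^sup>2 * (hnorm E x)\<^sup>2" using ip_self_le[OF i assms] by (intro mult_left_mono) auto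
    finally show ?thesis by (simp add: power_mult_distrib)
  qed
  then show ?thesis using assms by (subst hnorm_le_iff) auto
qed

lemma hnorm_scale:
  assumes "x \<in> carrier E"
  shows "hnorm E (hscale E c x) = cmod c * hnorm E x"
proof (cases "c = 0")
  case True
  then show ?thesis using hnorm_scale_le[OF assms, of c] hnorm_nonneg[OF hscale_closed[OF assms, of c]] by simp
next
  case False
  have "x = hscale E (inverse c) (hscale E c x)"
    using assms False by (intro vec_eqI) auto
  then have "hnorm E x \<le> cmod (inverse c) * hnorm E (hscale E c x)"
    using hnorm_scale_le[of "hscale E c x" "inverse c"] assms by simp
  then have "cmod c * hnorm E x \<le> hnorm E (hscale E c x)"
    using False by (simp add: norm_inverse norm_divide field_simps)
  then show ?thesis using hnorm_scale_le[OF assms, of c] by simp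
qed

lemma hnorm_zero [simp]: "hnorm E (hzero E) = 0"
proof -
  have "hnorm E (hzero E) \<le> 0" by (subst hnorm_le_iff) auto
  then show ?thesis using hnorm_nonneg[OF hzero_closed] by simp
qed

lemma hsub_self: "x \<in> carrier E \<Longrightarrow> hsub x x = hzero E"
  by (rule vec_eqI) auto

lemma hnorm_sub_comm: "\<lbrakk>x \<in> carrier E; y \<in> carrier E\<rbrakk> \<Longrightarrow> hnorm E (hsub x y) = hnorm E (hsub y x)"
proof -
  assume xy: "x \<in> carrier E" "y \<in> carrier E"
  have "hsub x y = hscale E (-1) (hsub y x)" using xy by (intro vec_eqI) auto
  then show ?thesis using hnorm_scale[of "hsub y x" "-1"] xy by simp
qed

lemma hnorm_sub_triangle:
  assumes "x \<in> carrier E" "y \<in> carrier E" "z \<in> carrier E"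
  shows "hnorm E (hsub x z) \<le> hnorm E (hsub x y) + hnorm E (hsub y z)"
proof -
  have "hsub x z = hadd E (hsub x y) (hsub y z)" using assms by (intro vec_eqI) auto
  then show ?thesis using hnorm_triangle[of "hsub x y" "hsub y z"] assms by simp
qed

lemma hnorm_le_sub: "\<lbrakk>x \<in> carrier E; y \<in> carrier E\<rbrakk> \<Longrightarrow> hnorm E x \<le> hnorm E y + hnorm E (hsub x y)"
proof -
  assume xy: "x \<in> carrier E" "y \<in> carrier E"
  have "x = hadd E y (hsub x y)" using xy by (intro vec_eqI) auto
  then show ?thesis using hnorm_triangle[of y "hsub x y"] xy by simp
qed

subsection \<open>Uniform boundedness\<close>

text \<open>A gliding hump: the \<open>n\<close>-th summand \<open>\<plusminus>3\<^sup>-\<^sup>n u n\<close> makes the \<open>n\<close>-th functional large at the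
  partial sum, and the remaining summands are too small to undo this.\<close>

lemma gliding_hump:
  fixes \<phi> :: "nat \<Rightarrow> 'h \<Rightarrow> complex" and c :: "nat \<Rightarrow> real"
  assumes add: "\<And>n x y. \<lbrakk>x \<in> carrier E; y \<in> carrier E\<rbrakk> \<Longrightarrow> \<phi> n (hadd E x y) = \<phi> n x + \<phi> n y"
    and scale: "\<And>n x d. x \<in> carrier E \<Longrightarrow> \<phi> n (hscale E d x) = d * \<phi> n x"
    and bound: "\<And>n x. x \<in> carrier E \<Longrightarrow> cmod (\<phi> n x) \<le> c n * hnorm E x"
    and u: "\<And>n. u n \<in> carrier E" "\<And>n. hnorm E (u n) \<le> 1"
    and large: "\<And>n. 3/4 * c n \<le> cmod (\<phi> n (u n))" "\<And>n. 4 ^ n \<le> c n"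
  shows "\<exists>x\<in>carrier E. \<forall>n. (4/3) ^ n / 4 \<le> cmod (\<phi> n x)"
proof -
  define d where "d n = complex_of_real ((1/3) ^ n)" for n
  define X where "X = rec_nat (hzero E) (\<lambda>n x.
    if (1/3) ^ n * cmod (\<phi> n (u n)) \<le> cmod (\<phi> n (hadd E x (hscale E (d n) (u n))))
    then hadd E x (hscale E (d n) (u n)) else hadd E x (hscale E (- d n) (u n)))"
  have X0: "X 0 = hzero E" and XS: "X (Suc n) = (if (1/3) ^ n * cmod (\<phi> n (u n)) \<le> cmod (\<phi> n (hadd E (X n) (hscale E (d n) (u n))))
    then hadd E (X n) (hscale E (d n) (u n)) else hadd E (X n) (hscale E (- d n) (u n)))" for n
    by (simp_all add: X_def)
  have Xc: "X n \<in> carrier E" for n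
    by (induction n) (auto simp: X0 XS u)
  have dn: "cmod (d n) = (1/3) ^ n" for n by (simp add: d_def norm_power norm_divide)
  \<comment> \<open>One of the two signs always succeeds, since twice the added term is the
    difference of the two candidate values.\<close>
  have big: "(1/3) ^ n * cmod (\<phi> n (u n)) \<le> cmod (\<phi> n (X (Suc n)))" for n
  proof (cases "(1/3) ^ n * cmod (\<phi> n (u n)) \<le> cmod (\<phi> n (hadd E (X n) (hscale E (d n) (u n))))")
    case True
    then show ?thesis by (simp add: XS)
  next
    case False
    let ?a = "\<phi> n (X n)" and ?b = "d n * \<phi> n (u n)"
    have b: "cmod ?b = (1/3) ^ n * cmod (\<phi> n (u n))" using dn by (simp add: norm_mult)
    have "2 * cmod ?b = cmod ((?a + ?b) - (?a - ?b))" by simp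
    also have "\<dots> \<le> cmod (?a + ?b) + cmod (?a - ?b)" by (rule norm_triangle_ineq4)
    finally have "cmod ?b \<le> cmod (?a - ?b)" using False b Xc u by (simp add: add scale)
    then show ?thesis using False b Xc u by (simp add: XS add scale)
  qed
  have step: "hnorm E (hsub (X (Suc n)) (X n)) \<le> (1/3) ^ n" for n
  proof -
    have "\<exists>e. cmod e = (1/3) ^ n \<and> X (Suc n) = hadd E (X n) (hscale E e (u n))"
      using XS dn by (metis norm_minus_cancel)
    then obtain e where e: "cmod e = (1/3) ^ n" "X (Suc n) = hadd E (X n) (hscale E e (u n))" by blast
    have "hsub (X (Suc n)) (X n) = hscale E e (u n)"
      unfolding e(2) using Xc u by (intro vec_eqI) auto
    then have "hnorm E (hsub (X (Suc n)) (X n)) = (1/3) ^ n * hnorm E (u n)"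
      using hnorm_scale[OF u(1)] e by simp
    then show ?thesis using u(2)[of n] by (simp add: mult_left_le)
  qed
  \<comment> \<open>The exact geometric sum of the steps from \<open>n + 1\<close> to
    \<open>m - 1\<close>; the negative term makes the induction close.\<close>
  have tail: "hnorm E (hsub (X m) (X (Suc n))) \<le> (1/3) ^ n / 2 - 3 * (1/3) ^ m / 2" if "m \<ge> Suc n" for m n
    using that
  proof (induction m rule: dec_induct)
    case base
    show ?case using Xc by (simp add: hsub_self)
  next
    case (step m)
    have "hnorm E (hsub (X (Suc m)) (X (Suc n))) \<le> hnorm E (hsub (X (Suc m)) (X m)) + hnorm E (hsub (X m) (X (Suc n)))"
      using Xc by (intro hnorm_sub_triangle)
    also have "\<dots> \<le> (1/3) ^ m + ((1/3) ^ n / 2 - 3 * (1/3) ^ m / 2)"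
      using \<open>\<And>n. hnorm E (hsub (X (Suc n)) (X n)) \<le> (1/3) ^ n\<close>[of m] step.IH by linarith
    finally show ?case by simp
  qed
  have tail': "hnorm E (hsub (X m) (X (Suc n))) \<le> (1/3) ^ n / 2" if "m \<ge> Suc n" for m n
    using tail[OF that] by (smt (verit) divide_nonneg_nonneg mult_nonneg_nonneg zero_le_power)
  have lim3: "(\<lambda>n. (1/3::real) ^ n) \<longlonglongrightarrow> 0" by (intro LIMSEQ_power_zero) simp
  have "\<exists>x\<in>carrier E. (\<lambda>n. hnorm E (hsub (X n) x)) \<longlonglongrightarrow> 0"
  proof (rule hcomplete[OF Xc])
    fix \<epsilon> :: real assume "\<epsilon> > 0"
    then obtain n where n: "(1/3::real) ^ n < \<epsilon>"
      using order_tendstoD(2)[OF lim3] by (metis eventually_sequentially order_refl)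
    have "hnorm E (hsub (X m) (X k)) < \<epsilon>" if "m \<ge> Suc n" "k \<ge> Suc n" for m k
      using hnorm_sub_triangle[OF Xc[of m] Xc[of "Suc n"] Xc[of k]] tail'[OF that(1)] tail'[OF that(2)]
        hnorm_sub_comm[OF Xc[of "Suc n"] Xc[of k]] n by linarith
    then show "\<exists>N. \<forall>m\<ge>N. \<forall>k\<ge>N. hnorm E (hsub (X m) (X k)) < \<epsilon>" by blast
  qed
  then obtain x where x: "x \<in> carrier E" "(\<lambda>n. hnorm E (hsub (X n) x)) \<longlonglongrightarrow> 0" by blast
  have xn: "hnorm E (hsub x (X (Suc n))) \<le> (1/3) ^ n / 2" for n
  proof (rule LIMSEQ_le_const)
    have "(\<lambda>m. hnorm E (hsub (X m) x) + (1/3) ^ n / 2) \<longlonglongrightarrow> 0 + (1/3) ^ n / 2"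
      by (intro tendsto_add x(2) tendsto_const)
    then show "(\<lambda>m. hnorm E (hsub (X m) x) + (1/3) ^ n / 2) \<longlonglongrightarrow> (1/3) ^ n / 2" by simp
    show "\<exists>N. \<forall>m\<ge>N. hnorm E (hsub x (X (Suc n))) \<le> hnorm E (hsub (X m) x) + (1/3) ^ n / 2"
    proof (intro exI[of _ "Suc n"] allI impI)
      fix m assume "Suc n \<le> m"
      then show "hnorm E (hsub x (X (Suc n))) \<le> hnorm E (hsub (X m) x) + (1/3) ^ n / 2"
        using hnorm_sub_triangle[OF x(1) Xc[of m] Xc[of "Suc n"]] hnorm_sub_comm[OF x(1) Xc[of m]] tail'[of n m]
        by linarith
    qed
  qed
  have "(4/3) ^ n / 4 \<le> cmod (\<phi> n x)" for n
  proof -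
    have "x = hadd E (X (Suc n)) (hsub x (X (Suc n)))" using x Xc by (intro vec_eqI) auto
    then have "\<phi> n x = \<phi> n (X (Suc n)) + \<phi> n (hsub x (X (Suc n)))" using add[of "X (Suc n)" "hsub x (X (Suc n))" n] x Xc by simp
    then have "cmod (\<phi> n x) \<ge> cmod (\<phi> n (X (Suc n))) - cmod (\<phi> n (hsub x (X (Suc n))))"
      by (metis add_diff_cancel_left' norm_diff_ineq)
    moreover have "cmod (\<phi> n (hsub x (X (Suc n)))) \<le> c n * ((1/3) ^ n / 2)"
    proof -
      have c0: "0 \<le> c n" using large(2)[of n] zero_le_power[of 4 n] by (smt (verit))
      have "cmod (\<phi> n (hsub x (X (Suc n)))) \<le> c n * hnorm E (hsub x (X (Suc n)))"
        using x Xc by (intro bound) auto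
      also have "\<dots> \<le> c n * ((1/3) ^ n / 2)" by (intro mult_left_mono xn c0)
      finally show ?thesis .
    qed
    moreover have "(1/3) ^ n * (3/4 * c n) \<le> cmod (\<phi> n (X (Suc n)))"
      by (rule order_trans[OF mult_left_mono[OF large(1)[of n]] big[of n]]) simp
    \<comment> \<open>The hump contributes 3/4 and the tail takes away at most 1/2 of
      \<open>(1/3) ^ n * c n\<close>, which leaves a quarter; the growth of \<open>c\<close> then
      produces the ratio 4/3.\<close>
    ultimately have "(1/3) ^ n * c n / 4 \<le> cmod (\<phi> n x)" by (simp add: algebra_simps)
    moreover have "(4/3) ^ n / 4 \<le> (1/3) ^ n * c n / 4"
      using mult_left_mono[OF large(2)[of n], of "(1/3) ^ n"] by (simp add: power_divide power_mult_distrib[symmetric])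
    ultimately show ?thesis by linarith
  qed
  then show ?thesis using x(1) by blast
qed

subsection \<open>Adjointable operators\<close>

abbreviation "L \<equiv> adjointable_ops E"

lemma L_simps:
  "S \<otimes>\<^bsub>L\<^esub> T = (\<lambda>x\<in>carrier E. S (T x))"
  "\<one>\<^bsub>L\<^esub> = (\<lambda>x\<in>carrier E. x)"
  "\<zero>\<^bsub>L\<^esub> = (\<lambda>x\<in>carrier E. hzero E)"
  "S \<oplus>\<^bsub>L\<^esub> T = (\<lambda>x\<in>carrier E. hadd E (S x) (T x))"
  "cscale L c T = (\<lambda>x\<in>carrier E. hscale E c (T x))"
  "cnorm L T = (SUP x\<in>{x \<in> carrier E. hnorm E x \<le> 1}. hnorm E (T x))"
  by (simp_all add: adjointable_ops_def)

lemma L_fun: "T \<in> carrier L \<Longrightarrow> T \<in> carrier E \<rightarrow>\<^sub>E carrier E"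
  by (simp add: adjointable_ops_def)

lemma L_closed [simp, intro]: "\<lbrakk>T \<in> carrier L; x \<in> carrier E\<rbrakk> \<Longrightarrow> T x \<in> carrier E"
  using L_fun by blast

text \<open>The adjoint relation may be tested at each index \<open>i\<close>. Nondegeneracy makes
  the adjoint unique, so the description defining \<open>star L T\<close> evaluates to
  \<open>S\<close>.\<close>

lemma adjointI:
  assumes T: "T \<in> carrier E \<rightarrow>\<^sub>E carrier E" and S: "S \<in> carrier E \<rightarrow>\<^sub>E carrier E"
    and ad: "\<And>i x y. \<lbrakk>i \<in> I; x \<in> carrier E; y \<in> carrier E\<rbrakk> \<Longrightarrow> ip i (T x) y = ip i x (S y)"
  shows "T \<in> carrier L" "star L T = S"
proof -
  have adj: "is_adjoint E T S"
    unfolding is_adjoint_def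
  proof (intro ballI)
    fix x y assume xy: "x \<in> carrier E" "y \<in> carrier E"
    then have "T x \<in> carrier E" "S y \<in> carrier E" using T S by auto
    then show "hinner E (T x) y = hinner E x (S y)" using xy ad hinner_eq_iff by simp
  qed
  then show "T \<in> carrier L" using T S by (auto simp: adjointable_ops_def)
  have "S' = S" if S': "S' \<in> carrier E \<rightarrow>\<^sub>E carrier E" "is_adjoint E T S'" for S'
  proof (rule PiE_ext[OF S'(1) S])
    fix y assume y: "y \<in> carrier E"
    show "S' y = S y"
    proof (rule vec_eqI)
      show "S' y \<in> carrier E" "S y \<in> carrier E" using y S S' by auto
      fix i z assume i: "i \<in> I" and z: "z \<in> carrier E"
      have "T z \<in> carrier E" using T z by auto
      then have "ip i (T z) y = ip i z (S' y)"
        using S' i z y hinner_eq_iff[of "T z" y z "S' y"] \<open>S' y \<in> carrier E\<close> by (auto simp: is_adjoint_def)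
      then show "ip i z (S' y) = ip i z (S y)" using ad[OF i z y] by simp
    qed
  qed
  then have uniq: "\<And>S'. S' \<in> carrier E \<rightarrow>\<^sub>E carrier E \<and> is_adjoint E T S' \<Longrightarrow> S' = S" by blast
  have "(THE S. S \<in> carrier E \<rightarrow>\<^sub>E carrier E \<and> is_adjoint E T S) = S"
    by (rule the_equality) (use S adj uniq in blast)+
  then show "star L T = S" by (simp add: adjointable_ops_def)
qed

lemma adjointE:
  assumes "T \<in> carrier L"
  shows "star L T \<in> carrier E \<rightarrow>\<^sub>E carrier E"
    and "\<lbrakk>i \<in> I; x \<in> carrier E; y \<in> carrier E\<rbrakk> \<Longrightarrow> ip i (T x) y = ip i x (star L T y)"
proof -
  obtain S where S: "S \<in> carrier E \<rightarrow>\<^sub>E carrier E" "is_adjoint E T S"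
    using assms by (auto simp: adjointable_ops_def)
  have ad: "ip i (T x) y = ip i x (S y)" if "i \<in> I" "x \<in> carrier E" "y \<in> carrier E" for i x y
  proof -
    have "S y \<in> carrier E" using S that by auto
    then show ?thesis using S(2) that assms hinner_eq_iff[of "T x" y x "S y"] by (auto simp: is_adjoint_def)
  qed
  have "star L T = S" by (rule adjointI(2)[OF L_fun[OF assms] S(1) ad])
  then show "star L T \<in> carrier E \<rightarrow>\<^sub>E carrier E"
    "\<lbrakk>i \<in> I; x \<in> carrier E; y \<in> carrier E\<rbrakk> \<Longrightarrow> ip i (T x) y = ip i x (star L T y)"
    using S ad by auto
qed

lemma star_fun_closed: "\<lbrakk>T \<in> carrier L; x \<in> carrier E\<rbrakk> \<Longrightarrow> star L T x \<in> carrier E"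
  using adjointE(1) by blast

lemma adjoint_right:
  assumes "T \<in> carrier L" "i \<in> I" "x \<in> carrier E" "y \<in> carrier E"
  shows "ip i y (T x) = ip i (star L T y) x"
  using adjointE(2)[OF assms] ip_sym[of i "T x" y] ip_sym[of i x "star L T y"] assms star_fun_closed by simp

lemma star_L:
  assumes "T \<in> carrier L"
  shows "star L T \<in> carrier L" "star L (star L T) = T"
  by (rule adjointI[OF adjointE(1)[OF assms] L_fun[OF assms]],
      use adjoint_right[OF assms] in simp)+

lemma L_scale: "\<lbrakk>T \<in> carrier L; x \<in> carrier E\<rbrakk> \<Longrightarrow> T (hscale E c x) = hscale E c (T x)"
  by (rule vec_eqI) (auto simp: adjoint_right star_fun_closed)

lemma L_zero: "T \<in> carrier L \<Longrightarrow> T (hzero E) = hzero E"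
  by (rule vec_eqI) (auto simp: adjoint_right star_fun_closed)

text \<open>For \<open>y\<close> in the unit ball the functionals pairing with \<open>T y\<close>
  are bounded at each \<open>x\<close> by the norm of \<open>star L T x\<close>. If \<open>T\<close>
  were unbounded, their norms would grow without bound along a sequence and the gliding hump would
  produce an \<open>x\<close> at which they are unbounded.\<close>

lemma L_bounded:
  assumes T: "T \<in> carrier L"
  shows "\<exists>B\<ge>0. \<forall>x\<in>carrier E. hnorm E (T x) \<le> B * hnorm E x"
proof (rule ccontr)
  assume "\<not> ?thesis"
  then have unb: "\<exists>x\<in>carrier E. hnorm E (T x) > B * hnorm E x" if "B \<ge> 0" for B
    using that by (meson not_le_imp_less)
  have ex: "\<exists>y i. y \<in> carrier E \<and> i \<in> I \<and> hnorm E y \<le> 1 \<and> 4 ^ n \<le> hnorm E (T y) \<and>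
      3/4 * (hnorm E (T y))\<^sup>2 \<le> Re (ip i (T y) (T y))" for n
  proof -
    obtain x where x: "x \<in> carrier E" "hnorm E (T x) > 4 ^ n * hnorm E x" using unb[of "4 ^ n"] by auto
    have Tx: "T x \<in> carrier E" using T x by simp
    have x0: "hnorm E x > 0"
    proof (rule ccontr)
      assume "\<not> hnorm E x > 0"
      then have "hnorm E x = 0" using hnorm_nonneg[OF x(1)] by simp
      then have "x = hzero E"
        using hnorm_le_sub[of "hsub x (hzero E)" x] x
        by (intro vec_eqI) (use ip_le[of _ _ x] in fastforce)+
      then show False using x(2) L_zero[OF T] by simp
    qed
    define y where "y = hscale E (complex_of_real (1 / hnorm E x)) x"
    have y: "y \<in> carrier E" using x by (simp add: y_def)
    have ny: "hnorm E y = 1" using x0 hnorm_scale[OF x(1)] by (simp add: y_def norm_divide)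
    have Ty: "hnorm E (T y) = hnorm E (T x) / hnorm E x"
      using x0 hnorm_scale[OF Tx] by (simp add: y_def L_scale[OF T x(1)] norm_divide)
    have big: "4 ^ n < hnorm E (T y)" using x(2) x0 by (simp add: Ty field_simps)
    have TyE: "T y \<in> carrier E" using T y by simp
    \<comment> \<open>The norm of the module is a supremum over \<open>i\<close> that need not be
      attained, so an index is chosen that reaches three quarters of its square.\<close>
    define q where "q = sqrt (3/4) * hnorm E (T y)"
    have Ty0: "hnorm E (T y) > 0" using big zero_le_power[of "4::real" n] by linarith
    have "sqrt (3/4) < 1" by (simp add: real_sqrt_lt_1_iff)
    then have q: "0 \<le> q" "q < hnorm E (T y)" using Ty0 by (auto simp: q_def)
    have "\<not> (\<forall>i\<in>I. Re (ip i (T y) (T y)) \<le> q\<^sup>2)"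
      using hnorm_le_iff[OF TyE q(1)] q(2) by simp
    then obtain i where "i \<in> I" "q\<^sup>2 < Re (ip i (T y) (T y))" by fastforce
    moreover have "q\<^sup>2 = 3/4 * (hnorm E (T y))\<^sup>2" by (simp add: q_def power_mult_distrib)
    ultimately show ?thesis using y ny big by (intro exI[of _ y] exI[of _ i]) auto
  qed
  then obtain y i where yi: "\<And>n. y n \<in> carrier E" "\<And>n. i n \<in> I" "\<And>n. hnorm E (y n) \<le> 1"
    "\<And>n. 4 ^ n \<le> hnorm E (T (y n))" "\<And>n. 3/4 * (hnorm E (T (y n)))\<^sup>2 \<le> Re (ip (i n) (T (y n)) (T (y n)))"
    by metis
  have Ty: "T (y n) \<in> carrier E" for n using T yi by simp
  define c where "c n = hnorm E (T (y n))" for n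
  have c0: "c n > 0" for n
  proof -
    have "0 < (4::real) ^ n" by simp
    then show ?thesis using yi(4)[of n] unfolding c_def by linarith
  qed
  \<comment> \<open>The normalized vector at which the functional \<open>n\<close> comes within the
    factor 3/4 of its bound \<open>c n\<close>.\<close>
  define u where "u n = hscale E (complex_of_real (1 / c n)) (T (y n))" for n
  define \<phi> where "\<phi> n x = ip (i n) (T (y n)) x" for n x
  have "\<exists>x\<in>carrier E. \<forall>n. (4/3) ^ n / 4 \<le> cmod (\<phi> n x)"
  proof (rule gliding_hump[of \<phi> c u])
    show "\<phi> n (hadd E x y) = \<phi> n x + \<phi> n y" if "x \<in> carrier E" "y \<in> carrier E" for n x y
      using that yi Ty by (simp add: \<phi>_def)
    show "\<phi> n (hscale E d x) = d * \<phi> n x" if "x \<in> carrier E" for n d x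
      using that yi Ty by (simp add: \<phi>_def)
    show "cmod (\<phi> n x) \<le> c n * hnorm E x" if "x \<in> carrier E" for n x
      using that yi Ty by (simp add: \<phi>_def c_def ip_le)
    show "u n \<in> carrier E" for n using Ty by (simp add: u_def)
    show "hnorm E (u n) \<le> 1" for n
      using hnorm_scale[OF Ty] c0[of n] by (simp add: u_def norm_divide c_def)
    show "4 ^ n \<le> c n" for n using yi(4) by (simp add: c_def)
    show "3/4 * c n \<le> cmod (\<phi> n (u n))" for n
    proof -
      have "\<phi> n (u n) = complex_of_real (1 / c n) * ip (i n) (T (y n)) (T (y n))"
        using yi Ty by (simp add: \<phi>_def u_def)
      then have "cmod (\<phi> n (u n)) = cmod (ip (i n) (T (y n)) (T (y n))) / c n"
        using c0[of n] by (simp add: norm_mult norm_divide)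
      also have "\<dots> \<ge> (3/4 * (c n)\<^sup>2) / c n"
        using yi(5)[of n] complex_Re_le_cmod[of "ip (i n) (T (y n)) (T (y n))"] c0[of n]
        by (intro divide_right_mono) (auto simp: c_def)
      finally show ?thesis using c0[of n] by (simp add: power2_eq_square)
    qed
  qed
  then obtain x where x: "x \<in> carrier E" "\<And>n. (4/3) ^ n / 4 \<le> cmod (\<phi> n x)" by blast
  let ?S = "star L T x"
  have Sx: "?S \<in> carrier E" using star_fun_closed[OF T x(1)] .
  obtain n where n: "4 * hnorm E ?S < (4/3) ^ n" using real_arch_pow[of "4/3" "4 * hnorm E ?S"] by auto
  have "\<phi> n x = ip (i n) (y n) ?S" using adjointE(2)[OF T yi(2) yi(1) x(1)] by (simp add: \<phi>_def)
  then have "cmod (\<phi> n x) \<le> hnorm E (y n) * hnorm E ?S" using ip_le[OF yi(2) yi(1) Sx] by simp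
  also have "\<dots> \<le> 1 * hnorm E ?S" using yi(3) Sx by (intro mult_right_mono) auto
  finally show False using x(2)[of n] n by simp
qed

lemma L_norm_bdd: "T \<in> carrier L \<Longrightarrow> bdd_above ((\<lambda>x. hnorm E (T x)) ` {x \<in> carrier E. hnorm E x \<le> 1})"
proof -
  assume T: "T \<in> carrier L"
  obtain B where B: "B \<ge> 0" "\<forall>x\<in>carrier E. hnorm E (T x) \<le> B * hnorm E x" using L_bounded[OF T] by blast
  show ?thesis
  proof (rule bdd_aboveI2[of _ _ B])
    fix x assume x: "x \<in> {x \<in> carrier E. hnorm E x \<le> 1}"
    then have "hnorm E (T x) \<le> B * hnorm E x" using B by blast
    also have "\<dots> \<le> B * 1" using x B by (intro mult_left_mono) auto
    finally show "hnorm E (T x) \<le> B" by simp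
  qed
qed

lemma hnorm_eq_0: "\<lbrakk>x \<in> carrier E; hnorm E x = 0\<rbrakk> \<Longrightarrow> x = hzero E"
proof -
  assume x: "x \<in> carrier E" "hnorm E x = 0"
  have "ip i z x = 0" if "i \<in> I" "z \<in> carrier E" for i z
    using ip_le[OF that(1,2) x(1)] x(2) by simp
  then show "x = hzero E" using x(1) by (intro vec_eqI) auto
qed

lemma L_norm_apply:
  assumes T: "T \<in> carrier L" and x: "x \<in> carrier E"
  shows "hnorm E (T x) \<le> cnorm L T * hnorm E x"
proof (cases "hnorm E x = 0")
  case True
  then show ?thesis using hnorm_eq_0[OF x] L_zero[OF T] by simp
next
  case False
  then have x0: "hnorm E x > 0" using hnorm_nonneg[OF x] by simp
  let ?y = "hscale E (complex_of_real (1 / hnorm E x)) x"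
  have "hnorm E (T ?y) \<le> cnorm L T"
    unfolding L_simps using x x0 hnorm_scale[OF x]
    by (intro cSUP_upper L_norm_bdd[OF T]) (auto simp: norm_divide)
  moreover have "hnorm E (T ?y) = hnorm E (T x) / hnorm E x"
    using hnorm_scale[of "T x"] x0 T x by (simp add: L_scale norm_divide)
  ultimately have "hnorm E (T x) / hnorm E x \<le> cnorm L T" by simp
  then show ?thesis using x0 by (simp add: pos_divide_le_eq)
qed

lemma L_norm_le:
  assumes "0 \<le> B" "\<And>x. x \<in> carrier E \<Longrightarrow> hnorm E (T x) \<le> B * hnorm E x"
  shows "cnorm L T \<le> B"
  unfolding L_simps
proof (rule cSUP_least)
  show "{x \<in> carrier E. hnorm E x \<le> 1} \<noteq> {}" using hzero_closed hnorm_zero by fastforce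
  fix x assume x: "x \<in> {x \<in> carrier E. hnorm E x \<le> 1}"
  then have "hnorm E (T x) \<le> B * hnorm E x" using assms by blast
  also have "\<dots> \<le> B * 1" using x assms(1) by (intro mult_left_mono) auto
  finally show "hnorm E (T x) \<le> B" by simp
qed

lemma L_norm_nonneg:
  assumes "T \<in> carrier L"
  shows "0 \<le> cnorm L T"
proof -
  have "hnorm E (T (hzero E)) \<le> cnorm L T"
    unfolding L_simps by (rule cSUP_upper[OF _ L_norm_bdd[OF assms]]) simp
  then show ?thesis using L_zero[OF assms] by simp
qed

lemma L_mult_closed:
  assumes "S \<in> carrier L" "T \<in> carrier L"
  shows "S \<otimes>\<^bsub>L\<^esub> T \<in> carrier L" "star L (S \<otimes>\<^bsub>L\<^esub> T) = star L T \<otimes>\<^bsub>L\<^esub> star L S"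
proof -
  have f: "S \<otimes>\<^bsub>L\<^esub> T \<in> carrier E \<rightarrow>\<^sub>E carrier E" "star L T \<otimes>\<^bsub>L\<^esub> star L S \<in> carrier E \<rightarrow>\<^sub>E carrier E"
    using assms by (auto simp: L_simps star_fun_closed)
  have ad: "ip i ((S \<otimes>\<^bsub>L\<^esub> T) x) y = ip i x ((star L T \<otimes>\<^bsub>L\<^esub> star L S) y)"
    if "i \<in> I" "x \<in> carrier E" "y \<in> carrier E" for i x y
    using that assms by (simp add: L_simps star_fun_closed adjointE(2))
  show "S \<otimes>\<^bsub>L\<^esub> T \<in> carrier L" "star L (S \<otimes>\<^bsub>L\<^esub> T) = star L T \<otimes>\<^bsub>L\<^esub> star L S"
    using adjointI[OF f ad] by blast+
qed

lemma L_add_closed: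
  assumes "S \<in> carrier L" "T \<in> carrier L"
  shows "S \<oplus>\<^bsub>L\<^esub> T \<in> carrier L" "star L (S \<oplus>\<^bsub>L\<^esub> T) = star L S \<oplus>\<^bsub>L\<^esub> star L T"
proof -
  have f: "S \<oplus>\<^bsub>L\<^esub> T \<in> carrier E \<rightarrow>\<^sub>E carrier E" "star L S \<oplus>\<^bsub>L\<^esub> star L T \<in> carrier E \<rightarrow>\<^sub>E carrier E"
    using assms by (auto simp: L_simps star_fun_closed)
  have ad: "ip i ((S \<oplus>\<^bsub>L\<^esub> T) x) y = ip i x ((star L S \<oplus>\<^bsub>L\<^esub> star L T) y)"
    if "i \<in> I" "x \<in> carrier E" "y \<in> carrier E" for i x y
    using that assms by (simp add: L_simps star_fun_closed adjointE(2))
  show "S \<oplus>\<^bsub>L\<^esub> T \<in> carrier L" "star L (S \<oplus>\<^bsub>L\<^esub> T) = star L S \<oplus>\<^bsub>L\<^esub> star L T"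
    using adjointI[OF f ad] by blast+
qed

lemma L_scale_closed:
  assumes "T \<in> carrier L"
  shows "cscale L c T \<in> carrier L" "star L (cscale L c T) = cscale L (cnj c) (star L T)"
proof -
  have f: "cscale L c T \<in> carrier E \<rightarrow>\<^sub>E carrier E" "cscale L (cnj c) (star L T) \<in> carrier E \<rightarrow>\<^sub>E carrier E"
    using assms by (auto simp: L_simps star_fun_closed)
  have ad: "ip i ((cscale L c T) x) y = ip i x ((cscale L (cnj c) (star L T)) y)"
    if "i \<in> I" "x \<in> carrier E" "y \<in> carrier E" for i x y
    using that assms by (simp add: L_simps star_fun_closed adjointE(2))
  show "cscale L c T \<in> carrier L" "star L (cscale L c T) = cscale L (cnj c) (star L T)"
    using adjointI[OF f ad] by blast+
qed

lemma L_zero_closed: "\<zero>\<^bsub>L\<^esub> \<in> carrier L"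
  by (rule adjointI(1)[where S = "\<zero>\<^bsub>L\<^esub>"]) (auto simp: L_simps)

lemma L_one_closed: "\<one>\<^bsub>L\<^esub> \<in> carrier L"
  by (rule adjointI(1)[where S = "\<one>\<^bsub>L\<^esub>"]) (auto simp: L_simps)

lemma L_eqI:
  assumes "S \<in> carrier L" "T \<in> carrier L"
    and "\<And>i x z. \<lbrakk>i \<in> I; x \<in> carrier E; z \<in> carrier E\<rbrakk> \<Longrightarrow> ip i z (S x) = ip i z (T x)"
  shows "S = T"
  by (rule PiE_ext[OF L_fun[OF assms(1)] L_fun[OF assms(2)]]) (rule vec_eqI; use assms in auto)

lemma L_star_alg: "star_alg L"
  by (rule star_algI; (rule L_eqI)?)
    (auto simp: L_zero_closed L_one_closed L_add_closed L_mult_closed L_scale_closed star_L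
      star_fun_closed L_scale, auto simp: L_simps L_zero_closed[unfolded L_simps] algebra_simps L_scale star_fun_closed)

text \<open>Moving \<open>T\<close> across the inner product bounds the square of
  \<open>hnorm E (T x)\<close> by a product containing the same factor once; that factor is
  cancelled.\<close>

lemma L_norm_le_star:
  assumes T: "T \<in> carrier L"
  shows "cnorm L T \<le> cnorm L (star L T)"
proof (rule L_norm_le)
  note S = star_L(1)[OF T]
  show B: "0 \<le> cnorm L (star L T)" by (rule L_norm_nonneg[OF S])
  fix x assume x: "x \<in> carrier E"
  note Tx = L_closed[OF T x]
  let ?r = "hnorm E x * (cnorm L (star L T) * hnorm E (T x))"
  have r: "0 \<le> ?r" using x Tx B by simp
  have "Re (ip i (T x) (T x)) \<le> ?r" if i: "i \<in> I" for i
  proof -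
    have "Re (ip i (T x) (T x)) \<le> cmod (ip i x (star L T (T x)))"
      unfolding adjointE(2)[OF T i x Tx] by (rule complex_Re_le_cmod)
    also have "\<dots> \<le> hnorm E x * hnorm E (star L T (T x))"
      by (rule ip_le[OF i x L_closed[OF S Tx]])
    also have "\<dots> \<le> ?r" using L_norm_apply[OF S Tx] x by (intro mult_left_mono) auto
    finally show ?thesis .
  qed
  then have "hnorm E (T x) \<le> sqrt ?r"
    using r by (subst hnorm_le_iff[OF Tx]) auto
  then have "(hnorm E (T x))\<^sup>2 \<le> ?r" using r Tx by (metis hnorm_nonneg power_mono real_sqrt_pow2)
  then have "hnorm E (T x) * hnorm E (T x) \<le> hnorm E (T x) * (cnorm L (star L T) * hnorm E x)"
    by (simp add: power2_eq_square algebra_simps)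
  then show "hnorm E (T x) \<le> cnorm L (star L T) * hnorm E x"
    using hnorm_nonneg[OF Tx] B x by (cases "hnorm E (T x) = 0") auto
qed

lemma L_seminormed: "seminormed_star_alg L (cnorm L)"
proof -
  interpret L: star_alg L by (rule L_star_alg)
  have scale_le: "cnorm L (cscale L c T) \<le> cmod c * cnorm L T" if T: "T \<in> carrier L" for c T
  proof (rule L_norm_le)
    fix x assume x: "x \<in> carrier E"
    have "hnorm E (cscale L c T x) = cmod c * hnorm E (T x)" using T x by (simp add: L_simps hnorm_scale)
    also have "\<dots> \<le> cmod c * (cnorm L T * hnorm E x)" by (intro mult_left_mono L_norm_apply T x) simp
    finally show "hnorm E (cscale L c T x) \<le> cmod c * cnorm L T * hnorm E x" by (simp add: mult.assoc)
  qed (use L_norm_nonneg[OF T] in simp)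
  show ?thesis
  proof
    fix T assume T: "T \<in> carrier L"
    show "0 \<le> cnorm L T" by (rule L_norm_nonneg[OF T])
    show "cnorm L (star L T) = cnorm L T"
      using L_norm_le_star[OF T] L_norm_le_star[OF star_L(1)[OF T]] star_L(2)[OF T] by simp
    show "cnorm L (cscale L c T) = cmod c * cnorm L T" for c
    proof (cases "c = 0")
      case True
      then show ?thesis using scale_le[OF T, of 0] L_norm_nonneg[OF L.scale_closed[OF T, of 0]] by simp
    next
      case False
      have "T = cscale L (inverse c) (cscale L c T)" using T False by (simp add: L.scale_scale)
      then have "cnorm L T \<le> cmod (inverse c) * cnorm L (cscale L c T)"
        using scale_le[OF L.scale_closed[OF T, of c], of "inverse c"] by simp
      then have "cmod c * cnorm L T \<le> cnorm L (cscale L c T)"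
        using False by (simp add: norm_inverse norm_divide field_simps)
      then show ?thesis using scale_le[OF T, of c] by simp
    qed
    fix S assume S: "S \<in> carrier L"
    show "cnorm L (T \<oplus>\<^bsub>L\<^esub> S) \<le> cnorm L T + cnorm L S"
    proof (rule L_norm_le)
      fix x assume x: "x \<in> carrier E"
      have "hnorm E ((T \<oplus>\<^bsub>L\<^esub> S) x) \<le> hnorm E (T x) + hnorm E (S x)"
        using T S x by (simp add: L_simps hnorm_triangle)
      also have "\<dots> \<le> cnorm L T * hnorm E x + cnorm L S * hnorm E x" by (intro add_mono L_norm_apply T S x)
      finally show "hnorm E ((T \<oplus>\<^bsub>L\<^esub> S) x) \<le> (cnorm L T + cnorm L S) * hnorm E x" by (simp add: algebra_simps)
    qed (use L_norm_nonneg T S in simp)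
    show "cnorm L (T \<otimes>\<^bsub>L\<^esub> S) \<le> cnorm L T * cnorm L S"
    proof (rule L_norm_le)
      fix x assume x: "x \<in> carrier E"
      have "hnorm E ((T \<otimes>\<^bsub>L\<^esub> S) x) \<le> cnorm L T * hnorm E (S x)"
        using T S x L_norm_apply[OF T, of "S x"] by (simp add: L_simps)
      also have "\<dots> \<le> cnorm L T * (cnorm L S * hnorm E x)" by (intro mult_left_mono L_norm_apply L_norm_nonneg T S x)
      finally show "hnorm E ((T \<otimes>\<^bsub>L\<^esub> S) x) \<le> cnorm L T * cnorm L S * hnorm E x" by (simp add: mult.assoc)
    qed (use L_norm_nonneg T S in simp)
  qed
qed

lemma L_diff_apply:
  assumes "S \<in> carrier L" "T \<in> carrier L" "x \<in> carrier E"
  shows "(S \<ominus>\<^bsub>L\<^esub> T) x = hsub (S x) (T x)"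
proof -
  interpret L: star_alg L by (rule L_star_alg)
  show ?thesis using assms by (simp add: L.diff_eq) (simp add: L_simps)
qed

lemma L_cauchy_pointwise:
  assumes "s \<in> seminorm_cauchy L (cnorm L)" "x \<in> carrier E"
  shows "\<exists>y\<in>carrier E. (\<lambda>n. hnorm E (hsub (s n x) y)) \<longlonglongrightarrow> 0"
proof -
  interpret L: seminormed_star_alg L "cnorm L" by (rule L_seminormed)
  note sc = L.cauchy_carrier[OF assms(1)]
  show ?thesis
  proof (rule hcomplete)
    show "s n x \<in> carrier E" for n using sc assms by simp
    fix \<epsilon> :: real assume e: "\<epsilon> > 0"
    define d where "d = \<epsilon> / (hnorm E x + 1)"
    have nx: "hnorm E x + 1 > 0" using hnorm_nonneg[OF assms(2)] by linarith
    have d: "d > 0" "d * (hnorm E x + 1) = \<epsilon>" using e nx by (auto simp: d_def)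
    obtain N where N: "\<forall>m\<ge>N. \<forall>n\<ge>N. cnorm L (s m \<ominus>\<^bsub>L\<^esub> s n) < d" using L.cauchyD[OF assms(1) d(1)] by blast
    have "hnorm E (hsub (s m x) (s n x)) < \<epsilon>" if "m \<ge> N" "n \<ge> N" for m n
    proof -
      have "hnorm E (hsub (s m x) (s n x)) \<le> cnorm L (s m \<ominus>\<^bsub>L\<^esub> s n) * hnorm E x"
        using L_norm_apply[of "s m \<ominus>\<^bsub>L\<^esub> s n" x] sc assms(2) by (simp add: L_diff_apply)
      also have "\<dots> \<le> d * hnorm E x"
        using N that assms(2) by (intro mult_right_mono) (auto simp: less_imp_le)
      also have "\<dots> < \<epsilon>" using d by (simp add: algebra_simps)
      finally show ?thesis .
    qed
    then show "\<exists>N. \<forall>m\<ge>N. \<forall>n\<ge>N. hnorm E (hsub (s m x) (s n x)) < \<epsilon>" by blast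
  qed
qed

lemma ip_tendsto:
  assumes "i \<in> I" "z \<in> carrier E" "\<And>n. y n \<in> carrier E" "y' \<in> carrier E" "(\<lambda>n. hnorm E (hsub (y n) y')) \<longlonglongrightarrow> 0"
  shows "(\<lambda>n. ip i z (y n)) \<longlonglongrightarrow> ip i z y'"
proof -
  have "(\<lambda>n. ip i z (y n) - ip i z y') \<longlonglongrightarrow> 0"
  proof (rule Lim_null_comparison)
    show "\<forall>\<^sub>F n in sequentially. norm (ip i z (y n) - ip i z y') \<le> hnorm E z * hnorm E (hsub (y n) y')"
    proof (intro always_eventually allI)
      fix n
      have "ip i z (y n) - ip i z y' = ip i z (hsub (y n) y')" using assms by simp
      then show "norm (ip i z (y n) - ip i z y') \<le> hnorm E z * hnorm E (hsub (y n) y')"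
        using ip_le[OF assms(1,2), of "hsub (y n) y'"] assms by simp
    qed
    show "(\<lambda>n. hnorm E z * hnorm E (hsub (y n) y')) \<longlonglongrightarrow> 0"
      using tendsto_mult_right_zero[OF assms(5)] .
  qed
  then show ?thesis by (simp add: LIM_zero_iff)
qed

text \<open>A Cauchy sequence of operators converges pointwise, and so does the sequence of
  adjoints. Continuity of the inner product makes the two limits adjoint to each other, so the limit
  operator is adjointable.\<close>

lemma L_banach: "banach_star_alg L"
proof -
  interpret L: seminormed_star_alg L "cnorm L" by (rule L_seminormed)
  show ?thesis
  proof
    fix T assume T: "T \<in> carrier L" "cnorm L T = 0"
    have "T x = hzero E" if x: "x \<in> carrier E" for x
      using L_norm_apply[OF T(1) x] T hnorm_nonneg[OF L_closed[OF T(1) x]] x by (intro hnorm_eq_0) auto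
    then show "T = \<zero>\<^bsub>L\<^esub>"
      using T(1) by (intro L_eqI) (auto simp: L_zero_closed, simp add: L_simps)
  next
    fix s assume s: "s \<in> seminorm_cauchy L (cnorm L)"
    note sc = L.cauchy_carrier[OF s]
    have s': "(\<lambda>n. star L (s n)) \<in> seminorm_cauchy L (cnorm L)" by (rule L.cauchy_star[OF s])
    obtain t where t: "\<And>x. x \<in> carrier E \<Longrightarrow> t x \<in> carrier E"
      "\<And>x. x \<in> carrier E \<Longrightarrow> (\<lambda>n. hnorm E (hsub (s n x) (t x))) \<longlonglongrightarrow> 0"
      using L_cauchy_pointwise[OF s] by metis
    obtain u where u: "\<And>x. x \<in> carrier E \<Longrightarrow> u x \<in> carrier E"
      "\<And>x. x \<in> carrier E \<Longrightarrow> (\<lambda>n. hnorm E (hsub (star L (s n) x) (u x))) \<longlonglongrightarrow> 0"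
      using L_cauchy_pointwise[OF s'] by metis
    define T where "T = restrict t (carrier E)"
    have T: "T \<in> carrier L"
    proof (rule adjointI(1)[of _ "restrict u (carrier E)"])
      fix i x y assume i: "i \<in> I" and x: "x \<in> carrier E" and y: "y \<in> carrier E"
      have "(\<lambda>n. ip i y (s n x)) \<longlonglongrightarrow> ip i y (t x)"
        using i x y sc t by (intro ip_tendsto) auto
      then have "(\<lambda>n. cnj (ip i y (s n x))) \<longlonglongrightarrow> cnj (ip i y (t x))" by (rule tendsto_cnj)
      moreover have "cnj (ip i y (s n x)) = ip i x (star L (s n) y)" for n
        using ip_sym[OF i y L_closed[OF sc x]] adjointE(2)[OF sc i x y] by metis
      moreover have "cnj (ip i y (t x)) = ip i (t x) y"
        using ip_sym[OF i y t(1)[OF x]] by simp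
      ultimately have "(\<lambda>n. ip i x (star L (s n) y)) \<longlonglongrightarrow> ip i (t x) y" by simp
      moreover have "(\<lambda>n. ip i x (star L (s n) y)) \<longlonglongrightarrow> ip i x (u y)"
        using i x y sc u star_fun_closed by (intro ip_tendsto) auto
      ultimately have "ip i (t x) y = ip i x (u y)" by (rule LIMSEQ_unique)
      then show "ip i (T x) y = ip i x (restrict u (carrier E) y)" using x y by (simp add: T_def)
    qed (use t u in \<open>auto simp: T_def\<close>)
    have "(\<lambda>n. cnorm L (s n \<ominus>\<^bsub>L\<^esub> T)) \<longlonglongrightarrow> 0"
    proof (rule LIMSEQ_I)
      fix r :: real assume r: "r > 0"
      obtain N where N: "\<forall>m\<ge>N. \<forall>n\<ge>N. cnorm L (s m \<ominus>\<^bsub>L\<^esub> s n) < r / 2"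
        using L.cauchyD[OF s, of "r / 2"] r by auto
      have "norm (cnorm L (s n \<ominus>\<^bsub>L\<^esub> T) - 0) < r" if n: "n \<ge> N" for n
      proof -
        have "cnorm L (s n \<ominus>\<^bsub>L\<^esub> T) \<le> r / 2"
        proof (rule L_norm_le)
          fix x assume x: "x \<in> carrier E"
          have lim: "(\<lambda>m. r / 2 * hnorm E x + hnorm E (hsub (s m x) (t x))) \<longlonglongrightarrow> r / 2 * hnorm E x + 0"
            by (intro tendsto_add tendsto_const t(2)[OF x])
          have "hnorm E ((s n \<ominus>\<^bsub>L\<^esub> T) x) \<le> r / 2 * hnorm E x + 0"
          proof (rule LIMSEQ_le_const[OF lim], intro exI[of _ N] allI impI)
            fix m assume m: "N \<le> m"
            have "hnorm E ((s n \<ominus>\<^bsub>L\<^esub> T) x) = hnorm E (hsub (s n x) (t x))"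
              using sc T x by (simp add: L_diff_apply) (simp add: T_def)
            also have "\<dots> \<le> hnorm E (hsub (s n x) (s m x)) + hnorm E (hsub (s m x) (t x))"
              using sc t x by (intro hnorm_sub_triangle) auto
            also have "hnorm E (hsub (s n x) (s m x)) \<le> cnorm L (s n \<ominus>\<^bsub>L\<^esub> s m) * hnorm E x"
              using L_norm_apply[of "s n \<ominus>\<^bsub>L\<^esub> s m" x] sc x by (simp add: L_diff_apply)
            also have "\<dots> \<le> r / 2 * hnorm E x"
              using N m n x by (intro mult_right_mono) (auto simp: less_imp_le)
            finally show "hnorm E ((s n \<ominus>\<^bsub>L\<^esub> T) x) \<le> r / 2 * hnorm E x + hnorm E (hsub (s m x) (t x))"
              by simp
          qed
          then show "hnorm E ((s n \<ominus>\<^bsub>L\<^esub> T) x) \<le> r / 2 * hnorm E x" by simp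
        qed (use r in simp)
        then show ?thesis using r L.norm_nonneg[OF L.minus_closed[OF sc T]] by auto
      qed
      then show "\<exists>no. \<forall>n\<ge>no. norm (cnorm L (s n \<ominus>\<^bsub>L\<^esub> T) - 0) < r" by blast
    qed
    then show "\<exists>x. L.tends s x" using sc T unfolding L.tends_def by blast
  qed
qed

end

section \<open>Square-summable functions\<close>

definition square_summable :: "'x set \<Rightarrow> ('x \<Rightarrow> complex) \<Rightarrow> bool" where
  "square_summable X f \<longleftrightarrow> (\<lambda>x. (cmod (f x))\<^sup>2) summable_on X"

definition l2_inner :: "'x set \<Rightarrow> ('x \<Rightarrow> complex) \<Rightarrow> ('x \<Rightarrow> complex) \<Rightarrow> complex" where
  "l2_inner X f g = (\<Sum>\<^sub>\<infinity>x\<in>X. cnj (f x) * g x)"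

lemma square_summableI:
  assumes "\<And>F. \<lbrakk>finite F; F \<subseteq> X\<rbrakk> \<Longrightarrow> (\<Sum>x\<in>F. (cmod (f x))\<^sup>2) \<le> B"
  shows "square_summable X f"
  unfolding square_summable_def
  by (rule nonneg_bdd_above_summable_on) (use assms in \<open>auto intro!: bdd_aboveI2[of _ _ B]\<close>)

lemma square_summable_cong: "(\<And>x. x \<in> X \<Longrightarrow> f x = g x) \<Longrightarrow> square_summable X f \<longleftrightarrow> square_summable X g"
  unfolding square_summable_def by (rule summable_on_cong) simp

lemma l2_inner_cong:
  "\<lbrakk>\<And>x. x \<in> X \<Longrightarrow> f x = f' x; \<And>x. x \<in> X \<Longrightarrow> g x = g' x\<rbrakk> \<Longrightarrow> l2_inner X f g = l2_inner X f' g'"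
  unfolding l2_inner_def by (rule infsum_cong) simp

lemma cmod_add_square: "(cmod (a + b))\<^sup>2 \<le> 2 * (cmod a)\<^sup>2 + 2 * (cmod b)\<^sup>2"
proof -
  have "(cmod (a + b))\<^sup>2 \<le> (cmod a + cmod b)\<^sup>2" by (intro power_mono norm_triangle_ineq) simp
  also have "\<dots> \<le> 2 * (cmod a)\<^sup>2 + 2 * (cmod b)\<^sup>2"
    using sum_squares_bound[of "cmod a" "cmod b"] by (simp add: power2_sum)
  finally show ?thesis .
qed

lemma square_summable_add:
  assumes "square_summable X f" "square_summable X g"
  shows "square_summable X (\<lambda>x. f x + g x)"
  unfolding square_summable_def
proof (rule summable_on_comparison_test)
  show "(\<lambda>x. 2 * (cmod (f x))\<^sup>2 + 2 * (cmod (g x))\<^sup>2) summable_on X"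
    using assms unfolding square_summable_def by (intro summable_on_add summable_on_cmult_right)
qed (auto intro: cmod_add_square)

lemma square_summable_scale:
  assumes "square_summable X f"
  shows "square_summable X (\<lambda>x. c * f x)"
  using assms unfolding square_summable_def norm_mult power_mult_distrib
  by (rule summable_on_cmult_right)

lemma square_summable_zero [simp]: "square_summable X (\<lambda>x. 0)"
  by (simp add: square_summable_def)

lemma l2_inner_summable:
  assumes "square_summable X f" "square_summable X g"
  shows "(\<lambda>x. cnj (f x) * g x) summable_on X"
proof (rule abs_summable_summable, rule abs_summable_on_comparison_test')
  show "(\<lambda>x. (cmod (f x))\<^sup>2 + (cmod (g x))\<^sup>2) summable_on X"
    using assms unfolding square_summable_def by (rule summable_on_add)
  fix x assume "x \<in> X"
  have "2 * (cmod (f x) * cmod (g x)) \<le> (cmod (f x))\<^sup>2 + (cmod (g x))\<^sup>2"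
    using sum_squares_bound[of "cmod (f x)" "cmod (g x)"] by simp
  moreover have "0 \<le> cmod (f x) * cmod (g x)" by simp
  moreover have "cmod (cnj (f x) * g x) = cmod (f x) * cmod (g x)" by (simp add: norm_mult)
  ultimately show "cmod (cnj (f x) * g x) \<le> (cmod (f x))\<^sup>2 + (cmod (g x))\<^sup>2" by linarith
qed

lemma l2_inner_add:
  assumes "square_summable X f" "square_summable X g" "square_summable X h"
  shows "l2_inner X h (\<lambda>x. f x + g x) = l2_inner X h f + l2_inner X h g"
  unfolding l2_inner_def
  using infsum_add[OF l2_inner_summable[OF assms(3,1)] l2_inner_summable[OF assms(3,2)]]
  by (simp add: algebra_simps)

lemma l2_inner_scale: "l2_inner X h (\<lambda>x. c * f x) = c * l2_inner X h f"
  unfolding l2_inner_def infsum_cmult_right'[symmetric] by (simp add: algebra_simps)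

lemma l2_inner_sym: "l2_inner X g f = cnj (l2_inner X f g)"
  unfolding l2_inner_def infsum_cnj[symmetric] by (simp add: mult.commute)

lemma l2_inner_self:
  assumes "square_summable X f"
  shows "Re (l2_inner X f f) = (\<Sum>\<^sub>\<infinity>x\<in>X. (cmod (f x))\<^sup>2)"
proof -
  have e: "Re (cnj (f x) * f x) = (cmod (f x))\<^sup>2" for x
  proof -
    have "cnj (f x) * f x = complex_of_real ((cmod (f x))\<^sup>2)" by (metis complex_norm_square mult.commute)
    then show ?thesis by (metis Re_complex_of_real)
  qed
  have "Re (l2_inner X f f) = (\<Sum>\<^sub>\<infinity>x\<in>X. Re (cnj (f x) * f x))"
    unfolding l2_inner_def by (rule infsum_Re[OF l2_inner_summable[OF assms assms], symmetric])
  then show ?thesis unfolding e .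
qed

lemma l2_inner_self_le_iff:
  assumes "square_summable X f"
  shows "Re (l2_inner X f f) \<le> r \<longleftrightarrow> (\<forall>F. finite F \<and> F \<subseteq> X \<longrightarrow> (\<Sum>x\<in>F. (cmod (f x))\<^sup>2) \<le> r)"
proof
  assume r: "Re (l2_inner X f f) \<le> r"
  show "\<forall>F. finite F \<and> F \<subseteq> X \<longrightarrow> (\<Sum>x\<in>F. (cmod (f x))\<^sup>2) \<le> r"
    using r finite_sum_le_infsum[of "\<lambda>x. (cmod (f x))\<^sup>2" X] assms
    unfolding l2_inner_self[OF assms] square_summable_def by fastforce
next
  assume "\<forall>F. finite F \<and> F \<subseteq> X \<longrightarrow> (\<Sum>x\<in>F. (cmod (f x))\<^sup>2) \<le> r"
  then show "Re (l2_inner X f f) \<le> r"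
    unfolding l2_inner_self[OF assms]
    using assms unfolding square_summable_def by (intro infsum_le_finite_sums) auto
qed

lemma l2_inner_self_nonneg: "square_summable X f \<Longrightarrow> 0 \<le> Re (l2_inner X f f)"
  unfolding l2_inner_self by (rule infsum_nonneg) simp

lemma l2_pointwise_le:
  assumes "square_summable X f" "Re (l2_inner X f f) \<le> r\<^sup>2" "0 \<le> r" "x \<in> X"
  shows "cmod (f x) \<le> r"
proof -
  have "(\<Sum>x\<in>{x}. (cmod (f x))\<^sup>2) \<le> r\<^sup>2"
    using assms(2,4) unfolding l2_inner_self_le_iff[OF assms(1)] by blast
  then have "(cmod (f x))\<^sup>2 \<le> r\<^sup>2" by simp
  then show ?thesis by (rule power2_le_imp_le[OF _ assms(3)])
qed

lemma sum_square_limit: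
  fixes s :: "nat \<Rightarrow> 'x \<Rightarrow> complex"
  assumes "finite F" "\<And>x. x \<in> F \<Longrightarrow> (\<lambda>m. s m x) \<longlonglongrightarrow> t x" "\<And>m. m \<ge> N \<Longrightarrow> (\<Sum>x\<in>F. (cmod (a x - s m x))\<^sup>2) \<le> c"
  shows "(\<Sum>x\<in>F. (cmod (a x - t x))\<^sup>2) \<le> c"
proof (rule LIMSEQ_le_const2)
  show "(\<lambda>m. \<Sum>x\<in>F. (cmod (a x - s m x))\<^sup>2) \<longlonglongrightarrow> (\<Sum>x\<in>F. (cmod (a x - t x))\<^sup>2)"
    using assms(2) by (intro tendsto_sum tendsto_power tendsto_norm tendsto_diff tendsto_const)
qed (use assms(3) in blast)

lemma complex_cauchy_limit:
  fixes z :: "nat \<Rightarrow> complex"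
  assumes "\<And>\<epsilon>. \<epsilon> > 0 \<Longrightarrow> \<exists>N. \<forall>m\<ge>N. \<forall>n\<ge>N. cmod (z m - z n) < \<epsilon>"
  shows "\<exists>l. z \<longlonglongrightarrow> l"
proof -
  have "Cauchy z" using assms by (simp add: Cauchy_iff)
  then show ?thesis by (simp add: Cauchy_convergent_iff convergent_def)
qed

lemma square_summable_tail:
  assumes "square_summable X f" "\<epsilon> > 0"
  shows "\<exists>F\<^sub>0. finite F\<^sub>0 \<and> F\<^sub>0 \<subseteq> X \<and> (\<forall>F. finite F \<and> F \<subseteq> X - F\<^sub>0 \<longrightarrow> (\<Sum>x\<in>F. (cmod (f x))\<^sup>2) \<le> \<epsilon>)"
proof -
  let ?e = "\<lambda>x. (cmod (f x))\<^sup>2" and ?S = "\<Sum>\<^sub>\<infinity>x\<in>X. (cmod (f x))\<^sup>2"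
  have "(?e has_sum ?S) X" using assms(1) unfolding square_summable_def by simp
  then have "\<forall>\<^sub>F F in finite_subsets_at_top X. ?S - \<epsilon> < sum ?e F"
    unfolding has_sum_def using order_tendstoD(1)[of _ ?S _ "?S - \<epsilon>"] assms(2) by simp
  then obtain F0 where F0: "finite F0" "F0 \<subseteq> X" "?S - \<epsilon> < sum ?e F0"
    unfolding eventually_finite_subsets_at_top by blast
  have "sum ?e F \<le> \<epsilon>" if F: "finite F" "F \<subseteq> X - F0" for F
  proof -
    have "sum ?e F0 + sum ?e F = sum ?e (F0 \<union> F)"
      using F F0 by (intro sum.union_disjoint[symmetric]) auto
    also have "\<dots> \<le> ?S"
      using F F0 assms(1) unfolding square_summable_def by (intro finite_sum_le_infsum) auto
    finally show ?thesis using F0 by simp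
  qed
  then show ?thesis using F0 by blast
qed

section \<open>The Hilbert space of square-summable functions\<close>

lemma ell2_simps:
  "\<xi> \<in> carrier (ell2 X) \<longleftrightarrow> \<xi> \<in> extensional X \<and> square_summable X \<xi>"
  "hadd (ell2 X) \<xi> \<eta> = (\<lambda>x\<in>X. \<xi> x + \<eta> x)"
  "hzero (ell2 X) = (\<lambda>x\<in>X. 0)"
  "hscale (ell2 X) c \<xi> = (\<lambda>x\<in>X. c * \<xi> x)"
  "hinner (ell2 X) \<xi> \<eta> = l2_inner X \<xi> \<eta>"
  by (auto simp: ell2_def square_summable_def l2_inner_def PiE_def)

lemma ell2_norm: "square_summable X \<xi> \<Longrightarrow> hnorm (ell2 X) \<xi> = sqrt (Re (l2_inner X \<xi> \<xi>))"
  by (simp add: ell2_def l2_inner_self)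

lemma ell2_restrict: "square_summable X f \<Longrightarrow> restrict f X \<in> carrier (ell2 X)"
  using square_summable_cong[of X "restrict f X" f] by (simp add: ell2_simps)

text \<open>The index set is a point because the inner product is scalar. Completeness is the
  Riesz-Fischer argument: pointwise limits exist, and the Cauchy bound survives the limit on every
  finite subset.\<close>

lemma ell2_hilbert_mod: "hilbert_mod (ell2 X) {()} (\<lambda>_. l2_inner X)"
proof
  show "hzero (ell2 X) \<in> carrier (ell2 X)"
    by (simp add: ell2_restrict ell2_simps(3))
  show "hadd (ell2 X) x y \<in> carrier (ell2 X)" if "x \<in> carrier (ell2 X)" "y \<in> carrier (ell2 X)" for x y
    using that unfolding ell2_simps(2) by (intro ell2_restrict square_summable_add) (auto simp: ell2_simps)
  show "hscale (ell2 X) c x \<in> carrier (ell2 X)" if "x \<in> carrier (ell2 X)" for c x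
    using that unfolding ell2_simps(4) by (intro ell2_restrict square_summable_scale) (auto simp: ell2_simps)
  show "l2_inner X z (hzero (ell2 X)) = 0" for z
    unfolding l2_inner_def ell2_simps by (rule infsum_0) simp
  show "l2_inner X z (hadd (ell2 X) x y) = l2_inner X z x + l2_inner X z y"
    if "x \<in> carrier (ell2 X)" "y \<in> carrier (ell2 X)" "z \<in> carrier (ell2 X)" for x y z
    using that l2_inner_add[of X x y z] l2_inner_cong[of X z z "\<lambda>x\<in>X. _ x" ]
    by (simp add: ell2_simps cong: l2_inner_cong)
  show "l2_inner X z (hscale (ell2 X) c x) = c * l2_inner X z x" for c x z
    using l2_inner_scale[of X z c x] by (simp add: ell2_simps cong: l2_inner_cong)
  show "l2_inner X y x = cnj (l2_inner X x y)" for x y by (rule l2_inner_sym)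
  show "0 \<le> Re (l2_inner X x x)" if "x \<in> carrier (ell2 X)" for x
    using that l2_inner_self_nonneg by (auto simp: ell2_simps)
  show "(hinner (ell2 X) x y = hinner (ell2 X) x' y') = (\<forall>i\<in>{()}. l2_inner X x y = l2_inner X x' y')" for x y x' y'
    by (simp add: ell2_simps)
  show "0 \<le> hnorm (ell2 X) x" if "x \<in> carrier (ell2 X)" for x
    using that l2_inner_self_nonneg by (auto simp: ell2_simps ell2_norm)
  show le_iff: "(hnorm (ell2 X) x \<le> r) = (\<forall>i\<in>{()}. Re (l2_inner X x x) \<le> r\<^sup>2)"
    if "x \<in> carrier (ell2 X)" "0 \<le> r" for x r
    using that by (auto simp: ell2_simps ell2_norm intro!: real_le_lsqrt dest!: sqrt_le_D)
  have pw: "cmod (x z - y z) \<le> hnorm (ell2 X) (hadd (ell2 X) x (hscale (ell2 X) (- 1) y))"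
    if x: "x \<in> carrier (ell2 X)" "y \<in> carrier (ell2 X)" "z \<in> X" for x y z
  proof -
    let ?d = "hadd (ell2 X) x (hscale (ell2 X) (- 1) y)"
    have d: "?d \<in> carrier (ell2 X)"
      using x square_summable_add[of X x "\<lambda>z. - 1 * y z"] square_summable_scale[of X y "-1"]
      by (simp add: ell2_simps cong: square_summable_cong)
    have n: "0 \<le> hnorm (ell2 X) ?d" using d l2_inner_self_nonneg by (auto simp: ell2_simps ell2_norm)
    have "cmod (?d z) \<le> hnorm (ell2 X) ?d"
      using d le_iff[OF d n] x(3) n by (intro l2_pointwise_le[of X]) (auto simp: ell2_simps(1))
    then show ?thesis using x(3) by (simp add: ell2_simps)
  qed
  show "x = y" if x: "x \<in> carrier (ell2 X)" "y \<in> carrier (ell2 X)"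
    "hnorm (ell2 X) (hadd (ell2 X) x (hscale (ell2 X) (- 1) y)) = 0" for x y
  proof (rule extensionalityI[of x X])
    show "x z = y z" if "z \<in> X" for z using pw[OF x(1,2) that] x(3) by simp
  qed (use x in \<open>auto simp: ell2_simps\<close>)
  fix s :: "nat \<Rightarrow> 'a \<Rightarrow> complex"
  assume s: "\<And>n. s n \<in> carrier (ell2 X)"
    and cauchy: "\<And>\<epsilon>. 0 < \<epsilon> \<Longrightarrow> \<exists>N. \<forall>m\<ge>N. \<forall>n\<ge>N. hnorm (ell2 X) (hadd (ell2 X) (s m) (hscale (ell2 X) (- 1) (s n))) < \<epsilon>"
  let ?d = "\<lambda>x y. hadd (ell2 X) x (hscale (ell2 X) (- 1) y)"
  have dc: "?d x y \<in> carrier (ell2 X)" if "x \<in> carrier (ell2 X)" "y \<in> carrier (ell2 X)" for x y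
    using that square_summable_add[of X x "\<lambda>z. - 1 * y z"] square_summable_scale[of X y "-1"]
    by (simp add: ell2_simps cong: square_summable_cong)
  have "\<exists>l. (\<lambda>n. s n z) \<longlonglongrightarrow> l" if z: "z \<in> X" for z
  proof (rule complex_cauchy_limit)
    fix \<epsilon> :: real assume "\<epsilon> > 0"
    then obtain N where "\<forall>m\<ge>N. \<forall>n\<ge>N. hnorm (ell2 X) (?d (s m) (s n)) < \<epsilon>" using cauchy by blast
    then show "\<exists>N. \<forall>m\<ge>N. \<forall>n\<ge>N. cmod (s m z - s n z) < \<epsilon>" using pw[OF s s z] by (meson le_less_trans)
  qed
  then obtain t where t: "\<And>z. z \<in> X \<Longrightarrow> (\<lambda>n. s n z) \<longlonglongrightarrow> t z" by metis
  have fin: "(\<Sum>z\<in>F. (cmod (s n z - t z))\<^sup>2) \<le> \<epsilon>\<^sup>2"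
    if F: "finite F" "F \<subseteq> X" and e: "\<epsilon> > 0" and N: "\<forall>m\<ge>N. \<forall>n\<ge>N. hnorm (ell2 X) (?d (s m) (s n)) < \<epsilon>" and n: "n \<ge> N"
    for F \<epsilon> N n
  proof (rule sum_square_limit[OF F(1)])
    show "(\<lambda>m. s m z) \<longlonglongrightarrow> t z" if "z \<in> F" for z using t that F by blast
    fix m assume m: "m \<ge> N"
    have "hnorm (ell2 X) (?d (s n) (s m)) \<le> \<epsilon>" using N n m by (auto intro: less_imp_le)
    then have "Re (l2_inner X (?d (s n) (s m)) (?d (s n) (s m))) \<le> \<epsilon>\<^sup>2"
      using le_iff[OF dc[OF s s], of \<epsilon> n m] e by simp
    then have "(\<Sum>z\<in>F. (cmod (?d (s n) (s m) z))\<^sup>2) \<le> \<epsilon>\<^sup>2"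
      using dc[OF s s, of n m] F l2_inner_self_le_iff[of X "?d (s n) (s m)"] unfolding ell2_simps(1) by blast
    moreover have "(\<Sum>z\<in>F. (cmod (?d (s n) (s m) z))\<^sup>2) = (\<Sum>z\<in>F. (cmod (s n z - s m z))\<^sup>2)"
      using F by (intro sum.cong) (auto simp: ell2_simps)
    ultimately show "(\<Sum>z\<in>F. (cmod (s n z - s m z))\<^sup>2) \<le> \<epsilon>\<^sup>2" by simp
  qed
  define T where "T = restrict t X"
  have sqd: "square_summable X (\<lambda>z. s n z - t z)"
    if "\<epsilon> > 0" "\<forall>m\<ge>N. \<forall>n\<ge>N. hnorm (ell2 X) (?d (s m) (s n)) < \<epsilon>" "n \<ge> N" for \<epsilon> N n
    using fin that by (intro square_summableI[of X _ "\<epsilon>\<^sup>2"]) blast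
  have T: "T \<in> carrier (ell2 X)"
  proof -
    obtain N where N: "\<forall>m\<ge>N. \<forall>n\<ge>N. hnorm (ell2 X) (?d (s m) (s n)) < 1" using cauchy[of 1] by auto
    have "square_summable X (\<lambda>z. s N z + - 1 * (s N z - t z))"
      using s sqd[OF zero_less_one N order_refl] by (intro square_summable_add square_summable_scale) (auto simp: ell2_simps)
    then have "square_summable X t" by simp
    then show ?thesis unfolding T_def by (rule ell2_restrict)
  qed
  have "(\<lambda>n. hnorm (ell2 X) (?d (s n) T)) \<longlonglongrightarrow> 0"
  proof (rule LIMSEQ_I)
    fix r :: real assume r: "r > 0"
    obtain N where N: "\<forall>m\<ge>N. \<forall>n\<ge>N. hnorm (ell2 X) (?d (s m) (s n)) < r / 2" using cauchy[of "r / 2"] r by auto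
    have "norm (hnorm (ell2 X) (?d (s n) T) - 0) < r" if n: "n \<ge> N" for n
    proof -
      note d = dc[OF s T, of n]
      have "(\<Sum>z\<in>F. (cmod (?d (s n) T z))\<^sup>2) \<le> (r / 2)\<^sup>2" if F: "finite F" "F \<subseteq> X" for F
      proof -
        have "(\<Sum>z\<in>F. (cmod (?d (s n) T z))\<^sup>2) = (\<Sum>z\<in>F. (cmod (s n z - t z))\<^sup>2)"
          using F by (intro sum.cong) (auto simp: ell2_simps T_def)
        then show ?thesis using fin[OF F _ N n] r by simp
      qed
      then have "Re (l2_inner X (?d (s n) T) (?d (s n) T)) \<le> (r / 2)\<^sup>2"
        using d l2_inner_self_le_iff[of X "?d (s n) T"] unfolding ell2_simps(1) by blast
      then have "hnorm (ell2 X) (?d (s n) T) \<le> r / 2" using r by (subst le_iff[OF d]) auto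
      moreover have "0 \<le> hnorm (ell2 X) (?d (s n) T)" using d l2_inner_self_nonneg by (auto simp: ell2_simps ell2_norm)
      ultimately show ?thesis using r by simp
    qed
    then show "\<exists>no. \<forall>n\<ge>no. norm (hnorm (ell2 X) (?d (s n) T) - 0) < r" by blast
  qed
  then show "\<exists>x\<in>carrier (ell2 X). (\<lambda>n. hnorm (ell2 X) (?d (s n) x)) \<longlonglongrightarrow> 0" using T by blast
qed

section \<open>The Hilbert module of square-summable sections\<close>

context submonoid_of_group
begin

abbreviation "UF \<equiv> unit_fiber G (canonical_bundle G P)"
abbreviation "Emod \<equiv> ell2_sections G (canonical_bundle G P)"

lemma UF_simps:
  "carrier UF = fib \<one>" "a \<oplus>\<^bsub>UF\<^esub> b = (\<lambda>x\<in>P. a x + b x)" "\<zero>\<^bsub>UF\<^esub> = (\<lambda>x\<in>P. 0)" "\<one>\<^bsub>UF\<^esub> = (\<lambda>x\<in>P. 1)"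
  "cscale UF c a = (\<lambda>x\<in>P. c * a x)" "cnorm UF = supn"
  by (simp_all add: unit_fiber_def bundle_simps)

lemma UF_mult: "a \<otimes>\<^bsub>UF\<^esub> b = (\<lambda>x\<in>P. a x * b x)"
  and UF_star: "star UF a = (\<lambda>x\<in>P. cnj (a x))"
  by (auto simp: unit_fiber_def bundle_mult bundle_star fun_eq_iff)

lemma UF_star_alg: "star_alg UF"
proof (rule star_algI)
  show "\<zero>\<^bsub>UF\<^esub> \<oplus>\<^bsub>UF\<^esub> a = a" "cscale UF 1 a = a" "\<one>\<^bsub>UF\<^esub> \<otimes>\<^bsub>UF\<^esub> a = a" "star UF (star UF a) = a" if "a \<in> carrier UF" for a
    using that fib_ext[of a \<one>] by (auto simp: UF_simps UF_mult UF_star fun_eq_iff extensional_def)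
qed (auto simp: UF_simps UF_mult UF_star fib_zero fib_one fib_add fib_mult fib_scale fib_cnj fun_eq_iff algebra_simps)

lemma UF_diff:
  assumes "a \<in> fib \<one>" "b \<in> fib \<one>"
  shows "a \<ominus>\<^bsub>UF\<^esub> b = (\<lambda>x\<in>P. a x - b x)"
proof -
  interpret U: star_alg UF by (rule UF_star_alg)
  show ?thesis using assms by (subst U.diff_eq) (auto simp: UF_simps fun_eq_iff)
qed

lemma UF_finsum:
  assumes "finite F" "\<And>g. g \<in> F \<Longrightarrow> f g \<in> fib \<one>"
  shows "finsum UF f F = (\<lambda>x\<in>P. \<Sum>g\<in>F. f g x)" "(\<lambda>x\<in>P. \<Sum>g\<in>F. f g x) \<in> fib \<one>"
  unfolding finsum_def
  by (rule finprod_pointwise[where M = "add_monoid UF" and g = \<one>, OF _ _ _ assms]; simp add: UF_simps)+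

text \<open>The norm of the unit fiber is a supremum over \<open>P\<close>, so unconditional norm
  convergence is uniform convergence of the finite partial sums. The weak inequality costs only a
  halving of \<open>\<epsilon>\<close>.\<close>

lemma has_norm_sum_iff:
  assumes "f \<in> I \<rightarrow> fib \<one>"
  shows "has_norm_sum UF f I s \<longleftrightarrow> s \<in> fib \<one> \<and>
    (\<forall>\<epsilon>>0. \<exists>F\<^sub>0. finite F\<^sub>0 \<and> F\<^sub>0 \<subseteq> I \<and>
      (\<forall>F. finite F \<and> F\<^sub>0 \<subseteq> F \<and> F \<subseteq> I \<longrightarrow> (\<forall>x\<in>P. cmod (s x - (\<Sum>g\<in>F. f g x)) \<le> \<epsilon>)))"
proof (cases "s \<in> fib \<one>")
  case True
  have fs: "finsum UF f F = (\<lambda>x\<in>P. \<Sum>g\<in>F. f g x)" "(\<lambda>x\<in>P. \<Sum>g\<in>F. f g x) \<in> fib \<one>"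
    if "finite F" "F \<subseteq> I" for F
    using UF_finsum[of F f] assms that by (auto simp: Pi_iff)
  have d: "s \<ominus>\<^bsub>UF\<^esub> finsum UF f F = (\<lambda>x\<in>P. s x - (\<Sum>g\<in>F. f g x))" if "finite F" "F \<subseteq> I" for F
    unfolding fs[OF that] UF_diff[OF True fs(2)[OF that]] by (simp cong: restrict_cong)
  have dc: "(\<lambda>x\<in>P. s x - (\<Sum>g\<in>F. f g x)) \<in> fib \<one>" if "finite F" "F \<subseteq> I" for F
    by (rule back_subst[of "\<lambda>a. a \<in> fib \<one>", OF fib_add[OF True fib_scale[OF fs(2)[OF that], of "-1"]]])
      (auto simp: fun_eq_iff)
  have 1: "cmod (s x - (\<Sum>g\<in>F. f g x)) \<le> \<epsilon>"
    if "supn (s \<ominus>\<^bsub>UF\<^esub> finsum UF f F) < \<epsilon>" "finite F" "F \<subseteq> I" "x \<in> P" for F \<epsilon> x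
    using supn_ge[OF dc[OF that(2,3)] that(4)] that d[OF that(2,3)] by simp
  have 2: "supn (s \<ominus>\<^bsub>UF\<^esub> finsum UF f F) < \<epsilon>"
    if "\<forall>x\<in>P. cmod (s x - (\<Sum>g\<in>F. f g x)) \<le> \<epsilon> / 2" "finite F" "F \<subseteq> I" "\<epsilon> > 0" for F \<epsilon>
  proof -
    have "supn (s \<ominus>\<^bsub>UF\<^esub> finsum UF f F) \<le> \<epsilon> / 2"
      unfolding d[OF that(2,3)] using that(1) by (intro supn_le) simp
    then show ?thesis using that(4) by simp
  qed
  show ?thesis
    unfolding has_norm_sum_def UF_simps
  proof (intro conj_cong refl iffI allI impI)
    fix \<epsilon> :: real
    assume A: "\<forall>\<epsilon>>0. \<exists>F\<^sub>0. finite F\<^sub>0 \<and> F\<^sub>0 \<subseteq> I \<and> (\<forall>F. finite F \<and> F\<^sub>0 \<subseteq> F \<and> F \<subseteq> I \<longrightarrow> supn (s \<ominus>\<^bsub>UF\<^esub> finsum UF f F) < \<epsilon>)"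
      and e: "0 < \<epsilon>"
    obtain F0 where F0: "finite F0" "F0 \<subseteq> I" "\<forall>F. finite F \<and> F0 \<subseteq> F \<and> F \<subseteq> I \<longrightarrow> supn (s \<ominus>\<^bsub>UF\<^esub> finsum UF f F) < \<epsilon>"
      using A[THEN spec, THEN mp, OF e] by blast
    then show "\<exists>F\<^sub>0. finite F\<^sub>0 \<and> F\<^sub>0 \<subseteq> I \<and> (\<forall>F. finite F \<and> F\<^sub>0 \<subseteq> F \<and> F \<subseteq> I \<longrightarrow> (\<forall>x\<in>P. cmod (s x - (\<Sum>g\<in>F. f g x)) \<le> \<epsilon>))"
    proof (intro exI[of _ F0] conjI allI impI ballI F0(1,2))
      fix F x assume "finite F \<and> F0 \<subseteq> F \<and> F \<subseteq> I" "x \<in> P"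
      then show "cmod (s x - (\<Sum>g\<in>F. f g x)) \<le> \<epsilon>" using 1[of F \<epsilon> x] F0(3) by blast
    qed
  next
    fix \<epsilon> :: real
    assume A: "\<forall>\<epsilon>>0. \<exists>F\<^sub>0. finite F\<^sub>0 \<and> F\<^sub>0 \<subseteq> I \<and> (\<forall>F. finite F \<and> F\<^sub>0 \<subseteq> F \<and> F \<subseteq> I \<longrightarrow> (\<forall>x\<in>P. cmod (s x - (\<Sum>g\<in>F. f g x)) \<le> \<epsilon>))"
      and e: "0 < \<epsilon>"
    obtain F0 where F0: "finite F0" "F0 \<subseteq> I" "\<forall>F. finite F \<and> F0 \<subseteq> F \<and> F \<subseteq> I \<longrightarrow> (\<forall>x\<in>P. cmod (s x - (\<Sum>g\<in>F. f g x)) \<le> \<epsilon> / 2)"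
      using A[THEN spec, THEN mp, OF half_gt_zero[OF e]] by blast
    then show "\<exists>F\<^sub>0. finite F\<^sub>0 \<and> F\<^sub>0 \<subseteq> I \<and> (\<forall>F. finite F \<and> F\<^sub>0 \<subseteq> F \<and> F \<subseteq> I \<longrightarrow> supn (s \<ominus>\<^bsub>UF\<^esub> finsum UF f F) < \<epsilon>)"
    proof (intro exI[of _ F0] conjI allI impI F0(1,2))
      fix F assume "finite F \<and> F0 \<subseteq> F \<and> F \<subseteq> I"
      then show "supn (s \<ominus>\<^bsub>UF\<^esub> finsum UF f F) < \<epsilon>" using 2[of F \<epsilon>] F0(3) e by blast
    qed
  qed
qed (simp add: has_norm_sum_def UF_simps)

lemma has_norm_sum_pointwise:
  assumes "f \<in> I \<rightarrow> fib \<one>" "has_norm_sum UF f I s" "x \<in> P"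
  shows "((\<lambda>g. f g x) has_sum s x) I"
  unfolding has_sum_def tendsto_iff eventually_finite_subsets_at_top
proof (intro allI impI)
  fix e :: real assume e: "e > 0"
  obtain F0 where F0: "finite F0" "F0 \<subseteq> I" "\<forall>F. finite F \<and> F0 \<subseteq> F \<and> F \<subseteq> I \<longrightarrow> (\<forall>x\<in>P. cmod (s x - (\<Sum>g\<in>F. f g x)) \<le> e / 2)"
    using iffD1[OF has_norm_sum_iff[OF assms(1)] assms(2), THEN conjunct2, THEN spec, THEN mp, OF half_gt_zero[OF e]] by blast
  have "dist (\<Sum>g\<in>F. f g x) (s x) < e" if "finite F" "F0 \<subseteq> F" "F \<subseteq> I" for F
  proof -
    have "cmod (s x - (\<Sum>g\<in>F. f g x)) \<le> e / 2" using F0(3) that assms(3) by blast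
    then show ?thesis using e by (simp add: dist_norm norm_minus_commute)
  qed
  then show "\<exists>X. finite X \<and> X \<subseteq> I \<and> (\<forall>Y. finite Y \<and> X \<subseteq> Y \<and> Y \<subseteq> I \<longrightarrow> dist (\<Sum>g\<in>Y. f g x) (s x) < e)"
    using F0 by blast
qed

text \<open>Pointwise summability supplies the candidate. Uniformly small finite tails turn
  pointwise convergence into uniform convergence, which also places the sum in the closed unit
  fiber.\<close>

lemma has_norm_sum_infsum:
  assumes f: "f \<in> I \<rightarrow> fib \<one>" and sm: "\<And>x. x \<in> P \<Longrightarrow> (\<lambda>g. f g x) summable_on I"
    and tail: "\<And>\<epsilon>. \<epsilon> > 0 \<Longrightarrow> \<exists>F\<^sub>0. finite F\<^sub>0 \<and> F\<^sub>0 \<subseteq> I \<and>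
      (\<forall>F. finite F \<and> F \<subseteq> I - F\<^sub>0 \<longrightarrow> (\<forall>x\<in>P. cmod (\<Sum>g\<in>F. f g x) \<le> \<epsilon>))"
  shows "has_norm_sum UF f I (\<lambda>x\<in>P. \<Sum>\<^sub>\<infinity>g\<in>I. f g x)"
proof -
  let ?s = "\<lambda>x\<in>P. \<Sum>\<^sub>\<infinity>g\<in>I. f g x"
  have main: "\<exists>F\<^sub>0. finite F\<^sub>0 \<and> F\<^sub>0 \<subseteq> I \<and>
      (\<forall>F. finite F \<and> F\<^sub>0 \<subseteq> F \<and> F \<subseteq> I \<longrightarrow> (\<forall>x\<in>P. cmod (?s x - (\<Sum>g\<in>F. f g x)) \<le> \<epsilon>))"
    if e: "\<epsilon> > 0" for \<epsilon>
  proof -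
    obtain F0 where F0: "finite F0" "F0 \<subseteq> I" "\<forall>F. finite F \<and> F \<subseteq> I - F0 \<longrightarrow> (\<forall>x\<in>P. cmod (\<Sum>g\<in>F. f g x) \<le> \<epsilon>)"
      using tail[OF e] by blast
    have "cmod (?s x - (\<Sum>g\<in>F. f g x)) \<le> \<epsilon>" if F: "finite F" "F0 \<subseteq> F" "F \<subseteq> I" and x: "x \<in> P" for F x
    proof (rule field_le_epsilon)
      fix d :: real assume d: "d > 0"
      have "((\<lambda>g. f g x) has_sum ?s x) I" using sm[OF x] x by simp
      then have "\<forall>\<^sub>F Y in finite_subsets_at_top I. dist (\<Sum>g\<in>Y. f g x) (?s x) < d"
        unfolding has_sum_def using tendstoD d by blast
      then obtain Y0 where Y0: "finite Y0" "Y0 \<subseteq> I" "\<forall>Y. finite Y \<and> Y0 \<subseteq> Y \<and> Y \<subseteq> I \<longrightarrow> dist (\<Sum>g\<in>Y. f g x) (?s x) < d"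
        unfolding eventually_finite_subsets_at_top by blast
      \<comment> \<open>\<open>Y0\<close> makes the partial sum at this one \<open>x\<close> close
        to the limit, and passing from \<open>F\<close> to the union adds only a finite tail
        avoiding \<open>F0\<close>.\<close>
      let ?Y = "Y0 \<union> F"
      have Y: "dist (\<Sum>g\<in>?Y. f g x) (?s x) < d" using Y0(1,2) F by (intro Y0(3)[THEN spec, THEN mp]) auto
      have "(\<Sum>g\<in>?Y. f g x) - (\<Sum>g\<in>F. f g x) = (\<Sum>g\<in>?Y - F. f g x)"
        using Y0 F by (intro sum_diff[symmetric]) auto
      moreover have tail': "cmod (\<Sum>g\<in>?Y - F. f g x) \<le> \<epsilon>" using F0(3)[THEN spec, of "?Y - F"] Y0(1,2) F x by blast
      ultimately have "?s x - (\<Sum>g\<in>F. f g x) = (\<Sum>g\<in>?Y - F. f g x) + (?s x - (\<Sum>g\<in>?Y. f g x))"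
        by (simp only: algebra_simps)
      moreover have "cmod (?s x - (\<Sum>g\<in>?Y. f g x)) \<le> d"
        using Y by (simp only: dist_norm norm_minus_commute)
      ultimately show "cmod (?s x - (\<Sum>g\<in>F. f g x)) \<le> \<epsilon> + d"
        using tail' by (simp only: norm_triangle_mono)
    qed
    then show ?thesis using F0 by blast
  qed
  have "?s \<in> fib \<one>"
  proof (rule fib_limit)
    fix \<epsilon> :: real assume "\<epsilon> > 0"
    from main[OF this] obtain F0 where F: "finite F0" "F0 \<subseteq> I"
      "\<forall>F. finite F \<and> F0 \<subseteq> F \<and> F \<subseteq> I \<longrightarrow> (\<forall>x\<in>P. cmod (?s x - (\<Sum>g\<in>F. f g x)) \<le> \<epsilon>)"
      by blast
    note F0 = F(1,2) F(3)[THEN spec, THEN mp, OF conjI[OF F(1) conjI[OF order_refl F(2)]]]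
    have "(\<lambda>x\<in>P. \<Sum>g\<in>F0. f g x) \<in> fib \<one>" using UF_finsum(2)[OF F0(1), of f] f F0(2) by (auto simp: Pi_iff)
    then show "\<exists>h\<in>fib \<one>. \<forall>x\<in>P. cmod (?s x - h x) \<le> \<epsilon>"
      using F0(3) by (intro bexI[of _ "\<lambda>x\<in>P. \<Sum>g\<in>F0. f g x"]) auto
  qed simp
  then show ?thesis by (intro iffD2[OF has_norm_sum_iff[OF f]] conjI allI impI main)
qed

text \<open>The column of \<^term>\<open>\<xi>\<close> over \<^term>\<open>x\<close>, indexed by \<open>g = zx\<^sup>-\<^sup>1\<close> instead of \<open>z\<close>.\<close>

definition gcol :: "('g \<Rightarrow> 'g \<Rightarrow> complex) \<Rightarrow> 'g \<Rightarrow> 'g \<Rightarrow> complex" where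
  "gcol \<xi> x g = (if g \<otimes> x \<in> P then \<xi> g (g \<otimes> x) else 0)"

lemma fiber_inner_eq:
  "g \<in> carrier G \<Longrightarrow> fiber_inner G bundle \<xi> \<eta> g = (\<lambda>x\<in>P. cnj (gcol \<xi> x g) * gcol \<eta> x g)"
  by (auto simp: fiber_inner_def bundle_mult bundle_star gcol_def fun_eq_iff)

lemma fiber_inner_fib:
  assumes "\<xi> \<in> sections" "\<eta> \<in> sections"
  shows "fiber_inner G bundle \<xi> \<eta> \<in> carrier G \<rightarrow> fib \<one>"
proof
  fix g assume g: "g \<in> carrier G"
  have "fstar bundle g (\<xi> g) \<in> fib (inv g)"
    unfolding bundle_star[OF g] using assms g by (intro fib_star) auto
  from fib_conv[OF inv_closed[OF g] g this, of "\<eta> g"] show "fiber_inner G bundle \<xi> \<eta> g \<in> fib \<one>"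
    using assms g by (auto simp: fiber_inner_def bundle_mult)
qed

text \<open>What unconditional norm convergence of the inner square amounts to: the columns are
  square-summable with tails that are small uniformly in the column.\<close>

definition uniform_tails :: "('g \<Rightarrow> 'g \<Rightarrow> complex) \<Rightarrow> bool" where
  "uniform_tails \<xi> \<longleftrightarrow> (\<forall>\<epsilon>>0. \<exists>F\<^sub>0. finite F\<^sub>0 \<and> F\<^sub>0 \<subseteq> carrier G \<and>
    (\<forall>F. finite F \<and> F \<subseteq> carrier G - F\<^sub>0 \<longrightarrow> (\<forall>x\<in>P. (\<Sum>g\<in>F. (cmod (gcol \<xi> x g))\<^sup>2) \<le> \<epsilon>)))"

lemma uniform_tailsD:
  assumes "uniform_tails \<xi>" "\<epsilon> > 0"
  shows "\<exists>F\<^sub>0. finite F\<^sub>0 \<and> F\<^sub>0 \<subseteq> carrier G \<and>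
    (\<forall>F. finite F \<and> F \<subseteq> carrier G - F\<^sub>0 \<longrightarrow> (\<forall>x\<in>P. (\<Sum>g\<in>F. (cmod (gcol \<xi> x g))\<^sup>2) \<le> \<epsilon>))"
  by (rule assms(1)[unfolded uniform_tails_def, THEN spec, THEN mp, OF assms(2)])

lemma uniform_tails_gcol:
  assumes "uniform_tails \<xi>" "x \<in> P"
  shows "square_summable (carrier G) (gcol \<xi> x)"
proof -
  obtain F0 where F0: "finite F0" "F0 \<subseteq> carrier G"
    "\<forall>F. finite F \<and> F \<subseteq> carrier G - F0 \<longrightarrow> (\<forall>x\<in>P. (\<Sum>g\<in>F. (cmod (gcol \<xi> x g))\<^sup>2) \<le> 1)"
    using uniform_tailsD[OF assms(1) zero_less_one] by blast
  let ?e = "\<lambda>g. (cmod (gcol \<xi> x g))\<^sup>2"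
  show ?thesis
  proof (rule square_summableI)
    fix F assume F: "finite F" "F \<subseteq> carrier G"
    have "sum ?e F = sum ?e (F \<inter> F0) + sum ?e (F - F0)" by (rule sum.Int_Diff[OF F(1)])
    also have "\<dots> \<le> sum ?e F0 + 1"
      using F F0 assms(2) by (intro add_mono sum_mono2 F0(3)[rule_format]) auto
    finally show "sum ?e F \<le> sum ?e F0 + 1" .
  qed
qed

lemma cnj_mult_self: "cnj z * z = complex_of_real ((cmod z)\<^sup>2)"
  by (metis complex_norm_square mult.commute)

text \<open>A finite tail of the mixed inner product is at most half the sum of the two tails of
  squares, so it inherits their uniformity.\<close>

lemma inner_has_norm_sum:
  assumes "\<xi> \<in> sections" "\<eta> \<in> sections" "uniform_tails \<xi>" "uniform_tails \<eta>"
  shows "has_norm_sum UF (fiber_inner G bundle \<xi> \<eta>) (carrier G)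
    (\<lambda>x\<in>P. l2_inner (carrier G) (gcol \<xi> x) (gcol \<eta> x))"
proof -
  let ?f = "fiber_inner G bundle \<xi> \<eta>"
  have v: "?f g x = cnj (gcol \<xi> x g) * gcol \<eta> x g" if "g \<in> carrier G" "x \<in> P" for g x
    using that by (simp add: fiber_inner_eq)
  have "has_norm_sum UF ?f (carrier G) (\<lambda>x\<in>P. \<Sum>\<^sub>\<infinity>g\<in>carrier G. ?f g x)"
  proof (rule has_norm_sum_infsum)
    show "?f \<in> carrier G \<rightarrow> fib \<one>" by (rule fiber_inner_fib[OF assms(1,2)])
    show "(\<lambda>g. ?f g x) summable_on carrier G" if "x \<in> P" for x
      using l2_inner_summable[OF uniform_tails_gcol[OF assms(3) that] uniform_tails_gcol[OF assms(4) that]]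
        summable_on_cong[of "carrier G" "\<lambda>g. ?f g x"] v that by simp
    fix \<epsilon> :: real assume e: "\<epsilon> > 0"
    obtain F1 where F1: "finite F1" "F1 \<subseteq> carrier G"
      "\<forall>F. finite F \<and> F \<subseteq> carrier G - F1 \<longrightarrow> (\<forall>x\<in>P. (\<Sum>g\<in>F. (cmod (gcol \<xi> x g))\<^sup>2) \<le> \<epsilon>)"
      using uniform_tailsD[OF assms(3) e] by blast
    obtain F2 where F2: "finite F2" "F2 \<subseteq> carrier G"
      "\<forall>F. finite F \<and> F \<subseteq> carrier G - F2 \<longrightarrow> (\<forall>x\<in>P. (\<Sum>g\<in>F. (cmod (gcol \<eta> x g))\<^sup>2) \<le> \<epsilon>)"
      using uniform_tailsD[OF assms(4) e] by blast
    have "cmod (\<Sum>g\<in>F. ?f g x) \<le> \<epsilon>" if F: "finite F" "F \<subseteq> carrier G - (F1 \<union> F2)" and x: "x \<in> P" for F x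
    proof -
      have "cmod (\<Sum>g\<in>F. ?f g x) \<le> (\<Sum>g\<in>F. ((cmod (gcol \<xi> x g))\<^sup>2 + (cmod (gcol \<eta> x g))\<^sup>2) / 2)"
      proof (rule sum_norm_le)
        fix g assume "g \<in> F"
        then have "cmod (?f g x) = cmod (gcol \<xi> x g) * cmod (gcol \<eta> x g)"
          using F x v[of g x] by (auto simp: norm_mult)
        then show "cmod (?f g x) \<le> ((cmod (gcol \<xi> x g))\<^sup>2 + (cmod (gcol \<eta> x g))\<^sup>2) / 2"
          using sum_squares_bound[of "cmod (gcol \<xi> x g)" "cmod (gcol \<eta> x g)"] by simp
      qed
      also have "\<dots> = ((\<Sum>g\<in>F. (cmod (gcol \<xi> x g))\<^sup>2) + (\<Sum>g\<in>F. (cmod (gcol \<eta> x g))\<^sup>2)) / 2"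
        by (simp add: sum.distrib sum_divide_distrib[symmetric])
      also have "\<dots> \<le> (\<epsilon> + \<epsilon>) / 2"
        using F x by (intro divide_right_mono add_mono F1(3)[rule_format] F2(3)[rule_format]) auto
      finally show ?thesis by simp
    qed
    then show "\<exists>F\<^sub>0. finite F\<^sub>0 \<and> F\<^sub>0 \<subseteq> carrier G \<and>
        (\<forall>F. finite F \<and> F \<subseteq> carrier G - F\<^sub>0 \<longrightarrow> (\<forall>x\<in>P. cmod (\<Sum>g\<in>F. ?f g x) \<le> \<epsilon>))"
      using F1(1,2) F2(1,2) by (intro exI[of _ "F1 \<union> F2"]) auto
  qed
  moreover have "(\<lambda>x\<in>P. \<Sum>\<^sub>\<infinity>g\<in>carrier G. ?f g x) = (\<lambda>x\<in>P. l2_inner (carrier G) (gcol \<xi> x) (gcol \<eta> x))"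
    unfolding l2_inner_def using v by (intro restrict_ext infsum_cong) auto
  ultimately show ?thesis by simp
qed

text \<open>A finite tail is the difference of two partial sums, each within half of
  \<open>\<epsilon>\<close> of the limit, and the terms of an inner square are nonnegative.\<close>

lemma Emod_iff: "\<xi> \<in> carrier Emod \<longleftrightarrow> \<xi> \<in> sections \<and> uniform_tails \<xi>"
proof
  assume "\<xi> \<in> carrier Emod"
  then obtain s where \<xi>: "\<xi> \<in> sections"
    and s: "has_norm_sum UF (fiber_inner G bundle \<xi> \<xi>) (carrier G) s"
    by (auto simp: ell2_sections_def bundle_simps)
  have v: "fiber_inner G bundle \<xi> \<xi> g x = complex_of_real ((cmod (gcol \<xi> x g))\<^sup>2)" if "g \<in> carrier G" "x \<in> P" for g x
    using that unfolding fiber_inner_eq[OF that(1)] cnj_mult_self by simp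
  have "uniform_tails \<xi>"
    unfolding uniform_tails_def
  proof (intro allI impI)
    fix \<epsilon> :: real assume e: "\<epsilon> > 0"
    let ?f = "\<lambda>g x. fiber_inner G bundle \<xi> \<xi> g x"
    obtain F0 where F0: "finite F0" "F0 \<subseteq> carrier G"
      "\<forall>F. finite F \<and> F0 \<subseteq> F \<and> F \<subseteq> carrier G \<longrightarrow> (\<forall>x\<in>P. cmod (s x - (\<Sum>g\<in>F. ?f g x)) \<le> \<epsilon> / 2)"
      using iffD1[OF has_norm_sum_iff[OF fiber_inner_fib[OF \<xi> \<xi>]] s, THEN conjunct2, THEN spec, THEN mp, OF half_gt_zero[OF e]] by blast
    have "(\<Sum>g\<in>F. (cmod (gcol \<xi> x g))\<^sup>2) \<le> \<epsilon>" if F: "finite F" "F \<subseteq> carrier G - F0" and x: "x \<in> P" for F x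
    proof -
      have "(\<Sum>g\<in>F0 \<union> F. ?f g x) = (\<Sum>g\<in>F0. ?f g x) + (\<Sum>g\<in>F. ?f g x)"
        using F F0 by (intro sum.union_disjoint) auto
      then have eq: "(\<Sum>g\<in>F. ?f g x) = (s x - (\<Sum>g\<in>F0. ?f g x)) - (s x - (\<Sum>g\<in>F0 \<union> F. ?f g x))" by simp
      have a: "cmod (s x - (\<Sum>g\<in>F0. ?f g x)) \<le> \<epsilon> / 2" "cmod (s x - (\<Sum>g\<in>F0 \<union> F. ?f g x)) \<le> \<epsilon> / 2"
        using F0 F x by (metis order_refl) (use F0 F x in blast)
      have "cmod (\<Sum>g\<in>F. ?f g x) \<le> \<epsilon>"
        unfolding eq using norm_triangle_ineq4[of "s x - (\<Sum>g\<in>F0. ?f g x)" "s x - (\<Sum>g\<in>F0 \<union> F. ?f g x)"] a by linarith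
      moreover have "(\<Sum>g\<in>F. ?f g x) = (\<Sum>g\<in>F. complex_of_real ((cmod (gcol \<xi> x g))\<^sup>2))"
        using F x v by (intro sum.cong) auto
      moreover have "\<dots> = complex_of_real (\<Sum>g\<in>F. (cmod (gcol \<xi> x g))\<^sup>2)" by simp
      ultimately have "\<bar>\<Sum>g\<in>F. (cmod (gcol \<xi> x g))\<^sup>2\<bar> \<le> \<epsilon>" by (metis norm_of_real)
      then show ?thesis by linarith
    qed
    then show "\<exists>F\<^sub>0. finite F\<^sub>0 \<and> F\<^sub>0 \<subseteq> carrier G \<and>
        (\<forall>F. finite F \<and> F \<subseteq> carrier G - F\<^sub>0 \<longrightarrow> (\<forall>x\<in>P. (\<Sum>g\<in>F. (cmod (gcol \<xi> x g))\<^sup>2) \<le> \<epsilon>))"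
      using F0(1,2) by blast
  qed
  then show "\<xi> \<in> sections \<and> uniform_tails \<xi>" using \<xi> by blast
next
  assume "\<xi> \<in> sections \<and> uniform_tails \<xi>"
  then show "\<xi> \<in> carrier Emod"
    using inner_has_norm_sum[of \<xi> \<xi>] by (auto simp: ell2_sections_def bundle_simps)
qed

text \<open>Norm convergence forces pointwise convergence, so the sum is unique and the description
  in \<open>section_inner\<close> is meaningful.\<close>

lemma section_inner_eq:
  assumes "\<xi> \<in> carrier Emod" "\<eta> \<in> carrier Emod"
  shows "section_inner G bundle \<xi> \<eta> = (\<lambda>x\<in>P. l2_inner (carrier G) (gcol \<xi> x) (gcol \<eta> x))"
    and "section_inner G bundle \<xi> \<eta> \<in> fib \<one>"
proof -
  let ?s = "\<lambda>x\<in>P. l2_inner (carrier G) (gcol \<xi> x) (gcol \<eta> x)"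
  have p: "\<xi> \<in> sections" "\<eta> \<in> sections" using assms by (auto simp: Emod_iff)
  have s: "has_norm_sum UF (fiber_inner G bundle \<xi> \<eta>) (carrier G) ?s"
    using assms by (intro inner_has_norm_sum) (auto simp: Emod_iff)
  have fs: "?s \<in> fib \<one>" using s by (simp add: has_norm_sum_def UF_simps)
  have "s' = ?s" if s': "has_norm_sum UF (fiber_inner G bundle \<xi> \<eta>) (carrier G) s'" for s'
  proof (rule extensionalityI[of _ P])
    show "s' \<in> extensional P" using s' fib_ext[of s' \<one>] by (auto simp: has_norm_sum_def UF_simps)
    show "?s \<in> extensional P" by simp
    fix x assume "x \<in> P"
    then show "s' x = ?s x"
      using has_norm_sum_pointwise[OF fiber_inner_fib[OF p] s] has_norm_sum_pointwise[OF fiber_inner_fib[OF p] s']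
      by (metis has_sum_unique)
  qed
  then show "section_inner G bundle \<xi> \<eta> = ?s"
    unfolding section_inner_def using s by (intro the_equality)
  then show "section_inner G bundle \<xi> \<eta> \<in> fib \<one>" using fs by simp
qed

lemma gcol_add: "\<lbrakk>g \<in> carrier G; x \<in> P\<rbrakk> \<Longrightarrow> gcol (\<lambda>g\<in>carrier G. \<lambda>x\<in>P. \<xi> g x + \<eta> g x) x g = gcol \<xi> x g + gcol \<eta> x g"
  and gcol_scale: "\<lbrakk>g \<in> carrier G; x \<in> P\<rbrakk> \<Longrightarrow> gcol (\<lambda>g\<in>carrier G. \<lambda>x\<in>P. c * \<xi> g x) x g = c * gcol \<xi> x g"
  and gcol_zero: "\<lbrakk>g \<in> carrier G; x \<in> P\<rbrakk> \<Longrightarrow> gcol (\<lambda>g\<in>carrier G. \<lambda>x\<in>P. 0) x g = 0"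
  by (auto simp: gcol_def)

lemma uniform_tails_add:
  assumes "uniform_tails \<xi>" "uniform_tails \<eta>"
  shows "uniform_tails (\<lambda>g\<in>carrier G. \<lambda>x\<in>P. \<xi> g x + \<eta> g x)"
  unfolding uniform_tails_def
proof (intro allI impI)
  fix \<epsilon> :: real assume e: "\<epsilon> > 0"
  then have e4: "\<epsilon> / 4 > 0" by simp
  obtain F1 where F1: "finite F1" "F1 \<subseteq> carrier G"
    "\<forall>F. finite F \<and> F \<subseteq> carrier G - F1 \<longrightarrow> (\<forall>x\<in>P. (\<Sum>g\<in>F. (cmod (gcol \<xi> x g))\<^sup>2) \<le> \<epsilon> / 4)"
    using uniform_tailsD[OF assms(1) e4] by blast
  obtain F2 where F2: "finite F2" "F2 \<subseteq> carrier G"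
    "\<forall>F. finite F \<and> F \<subseteq> carrier G - F2 \<longrightarrow> (\<forall>x\<in>P. (\<Sum>g\<in>F. (cmod (gcol \<eta> x g))\<^sup>2) \<le> \<epsilon> / 4)"
    using uniform_tailsD[OF assms(2) e4] by blast
  have "(\<Sum>g\<in>F. (cmod (gcol (\<lambda>g\<in>carrier G. \<lambda>x\<in>P. \<xi> g x + \<eta> g x) x g))\<^sup>2) \<le> \<epsilon>"
    if F: "finite F" "F \<subseteq> carrier G - (F1 \<union> F2)" and x: "x \<in> P" for F x
  proof -
    have "(\<Sum>g\<in>F. (cmod (gcol (\<lambda>g\<in>carrier G. \<lambda>x\<in>P. \<xi> g x + \<eta> g x) x g))\<^sup>2) \<le>
        (\<Sum>g\<in>F. 2 * (cmod (gcol \<xi> x g))\<^sup>2 + 2 * (cmod (gcol \<eta> x g))\<^sup>2)"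
    proof (rule sum_mono)
      fix g assume "g \<in> F"
      then have "gcol (\<lambda>g\<in>carrier G. \<lambda>x\<in>P. \<xi> g x + \<eta> g x) x g = gcol \<xi> x g + gcol \<eta> x g"
        using F x by (intro gcol_add) auto
      then show "(cmod (gcol (\<lambda>g\<in>carrier G. \<lambda>x\<in>P. \<xi> g x + \<eta> g x) x g))\<^sup>2 \<le> 2 * (cmod (gcol \<xi> x g))\<^sup>2 + 2 * (cmod (gcol \<eta> x g))\<^sup>2"
        by (simp add: cmod_add_square)
    qed
    also have "\<dots> = 2 * (\<Sum>g\<in>F. (cmod (gcol \<xi> x g))\<^sup>2) + 2 * (\<Sum>g\<in>F. (cmod (gcol \<eta> x g))\<^sup>2)"
      by (simp add: sum.distrib sum_distrib_left)
    also have "\<dots> \<le> 2 * (\<epsilon> / 4) + 2 * (\<epsilon> / 4)"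
      using F x by (intro add_mono mult_left_mono F1(3)[rule_format] F2(3)[rule_format]) auto
    finally show ?thesis by simp
  qed
  then show "\<exists>F\<^sub>0. finite F\<^sub>0 \<and> F\<^sub>0 \<subseteq> carrier G \<and> (\<forall>F. finite F \<and> F \<subseteq> carrier G - F\<^sub>0 \<longrightarrow>
      (\<forall>x\<in>P. (\<Sum>g\<in>F. (cmod (gcol (\<lambda>g\<in>carrier G. \<lambda>x\<in>P. \<xi> g x + \<eta> g x) x g))\<^sup>2) \<le> \<epsilon>))"
    using F1(1,2) F2(1,2) by (intro exI[of _ "F1 \<union> F2"]) auto
qed

lemma uniform_tails_scale:
  assumes "uniform_tails \<xi>"
  shows "uniform_tails (\<lambda>g\<in>carrier G. \<lambda>x\<in>P. c * \<xi> g x)"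
  unfolding uniform_tails_def
proof (intro allI impI)
  fix \<epsilon> :: real assume e: "\<epsilon> > 0"
  define d where "d = \<epsilon> / ((cmod c)\<^sup>2 + 1)"
  have c: "(cmod c)\<^sup>2 + 1 > 0" by (simp add: add_nonneg_pos)
  have d: "d > 0" "(cmod c)\<^sup>2 * d \<le> \<epsilon>" using e c by (auto simp: d_def field_simps)
  obtain F1 where F1: "finite F1" "F1 \<subseteq> carrier G"
    "\<forall>F. finite F \<and> F \<subseteq> carrier G - F1 \<longrightarrow> (\<forall>x\<in>P. (\<Sum>g\<in>F. (cmod (gcol \<xi> x g))\<^sup>2) \<le> d)"
    using uniform_tailsD[OF assms(1) d(1)] by blast
  have "(\<Sum>g\<in>F. (cmod (gcol (\<lambda>g\<in>carrier G. \<lambda>x\<in>P. c * \<xi> g x) x g))\<^sup>2) \<le> \<epsilon>"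
    if F: "finite F" "F \<subseteq> carrier G - F1" and x: "x \<in> P" for F x
  proof -
    have "(\<Sum>g\<in>F. (cmod (gcol (\<lambda>g\<in>carrier G. \<lambda>x\<in>P. c * \<xi> g x) x g))\<^sup>2) = (\<Sum>g\<in>F. (cmod c)\<^sup>2 * (cmod (gcol \<xi> x g))\<^sup>2)"
    proof (rule sum.cong[OF refl])
      fix g assume "g \<in> F"
      then have "gcol (\<lambda>g\<in>carrier G. \<lambda>x\<in>P. c * \<xi> g x) x g = c * gcol \<xi> x g"
        using F x by (intro gcol_scale) auto
      then show "(cmod (gcol (\<lambda>g\<in>carrier G. \<lambda>x\<in>P. c * \<xi> g x) x g))\<^sup>2 = (cmod c)\<^sup>2 * (cmod (gcol \<xi> x g))\<^sup>2"
        by (simp add: norm_mult power_mult_distrib)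
    qed
    also have "\<dots> = (cmod c)\<^sup>2 * (\<Sum>g\<in>F. (cmod (gcol \<xi> x g))\<^sup>2)" by (simp add: sum_distrib_left)
    also have "\<dots> \<le> (cmod c)\<^sup>2 * d" using F x by (intro mult_left_mono F1(3)[rule_format]) auto
    finally show ?thesis using d by simp
  qed
  then show "\<exists>F\<^sub>0. finite F\<^sub>0 \<and> F\<^sub>0 \<subseteq> carrier G \<and> (\<forall>F. finite F \<and> F \<subseteq> carrier G - F\<^sub>0 \<longrightarrow>
      (\<forall>x\<in>P. (\<Sum>g\<in>F. (cmod (gcol (\<lambda>g\<in>carrier G. \<lambda>x\<in>P. c * \<xi> g x) x g))\<^sup>2) \<le> \<epsilon>))"
    using F1(1,2) by (intro exI[of _ F1]) auto
qed

lemma uniform_tails_zero: "uniform_tails (\<lambda>g\<in>carrier G. \<lambda>x\<in>P. 0)"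
  unfolding uniform_tails_def
proof (intro allI impI)
  fix \<epsilon> :: real assume e: "\<epsilon> > 0"
  have "(\<Sum>g\<in>F. (cmod (gcol (\<lambda>g\<in>carrier G. \<lambda>x\<in>P. 0) x g))\<^sup>2) \<le> \<epsilon>" if "F \<subseteq> carrier G" "x \<in> P" for F x
    using e gcol_zero that by (subst sum.neutral) auto
  then show "\<exists>F\<^sub>0. finite F\<^sub>0 \<and> F\<^sub>0 \<subseteq> carrier G \<and> (\<forall>F. finite F \<and> F \<subseteq> carrier G - F\<^sub>0 \<longrightarrow>
      (\<forall>x\<in>P. (\<Sum>g\<in>F. (cmod (gcol (\<lambda>g\<in>carrier G. \<lambda>x\<in>P. 0) x g))\<^sup>2) \<le> \<epsilon>))"
    by (intro exI[of _ "{}"]) auto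
qed

lemma Emod_simps:
  "hadd Emod \<xi> \<eta> = (\<lambda>g\<in>carrier G. \<lambda>x\<in>P. \<xi> g x + \<eta> g x)"
  "hzero Emod = (\<lambda>g\<in>carrier G. \<lambda>x\<in>P. 0)"
  "hscale Emod c \<xi> = (\<lambda>g\<in>carrier G. \<lambda>x\<in>P. c * \<xi> g x)"
  "hinner Emod = section_inner G bundle"
  "hnorm Emod \<xi> = sqrt (supn (section_inner G bundle \<xi> \<xi>))"
  by (simp_all add: ell2_sections_def bundle_simps)

lemma Emod_closed:
  "hzero Emod \<in> carrier Emod"
  "\<lbrakk>\<xi> \<in> carrier Emod; \<eta> \<in> carrier Emod\<rbrakk> \<Longrightarrow> hadd Emod \<xi> \<eta> \<in> carrier Emod"
  "\<xi> \<in> carrier Emod \<Longrightarrow> hscale Emod c \<xi> \<in> carrier Emod"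
  unfolding Emod_simps Emod_iff
  by (auto simp: uniform_tails_zero uniform_tails_add uniform_tails_scale fib_zero PiE_iff fib_add fib_scale)

lemma Emod_gcol: "\<lbrakk>\<xi> \<in> carrier Emod; x \<in> P\<rbrakk> \<Longrightarrow> square_summable (carrier G) (gcol \<xi> x)"
  using uniform_tails_gcol by (simp add: Emod_iff)

lemma Emod_norm_nonneg: "\<xi> \<in> carrier Emod \<Longrightarrow> 0 \<le> hnorm Emod \<xi>"
  using supn_nonneg[OF section_inner_eq(2)] by (simp add: Emod_simps)

lemma Emod_norm_le_iff:
  assumes "\<xi> \<in> carrier Emod" "0 \<le> r"
  shows "hnorm Emod \<xi> \<le> r \<longleftrightarrow> (\<forall>x\<in>P. Re (l2_inner (carrier G) (gcol \<xi> x) (gcol \<xi> x)) \<le> r\<^sup>2)"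
proof -
  note s = section_inner_eq[OF assms(1) assms(1)]
  have c: "cmod (section_inner G bundle \<xi> \<xi> x) = Re (l2_inner (carrier G) (gcol \<xi> x) (gcol \<xi> x))" if "x \<in> P" for x
  proof -
    let ?l = "l2_inner (carrier G) (gcol \<xi> x) (gcol \<xi> x)"
    have "?l = complex_of_real (Re ?l)" using l2_inner_sym[of "carrier G" "gcol \<xi> x" "gcol \<xi> x"] by (simp add: complex_eq_iff)
    then have "cmod ?l = \<bar>Re ?l\<bar>" by (metis norm_of_real)
    then show ?thesis using that s(1) l2_inner_self_nonneg[OF Emod_gcol[OF assms(1) that]] by simp
  qed
  have "hnorm Emod \<xi> \<le> r \<longleftrightarrow> supn (section_inner G bundle \<xi> \<xi>) \<le> r\<^sup>2"
    using supn_nonneg[OF s(2)] assms(2) by (auto simp: Emod_simps intro!: real_le_lsqrt dest!: sqrt_le_D)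
  also have "\<dots> \<longleftrightarrow> (\<forall>x\<in>P. cmod (section_inner G bundle \<xi> \<xi> x) \<le> r\<^sup>2)"
    using supn_ge[OF s(2)] supn_le[of "section_inner G bundle \<xi> \<xi>" "r\<^sup>2"] by (meson order_trans)
  finally show ?thesis using c by auto
qed

lemma gcol_entry:
  assumes "g \<in> carrier G" "y \<in> P" "inv g \<otimes> y \<in> P"
  shows "gcol \<xi> (inv g \<otimes> y) g = \<xi> g y"
  using assms by (simp add: gcol_def)

text \<open>An entry either occurs in a column, whose norm the module norm dominates, or vanishes by
  \<open>fib_support\<close>. Convergence in the module is therefore uniform on each fiber.\<close>

lemma Emod_entry_le:
  assumes "\<xi> \<in> carrier Emod" "g \<in> carrier G" "y \<in> P"
  shows "cmod (\<xi> g y) \<le> hnorm Emod \<xi>"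
proof (cases "inv g \<otimes> y \<in> P")
  case True
  have "Re (l2_inner (carrier G) (gcol \<xi> (inv g \<otimes> y)) (gcol \<xi> (inv g \<otimes> y))) \<le> (hnorm Emod \<xi>)\<^sup>2"
    using Emod_norm_le_iff[OF assms(1) Emod_norm_nonneg[OF assms(1)]] True by blast
  from l2_pointwise_le[OF Emod_gcol[OF assms(1) True] this Emod_norm_nonneg[OF assms(1)] assms(2)]
  show ?thesis using gcol_entry[OF assms(2,3) True] by simp
next
  case False
  have "\<xi> g \<in> fib g" using assms by (auto simp: Emod_iff)
  from fib_support[OF assms(2) this assms(3) False] show ?thesis using Emod_norm_nonneg[OF assms(1)] by simp
qed

text \<open>Entrywise limits are uniform on each fiber, hence stay in the closed fibers. The uniform
  tails of the limit are borrowed from a single approximant \<open>s N\<close>.\<close>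

lemma Emod_complete:
  assumes s: "\<And>n. s n \<in> carrier Emod"
    and cauchy: "\<And>\<epsilon>. 0 < \<epsilon> \<Longrightarrow> \<exists>N. \<forall>m\<ge>N. \<forall>n\<ge>N. hnorm Emod (hadd Emod (s m) (hscale Emod (- 1) (s n))) < \<epsilon>"
  shows "\<exists>\<xi>\<in>carrier Emod. (\<lambda>n. hnorm Emod (hadd Emod (s n) (hscale Emod (- 1) \<xi>))) \<longlonglongrightarrow> 0"
proof -
  let ?d = "\<lambda>\<xi> \<eta>. hadd Emod \<xi> (hscale Emod (- 1) \<eta>)"
  have dc: "?d \<xi> \<eta> \<in> carrier Emod" if "\<xi> \<in> carrier Emod" "\<eta> \<in> carrier Emod" for \<xi> \<eta>
    using that by (intro Emod_closed)
  have dv: "?d \<xi> \<eta> g y = \<xi> g y - \<eta> g y" if "g \<in> carrier G" "y \<in> P" for \<xi> \<eta> g y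
    using that by (simp add: Emod_simps)
  have dr: "gcol (?d \<xi> \<eta>) x g = gcol \<xi> x g - gcol \<eta> x g" if "g \<in> carrier G" "x \<in> P" for \<xi> \<eta> g x
    using that by (simp add: Emod_simps gcol_def)
  have pw: "cmod (s m g y - s n g y) \<le> hnorm Emod (?d (s m) (s n))" if "g \<in> carrier G" "y \<in> P" for m n g y
    using Emod_entry_le[OF dc[OF s s] that] dv[OF that] by metis
  have "\<exists>l. (\<lambda>n. s n g y) \<longlonglongrightarrow> l" if gy: "g \<in> carrier G" "y \<in> P" for g y
  proof (rule complex_cauchy_limit)
    fix \<epsilon> :: real assume "\<epsilon> > 0"
    then obtain N where "\<forall>m\<ge>N. \<forall>n\<ge>N. hnorm Emod (?d (s m) (s n)) < \<epsilon>" using cauchy by blast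
    then show "\<exists>N. \<forall>m\<ge>N. \<forall>n\<ge>N. cmod (s m g y - s n g y) < \<epsilon>" using pw[OF gy] by (meson le_less_trans)
  qed
  then obtain t where t: "\<And>g y. \<lbrakk>g \<in> carrier G; y \<in> P\<rbrakk> \<Longrightarrow> (\<lambda>n. s n g y) \<longlonglongrightarrow> t g y" by metis
  define T where "T = (\<lambda>g\<in>carrier G. \<lambda>y\<in>P. t g y)"
  have Tlim: "(\<lambda>n. s n g y) \<longlonglongrightarrow> T g y" if "g \<in> carrier G" "y \<in> P" for g y
    using t[OF that] that by (simp add: T_def)
  have Trow: "(\<lambda>n. gcol (s n) x g) \<longlonglongrightarrow> gcol T x g" if "g \<in> carrier G" "x \<in> P" for g x
    using Tlim[OF that(1), of "g \<otimes> x"] by (simp add: gcol_def)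
  have Tfib: "T \<in> sections"
  proof (rule PiE_I)
    fix g assume g: "g \<in> carrier G"
    show "T g \<in> fib g"
    proof (rule fib_limit)
      show "T g \<in> extensional P" using g by (simp add: T_def)
      fix \<epsilon> :: real assume e: "\<epsilon> > 0"
      then obtain N where N: "\<forall>m\<ge>N. \<forall>n\<ge>N. hnorm Emod (?d (s m) (s n)) < \<epsilon>" using cauchy by blast
      have "cmod (T g y - s N g y) \<le> \<epsilon>" if y: "y \<in> P" for y
      proof (rule LIMSEQ_le_const2)
        show "(\<lambda>m. cmod (s m g y - s N g y)) \<longlonglongrightarrow> cmod (T g y - s N g y)"
          by (intro tendsto_norm tendsto_diff tendsto_const Tlim g y)
        show "\<exists>M. \<forall>m\<ge>M. cmod (s m g y - s N g y) \<le> \<epsilon>"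
          using pw[OF g y] N by (meson less_imp_le order_refl order_trans)
      qed
      moreover have "s N g \<in> fib g" using s g by (auto simp: Emod_iff)
      ultimately show "\<exists>h\<in>fib g. \<forall>y\<in>P. cmod (T g y - h y) \<le> \<epsilon>" by blast
    qed
  qed (simp add: T_def)
  have fin: "(\<Sum>g\<in>F. (cmod (gcol (s n) x g - gcol T x g))\<^sup>2) \<le> \<epsilon>\<^sup>2"
    if F: "finite F" "F \<subseteq> carrier G" and x: "x \<in> P" and e: "\<epsilon> > 0"
      and N: "\<forall>m\<ge>N. \<forall>n\<ge>N. hnorm Emod (?d (s m) (s n)) < \<epsilon>" and n: "n \<ge> N"
    for F x \<epsilon> N n
  proof (rule sum_square_limit[OF F(1)])
    show "(\<lambda>m. gcol (s m) x g) \<longlonglongrightarrow> gcol T x g" if "g \<in> F" for g using Trow that F x by blast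
    fix m assume m: "m \<ge> N"
    have "hnorm Emod (?d (s n) (s m)) \<le> \<epsilon>" using N n m by (auto intro: less_imp_le)
    then have "Re (l2_inner (carrier G) (gcol (?d (s n) (s m)) x) (gcol (?d (s n) (s m)) x)) \<le> \<epsilon>\<^sup>2"
      using Emod_norm_le_iff[OF dc[OF s s], of \<epsilon> n m] e x by simp
    then have "(\<Sum>g\<in>F. (cmod (gcol (?d (s n) (s m)) x g))\<^sup>2) \<le> \<epsilon>\<^sup>2"
      unfolding l2_inner_self_le_iff[OF Emod_gcol[OF dc[OF s s] x]] using F by blast
    moreover have "(\<Sum>g\<in>F. (cmod (gcol (?d (s n) (s m)) x g))\<^sup>2) = (\<Sum>g\<in>F. (cmod (gcol (s n) x g - gcol (s m) x g))\<^sup>2)"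
      using F x dr by (intro sum.cong) auto
    ultimately show "(\<Sum>g\<in>F. (cmod (gcol (s n) x g - gcol (s m) x g))\<^sup>2) \<le> \<epsilon>\<^sup>2" by simp
  qed
  have "uniform_tails T"
    unfolding uniform_tails_def
  proof (intro allI impI)
    fix \<epsilon> :: real assume e: "\<epsilon> > 0"
    \<comment> \<open>Chosen so that the tail of the approximant and the squared distance, each
      weighted by 2, contribute half of \<open>\<epsilon>\<close>.\<close>
    define d where "d = sqrt (\<epsilon> / 4)"
    have d: "d > 0" "d\<^sup>2 = \<epsilon> / 4" using e by (auto simp: d_def)
    obtain N where N: "\<forall>m\<ge>N. \<forall>n\<ge>N. hnorm Emod (?d (s m) (s n)) < d" using cauchy[OF d(1)] by blast
    have sN: "uniform_tails (s N)" using s by (simp add: Emod_iff)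
    have e4: "\<epsilon> / 4 > 0" using e by simp
    obtain F1 where F1: "finite F1" "F1 \<subseteq> carrier G"
      "\<forall>F. finite F \<and> F \<subseteq> carrier G - F1 \<longrightarrow> (\<forall>x\<in>P. (\<Sum>g\<in>F. (cmod (gcol (s N) x g))\<^sup>2) \<le> \<epsilon> / 4)"
      using uniform_tailsD[OF sN e4] by blast
    have "(\<Sum>g\<in>F. (cmod (gcol T x g))\<^sup>2) \<le> \<epsilon>" if F: "finite F" "F \<subseteq> carrier G - F1" and x: "x \<in> P" for F x
    proof -
      have "(\<Sum>g\<in>F. (cmod (gcol T x g))\<^sup>2) \<le>
          (\<Sum>g\<in>F. 2 * (cmod (gcol (s N) x g))\<^sup>2 + 2 * (cmod (gcol (s N) x g - gcol T x g))\<^sup>2)"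
      proof (rule sum_mono)
        fix g
        show "(cmod (gcol T x g))\<^sup>2 \<le> 2 * (cmod (gcol (s N) x g))\<^sup>2 + 2 * (cmod (gcol (s N) x g - gcol T x g))\<^sup>2"
          using cmod_add_square[of "gcol (s N) x g" "gcol T x g - gcol (s N) x g"] by (simp add: norm_minus_commute)
      qed
      also have "\<dots> = 2 * (\<Sum>g\<in>F. (cmod (gcol (s N) x g))\<^sup>2) + 2 * (\<Sum>g\<in>F. (cmod (gcol (s N) x g - gcol T x g))\<^sup>2)"
        by (simp add: sum.distrib sum_distrib_left)
      also have "\<dots> \<le> 2 * (\<epsilon> / 4) + 2 * d\<^sup>2"
        using F x by (intro add_mono mult_left_mono F1(3)[rule_format] fin[OF _ _ x d(1) N order_refl]) auto
      finally show ?thesis using d by simp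
    qed
    then show "\<exists>F\<^sub>0. finite F\<^sub>0 \<and> F\<^sub>0 \<subseteq> carrier G \<and>
        (\<forall>F. finite F \<and> F \<subseteq> carrier G - F\<^sub>0 \<longrightarrow> (\<forall>x\<in>P. (\<Sum>g\<in>F. (cmod (gcol T x g))\<^sup>2) \<le> \<epsilon>))"
      using F1(1,2) by (intro exI[of _ F1]) auto
  qed
  then have T: "T \<in> carrier Emod" using Tfib by (simp add: Emod_iff)
  have "(\<lambda>n. hnorm Emod (?d (s n) T)) \<longlonglongrightarrow> 0"
  proof (rule LIMSEQ_I)
    fix r :: real assume r: "r > 0"
    obtain N where N: "\<forall>m\<ge>N. \<forall>n\<ge>N. hnorm Emod (?d (s m) (s n)) < r / 2" using cauchy[of "r / 2"] r by auto
    have "norm (hnorm Emod (?d (s n) T) - 0) < r" if n: "n \<ge> N" for n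
    proof -
      note d = dc[OF s T, of n]
      have "Re (l2_inner (carrier G) (gcol (?d (s n) T) x) (gcol (?d (s n) T) x)) \<le> (r / 2)\<^sup>2" if x: "x \<in> P" for x
      proof -
        have "(\<Sum>g\<in>F. (cmod (gcol (?d (s n) T) x g))\<^sup>2) \<le> (r / 2)\<^sup>2" if F: "finite F" "F \<subseteq> carrier G" for F
        proof -
          have "(\<Sum>g\<in>F. (cmod (gcol (?d (s n) T) x g))\<^sup>2) = (\<Sum>g\<in>F. (cmod (gcol (s n) x g - gcol T x g))\<^sup>2)"
            using F x dr by (intro sum.cong) auto
          then show ?thesis using fin[OF F x _ N n] r by simp
        qed
        then show ?thesis unfolding l2_inner_self_le_iff[OF Emod_gcol[OF d x]] by blast
      qed
      then have "hnorm Emod (?d (s n) T) \<le> r / 2" using r by (subst Emod_norm_le_iff[OF d]) auto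
      then show ?thesis using r Emod_norm_nonneg[OF d] by simp
    qed
    then show "\<exists>no. \<forall>n\<ge>no. norm (hnorm Emod (?d (s n) T) - 0) < r" by blast
  qed
  then show ?thesis using T by blast
qed

lemma Emod_hilbert_mod: "hilbert_mod Emod P (\<lambda>x \<xi> \<eta>. l2_inner (carrier G) (gcol \<xi> x) (gcol \<eta> x))"
proof
  let ?ip = "\<lambda>x \<xi> \<eta>. l2_inner (carrier G) (gcol \<xi> x) (gcol \<eta> x)"
  fix x assume x: "x \<in> P"
  have "gcol (hzero Emod) x g = 0" if "g \<in> carrier G" for g
    unfolding Emod_simps using gcol_zero[OF that x] .
  then show "?ip x z (hzero Emod) = 0" for z
    unfolding l2_inner_def by (intro infsum_0) simp
  show "?ip x \<zeta> (hadd Emod \<xi> \<eta>) = ?ip x \<zeta> \<xi> + ?ip x \<zeta> \<eta>"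
    if "\<xi> \<in> carrier Emod" "\<eta> \<in> carrier Emod" "\<zeta> \<in> carrier Emod" for \<xi> \<eta> \<zeta>
  proof -
    have "?ip x \<zeta> (hadd Emod \<xi> \<eta>) = l2_inner (carrier G) (gcol \<zeta> x) (\<lambda>g. gcol \<xi> x g + gcol \<eta> x g)"
      unfolding Emod_simps by (rule l2_inner_cong) (simp_all add: gcol_add x)
    then show ?thesis using that x by (simp add: l2_inner_add Emod_gcol)
  qed
  show "?ip x \<zeta> (hscale Emod c \<xi>) = c * ?ip x \<zeta> \<xi>" for \<zeta> \<xi> c
  proof -
    have "?ip x \<zeta> (hscale Emod c \<xi>) = l2_inner (carrier G) (gcol \<zeta> x) (\<lambda>g. c * gcol \<xi> x g)"
      unfolding Emod_simps by (rule l2_inner_cong) (simp_all add: gcol_scale x)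
    then show ?thesis by (simp add: l2_inner_scale)
  qed
  show "?ip x \<eta> \<xi> = cnj (?ip x \<xi> \<eta>)" for \<xi> \<eta> by (rule l2_inner_sym)
  show "0 \<le> Re (?ip x \<xi> \<xi>)" if "\<xi> \<in> carrier Emod" for \<xi>
    using that x by (intro l2_inner_self_nonneg Emod_gcol)
next
  fix x y x' y' assume "x \<in> carrier Emod" "y \<in> carrier Emod" "x' \<in> carrier Emod" "y' \<in> carrier Emod"
  then show "(hinner Emod x y = hinner Emod x' y') =
      (\<forall>i\<in>P. l2_inner (carrier G) (gcol x i) (gcol y i) = l2_inner (carrier G) (gcol x' i) (gcol y' i))"
    unfolding Emod_simps by (simp add: section_inner_eq fun_eq_iff restrict_def) blast
next
  fix \<xi> \<eta> assume \<xi>: "\<xi> \<in> carrier Emod" "\<eta> \<in> carrier Emod"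
    and z: "hnorm Emod (hadd Emod \<xi> (hscale Emod (- 1) \<eta>)) = 0"
  have d: "hadd Emod \<xi> (hscale Emod (- 1) \<eta>) \<in> carrier Emod" using \<xi> by (intro Emod_closed)
  have p: "\<xi> \<in> sections" "\<eta> \<in> sections" using \<xi> by (auto simp: Emod_iff)
  show "\<xi> = \<eta>"
  proof (rule sections_eqI[OF p])
    fix x y assume "x \<in> P" "y \<in> P"
    then show "col \<xi> y x = col \<eta> y x"
      using Emod_entry_le[OF d, of "x \<otimes> inv y" x] z by (simp add: col_def Emod_simps)
  qed
qed (use Emod_closed Emod_norm_nonneg Emod_norm_le_iff Emod_complete in blast)+

end

section \<open>The reduced algebras\<close>

text \<open>By Cauchy-Schwarz the inner square of \<open>T x\<close> is at most the norm of the
  product of \<open>star L T\<close> and \<open>T\<close> times the square of the norm of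
  \<open>x\<close>; this gives the nontrivial half of the C*-identity.\<close>

lemma (in hilbert_mod) L_cstar: "cstar_seminorm L (cnorm L)"
proof -
  interpret L: seminormed_star_alg L "cnorm L" by (rule L_seminormed)
  have "cnorm L (star L T \<otimes>\<^bsub>L\<^esub> T) = (cnorm L T)\<^sup>2" if T: "T \<in> carrier L" for T
  proof (rule antisym)
    show "cnorm L (star L T \<otimes>\<^bsub>L\<^esub> T) \<le> (cnorm L T)\<^sup>2"
      using L.norm_mult[OF L.star_closed[OF T] T] L.norm_star[OF T] by (simp add: power2_eq_square)
    let ?c = "cnorm L (star L T \<otimes>\<^bsub>L\<^esub> T)"
    have M: "star L T \<otimes>\<^bsub>L\<^esub> T \<in> carrier L" using T by (intro L.m_closed L.star_closed)
    have c: "0 \<le> ?c" by (rule L_norm_nonneg[OF M])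
    have "cnorm L T \<le> sqrt ?c"
    proof (rule L_norm_le)
      fix x assume x: "x \<in> carrier E"
      have "Re (ip i (T x) (T x)) \<le> (sqrt ?c * hnorm E x)\<^sup>2" if i: "i \<in> I" for i
      proof -
        have "Re (ip i (T x) (T x)) \<le> cmod (ip i x ((star L T \<otimes>\<^bsub>L\<^esub> T) x))"
          using adjointE(2)[OF T i x L_closed[OF T x]] complex_Re_le_cmod x by (simp add: L_simps)
        also have "\<dots> \<le> hnorm E x * hnorm E ((star L T \<otimes>\<^bsub>L\<^esub> T) x)"
          by (rule ip_le[OF i x L_closed[OF M x]])
        also have "\<dots> \<le> hnorm E x * (?c * hnorm E x)"
          using L_norm_apply[OF M x] x by (intro mult_left_mono) auto
        finally show ?thesis using c by (simp add: power_mult_distrib power2_eq_square algebra_simps)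
      qed
      then show "hnorm E (T x) \<le> sqrt ?c * hnorm E x"
        using c x by (subst hnorm_le_iff[OF L_closed[OF T x]]) auto
    qed (use c in simp)
    then show "(cnorm L T)\<^sup>2 \<le> ?c" using c L_norm_nonneg[OF T] by (metis power_mono real_sqrt_pow2)
  qed
  then show ?thesis
    unfolding cstar_seminorm_def by (simp add: L.norm_triangle L.norm_scale L.norm_mult)
qed

lemma (in banach_star_alg) closed_star_subalgebra_closure:
  assumes S: "S \<subseteq> carrier A" "\<zero> \<in> S"
    and add: "\<And>x y. \<lbrakk>x \<in> S; y \<in> S\<rbrakk> \<Longrightarrow> x \<oplus> y \<in> S" and mult: "\<And>x y. \<lbrakk>x \<in> S; y \<in> S\<rbrakk> \<Longrightarrow> x \<otimes> y \<in> S"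
    and scale: "\<And>c x. x \<in> S \<Longrightarrow> cscale A c x \<in> S" and star: "\<And>x. x \<in> S \<Longrightarrow> star A x \<in> S"
  shows "closed_star_subalgebra A (norm_closure A S)" "S \<subseteq> norm_closure A S"
proof -
  note iff = norm_closure_iff[OF S(1)]
  show sub: "S \<subseteq> norm_closure A S"
  proof
    fix x assume x: "x \<in> S"
    then show "x \<in> norm_closure A S"
      unfolding iff using S(1) by (intro exI[of _ "\<lambda>_. x"]) (auto intro: tends_const)
  qed
  have cl: "norm_closure A S \<subseteq> carrier A" by (auto simp: norm_closure_def)
  show "closed_star_subalgebra A (norm_closure A S)"
    unfolding closed_star_subalgebra_def
  proof (intro conjI ballI allI)
    fix x y assume "x \<in> norm_closure A S" "y \<in> norm_closure A S"
    then obtain s t where st: "range s \<subseteq> S" "tends s x" "range t \<subseteq> S" "tends t y" unfolding iff by blast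
    show "x \<oplus> y \<in> norm_closure A S"
      unfolding iff using st add by (intro exI[of _ "\<lambda>n. s n \<oplus> t n"]) (auto intro: tends_add)
    show "x \<otimes> y \<in> norm_closure A S"
      unfolding iff using st mult by (intro exI[of _ "\<lambda>n. s n \<otimes> t n"]) (auto intro: tends_mult)
  next
    fix x c assume "x \<in> norm_closure A S"
    then obtain s where s: "range s \<subseteq> S" "tends s x" unfolding iff by blast
    show "cscale A c x \<in> norm_closure A S"
      unfolding iff using s scale by (intro exI[of _ "\<lambda>n. cscale A c (s n)"]) (auto intro: tends_scale)
    show "star A x \<in> norm_closure A S"
      unfolding iff using s star by (intro exI[of _ "\<lambda>n. star A (s n)"]) (auto intro: tends_star)
  next
    show "norm_closure A (norm_closure A S) \<subseteq> norm_closure A S"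
    proof
      fix x assume x: "x \<in> norm_closure A (norm_closure A S)"
      then have xc: "x \<in> carrier A" by (simp add: norm_closure_def)
      have "\<exists>z\<in>S. cnorm A (x \<ominus> z) < \<epsilon>" if e: "\<epsilon> > 0" for \<epsilon>
      proof -
        have e2: "\<epsilon> / 2 > 0" using e by simp
        obtain y where y: "y \<in> norm_closure A S" "cnorm A (x \<ominus> y) < \<epsilon> / 2"
          using x e2 unfolding norm_closure_def by blast
        obtain z where z: "z \<in> S" "cnorm A (y \<ominus> z) < \<epsilon> / 2"
          using y(1) e2 unfolding norm_closure_def by blast
        have "y \<in> carrier A" "z \<in> carrier A" using y(1) z(1) cl S(1) by auto
        then have "cnorm A (x \<ominus> z) < \<epsilon>" using norm_diff_triangle[OF xc, of y z] y(2) z(2) by linarith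
        then show ?thesis using z(1) by blast
      qed
      then show "x \<in> norm_closure A S" using xc by (simp add: norm_closure_def)
    qed
  qed (use cl sub S(2) in auto)
qed

text \<open>Made for partial translations of \<open>P\<close>: \<open>f\<close> lives on the range
  \<open>Y\<close> and is carried back to the domain \<open>X\<close>.\<close>

lemma l2_transport:
  assumes "bij_betw \<phi> X Y" "Y \<subseteq> Z" "\<And>z. z \<in> Z - Y \<Longrightarrow> f z = 0"
  shows "square_summable Z f \<longleftrightarrow> square_summable X (\<lambda>x. f (\<phi> x))"
    and "l2_inner Z f g = l2_inner X (\<lambda>x. f (\<phi> x)) (\<lambda>x. g (\<phi> x))"
proof -
  have "square_summable Z f \<longleftrightarrow> (\<lambda>z. (cmod (f z))\<^sup>2) summable_on Y"
    unfolding square_summable_def using assms(2,3) by (intro summable_on_cong_neutral) auto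
  then show "square_summable Z f \<longleftrightarrow> square_summable X (\<lambda>x. f (\<phi> x))"
    unfolding square_summable_def using summable_on_reindex_bij_betw[OF assms(1), of "\<lambda>z. (cmod (f z))\<^sup>2"] by simp
  have "l2_inner Z f g = (\<Sum>\<^sub>\<infinity>z\<in>Y. cnj (f z) * g z)"
    unfolding l2_inner_def using assms(2,3) by (intro infsum_cong_neutral) auto
  then show "l2_inner Z f g = l2_inner X (\<lambda>x. f (\<phi> x)) (\<lambda>x. g (\<phi> x))"
    unfolding l2_inner_def using infsum_reindex_bij_betw[OF assms(1), of "\<lambda>z. cnj (f z) * g z"] by simp
qed

lemma square_summable_mult:
  assumes "square_summable X u" "\<And>x. x \<in> X \<Longrightarrow> cmod (a x) \<le> M" "Y \<subseteq> X"
  shows "square_summable Y (\<lambda>x. a x * u x)"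
  unfolding square_summable_def
proof (rule summable_on_comparison_test)
  show "(\<lambda>x. M\<^sup>2 * (cmod (u x))\<^sup>2) summable_on Y"
    by (rule summable_on_subset_banach[OF _ assms(3)])
      (rule summable_on_cmult_right[OF assms(1)[unfolded square_summable_def]])
  show "(cmod (a x * u x))\<^sup>2 \<le> M\<^sup>2 * (cmod (u x))\<^sup>2" if "x \<in> Y" for x
    using assms(2)[of x] that assms(3) unfolding norm_mult power_mult_distrib
    by (intro mult_right_mono power_mono) auto
qed simp

context submonoid_of_group
begin

lemma act_square_summable:
  assumes "f \<in> carrier Sec" "square_summable P u"
  shows "square_summable P (act f u)"
  using assms(1)
proof (induction rule: Sec_induct)
  case zero
  show ?case using square_summable_cong[of P "act \<zero>\<^bsub>Sec\<^esub> u" "\<lambda>_. 0"] by (simp add: act_zero)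
next
  case (delta s a)
  let ?X = "{z \<in> P. s \<otimes> z \<in> P}" and ?Y = "{x \<in> P. inv s \<otimes> x \<in> P}"
  have bij: "bij_betw (\<lambda>z. s \<otimes> z) ?X ?Y"
    using delta(1) by (intro bij_betwI[where g = "\<lambda>x. inv s \<otimes> x"]) auto
  have "square_summable P (act (delta a s) u) \<longleftrightarrow>
      square_summable ?X (\<lambda>z. act (delta a s) u (s \<otimes> z))"
    using delta(1) by (intro l2_transport(1)[OF bij]) (auto simp: act_delta_section)
  also have "\<dots> \<longleftrightarrow> square_summable ?X (\<lambda>z. (if s \<otimes> z \<in> P then a (s \<otimes> z) else 0) * u z)"
    using delta(1) by (intro square_summable_cong) (auto simp: act_delta_section)
  finally show ?case
    using supn_ge[OF delta(2)] supn_nonneg[OF delta(2)]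
    by (simp add: square_summable_mult[OF assms(2), of _ "supn a"])
next
  case (add f h)
  then show ?case
    using square_summable_add[OF add(3,4)] square_summable_cong[of P "act (f \<oplus>\<^bsub>Sec\<^esub> h) u" "\<lambda>x. act f u x + act h u x"]
    by (simp add: act_add)
qed

text \<open>By additivity a section concentrated at one \<open>s\<close> suffices. Then both sides
  run over the points \<open>z\<close> for which \<open>z\<close> and \<open>s \<otimes> z\<close>
  lie in \<open>P\<close>, and the terms agree.\<close>

lemma act_adjoint:
  assumes "f \<in> carrier Sec" "square_summable P u" "square_summable P v"
  shows "l2_inner P (act f u) v = l2_inner P u (act (star Sec f) v)"
  using assms(1)
proof (induction rule: Sec_induct)
  case zero
  show ?case unfolding l2_inner_def by (simp add: act_zero Sec.star_zero)
next
  case (delta s a)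
  let ?X = "{z \<in> P. s \<otimes> z \<in> P}" and ?Y = "{x \<in> P. inv s \<otimes> x \<in> P}"
  let ?f = "delta a s"
  let ?b = "\<lambda>x\<in>P. if s \<otimes> x \<in> P then cnj (a (s \<otimes> x)) else 0"
  have bij: "bij_betw (\<lambda>z. s \<otimes> z) ?X ?Y"
    using delta(1) by (intro bij_betwI[where g = "\<lambda>x. inv s \<otimes> x"]) auto
  have r: "act (star Sec ?f) v z = (if s \<otimes> z \<in> P then cnj (a (s \<otimes> z)) * v (s \<otimes> z) else 0)" if "z \<in> P" for z
    using that delta(1) by (simp add: delta_star act_delta_section)
  have "l2_inner P (act ?f u) v = l2_inner ?X (\<lambda>z. act ?f u (s \<otimes> z)) (\<lambda>z. v (s \<otimes> z))"
    using delta(1) by (intro l2_transport(2)[OF bij]) (auto simp: act_delta_section)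
  also have "\<dots> = l2_inner ?X u (act (star Sec ?f) v)"
    unfolding l2_inner_def using delta(1) r by (intro infsum_cong) (auto simp: act_delta_section)
  also have "\<dots> = l2_inner P u (act (star Sec ?f) v)"
    unfolding l2_inner_def using r by (intro infsum_cong_neutral) auto
  finally show ?case .
next
  case (add f h)
  note sv = act_square_summable[OF Sec.star_closed[OF add(1)] assms(3)]
    act_square_summable[OF Sec.star_closed[OF add(2)] assms(3)]
  note su = act_square_summable[OF add(1) assms(2)] act_square_summable[OF add(2) assms(2)]
  have "l2_inner P (act (f \<oplus>\<^bsub>Sec\<^esub> h) u) v = l2_inner P (\<lambda>x. act f u x + act h u x) v"
    using add(1,2) by (intro l2_inner_cong) (simp_all add: act_add)
  also have "\<dots> = l2_inner P (act f u) v + l2_inner P (act h u) v"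
    using l2_inner_add[OF su assms(3)]
    by (subst (1 2 3) l2_inner_sym) simp
  also have "\<dots> = l2_inner P u (\<lambda>x. act (star Sec f) v x + act (star Sec h) v x)"
    unfolding add(3,4) by (rule l2_inner_add[OF sv assms(2), symmetric])
  also have "\<dots> = l2_inner P u (act (star Sec (f \<oplus>\<^bsub>Sec\<^esub> h)) v)"
    using add(1,2) by (intro l2_inner_cong) (simp_all add: act_add Sec.star_add)
  finally show ?case .
qed

section \<open>Sections acting on the Hilbert space and on the Hilbert module\<close>

definition lrep :: "('g \<Rightarrow> 'g \<Rightarrow> complex) \<Rightarrow> ('g \<Rightarrow> complex) \<Rightarrow> 'g \<Rightarrow> complex" where
  "lrep f = (\<lambda>u\<in>carrier (ell2 P). \<lambda>x\<in>P. act f u x)"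

abbreviation "rrep \<equiv> regular_rep G (canonical_bundle G P)"
abbreviation "LH \<equiv> adjointable_ops (ell2 P)"
abbreviation "LE \<equiv> adjointable_ops (ell2_sections G (canonical_bundle G P))"

sublocale H: hilbert_mod "ell2 P" "{()}" "\<lambda>_. l2_inner P"
  by (rule ell2_hilbert_mod)

sublocale E: hilbert_mod "ell2_sections G (canonical_bundle G P)" P
  "\<lambda>x \<xi> \<eta>. l2_inner (carrier G) (gcol \<xi> x) (gcol \<eta> x)"
  by (rule Emod_hilbert_mod)

lemma lrep_closed:
  assumes "f \<in> carrier Sec"
  shows "lrep f \<in> carrier LH" "star LH (lrep f) = lrep (star Sec f)"
proof -
  have fn: "lrep h \<in> carrier (ell2 P) \<rightarrow>\<^sub>E carrier (ell2 P)" if "h \<in> carrier Sec" for h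
    unfolding lrep_def using act_square_summable[OF that]
    by (auto intro!: ell2_restrict simp: ell2_simps)
  have "l2_inner P (lrep f u) v = l2_inner P u (lrep (star Sec f) v)"
    if "u \<in> carrier (ell2 P)" "v \<in> carrier (ell2 P)" for u v
  proof -
    have "l2_inner P (lrep f u) v = l2_inner P (act f u) v"
      using that(1) by (intro l2_inner_cong) (simp_all add: lrep_def)
    also have "\<dots> = l2_inner P u (act (star Sec f) v)" using that assms by (simp add: act_adjoint ell2_simps)
    also have "\<dots> = l2_inner P u (lrep (star Sec f) v)"
      using that(2) by (intro l2_inner_cong) (simp_all add: lrep_def)
    finally show ?thesis .
  qed
  then show "lrep f \<in> carrier LH" "star LH (lrep f) = lrep (star Sec f)"
    using H.adjointI[OF fn[OF assms] fn[OF Sec.star_closed[OF assms]]] by blast+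
qed

lemma lrep_hom: "star_hom Sec LH lrep"
proof -
  interpret LH: banach_star_alg LH by (rule H.L_banach)
  show ?thesis
  proof
    fix f h assume f: "f \<in> carrier Sec" and h: "h \<in> carrier Sec"
    show "lrep (f \<oplus>\<^bsub>Sec\<^esub> h) = lrep f \<oplus>\<^bsub>LH\<^esub> lrep h"
      unfolding H.L_simps using f h by (auto simp: lrep_def ell2_simps(2) act_add fun_eq_iff)
    have "act f (act h u) x = act f (\<lambda>x\<in>P. act h u x) x" for u x by (rule act_cong) simp
    then show "lrep (f \<otimes>\<^bsub>Sec\<^esub> h) = lrep f \<otimes>\<^bsub>LH\<^esub> lrep h"
      unfolding H.L_simps using f h H.L_closed[OF lrep_closed(1)[OF h]]
      by (auto simp: lrep_def act_mult fun_eq_iff)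
  next
    fix f c assume f: "f \<in> carrier Sec"
    show "lrep f \<in> carrier LH" by (rule lrep_closed(1)[OF f])
    show "lrep (star Sec f) = star LH (lrep f)" by (rule lrep_closed(2)[OF f, symmetric])
    show "lrep (cscale Sec c f) = cscale LH c (lrep f)"
      unfolding H.L_simps using f by (auto simp: lrep_def ell2_simps(4) act_scale fun_eq_iff)
  next
    show "lrep \<one>\<^bsub>Sec\<^esub> = \<one>\<^bsub>LH\<^esub>"
      unfolding H.L_simps by (auto simp: lrep_def act_one fun_eq_iff ell2_simps(1) extensional_def)
  qed
qed

lemma left_regular_lrep:
  assumes "p \<in> P"
  shows "left_regular G P p = lrep (sgen p)"
proof -
  have "x \<in> p <# P \<longleftrightarrow> inv p \<otimes> x \<in> P" if "x \<in> P" for x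
    using that assms by (subst mem_l_coset_iff[OF is_group _ P_sub]) auto
  then show ?thesis
    using assms unfolding left_regular_def lrep_def sgen_def
    by (auto simp: act_delta_section char_fun_def fun_eq_iff)
qed

text \<open>The map from \<open>z\<close> to \<open>z \<otimes> inv x\<close> is a bijection of
  \<open>P\<close> onto the group elements at which \<open>gcol\<close> can be nonzero.\<close>

lemma gcol_col:
  assumes "x \<in> P"
  shows "square_summable (carrier G) (gcol \<xi> x) \<longleftrightarrow> square_summable P (col \<xi> x)"
    and "l2_inner (carrier G) (gcol \<xi> x) (gcol \<eta> x) = l2_inner P (col \<xi> x) (col \<eta> x)"
proof -
  have bij: "bij_betw (\<lambda>z. z \<otimes> inv x) P {g \<in> carrier G. g \<otimes> x \<in> P}"
    using assms by (intro bij_betwI[where g = "\<lambda>g. g \<otimes> x"]) (auto simp: m_assoc)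
  have e: "gcol \<zeta> x (z \<otimes> inv x) = col \<zeta> x z" if "z \<in> P" for z \<zeta>
    using that assms by (simp add: gcol_def col_def m_assoc)
  have z: "gcol \<xi> x g = 0" if "g \<in> carrier G - {g \<in> carrier G. g \<otimes> x \<in> P}" for g
    using that by (simp add: gcol_def)
  have sub: "{g \<in> carrier G. g \<otimes> x \<in> P} \<subseteq> carrier G" by blast
  have "square_summable (carrier G) (gcol \<xi> x) \<longleftrightarrow> square_summable P (\<lambda>z. gcol \<xi> x (z \<otimes> inv x))"
    by (rule l2_transport(1)[OF bij sub z])
  also have "\<dots> \<longleftrightarrow> square_summable P (col \<xi> x)" by (rule square_summable_cong[OF e])
  finally show "square_summable (carrier G) (gcol \<xi> x) \<longleftrightarrow> square_summable P (col \<xi> x)" .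
  have "l2_inner (carrier G) (gcol \<xi> x) (gcol \<eta> x) = l2_inner P (\<lambda>z. gcol \<xi> x (z \<otimes> inv x)) (\<lambda>z. gcol \<eta> x (z \<otimes> inv x))"
    by (rule l2_transport(2)[OF bij sub z])
  also have "\<dots> = l2_inner P (col \<xi> x) (col \<eta> x)" by (rule l2_inner_cong[OF e e])
  finally show "l2_inner (carrier G) (gcol \<xi> x) (gcol \<eta> x) = l2_inner P (col \<xi> x) (col \<eta> x)" .
qed

lemma conv_add:
  assumes "f \<in> carrier Sec" "h \<in> carrier Sec" "\<xi> \<in> sections"
  shows "sconv (f \<oplus>\<^bsub>Sec\<^esub> h) \<xi> =
    (\<lambda>g\<in>carrier G. \<lambda>x\<in>P. sconv f \<xi> g x + sconv h \<xi> g x)"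
proof (rule sections_eqI)
  note c = section_conv_eq(2)[OF _ assms(3)]
  show "sconv (f \<oplus>\<^bsub>Sec\<^esub> h) \<xi> \<in> sections" using assms by (intro c) auto
  show "(\<lambda>g\<in>carrier G. \<lambda>x\<in>P. sconv f \<xi> g x + sconv h \<xi> g x) \<in> sections"
    using c[OF assms(1)] c[OF assms(2)] by (auto intro!: fib_add)
  fix x z assume xz: "x \<in> P" "z \<in> P"
  then have "col (\<lambda>g\<in>carrier G. \<lambda>x\<in>P. sconv f \<xi> g x + sconv h \<xi> g x) z x =
      col (sconv f \<xi>) z x + col (sconv h \<xi>) z x"
    by (simp add: col_def)
  then show "col (sconv (f \<oplus>\<^bsub>Sec\<^esub> h) \<xi>) z x =
      col (\<lambda>g\<in>carrier G. \<lambda>x\<in>P. sconv f \<xi> g x + sconv h \<xi> g x) z x"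
    using assms xz by (simp add: col_conv act_add)
qed

text \<open>A section concentrated at \<open>s\<close> shifts each column by \<open>s\<close> and
  multiplies it by a function bounded by \<open>supn a\<close>. So the exceptional set moves to its
  translate by \<open>s\<close>, and the tails grow at most by the square of that bound.\<close>

lemma conv_uniform_tails:
  assumes "f \<in> carrier Sec" "\<xi> \<in> sections" "uniform_tails \<xi>"
  shows "uniform_tails (sconv f \<xi>)"
  using assms(1)
proof (induction rule: Sec_induct)
  case zero
  have "sconv \<zero>\<^bsub>Sec\<^esub> \<xi> = (\<lambda>g\<in>carrier G. \<lambda>x\<in>P. 0)"
  proof (rule sections_eqI[OF section_conv_eq(2)[OF Sec.zero_closed assms(2)]])
    fix x z assume "x \<in> P" "z \<in> P"
    then show "col (sconv \<zero>\<^bsub>Sec\<^esub> \<xi>) z x = col (\<lambda>g\<in>carrier G. \<lambda>x\<in>P. 0) z x"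
      unfolding col_conv[OF Sec.zero_closed assms(2) \<open>x \<in> P\<close> \<open>z \<in> P\<close>] act_zero by (simp add: col_def)
  qed (auto simp: fib_zero)
  then show ?case using uniform_tails_zero by (simp only:)
next
  case (delta s a)
  let ?\<zeta> = "sconv (delta a s) \<xi>"
  have dc: "delta a s \<in> carrier Sec" using delta by (intro delta_closed)
  let ?M = "supn a"
  have gcol: "cmod (gcol ?\<zeta> x g) \<le> ?M * cmod (gcol \<xi> x (inv s \<otimes> g))" if g: "g \<in> carrier G" and x: "x \<in> P" for g x
  proof (cases "g \<otimes> x \<in> P \<and> inv s \<otimes> (g \<otimes> x) \<in> P")
    case True
    have "gcol ?\<zeta> x g = col ?\<zeta> x (g \<otimes> x)" using True g x by (simp add: gcol_def col_def m_assoc)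
    also have "\<dots> = a (g \<otimes> x) * col \<xi> x (inv s \<otimes> (g \<otimes> x))"
      using True x delta by (simp add: col_conv[OF dc assms(2)] act_delta_section)
    also have "col \<xi> x (inv s \<otimes> (g \<otimes> x)) = gcol \<xi> x (inv s \<otimes> g)"
      using True g x delta(1) by (simp add: gcol_def col_def m_assoc)
    finally show ?thesis
      using supn_ge[OF delta(2), of "g \<otimes> x"] True by (simp add: norm_mult mult_right_mono)
  next
    case False
    have "gcol ?\<zeta> x g = 0"
    proof (cases "g \<otimes> x \<in> P")
      case True
      then have "gcol ?\<zeta> x g = col ?\<zeta> x (g \<otimes> x)" using g x by (simp add: gcol_def col_def m_assoc)
      then show ?thesis using False True x delta by (simp add: col_conv[OF dc assms(2)] act_delta_section)
    qed (simp add: gcol_def)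
    then show ?thesis using supn_nonneg[OF delta(2)] by simp
  qed
  show ?case
    unfolding uniform_tails_def
  proof (intro allI impI)
    fix \<epsilon> :: real assume e: "\<epsilon> > 0"
    define d where "d = \<epsilon> / (?M\<^sup>2 + 1)"
    have c: "?M\<^sup>2 + 1 > 0" by (simp add: add_nonneg_pos)
    have d: "d > 0" "?M\<^sup>2 * d \<le> \<epsilon>" using e c by (auto simp: d_def field_simps)
    obtain F0 where F0: "finite F0" "F0 \<subseteq> carrier G"
      "\<forall>F. finite F \<and> F \<subseteq> carrier G - F0 \<longrightarrow> (\<forall>x\<in>P. (\<Sum>g\<in>F. (cmod (gcol \<xi> x g))\<^sup>2) \<le> d)"
      using uniform_tailsD[OF assms(3) d(1)] by blast
    have "(\<Sum>g\<in>F. (cmod (gcol ?\<zeta> x g))\<^sup>2) \<le> \<epsilon>"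
      if F: "finite F" "F \<subseteq> carrier G - (\<lambda>g. s \<otimes> g) ` F0" and x: "x \<in> P" for F x
    proof -
      have inj: "inj_on (\<lambda>g. inv s \<otimes> g) F" using F(2) delta(1) by (auto intro!: inj_onI simp: subset_iff)
      have "inv s \<otimes> g \<in> carrier G - F0" if "g \<in> F" for g
        using that F(2) delta(1) by (auto simp: subset_iff image_iff) (metis inv_cancel(2))
      then have sub: "(\<lambda>g. inv s \<otimes> g) ` F \<subseteq> carrier G - F0" by blast
      have "(\<Sum>g\<in>F. (cmod (gcol ?\<zeta> x g))\<^sup>2) \<le> (\<Sum>g\<in>F. ?M\<^sup>2 * (cmod (gcol \<xi> x (inv s \<otimes> g)))\<^sup>2)"
        unfolding power_mult_distrib[symmetric] using F(2) x gcol by (intro sum_mono power_mono) auto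
      also have "\<dots> = ?M\<^sup>2 * (\<Sum>g\<in>(\<lambda>g. inv s \<otimes> g) ` F. (cmod (gcol \<xi> x g))\<^sup>2)"
        by (simp add: sum.reindex[OF inj] sum_distrib_left)
      also have "\<dots> \<le> ?M\<^sup>2 * d" using F(1) sub x by (intro mult_left_mono F0(3)[rule_format]) auto
      finally show ?thesis using d by simp
    qed
    moreover have "finite ((\<lambda>g. s \<otimes> g) ` F0)" "(\<lambda>g. s \<otimes> g) ` F0 \<subseteq> carrier G"
      using F0(1,2) delta(1) by auto
    ultimately show "\<exists>F\<^sub>0. finite F\<^sub>0 \<and> F\<^sub>0 \<subseteq> carrier G \<and> (\<forall>F. finite F \<and> F \<subseteq> carrier G - F\<^sub>0 \<longrightarrow>
        (\<forall>x\<in>P. (\<Sum>g\<in>F. (cmod (gcol ?\<zeta> x g))\<^sup>2) \<le> \<epsilon>))"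
      by (intro exI[of _ "(\<lambda>g. s \<otimes> g) ` F0"]) simp
  qed
next
  case (add f h)
  have "sconv (f \<oplus>\<^bsub>Sec\<^esub> h) \<xi> =
      (\<lambda>g\<in>carrier G. \<lambda>x\<in>P. sconv f \<xi> g x + sconv h \<xi> g x)" (is "_ = ?s")
    by (rule conv_add[OF add(1,2) assms(2)])
  then show ?case using uniform_tails_add[OF add(3,4)] by (simp only:)
qed

lemma rrep_apply: "\<xi> \<in> carrier Emod \<Longrightarrow> rrep f \<xi> = sconv f \<xi>"
  by (simp add: regular_rep_def)

lemma Emod_pi: "\<xi> \<in> carrier Emod \<Longrightarrow> \<xi> \<in> sections"
  by (simp add: Emod_iff)

lemma rrep_fun:
  assumes "f \<in> carrier Sec"
  shows "rrep f \<in> carrier Emod \<rightarrow>\<^sub>E carrier Emod"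
  using section_conv_eq(2)[OF assms] conv_uniform_tails[OF assms]
  by (auto simp: regular_rep_def Emod_iff)

lemma col_rrep:
  "\<lbrakk>f \<in> carrier Sec; \<xi> \<in> carrier Emod; x \<in> P; y \<in> P\<rbrakk> \<Longrightarrow> col (rrep f \<xi>) y x = act f (col \<xi> y) x"
  by (simp add: rrep_apply col_conv Emod_pi)

lemma Emod_col: "\<lbrakk>\<xi> \<in> carrier Emod; x \<in> P\<rbrakk> \<Longrightarrow> square_summable P (col \<xi> x)"
  using gcol_col(1) Emod_gcol by blast

lemma rrep_closed:
  assumes "f \<in> carrier Sec"
  shows "rrep f \<in> carrier LE" "star LE (rrep f) = rrep (star Sec f)"
proof -
  note sf = Sec.star_closed[OF assms]
  have "l2_inner (carrier G) (gcol (rrep f \<xi>) x) (gcol \<eta> x) = l2_inner (carrier G) (gcol \<xi> x) (gcol (rrep (star Sec f) \<eta>) x)"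
    if "x \<in> P" "\<xi> \<in> carrier Emod" "\<eta> \<in> carrier Emod" for x \<xi> \<eta>
  proof -
    have "l2_inner P (col (rrep f \<xi>) x) (col \<eta> x) = l2_inner P (act f (col \<xi> x)) (col \<eta> x)"
      using that assms by (intro l2_inner_cong) (simp_all add: col_rrep)
    also have "\<dots> = l2_inner P (col \<xi> x) (act (star Sec f) (col \<eta> x))"
      using that assms by (simp add: act_adjoint Emod_col)
    also have "\<dots> = l2_inner P (col \<xi> x) (col (rrep (star Sec f) \<eta>) x)"
      using that sf by (intro l2_inner_cong) (simp_all add: col_rrep)
    finally show ?thesis unfolding gcol_col(2)[OF that(1)] .
  qed
  then show "rrep f \<in> carrier LE" "star LE (rrep f) = rrep (star Sec f)"
    using E.adjointI[OF rrep_fun[OF assms] rrep_fun[OF sf]] by blast+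
qed

lemma rrep_eqI:
  assumes "T \<in> carrier LE" "f \<in> carrier Sec"
    and "\<And>\<xi> x y. \<lbrakk>\<xi> \<in> carrier Emod; x \<in> P; y \<in> P\<rbrakk> \<Longrightarrow> act f (col \<xi> y) x = col (T \<xi>) y x"
  shows "rrep f = T"
proof (rule extensionalityI[of _ "carrier Emod"])
  show "rrep f \<in> extensional (carrier Emod)" "T \<in> extensional (carrier Emod)"
    using rrep_fun[OF assms(2)] E.L_fun[OF assms(1)] by (auto simp: PiE_def)
  fix \<xi> assume \<xi>: "\<xi> \<in> carrier Emod"
  have "rrep f \<xi> \<in> carrier Emod" using rrep_fun[OF assms(2)] \<xi> by blast
  then show "rrep f \<xi> = T \<xi>"
    by (rule sections_eqI[OF Emod_pi Emod_pi[OF E.L_closed[OF assms(1) \<xi>]]])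
      (use \<xi> assms in \<open>simp add: col_rrep\<close>)
qed

lemma rrep_hom: "star_hom Sec LE rrep"
proof -
  interpret LE: banach_star_alg LE by (rule E.L_banach)
  show ?thesis
  proof
    fix f h assume f: "f \<in> carrier Sec" and h: "h \<in> carrier Sec"
    note r = rrep_closed(1)[OF f] rrep_closed(1)[OF h]
    show "rrep (f \<oplus>\<^bsub>Sec\<^esub> h) = rrep f \<oplus>\<^bsub>LE\<^esub> rrep h"
    proof (rule rrep_eqI)
      fix \<xi> x y assume a: "\<xi> \<in> carrier Emod" "x \<in> P" "y \<in> P"
      have "col ((rrep f \<oplus>\<^bsub>LE\<^esub> rrep h) \<xi>) y x = col (rrep f \<xi>) y x + col (rrep h \<xi>) y x"
        unfolding E.L_simps Emod_simps using a by (simp add: col_def)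
      then show "act (f \<oplus>\<^bsub>Sec\<^esub> h) (col \<xi> y) x = col ((rrep f \<oplus>\<^bsub>LE\<^esub> rrep h) \<xi>) y x"
        using a f h by (simp add: col_rrep act_add)
    qed (use f h r in auto)
    show "rrep (f \<otimes>\<^bsub>Sec\<^esub> h) = rrep f \<otimes>\<^bsub>LE\<^esub> rrep h"
    proof (rule rrep_eqI)
      fix \<xi> x y assume a: "\<xi> \<in> carrier Emod" "x \<in> P" "y \<in> P"
      have "col ((rrep f \<otimes>\<^bsub>LE\<^esub> rrep h) \<xi>) y x = act f (col (rrep h \<xi>) y) x"
        unfolding E.L_simps using a f E.L_closed[OF r(2) a(1)] by (simp add: col_rrep)
      also have "\<dots> = act f (act h (col \<xi> y)) x"
        using a h by (intro act_cong) (simp add: col_rrep)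
      finally show "act (f \<otimes>\<^bsub>Sec\<^esub> h) (col \<xi> y) x = col ((rrep f \<otimes>\<^bsub>LE\<^esub> rrep h) \<xi>) y x"
        using a f h by (simp add: act_mult)
    qed (use f h r in auto)
  next
    fix f c assume f: "f \<in> carrier Sec"
    show r: "rrep f \<in> carrier LE" by (rule rrep_closed(1)[OF f])
    show "rrep (star Sec f) = star LE (rrep f)" by (rule rrep_closed(2)[OF f, symmetric])
    show "rrep (cscale Sec c f) = cscale LE c (rrep f)"
    proof (rule rrep_eqI)
      fix \<xi> x y assume a: "\<xi> \<in> carrier Emod" "x \<in> P" "y \<in> P"
      have "col (cscale LE c (rrep f) \<xi>) y x = c * col (rrep f \<xi>) y x"
        unfolding E.L_simps Emod_simps using a by (simp add: col_def)
      then show "act (cscale Sec c f) (col \<xi> y) x = col (cscale LE c (rrep f) \<xi>) y x"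
        using a f by (simp add: col_rrep act_scale)
    qed (use f r in auto)
  next
    show "rrep \<one>\<^bsub>Sec\<^esub> = \<one>\<^bsub>LE\<^esub>"
    proof (rule rrep_eqI)
      fix \<xi> x y assume a: "\<xi> \<in> carrier Emod" "x \<in> P" "y \<in> P"
      then show "act \<one>\<^bsub>Sec\<^esub> (col \<xi> y) x = col (\<one>\<^bsub>LE\<^esub> \<xi>) y x"
        unfolding E.L_simps by (simp add: act_one)
    qed auto
  qed
qed

text \<open>The regular representation acts on the columns as \<^term>\<open>lrep\<close>, and every vector of
  \<open>\<ell>\<^sup>2(P)\<close> is the column over \<open>1\<close> of the section below, all of whose columns have the same norm.\<close>

definition vec_section :: "('g \<Rightarrow> complex) \<Rightarrow> 'g \<Rightarrow> 'g \<Rightarrow> complex" where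
  "vec_section v = (\<lambda>g\<in>carrier G. if g \<in> P then (\<lambda>x\<in>P. v g * char_fun P (g <# P) x) else (\<lambda>x\<in>P. 0))"

lemma gcol_vec_section:
  assumes "g \<in> carrier G" "x \<in> P"
  shows "gcol (vec_section v) x g = (if g \<in> P then v g else 0)"
  using assms mem_l_coset_iff[OF is_group _ P_sub, of g "g \<otimes> x"]
  by (auto simp: gcol_def vec_section_def char_fun_def)

lemma vec_section_inner:
  assumes "x \<in> P"
  shows "l2_inner (carrier G) (gcol (vec_section v) x) (gcol (vec_section v) x) = l2_inner P v v"
  unfolding l2_inner_def using assms P_sub by (intro infsum_cong_neutral) (auto simp: gcol_vec_section)

text \<open>Every column has the entries of \<open>v\<close>, so one exceptional set for
  \<open>v\<close> serves all columns at once.\<close>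

lemma vec_section_closed:
  assumes "square_summable P v"
  shows "vec_section v \<in> carrier Emod"
  unfolding Emod_iff
proof
  have "char_fun P (g <# P) \<in> fib g" if "g \<in> P" for g
    using Sec_fib[of "sgen g" g] sgen_closed that by (auto simp: sgen_def delta_def')
  then show "vec_section v \<in> sections"
    by (auto simp: vec_section_def fib_zero fib_scale)
  show "uniform_tails (vec_section v)"
    unfolding uniform_tails_def
  proof (intro allI impI)
    fix \<epsilon> :: real assume "\<epsilon> > 0"
    from square_summable_tail[OF assms this] obtain F0 where F0: "finite F0" "F0 \<subseteq> P"
      "\<forall>F. finite F \<and> F \<subseteq> P - F0 \<longrightarrow> (\<Sum>g\<in>F. (cmod (v g))\<^sup>2) \<le> \<epsilon>" by blast
    have "(\<Sum>g\<in>F. (cmod (gcol (vec_section v) x g))\<^sup>2) \<le> \<epsilon>" if F: "finite F" "F \<subseteq> carrier G - F0" and x: "x \<in> P" for F x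
    proof -
      have "(\<Sum>g\<in>F. (cmod (gcol (vec_section v) x g))\<^sup>2) = (\<Sum>g\<in>F \<inter> P. (cmod (v g))\<^sup>2)"
        using F x by (intro sum.mono_neutral_cong_right) (auto simp: gcol_vec_section subset_iff)
      also have "\<dots> \<le> \<epsilon>" using F by (intro F0(3)[rule_format]) auto
      finally show ?thesis .
    qed
    then show "\<exists>F\<^sub>0. finite F\<^sub>0 \<and> F\<^sub>0 \<subseteq> carrier G \<and> (\<forall>F. finite F \<and> F \<subseteq> carrier G - F\<^sub>0 \<longrightarrow>
        (\<forall>x\<in>P. (\<Sum>g\<in>F. (cmod (gcol (vec_section v) x g))\<^sup>2) \<le> \<epsilon>))"
      using F0(1,2) P_sub by (intro exI[of _ F0]) auto
  qed
qed

lemma col_vec_section: "z \<in> P \<Longrightarrow> col (vec_section v) \<one> z = v z"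
  using mem_l_coset_iff[OF is_group _ P_sub, of z z] by (simp add: col_def vec_section_def char_fun_def)

lemma ell2_norm_square: "u \<in> carrier (ell2 P) \<Longrightarrow> (hnorm (ell2 P) u)\<^sup>2 = Re (l2_inner P u u)"
  using l2_inner_self_nonneg[of P u] by (simp add: ell2_norm ell2_simps(1))

text \<open>In one direction each column of \<open>\<xi>\<close> is a vector of norm at most that of
  \<open>\<xi>\<close>. In the other \<open>vec_section v\<close> has norm at most that of
  \<open>v\<close> and contains \<open>v\<close> as a column, so testing the module operator on it
  suffices.\<close>

lemma rrep_norm:
  assumes f: "f \<in> carrier Sec"
  shows "cnorm LH (lrep f) = cnorm LE (rrep f)"
proof (rule antisym)
  note l = lrep_closed(1)[OF f] and r = rrep_closed(1)[OF f]
  have lr: "Re (l2_inner P (act f u) (act f u)) = (hnorm (ell2 P) (lrep f u))\<^sup>2" if "u \<in> carrier (ell2 P)" for u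
    unfolding ell2_norm_square[OF H.L_closed[OF l that]]
    using that by (auto simp: lrep_def cong: l2_inner_cong)
  have col: "l2_inner (carrier G) (gcol (rrep f \<xi>) x) (gcol (rrep f \<xi>) x) = l2_inner P (act f (col \<xi> x)) (act f (col \<xi> x))"
    if "\<xi> \<in> carrier Emod" "x \<in> P" for \<xi> x
    unfolding gcol_col(2)[OF that(2)] using that f by (intro l2_inner_cong) (simp_all add: col_rrep)
  show "cnorm LE (rrep f) \<le> cnorm LH (lrep f)"
  proof (rule E.L_norm_le[OF H.L_norm_nonneg[OF l]])
    fix \<xi> assume \<xi>: "\<xi> \<in> carrier Emod"
    have "Re (l2_inner (carrier G) (gcol (rrep f \<xi>) x) (gcol (rrep f \<xi>) x)) \<le> (cnorm LH (lrep f) * hnorm Emod \<xi>)\<^sup>2"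
      if x: "x \<in> P" for x
    proof -
      let ?u = "restrict (col \<xi> x) P"
      have u: "?u \<in> carrier (ell2 P)" by (rule ell2_restrict[OF Emod_col[OF \<xi> x]])
      have "(hnorm (ell2 P) ?u)\<^sup>2 = Re (l2_inner P (col \<xi> x) (col \<xi> x))"
        unfolding ell2_norm_square[OF u] by (simp cong: l2_inner_cong)
      also have "\<dots> \<le> (hnorm Emod \<xi>)\<^sup>2"
        using E.ip_self_le[OF x \<xi>] by (simp add: gcol_col(2)[OF x])
      finally have n: "hnorm (ell2 P) ?u \<le> hnorm Emod \<xi>"
        by (rule power2_le_imp_le) (rule Emod_norm_nonneg[OF \<xi>])
      have "l2_inner P (act f (col \<xi> x)) (act f (col \<xi> x)) = l2_inner P (act f ?u) (act f ?u)"
        by (intro l2_inner_cong act_cong) auto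
      then have "Re (l2_inner (carrier G) (gcol (rrep f \<xi>) x) (gcol (rrep f \<xi>) x)) = (hnorm (ell2 P) (lrep f ?u))\<^sup>2"
        unfolding col[OF \<xi> x] using lr[OF u] by simp
      also have "\<dots> \<le> (cnorm LH (lrep f) * hnorm Emod \<xi>)\<^sup>2"
      proof (rule power_mono)
        have "hnorm (ell2 P) (lrep f ?u) \<le> cnorm LH (lrep f) * hnorm (ell2 P) ?u" by (rule H.L_norm_apply[OF l u])
        also have "\<dots> \<le> cnorm LH (lrep f) * hnorm Emod \<xi>"
          by (intro mult_left_mono n H.L_norm_nonneg[OF l])
        finally show "hnorm (ell2 P) (lrep f ?u) \<le> cnorm LH (lrep f) * hnorm Emod \<xi>" .
        show "0 \<le> hnorm (ell2 P) (lrep f ?u)" by (rule H.hnorm_nonneg[OF H.L_closed[OF l u]])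
      qed
      finally show ?thesis .
    qed
    then show "hnorm Emod (rrep f \<xi>) \<le> cnorm LH (lrep f) * hnorm Emod \<xi>"
      using H.L_norm_nonneg[OF l] Emod_norm_nonneg[OF \<xi>]
      by (subst Emod_norm_le_iff[OF E.L_closed[OF r \<xi>]]) auto
  qed
  show "cnorm LH (lrep f) \<le> cnorm LE (rrep f)"
  proof (rule H.L_norm_le[OF E.L_norm_nonneg[OF r]])
    fix v assume v: "v \<in> carrier (ell2 P)"
    let ?\<xi> = "vec_section v"
    have \<xi>: "?\<xi> \<in> carrier Emod" using v by (intro vec_section_closed) (simp add: ell2_simps)
    have n: "hnorm Emod ?\<xi> \<le> hnorm (ell2 P) v"
      using v by (subst Emod_norm_le_iff[OF \<xi>]) (auto simp: vec_section_inner ell2_norm_square)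
    have "(hnorm (ell2 P) (lrep f v))\<^sup>2 = Re (l2_inner P (act f v) (act f v))" by (rule lr[OF v, symmetric])
    also have "l2_inner P (act f v) (act f v) = l2_inner P (act f (col ?\<xi> \<one>)) (act f (col ?\<xi> \<one>))"
      by (intro l2_inner_cong act_cong) (simp_all add: col_vec_section)
    also have "Re \<dots> \<le> (hnorm Emod (rrep f ?\<xi>))\<^sup>2"
      using E.ip_self_le[OF one_P E.L_closed[OF r \<xi>]] unfolding col[OF \<xi> one_P] .
    finally have "hnorm (ell2 P) (lrep f v) \<le> hnorm Emod (rrep f ?\<xi>)"
      by (rule power2_le_imp_le) (rule Emod_norm_nonneg[OF E.L_closed[OF r \<xi>]])
    also have "\<dots> \<le> cnorm LE (rrep f) * hnorm Emod ?\<xi>" by (rule E.L_norm_apply[OF r \<xi>])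
    also have "\<dots> \<le> cnorm LE (rrep f) * hnorm (ell2 P) v"
      by (intro mult_left_mono n E.L_norm_nonneg[OF r])
    finally show "hnorm (ell2 P) (lrep f v) \<le> cnorm LE (rrep f) * hnorm (ell2 P) v" .
  qed
qed

text \<open>The generators produce only polynomial sections, while the closure is taken over all
  finitely supported ones. The two agree because polynomial sections are dense in the 1-norm and the
  operator norm is dominated by it.\<close>

lemma reduced_toeplitz_closure:
  "reduced_toeplitz G P = LH\<lparr>carrier := norm_closure LH (lrep ` carrier Sec)\<rparr>"
proof -
  interpret LH: banach_star_alg LH by (rule H.L_banach)
  interpret lrep: star_hom Sec LH lrep by (rule lrep_hom)
  have sub: "lrep ` carrier Sec \<subseteq> carrier LH" by auto
  have norm: "cnorm LH (lrep f) \<le> norm1 f" if "f \<in> carrier Sec" for f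
    by (rule cstar_seminorm_le_norm1[OF lrep.cstar_seminorm_comp[OF H.L_cstar] that])
  have zero: "\<zero>\<^bsub>LH\<^esub> \<in> lrep ` carrier Sec" using lrep.hom_zero by (metis Sec.zero_closed image_eqI)
  have alg: "closed_star_subalgebra LH (norm_closure LH (lrep ` carrier Sec)) \<and>
    lrep ` carrier Sec \<subseteq> norm_closure LH (lrep ` carrier Sec)"
    by (intro conjI LH.closed_star_subalgebra_closure[OF sub zero])
      (auto simp: lrep.hom_add[symmetric] lrep.hom_mult[symmetric] lrep.hom_scale[symmetric] lrep.hom_star[symmetric])
  have gens: "left_regular G P ` P \<subseteq> lrep ` carrier Sec"
    using left_regular_lrep sgen_closed by auto
  have "norm_closure LH (lrep ` carrier Sec) \<subseteq> B"
    if B: "closed_star_subalgebra LH B" "left_regular G P ` P \<subseteq> B" for B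
  proof -
    have Bc: "B \<subseteq> carrier LH" "\<zero>\<^bsub>LH\<^esub> \<in> B" "norm_closure LH B \<subseteq> B"
      and Bo: "\<And>x y. \<lbrakk>x \<in> B; y \<in> B\<rbrakk> \<Longrightarrow> x \<oplus>\<^bsub>LH\<^esub> y \<in> B" "\<And>x y. \<lbrakk>x \<in> B; y \<in> B\<rbrakk> \<Longrightarrow> x \<otimes>\<^bsub>LH\<^esub> y \<in> B"
        "\<And>c x. x \<in> B \<Longrightarrow> cscale LH c x \<in> B" "\<And>x. x \<in> B \<Longrightarrow> star LH x \<in> B"
      using B(1) unfolding closed_star_subalgebra_def by auto
    have gen: "lrep (sgen p) \<in> B" if "p \<in> P" for p using that B(2) left_regular_lrep by force
    have mono: "lrep (monomial_value Sec sgen w) \<in> B" if "w \<in> lists (P \<times> UNIV)" for w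
      using that
    proof (induction w rule: list.induct)
      case Nil
      show ?case using gen[OF one_P] by (simp add: monomial_value_def sgen_one)
    next
      case (Cons l w)
      obtain p b where l: "l = (p, b)" by (cases l)
      have p: "p \<in> P" "sgen p \<in> carrier Sec" and w: "w \<in> lists (P \<times> UNIV)" "monomial_value Sec sgen w \<in> carrier Sec"
        using Cons.prems l sgen_closed Sec.monomial_value_closed[OF sgen_closed, of w] by auto
      have "monomial_value Sec sgen (l # w) = (if b then star Sec (sgen p) else sgen p) \<otimes>\<^bsub>Sec\<^esub> monomial_value Sec sgen w"
        by (simp add: monomial_value_def l)
      then show ?case
        using p w Cons.IH Bo gen by (simp add: lrep.hom_mult lrep.hom_star)
    qed
    have free: "lrep (\<Phi> x) \<in> B" if "x \<in> carrier FA" for x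
      using that
    proof (induction rule: free_induct)
      case zero
      show ?case using Bc(2) by (simp add: Phi.hom_zero del: free_ops)
    next
      case (monomial w)
      then show ?case using mono by (simp add: Sec.free_eval_monomial[OF sgen_closed])
    qed (simp_all add: Phi.hom_add Phi.hom_scale lrep.hom_add lrep.hom_scale Bo del: free_ops)
    have "lrep f \<in> B" if f: "f \<in> carrier Sec" for f
    proof -
      have "\<exists>y\<in>B. cnorm LH (lrep f \<ominus>\<^bsub>LH\<^esub> y) < \<epsilon>" if e: "\<epsilon> > 0" for \<epsilon>
      proof -
        obtain x where x: "x \<in> carrier FA" "norm1 (f \<ominus>\<^bsub>Sec\<^esub> \<Phi> x) < \<epsilon>" using Phi_dense[OF f e] by blast
        have "cnorm LH (lrep f \<ominus>\<^bsub>LH\<^esub> lrep (\<Phi> x)) \<le> norm1 (f \<ominus>\<^bsub>Sec\<^esub> \<Phi> x)"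
          using norm[of "f \<ominus>\<^bsub>Sec\<^esub> \<Phi> x"] f x(1) by (simp add: lrep.hom_diff)
        then show ?thesis using free[OF x(1)] x(2) by (meson le_less_trans)
      qed
      then show ?thesis using Bc(3) f by (auto simp: norm_closure_def)
    qed
    then have "lrep ` carrier Sec \<subseteq> B" by blast
    then show ?thesis using Bc(3) by (force simp: norm_closure_def)
  qed
  note least = this
  have "\<Inter>{B. closed_star_subalgebra LH B \<and> left_regular G P ` P \<subseteq> B} = norm_closure LH (lrep ` carrier Sec)"
  proof
    have "left_regular G P ` P \<subseteq> norm_closure LH (lrep ` carrier Sec)" using gens alg by blast
    then show "\<Inter>{B. closed_star_subalgebra LH B \<and> left_regular G P ` P \<subseteq> B} \<subseteq> norm_closure LH (lrep ` carrier Sec)"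
      using alg by (intro Inter_lower) simp
  qed (use least in \<open>intro Inter_greatest, simp\<close>)
  then show ?thesis by (simp add: reduced_toeplitz_def generated_cstar_def)
qed

theorem reduced_isomorphism:
  "\<exists>\<psi>. cstar_iso (reduced_toeplitz G P) (reduced_cross_sectional G bundle) \<psi> \<and>
     (\<forall>p\<in>P. \<psi> (left_regular G P p) =
        rrep (delta (char_fun P (p <# P)) p))"
proof -
  from dense_hom_iso[OF lrep_hom rrep_hom H.L_banach E.L_banach rrep_norm]
  obtain \<psi> where \<psi>: "cstar_iso (reduced_toeplitz G P) (reduced_cross_sectional G bundle) \<psi>"
    "\<forall>f\<in>carrier Sec. \<psi> (lrep f) = rrep f"
    unfolding reduced_toeplitz_closure reduced_cross_sectional_def by auto
  have "\<psi> (left_regular G P p) = rrep (sgen p)" if "p \<in> P" for p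
    using \<psi>(2) left_regular_lrep[OF that] sgen_closed that by auto
  then show ?thesis using \<psi>(1) unfolding sgen_def by blast
qed

end

theorem theorem4p7:
  fixes G :: "('g, 'm) monoid_scheme" and P :: "'g set"
  assumes "group G" and "submonoid P G"
  shows
    "(\<exists>\<phi>. cstar_iso (universal_toeplitz G P) (full_cross_sectional G (canonical_bundle G P)) \<phi> \<and>
          (\<forall>p\<in>P. \<phi> (toeplitz_gen G P p) =
             full_embed G (canonical_bundle G P)
               (delta_section G (canonical_bundle G P) (char_fun P (p <#\<^bsub>G\<^esub> P)) p))) \<and>
     (\<exists>\<psi>. cstar_iso (reduced_toeplitz G P) (reduced_cross_sectional G (canonical_bundle G P)) \<psi> \<and>
          (\<forall>p\<in>P. \<psi> (left_regular G P p) =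
             regular_rep G (canonical_bundle G P)
               (delta_section G (canonical_bundle G P) (char_fun P (p <#\<^bsub>G\<^esub> P)) p)))"
proof -
  interpret submonoid_of_group G P
    by (intro submonoid_of_group.intro submonoid_of_group_axioms.intro assms)
  show ?thesis using full_isomorphism reduced_isomorphism by (rule conjI)
qed

end
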